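(* Let $\mu,\mu_1,\mu_2,\ldots$ be Borel measures on $S$. Suppose there exists an increasing sequence $(V_k)_{k\ge1}$ of relatively compact open subsets of $S$ with $\bigcup_{k\ge1}V_k=S$ such that, for every $k\ge1$, $\mu^{V_k}\in\mathcal S_{00}$, $\mu_n^{V_k}\in\mathcal S_{00}$ for all $n\ge1$, and $$\lim_{n\to\infty}\|R_1\mu_n^{V_k}-R_1\mu^{V_k}\|_{L^\infty(S,\,\mu_n^{V_k}+\mu^{V_k})}=0 .$$ (Then $\mu$ and all $\mu_n$ are smooth measures.) Suppose that $X$ is conservative, i.e. $P_x(X_t\in S,\ \forall t\in[0,\infty))=1$ for all $x\in S$, and moreover that the transition semigroup of $X$ has the doubly-Feller property. Let $A_n$ and $A$ be the PCAFs of $X$ associated with $\mu_n$ and $\mu$, respectively, by the Revuz correspondence. Then, for any $\varepsilon,T>0$ and any compact subset $K\subseteq S$, $$\lim_{n\to\infty}\ \sup_{x\in K}P_x\Big(\sup_{0\le t\le T}|A_n(t)-A(t)|>\varepsilon\Big)=0 .$$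
   Context: Setting. $S$ is a locally compact separable metrizable space; $S_\Delta=S\cup\{\Delta\}$ is its one-point compactification ($\Delta$ isolated if $S$ is compact). Functions $f$ on $S$ are extended by $f(\Delta)=0$; $\inf\emptyset=\infty$. $X=(\Omega,\mathscr M,(X_t)_{t\in[0,\infty]},(P_x)_{x\in S_\Delta},(\theta_t)_{t\in[0,\infty]})$ is a standard process on $S$ (a normal, right-continuous strong Markov process with cemetery $\Delta$, having left limits and quasi-left-continuous on $[0,\zeta)$, where $\zeta=\inf\{t: X_t=\Delta\}$ is the lifetime; $X_\infty=\Delta$; $\theta_t$ are shift operators, $X_s\circ\theta_t=X_{s+t}$). $(\mathscr F_t)_{t\in[0,\infty]}$ is the minimum augmented admissible filtration. Standing assumption (duality and absolute continuity): there exist another standard process $\hat X$ on $S$ with laws $\hat P_x$, a $\sigma$-finite Borel measure $m$ on $S$ and a Borel measurable function $p:(0,\infty)\times S\times S\to[0,\infty]$ such that for all $s,t>0$, $x,y\in S$: $P_x(X_t\in dy)=p_t(x,y)\,m(dy)$; $\hat P_y(\hat X_t\in dx)=p_t(x,y)\,m(dx)$; $p_{t+s}(x,y)=\int_S p_t(x,z)p_s(z,y)\,m(dz)$. Doubly-Feller property. Let $T_tf(x)=E_x[f(X_t)]$, $t>0$, be the transition semigroup of $X$. It has the Feller property if (F1) for each $t>0$ and each continuous $f$ on $S_\Delta$ with $f(\Delta)=0$, $T_tf$ is continuous on $S_\Delta$; and (F2) for each such $f$, $\lim_{t\downarrow0}T_tf(x)=f(x)$. It has the strong Feller property if for each $t>0$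 and each bounded measurable $f$ on $S$, $T_tf$ is a bounded continuous function on $S$. It is doubly Feller if it has both properties. Notation. For $\alpha\ge0$: $r_\alpha(x,y)=\int_0^\infty e^{-\alpha t}p_t(x,y)\,dt$ and, for a Borel measure $\mu$, $R_\alpha\mu(x)=\int_S r_\alpha(x,y)\,\mu(dy)$ (the $\alpha$-potential). $\mu^E(dx)=1_E(x)\mu(dx)$. $\|f\|_\infty=\sup_{x\in S}|f(x)|$; $\|f\|_{L^\infty(S,\nu)}=\inf\{C>0:|f|\le C\ \nu\text{-a.e.}\}$. For Borel $E\subseteq S$: $\sigma_E=\inf\{t\in(0,\infty):X_t\in E\}$, $\tau_E=\inf\{t\in[0,\infty):X_t\notin E\}$. A set is thin if it is contained in a nearly Borel set $B$ with $P_x(\sigma_B=0)=0$ for all $x$; a set is semipolar if it is contained in a countable union of thin sets. $\mathcal S_{00}$: finite Borel measures $\mu$ on $S$ charging no semipolar set with $\|R_1\mu\|_\infty<\infty$. A Borel measure $\mu$ is smooth ($\mu\in\mathcal S_1$) if it charges no semipolar set and there is an increasing sequence of Borel sets $E_n$ with $\bigcup_nE_n=S$, $\mu(E_n)<\infty$, $\|R_1\mu^{E_n}\|_\infty<\infty$ for all $n$, and $P_x(\lim_n\tau_{E_n}\ge\zeta)=1$ for all $x\in S$. One has $\mathcal S_{00}\subseteq\mathcal S_1$. PCAF: an $(\mathscr F_t)$-adapted non-negative process $A=(A_t)_{t\ge0}$ for which there is $\Lambda\in\mathscr F_\infty$ (a defining set) with $P_x(\Lambda)=1$ for all $x\in S$,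 $\theta_t(\Lambda)\subseteq\Lambda$ for all $t\ge0$, and for every $\omega\in\Lambda$: $A_0(\omega)=0$, $t\mapsto A_t(\omega)\in[0,\infty]$ is continuous on $[0,\infty)$, $A_t(\omega)<\infty$ for $t<\zeta(\omega)$, $A_t(\omega)=A_{\zeta(\omega)}(\omega)$ for $t\ge\zeta(\omega)$, and $A_{t+s}(\omega)=A_t(\omega)+A_s(\theta_t\omega)$ for all $s,t\ge0$. Two PCAFs are equivalent if they coincide for all $t$ on a common defining set. Revuz correspondence (known): equivalence classes of PCAFs $A$ and smooth measures $\mu$ are in one-to-one correspondence, characterized by $E_x[\int_0^\infty e^{-\alpha t}f(X_t)\,dA_t]=\int_S r_\alpha(x,y)f(y)\,\mu(dy)$ for all $\alpha>0$, $x\in S$ and non-negative Borel $f$. *)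

theory Defs
  imports "HOL-Probability.Probability"
begin

text \<open>
  The state space S is the type \<open>'a\<close>, its one-point compactification is \<open>'a option\<close>, with
  \<^term>\<open>None\<close> as the cemetery. Time runs through \<^typ>\<open>ennreal\<close>, that is [0,\<infinity>]. The sample space is
  \<^term>\<open>space (events X)\<close> and the laws are indexed by all starting points, cemetery included.
\<close>

record ('w, 'a) process =
  events :: "'w measure"
  path :: "ennreal \<Rightarrow> 'w \<Rightarrow> 'a option"
  law :: "'a option \<Rightarrow> 'w measure"
  shift :: "ennreal \<Rightarrow> 'w \<Rightarrow> 'w"

abbreviation sample_space :: "('w, 'a) process \<Rightarrow> 'w set" where
  "sample_space X \<equiv> space (events X)"

abbreviation state_topology :: "'a::topological_space option topology" where
  "state_topology \<equiv> Alexandroff_compactification (euclidean :: 'a topology)"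

definition state_borel :: "'a::topological_space option measure" where
  "state_borel = sigma UNIV {U. openin state_topology U}"

definition extend_zero :: "('a \<Rightarrow> 'b::zero) \<Rightarrow> 'a option \<Rightarrow> 'b" where
  "extend_zero f x = (case x of None \<Rightarrow> 0 | Some y \<Rightarrow> f y)"

definition lifetime :: "('w, 'a) process \<Rightarrow> 'w \<Rightarrow> ennreal" where
  "lifetime X \<omega> = Inf {t. path X t \<omega> = None}"

definition hitting_time :: "('w, 'a) process \<Rightarrow> 'a set \<Rightarrow> 'w \<Rightarrow> ennreal" where
  "hitting_time X E \<omega> = Inf {t. 0 < t \<and> t < \<infinity> \<and> path X t \<omega> \<in> Some ` E}"

definition exit_time :: "('w, 'a) process \<Rightarrow> 'a set \<Rightarrow> 'w \<Rightarrow> ennreal" where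
  "exit_time X E \<omega> = Inf {t. t < \<infinity> \<and> path X t \<omega> \<notin> Some ` E}"

definition admissible_filtration ::
  "('w, 'a::topological_space) process \<Rightarrow> (ennreal \<Rightarrow> 'w measure) \<Rightarrow> bool" where
  "admissible_filtration X G \<longleftrightarrow>
     filtration (sample_space X) G \<and>
     (\<forall>t. sets (G t) \<subseteq> sets (events X)) \<and>
     (\<forall>t. path X t \<in> G t \<rightarrow>\<^sub>M state_borel)"

definition right_continuous_filtration :: "(ennreal \<Rightarrow> 'w measure) \<Rightarrow> bool" where
  "right_continuous_filtration G \<longleftrightarrow> (\<forall>t<\<infinity>. (\<Inter>s\<in>{t<..}. sets (G s)) = sets (G t))"

definition strong_Markov_wrt ::
  "('w, 'a::topological_space) process \<Rightarrow> (ennreal \<Rightarrow> 'w measure) \<Rightarrow> bool" where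
  "strong_Markov_wrt X G \<longleftrightarrow>
     (\<forall>\<sigma>. stopping_time G \<sigma> \<longrightarrow>
       (\<forall>x s. \<forall>B\<in>sets state_borel.
         AE \<omega> in law X x.
           real_cond_exp (law X x) (filtration.pre_sigma (sample_space X) G \<sigma>)
             (\<lambda>\<omega>. indicator B (path X (\<sigma> \<omega> + s) \<omega>)) \<omega>
           = measure (law X (path X (\<sigma> \<omega>) \<omega>)) {\<omega>' \<in> sample_space X. path X s \<omega>' \<in> B}))"

definition quasi_left_continuous_wrt ::
  "('w, 'a::topological_space) process \<Rightarrow> (ennreal \<Rightarrow> 'w measure) \<Rightarrow> bool" where
  "quasi_left_continuous_wrt X G \<longleftrightarrow>
     (\<forall>\<sigma> :: nat \<Rightarrow> 'w \<Rightarrow> ennreal.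
       (\<forall>n. stopping_time G (\<sigma> n)) \<and> (\<forall>\<omega>\<in>sample_space X. incseq (\<lambda>n. \<sigma> n \<omega>)) \<longrightarrow>
       (\<forall>x. AE \<omega> in law X x. (SUP n. \<sigma> n \<omega>) < lifetime X \<omega> \<longrightarrow>
         limitin state_topology (\<lambda>n. path X (\<sigma> n \<omega>) \<omega>) (path X (SUP n. \<sigma> n \<omega>) \<omega>) sequentially))"

text \<open>
  As for Hunt processes in the literature on Dirichlet forms, the strong Markov property and the
  quasi-left-continuity refer to some right-continuous admissible filtration. Only the laws
  \<open>law X x\<close> are used there, since mixtures over x are defined on the natural filtration only. Left limits are
  taken in the compactification; on [0,lifetime) they lie in S by quasi-left-continuity.
\<close>

definition standard_process :: "('w, 'a::topological_space) process \<Rightarrow> bool" where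
  "standard_process X \<longleftrightarrow>
     (\<forall>x. prob_space (law X x) \<and> sets (law X x) = sets (events X)) \<and>
     (\<forall>t. path X t \<in> events X \<rightarrow>\<^sub>M state_borel) \<and>
     (\<forall>t. \<forall>B\<in>sets state_borel.
        (\<lambda>x. emeasure (law X x) {\<omega> \<in> sample_space X. path X t \<omega> \<in> B})
          \<in> borel_measurable state_borel) \<and>
     (\<forall>x. AE \<omega> in law X x. path X 0 \<omega> = x) \<and>
     (\<forall>\<omega>\<in>sample_space X. path X \<infinity> \<omega> = None) \<and>
     (\<forall>\<omega>\<in>sample_space X. \<forall>s t. s \<le> t \<and> path X s \<omega> = None \<longrightarrow> path X t \<omega> = None) \<and>
     (\<forall>\<omega>\<in>sample_space X. \<forall>t. shift X t \<omega> \<in> sample_space X) \<and>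
     (\<forall>\<omega>\<in>sample_space X. \<forall>s t. path X s (shift X t \<omega>) = path X (s + t) \<omega>) \<and>
     (\<forall>\<omega>\<in>sample_space X. \<forall>t<\<infinity>.
        limitin state_topology (\<lambda>s. path X s \<omega>) (path X t \<omega>) (at_right t)) \<and>
     (\<forall>x. AE \<omega> in law X x. \<forall>t. 0 < t \<and> t < lifetime X \<omega> \<longrightarrow>
        (\<exists>l. limitin state_topology (\<lambda>s. path X s \<omega>) l (at_left t))) \<and>
     (\<exists>G. admissible_filtration X G \<and> right_continuous_filtration G \<and>
        strong_Markov_wrt X G \<and> quasi_left_continuous_wrt X G)"

definition natural_filtration ::
  "('w, 'a::topological_space) process \<Rightarrow> ennreal \<Rightarrow> 'w measure" where
  "natural_filtration X t = sigma (sample_space X)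
     (\<Union>s\<in>{..t}. {path X s -` B \<inter> sample_space X | B. B \<in> sets state_borel})"

definition law_initial ::
  "('w, 'a::topological_space) process \<Rightarrow> 'a option measure \<Rightarrow> 'w measure" where
  "law_initial X \<nu> = measure_of (sample_space X) (sets (natural_filtration X \<infinity>))
     (\<lambda>L. \<integral>\<^sup>+x. emeasure (law X x) L \<partial>\<nu>)"

definition minimum_augmented_filtration ::
  "('w, 'a::topological_space) process \<Rightarrow> ennreal \<Rightarrow> 'w measure" where
  "minimum_augmented_filtration X t = sigma (sample_space X)
     {L. L \<subseteq> sample_space X \<and>
         (\<forall>\<nu>. prob_space \<nu> \<and> sets \<nu> = sets state_borel \<longrightarrow>
            (\<exists>L'\<in>sets (natural_filtration X t).
               sym_diff L L' \<in> null_sets (completion (law_initial X \<nu>))))}"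

definition conservative :: "('w, 'a) process \<Rightarrow> bool" where
  "conservative X \<longleftrightarrow> (\<forall>x. AE \<omega> in law X (Some x). \<forall>t<\<infinity>. path X t \<omega> \<noteq> None)"

definition transition ::
  "('w, 'a) process \<Rightarrow> real \<Rightarrow> ('a option \<Rightarrow> real) \<Rightarrow> 'a option \<Rightarrow> real" where
  "transition X t f x = (\<integral>\<omega>. f (path X (ennreal t) \<omega>) \<partial>law X x)"

definition Feller :: "('w, 'a::topological_space) process \<Rightarrow> bool" where
  "Feller X \<longleftrightarrow>
     (\<forall>f. continuous_map state_topology euclideanreal f \<and> f None = 0 \<longrightarrow>
        (\<forall>t>0. continuous_map state_topology euclideanreal (transition X t f)) \<and>
        (\<forall>x. ((\<lambda>t. transition X t f x) \<longlongrightarrow> f x) (at_right 0)))"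

definition strong_Feller :: "('w, 'a::topological_space) process \<Rightarrow> bool" where
  "strong_Feller X \<longleftrightarrow>
     (\<forall>t>0. \<forall>f :: 'a \<Rightarrow> real. f \<in> borel_measurable borel \<and> bounded (range f) \<longrightarrow>
        continuous_on UNIV (\<lambda>x. transition X t (extend_zero f) (Some x)) \<and>
        bounded (range (\<lambda>x. transition X t (extend_zero f) (Some x))))"

definition doubly_Feller :: "('w, 'a::topological_space) process \<Rightarrow> bool" where
  "doubly_Feller X \<longleftrightarrow> Feller X \<and> strong_Feller X"

definition dual_with_density ::
  "('w, 'a::topological_space) process \<Rightarrow> ('v, 'a) process \<Rightarrow> 'a measure
     \<Rightarrow> (real \<Rightarrow> 'a \<Rightarrow> 'a \<Rightarrow> ennreal) \<Rightarrow> bool" where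
  "dual_with_density X Xd m p \<longleftrightarrow>
     sets m = sets borel \<and> sigma_finite_measure m \<and>
     (\<lambda>(t, x, y). p t x y)
       \<in> borel_measurable (restrict_space borel {0<..} \<Otimes>\<^sub>M (borel \<Otimes>\<^sub>M borel)) \<and>
     (\<forall>t>0. \<forall>x. \<forall>B\<in>sets borel.
        emeasure (law X (Some x)) {\<omega> \<in> sample_space X. path X (ennreal t) \<omega> \<in> Some ` B}
          = (\<integral>\<^sup>+y\<in>B. p t x y \<partial>m)) \<and>
     (\<forall>t>0. \<forall>y. \<forall>B\<in>sets borel.
        emeasure (law Xd (Some y)) {\<omega> \<in> sample_space Xd. path Xd (ennreal t) \<omega> \<in> Some ` B}
          = (\<integral>\<^sup>+x\<in>B. p t x y \<partial>m)) \<and>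
     (\<forall>s>0. \<forall>t>0. \<forall>x y. p (t + s) x y = (\<integral>\<^sup>+z. p t x z * p s z y \<partial>m))"

definition resolvent_density ::
  "(real \<Rightarrow> 'a \<Rightarrow> 'a \<Rightarrow> ennreal) \<Rightarrow> real \<Rightarrow> 'a \<Rightarrow> 'a \<Rightarrow> ennreal" where
  "resolvent_density p \<alpha> x y = (\<integral>\<^sup>+t\<in>{0<..}. ennreal (exp (- \<alpha> * t)) * p t x y \<partial>lborel)"

definition potential ::
  "(real \<Rightarrow> 'a \<Rightarrow> 'a \<Rightarrow> ennreal) \<Rightarrow> real \<Rightarrow> 'a measure \<Rightarrow> 'a \<Rightarrow> ennreal" where
  "potential p \<alpha> \<mu> x = (\<integral>\<^sup>+y. resolvent_density p \<alpha> x y \<partial>\<mu>)"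

definition restrict_to :: "'a measure \<Rightarrow> 'a set \<Rightarrow> 'a measure" where
  "restrict_to \<mu> E = density \<mu> (indicator E)"

definition add_measure :: "'a measure \<Rightarrow> 'a measure \<Rightarrow> 'a measure" where
  "add_measure \<mu> \<nu> = measure_of (space \<mu>) (sets \<mu>) (\<lambda>B. emeasure \<mu> B + emeasure \<nu> B)"

definition Linf_norm :: "'a measure \<Rightarrow> ('a \<Rightarrow> ereal) \<Rightarrow> ereal" where
  "Linf_norm \<nu> f = Inf {ereal C | C. 0 < C \<and> (AE x in \<nu>. \<bar>f x\<bar> \<le> ereal C)}"

definition nearly_Borel :: "('w, 'a::topological_space) process \<Rightarrow> 'a set \<Rightarrow> bool" where
  "nearly_Borel X B \<longleftrightarrow>
     (\<forall>\<nu>. prob_space \<nu> \<and> sets \<nu> = sets state_borel \<longrightarrow>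
        (\<exists>B1\<in>sets borel. \<exists>B2\<in>sets borel. B1 \<subseteq> B \<and> B \<subseteq> B2 \<and>
           (AE \<omega> in law_initial X \<nu>. \<forall>t. path X t \<omega> \<notin> Some ` (B2 - B1))))"

definition thin :: "('w, 'a::topological_space) process \<Rightarrow> 'a set \<Rightarrow> bool" where
  "thin X N \<longleftrightarrow>
     (\<exists>B. N \<subseteq> B \<and> nearly_Borel X B \<and> (\<forall>x. AE \<omega> in law X (Some x). hitting_time X B \<omega> \<noteq> 0))"

definition semipolar :: "('w, 'a::topological_space) process \<Rightarrow> 'a set \<Rightarrow> bool" where
  "semipolar X N \<longleftrightarrow> (\<exists>B :: nat \<Rightarrow> 'a set. (\<forall>n. thin X (B n)) \<and> N \<subseteq> (\<Union>n. B n))"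

text \<open>Semipolar sets need not be Borel, hence the completion.\<close>

definition charges_no_semipolar ::
  "('w, 'a::topological_space) process \<Rightarrow> 'a measure \<Rightarrow> bool" where
  "charges_no_semipolar X \<mu> \<longleftrightarrow> (\<forall>N. semipolar X N \<longrightarrow> N \<in> null_sets (completion \<mu>))"

definition S00 ::
  "('w, 'a::topological_space) process \<Rightarrow> (real \<Rightarrow> 'a \<Rightarrow> 'a \<Rightarrow> ennreal) \<Rightarrow> 'a measure set" where
  "S00 X p = {\<mu>. sets \<mu> = sets borel \<and> finite_measure \<mu> \<and> charges_no_semipolar X \<mu> \<and>
     (SUP x. potential p 1 \<mu> x) < \<infinity>}"

definition smooth_measures ::
  "('w, 'a::topological_space) process \<Rightarrow> (real \<Rightarrow> 'a \<Rightarrow> 'a \<Rightarrow> ennreal) \<Rightarrow> 'a measure set" where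
  "smooth_measures X p = {\<mu>. sets \<mu> = sets borel \<and> charges_no_semipolar X \<mu> \<and>
     (\<exists>E :: nat \<Rightarrow> 'a set. incseq E \<and> (\<forall>n. E n \<in> sets borel) \<and> (\<Union>n. E n) = UNIV \<and>
        (\<forall>n. emeasure \<mu> (E n) < \<infinity> \<and> (SUP x. potential p 1 (restrict_to \<mu> (E n)) x) < \<infinity>) \<and>
        (\<forall>x. AE \<omega> in law X (Some x). lifetime X \<omega> \<le> (SUP n. exit_time X (E n) \<omega>)))}"

definition PCAF ::
  "('w, 'a::topological_space) process \<Rightarrow> (real \<Rightarrow> 'w \<Rightarrow> ennreal) \<Rightarrow> bool" where
  "PCAF X A \<longleftrightarrow>
     (\<forall>t\<ge>0. A t \<in> minimum_augmented_filtration X (ennreal t) \<rightarrow>\<^sub>M borel) \<and>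
     (\<exists>\<Lambda>\<in>sets (minimum_augmented_filtration X \<infinity>).
        (\<forall>x. AE \<omega> in law X (Some x). \<omega> \<in> \<Lambda>) \<and>
        (\<forall>t\<ge>0. shift X (ennreal t) ` \<Lambda> \<subseteq> \<Lambda>) \<and>
        (\<forall>\<omega>\<in>\<Lambda>.
           A 0 \<omega> = 0 \<and>
           continuous_on {0..} (\<lambda>t. A t \<omega>) \<and>
           (\<forall>t\<ge>0. ennreal t < lifetime X \<omega> \<longrightarrow> A t \<omega> < \<infinity>) \<and>
           (\<forall>t\<ge>0. lifetime X \<omega> \<le> ennreal t \<longrightarrow> A t \<omega> = A (enn2real (lifetime X \<omega>)) \<omega>) \<and>
           (\<forall>s\<ge>0. \<forall>t\<ge>0. A (t + s) \<omega> = A t \<omega> + A s (shift X (ennreal t) \<omega>))))"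

text \<open>
  Integral of \<open>g\<close> over [0,\<infinity>) against the Stieltjes measure of the continuous nondecreasing function
  \<open>a\<close> with \<open>a 0 = 0\<close>, as the supremum of the integrals over [0,u] with \<open>a u\<close> finite. A PCAF can be
  infinite only from the lifetime on, where the integrands used below vanish.
\<close>

definition Stieltjes_integral :: "(real \<Rightarrow> ennreal) \<Rightarrow> (real \<Rightarrow> ennreal) \<Rightarrow> ennreal" where
  "Stieltjes_integral a g =
     (SUP u\<in>{u. 0 \<le> u \<and> a u < \<infinity>}.
        \<integral>\<^sup>+t\<in>{0..u}. g t \<partial>interval_measure (\<lambda>t. enn2real (a (min (max t 0) u))))"

text \<open>
  The expectation is with respect to the completed law, which measures the events of the augmented
  filtration.
\<close>

definition Revuz_correspondence ::
  "('w, 'a::topological_space) process \<Rightarrow> (real \<Rightarrow> 'a \<Rightarrow> 'a \<Rightarrow> ennreal)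
     \<Rightarrow> (real \<Rightarrow> 'w \<Rightarrow> ennreal) \<Rightarrow> 'a measure \<Rightarrow> bool" where
  "Revuz_correspondence X p A \<mu> \<longleftrightarrow>
     PCAF X A \<and> \<mu> \<in> smooth_measures X p \<and>
     (\<forall>\<alpha>>0. \<forall>x. \<forall>f :: 'a \<Rightarrow> ennreal. f \<in> borel_measurable borel \<longrightarrow>
        (\<integral>\<^sup>+\<omega>. Stieltjes_integral (\<lambda>t. A t \<omega>)
            (\<lambda>t. ennreal (exp (- \<alpha> * t)) * extend_zero f (path X (ennreal t) \<omega>))
          \<partial>completion (law X (Some x)))
        = (\<integral>\<^sup>+y. resolvent_density p \<alpha> x y * f y \<partial>\<mu>))"

end

theory Submission
  imports Defs
begin

text \<open>
  Let \<open>V\<close> be one of the sets \<open>V\<^sub>k\<close> and replace \<open>A\<close> by \<open>C\<^sub>t = \<integral>\<^sub>0\<^sup>t e\<^sup>-\<^sup>s 1\<^sub>V(X\<^sub>s) dA\<^sub>s\<close>, whose total mass has expectation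
  \<open>u = R\<^sub>1 \<mu>\<^sup>V\<close>, and likewise for \<open>A\<^sub>n\<close>, with potential \<open>u\<^sub>n\<close>. The Revuz correspondence expresses the mixed
  second moment of the totals of \<open>C\<^sub>n\<close> and \<open>C\<close> as \<open>\<integral> r\<^sub>2(x,y) u(y) \<mu>\<^sub>n\<^sup>V(dy) + \<integral> r\<^sub>2(x,y) u\<^sub>n(y) \<mu>\<^sup>V(dy)\<close>. So
  only the values of the potentials on the two measures matter, and \<open>E\<^sub>x(C\<^sub>n - C)\<^sup>2\<close> tends to 0 uniformly
  in \<open>x\<close>. Since \<open>C\<^sub>\<infinity> = C\<^sub>t + e\<^sup>-\<^sup>t C\<^sub>\<infinity> \<circ> \<theta>\<^sub>t\<close>, an inequality of Ottaviani type for the Markov process turns this into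
  uniform smallness of \<open>sup\<^sub>t |C\<^sub>n(t) - C(t)|\<close>. As long as the path stays in \<open>V\<close> one has
  \<open>A\<^sub>t = e\<^sup>t C\<^sub>t - \<integral>\<^sub>0\<^sup>t e\<^sup>r C\<^sub>r dr\<close>, which carries the estimate over to \<open>A\<^sub>n - A\<close> up to a factor \<open>e\<^sup>T\<close>.

  It remains to see that paths started in \<open>K\<close> leave a large \<open>V\<^sub>k\<close> before time \<open>T\<close> with small probability,
  uniformly in the starting point. After a time \<open>\<delta>\<close> this follows from the strong Feller property, the
  conservativeness and Dini's theorem. Before \<open>\<delta>\<close> it follows from the Feller property: continuous excessive
  functions separate the points of the compactification, and for each of them the second moment of the
  displacement in a short time is uniformly small, again by Dini's theorem.
\<close>

section \<open>The Markov property\<close>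

text \<open>The potentials are only measurable, while sums along a time grid need integrands that
  converge along right-continuous paths. Each potential \<open>u\<close> is therefore approached
  from below by e^(-t) P_t u, continuous by the strong Feller property; these functions are
  supermedian, so expected grid sums increase with the grid and the two limits are suprema that may
  be exchanged. The hypothesis compares potentials only almost everywhere for the measures involved:
  this is enough inside the second moment formula, but a bound at every starting point is needed as
  well, and it comes from a weak maximum principle. Integrals take values in [0,\<infinity>], so
  identities are written as sums and common finite terms are cancelled. A PCAF is adapted only to
  the augmented filtration, whose null sets refer to mixtures of the laws; the Markov property has
  to be carried there from events of the path. The maximal inequality needs smallness for all
  starting points at once, hence Dini's theorem on the whole compactification and not only on
  \<open>K\<close>; strong Feller continuity holds at positive times only, hence the split of the
  time axis.\<close>

lemma space_state_borel [simp]: "space state_borel = UNIV"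
  by (simp add: state_borel_def)

lemma openin_state_borel: "openin state_topology U \<Longrightarrow> U \<in> sets state_borel"
  by (simp add: state_borel_def)

lemma Some_measurable [measurable]: "Some \<in> borel \<rightarrow>\<^sub>M state_borel"
  unfolding state_borel_def
proof (rule measurable_measure_of)
  fix U :: "'a option set" assume "U \<in> {U. openin state_topology U}"
  then have "openin euclidean {x \<in> topspace euclidean. Some x \<in> U}"
    using continuous_map_Some[of "euclidean :: 'a topology"] by (auto simp: continuous_map_def)
  then show "Some -` U \<inter> space borel \<in> sets borel"
    by (auto simp: vimage_def)
qed auto

lemma Some_image_state_borel:
  fixes B :: "'a::topological_space set"
  assumes "B \<in> sets borel"
  shows "Some ` B \<in> sets state_borel"
proof -
  have "B \<in> sigma_sets UNIV {S. open S}"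
    using assms by (simp add: borel_def)
  then show ?thesis
  proof induction
    case (Basic a)
    then show ?case by (auto intro!: openin_state_borel)
  next
    case (Compl a)
    have "Some ` (UNIV :: 'a set) \<in> sets state_borel"
      by (rule openin_state_borel) simp
    moreover have "Some ` (UNIV - a) = Some ` UNIV - Some ` a" by auto
    ultimately show ?case using Compl by auto
  next
    case (Union a)
    then show ?case by (simp add: image_UN)
  qed auto
qed

lemma None_state_borel: "{None} \<in> sets state_borel"
proof -
  have "space state_borel - Some ` UNIV \<in> sets state_borel"
    using Some_image_state_borel[of UNIV] by (intro sets.Diff sets.top) simp
  moreover have "space state_borel - Some ` UNIV = {None}"
    by (auto simp: notin_range_Some)
  ultimately show ?thesis by metis
qed

lemma extend_zero_simps [simp]: "extend_zero f None = 0" "extend_zero f (Some y) = f y"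
  by (simp_all add: extend_zero_def)

lemma extend_zero_measurable [measurable]:
  fixes f :: "'a::topological_space \<Rightarrow> 'b::{zero, topological_space}"
  assumes "f \<in> borel_measurable borel"
  shows "extend_zero f \<in> borel_measurable state_borel"
proof (rule measurableI)
  fix S :: "'b set" assume "S \<in> sets borel"
  then have "f -` S \<in> sets borel"
    using measurable_sets[OF assms] by auto
  then have "Some ` (f -` S) \<union> (if 0 \<in> S then {None} else {}) \<in> sets state_borel"
    using Some_image_state_borel None_state_borel by (intro sets.Un) auto
  moreover have "Some ` (f -` S) \<union> (if 0 \<in> S then {None} else {}) = extend_zero f -` S \<inter> space state_borel"
    by (auto simp: extend_zero_def split: option.splits)
  ultimately show "extend_zero f -` S \<inter> space state_borel \<in> sets state_borel" by simp
qed auto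

text \<open>The hypothesis on events says that two measures on \<open>N\<close> agree: the image
  under \<open>T\<close> of \<open>M\<close> restricted to \<open>L\<close>, and the mixture of the
  kernels \<open>Q (Y \<omega>)\<close> over the same restricted measure. Integrating
  \<open>f\<close> against both gives the conclusion. It is applied once to the position at a single
  time and once to the whole shifted path.\<close>

lemma nn_integral_disintegrate:
  assumes Q: "\<And>y. subprob_space (Q y)" "\<And>y. sets (Q y) = sets N"
    and Qm: "\<And>\<Gamma>. \<Gamma> \<in> sets N \<Longrightarrow> (\<lambda>y. emeasure (Q y) \<Gamma>) \<in> borel_measurable S"
    and T: "T \<in> M \<rightarrow>\<^sub>M N" and Y: "Y \<in> M \<rightarrow>\<^sub>M S" and L: "L \<in> sets M" and M: "space M \<noteq> {}"
    and eq: "\<And>\<Gamma>. \<Gamma> \<in> sets N \<Longrightarrow> emeasure M (L \<inter> (T -` \<Gamma> \<inter> space M))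
      = (\<integral>\<^sup>+\<omega>. indicator L \<omega> * emeasure (Q (Y \<omega>)) \<Gamma> \<partial>M)"
    and f: "f \<in> borel_measurable N"
  shows "(\<lambda>y. \<integral>\<^sup>+z. f z \<partial>Q y) \<in> borel_measurable S"
    and "(\<integral>\<^sup>+\<omega>. indicator L \<omega> * f (T \<omega>) \<partial>M) = (\<integral>\<^sup>+\<omega>. indicator L \<omega> * (\<integral>\<^sup>+z. f z \<partial>Q (Y \<omega>)) \<partial>M)"
proof -
  note [measurable] = T Y L f
  have QS: "Q \<in> S \<rightarrow>\<^sub>M subprob_algebra N"
    by (rule measurable_subprob_algebra) (use Q Qm in auto)
  show m [measurable]: "(\<lambda>y. \<integral>\<^sup>+z. f z \<partial>Q y) \<in> borel_measurable S"
    using measurable_compose[OF QS nn_integral_measurable_subprob_algebra[OF f]] .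
  let ?M = "density M (indicator L)"
  have QY: "(\<lambda>\<omega>. Q (Y \<omega>)) \<in> ?M \<rightarrow>\<^sub>M subprob_algebra N"
    using measurable_compose[OF Y QS] by simp
  have T': "T \<in> ?M \<rightarrow>\<^sub>M N" by simp
  have eqM: "distr ?M N T = ?M \<bind> (\<lambda>\<omega>. Q (Y \<omega>))"
  proof (rule measure_eqI)
    show "sets (distr ?M N T) = sets (?M \<bind> (\<lambda>\<omega>. Q (Y \<omega>)))"
      using Q(2) M by (subst sets_bind[where N=N]) auto
    fix \<Gamma> assume "\<Gamma> \<in> sets (distr ?M N T)"
    then have G[measurable]: "\<Gamma> \<in> sets N" by simp
    have Qm' [measurable]: "(\<lambda>\<omega>. emeasure (Q (Y \<omega>)) \<Gamma>) \<in> borel_measurable M"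
      by (rule measurable_compose[OF Y Qm[OF G]])
    have "emeasure (distr ?M N T) \<Gamma> = emeasure M (L \<inter> (T -` \<Gamma> \<inter> space M))"
      by (subst emeasure_distr) (auto simp: emeasure_density indicator_inter_arith[symmetric] measurable_sets)
    also have "\<dots> = emeasure (?M \<bind> (\<lambda>\<omega>. Q (Y \<omega>))) \<Gamma>"
      using M by (subst emeasure_bind[OF _ QY G]) (auto simp: eq[OF G] nn_integral_density)
    finally show "emeasure (distr ?M N T) \<Gamma> = emeasure (?M \<bind> (\<lambda>\<omega>. Q (Y \<omega>))) \<Gamma>" .
  qed
  have "(\<integral>\<^sup>+\<omega>. indicator L \<omega> * f (T \<omega>) \<partial>M) = (\<integral>\<^sup>+z. f z \<partial>distr ?M N T)"
    by (simp add: nn_integral_distr nn_integral_density)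
  also have "\<dots> = (\<integral>\<^sup>+\<omega>. indicator L \<omega> * (\<integral>\<^sup>+z. f z \<partial>Q (Y \<omega>)) \<partial>M)"
    using measurable_compose[OF Y m] unfolding eqM
    by (subst nn_integral_bind[OF f QY]) (simp add: nn_integral_density)
  finally show "(\<integral>\<^sup>+\<omega>. indicator L \<omega> * f (T \<omega>) \<partial>M) = (\<integral>\<^sup>+\<omega>. indicator L \<omega> * (\<integral>\<^sup>+z. f z \<partial>Q (Y \<omega>)) \<partial>M)" .
qed

section \<open>Standard processes and the Markov property at a fixed time\<close>

locale standard_proc =
  fixes X :: "('w, 'a::{metric_space, second_countable_topology}) process"
  assumes standard: "standard_process X"
begin

lemma prob_law: "prob_space (law X x)"
  and sets_law [measurable_cong]: "sets (law X x) = sets (events X)"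
  and path_measurable: "path X t \<in> events X \<rightarrow>\<^sub>M state_borel"
  and law_path_measurable: "B \<in> sets state_borel \<Longrightarrow>
        (\<lambda>x. emeasure (law X x) {\<omega> \<in> sample_space X. path X t \<omega> \<in> B}) \<in> borel_measurable state_borel"
  and path_0: "AE \<omega> in law X x. path X 0 \<omega> = x"
  and path_absorbed: "\<omega> \<in> sample_space X \<Longrightarrow> s \<le> t \<Longrightarrow> path X s \<omega> = None \<Longrightarrow> path X t \<omega> = None"
  and shift_space: "\<omega> \<in> sample_space X \<Longrightarrow> shift X t \<omega> \<in> sample_space X"
  and path_shift: "\<omega> \<in> sample_space X \<Longrightarrow> path X s (shift X t \<omega>) = path X (s + t) \<omega>"
  and path_right_cont: "\<omega> \<in> sample_space X \<Longrightarrow> t < \<infinity> \<Longrightarrow>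
        limitin state_topology (\<lambda>s. path X s \<omega>) (path X t \<omega>) (at_right t)"
proof -
  note * = standard[unfolded standard_process_def]
  note c1 = conjunct1[OF *] and r1 = conjunct2[OF *]
  note c2 = conjunct1[OF r1] and r2 = conjunct2[OF r1]
  note c3 = conjunct1[OF r2] and r3 = conjunct2[OF r2]
  note c4 = conjunct1[OF r3] and r4 = conjunct2[OF r3]
  note r5 = conjunct2[OF r4]
  note c6 = conjunct1[OF r5] and r6 = conjunct2[OF r5]
  note c7 = conjunct1[OF r6] and r7 = conjunct2[OF r6]
  note c8 = conjunct1[OF r7] and r8 = conjunct2[OF r7]
  note c9 = conjunct1[OF r8]
  show "prob_space (law X x)" "sets (law X x) = sets (events X)" using c1 by simp_all
  show "path X t \<in> events X \<rightarrow>\<^sub>M state_borel" using c2 by simp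
  show "(\<lambda>x. emeasure (law X x) {\<omega> \<in> sample_space X. path X t \<omega> \<in> B}) \<in> borel_measurable state_borel"
    if "B \<in> sets state_borel" using c3 that by simp
  show "AE \<omega> in law X x. path X 0 \<omega> = x" using c4 by (rule spec)
  show "path X t \<omega> = None" if "\<omega> \<in> sample_space X" "s \<le> t" "path X s \<omega> = None" using c6 that by blast
  show "shift X t \<omega> \<in> sample_space X" if "\<omega> \<in> sample_space X" using c7 that by simp
  show "path X s (shift X t \<omega>) = path X (s + t) \<omega>" if "\<omega> \<in> sample_space X" using c8 that by simp
  show "limitin state_topology (\<lambda>s. path X s \<omega>) (path X t \<omega>) (at_right t)"
    if "\<omega> \<in> sample_space X" "t < \<infinity>" using c9 that by blast
qed

lemma space_law [simp]: "space (law X x) = sample_space X"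
  using sets_law by (rule sets_eq_imp_space_eq)

lemma path_measurable_law [measurable]: "path X t \<in> law X x \<rightarrow>\<^sub>M state_borel"
  using path_measurable by (simp cong: measurable_cong_sets add: sets_law)

text \<open>A fixed witness for the filtration whose existence is part of a standard process. Its
  right-continuity makes exit times stopping times, and quasi-left-continuity with respect to it
  controls the limit of these times.\<close>

definition filt where
  "filt = (SOME G. admissible_filtration X G \<and> right_continuous_filtration G \<and>
        strong_Markov_wrt X G \<and> quasi_left_continuous_wrt X G)"

lemma filt: "admissible_filtration X filt" "right_continuous_filtration filt"
    "strong_Markov_wrt X filt" "quasi_left_continuous_wrt X filt"
proof -
  have "\<exists>G. admissible_filtration X G \<and> right_continuous_filtration G \<and>
        strong_Markov_wrt X G \<and> quasi_left_continuous_wrt X G"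
    using standard unfolding standard_process_def by (elim conjE)
  from someI_ex[OF this]
  show "admissible_filtration X filt" "right_continuous_filtration filt"
    "strong_Markov_wrt X filt" "quasi_left_continuous_wrt X filt"
    unfolding filt_def by auto
qed

sublocale filt: filtration "sample_space X" filt
  using filt(1)[unfolded admissible_filtration_def] by (rule conjunct1)

lemma sets_filt_subset: "sets (filt t) \<subseteq> sets (law X x)"
  using filt(1) by (simp add: admissible_filtration_def sets_law)

lemma path_filt: "path X s \<in> filt s \<rightarrow>\<^sub>M state_borel"
  using filt(1) by (simp add: admissible_filtration_def)

lemma path_event_filt: "s \<le> t \<Longrightarrow> B \<in> sets state_borel \<Longrightarrow> {\<omega>\<in>sample_space X. path X s \<omega> \<in> B} \<in> sets (filt t)"
  using measurable_sets[OF path_filt, of B s] filt.sets_F_mono[of s t]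
  by (auto simp: vimage_def Int_def filt.space_F conj_commute)

text \<open>The strong Markov property is given for conditional expectations with respect to the
  past of a stopping time. At the constant time \<open>t\<close> that past contains
  \<open>filt t\<close>, and integrating over \<open>L\<close> removes the conditional
  expectation.\<close>

lemma Markov_one_time:
  assumes L: "L \<in> sets (filt t)" and B: "B \<in> sets state_borel"
  shows "emeasure (law X x) (L \<inter> {\<omega>\<in>sample_space X. path X (t + s) \<omega> \<in> B})
    = (\<integral>\<^sup>+\<omega>. indicator L \<omega> * emeasure (law X (path X t \<omega>)) {\<omega> \<in> sample_space X. path X s \<omega> \<in> B} \<partial>law X x)"
proof -
  interpret prob_space "law X x" by (rule prob_law)
  let ?F = "filtration.pre_sigma (sample_space X) filt (\<lambda>_. t)"
  have st: "stopping_time filt (\<lambda>_. t)" by (rule stopping_time_const)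
  have sF: "sets ?F \<subseteq> sets (law X x)"
  proof
    fix A assume "A \<in> sets ?F"
    from filt.sets_pre_sigmaD[OF st this, of t] show "A \<in> sets (law X x)"
      using sets_filt_subset by auto
  qed
  then have "subalgebra (law X x) ?F"
    by (simp add: subalgebra_def filt.space_pre_sigma)
  then interpret finite_measure_subalgebra "law X x" ?F
    by unfold_locales
  have LF: "L \<in> sets ?F"
  proof (rule filt.sets_pre_sigmaI[OF st])
    show "{\<omega> \<in> L. t \<le> r} \<in> sets (filt r)" for r
      using L filt.sets_F_mono[of t r] by (cases "t \<le> r") auto
  qed
  have L' [measurable]: "L \<in> sets (law X x)" using LF sF by auto
  note B[measurable]
  let ?f = "\<lambda>\<omega>. indicator B (path X (t + s) \<omega>) :: real"
  let ?g = "\<lambda>\<omega>. measure (law X (path X t \<omega>)) {\<omega>' \<in> sample_space X. path X s \<omega>' \<in> B}"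
  have int: "integrable (law X x) ?f"
    by (rule integrable_const_bound[of _ 1]) (auto simp: indicator_def)
  have gm: "(\<lambda>y. measure (law X y) {\<omega>' \<in> sample_space X. path X s \<omega>' \<in> B}) \<in> borel_measurable state_borel"
    unfolding measure_def by (intro measurable_compose[OF law_path_measurable[OF B]]) simp
  have gm' [measurable]: "?g \<in> borel_measurable (law X x)"
    by (rule measurable_compose[OF path_measurable_law gm])
  have g1: "0 \<le> ?g \<omega> \<and> ?g \<omega> \<le> 1" for \<omega>
    using prob_space.prob_le_1[OF prob_law] by simp
  have AEg: "AE \<omega> in law X x. real_cond_exp (law X x) ?F ?f \<omega> = ?g \<omega>"
    using filt(3)[unfolded strong_Markov_wrt_def, rule_format, OF st B, of x s] by simp
  have *: "(\<integral>\<omega>\<in>L. ?f \<omega> \<partial>law X x) = (\<integral>\<omega>\<in>L. ?g \<omega> \<partial>law X x)"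
    unfolding real_cond_exp_intA[OF int LF]
    by (rule set_lebesgue_integral_cong_AE) (use AEg in auto)
  have i1: "integrable (law X x) (\<lambda>\<omega>. indicator L \<omega> * ?g \<omega>)"
    by (rule integrable_const_bound[of _ 1]) (use g1 in \<open>auto simp: indicator_def\<close>)
  have "emeasure (law X x) (L \<inter> {\<omega>\<in>sample_space X. path X (t + s) \<omega> \<in> B})
      = ennreal (\<integral>\<omega>. indicator (L \<inter> {\<omega>\<in>sample_space X. path X (t + s) \<omega> \<in> B}) \<omega> \<partial>law X x)"
    unfolding emeasure_eq_measure by (simp add: Int_absorb2 le_infI2 subset_eq)
  also have "(\<integral>\<omega>. indicator (L \<inter> {\<omega>\<in>sample_space X. path X (t + s) \<omega> \<in> B}) \<omega> \<partial>law X x) = (\<integral>\<omega>\<in>L. ?f \<omega> \<partial>law X x)"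
    unfolding set_lebesgue_integral_def
    by (rule Bochner_Integration.integral_cong) (auto simp: indicator_def)
  also have "ennreal \<dots> = ennreal (\<integral>\<omega>. indicator L \<omega> * ?g \<omega> \<partial>law X x)"
    using * by (simp only: set_lebesgue_integral_def real_scaleR_def)
  also have "\<dots> = (\<integral>\<^sup>+\<omega>. ennreal (indicator L \<omega> * ?g \<omega>) \<partial>law X x)"
    using g1 by (intro nn_integral_eq_integral[symmetric] i1) auto
  also have "\<dots> = (\<integral>\<^sup>+\<omega>. indicator L \<omega> * emeasure (law X (path X t \<omega>)) {\<omega> \<in> sample_space X. path X s \<omega> \<in> B} \<partial>law X x)"
    by (intro nn_integral_cong)
       (simp add: indicator_def finite_measure.emeasure_eq_measure[OF prob_space.finite_measure[OF prob_law]])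
  finally show ?thesis .
qed

lemma sample_space_nonempty: "sample_space X \<noteq> {}"
  using prob_space.not_empty[OF prob_law, of None] by simp

lemma Markov_one_time_fun:
  assumes L: "L \<in> sets (filt t)" and f: "f \<in> borel_measurable state_borel"
  shows "(\<lambda>y. \<integral>\<^sup>+\<omega>. f (path X s \<omega>) \<partial>law X y) \<in> borel_measurable state_borel"
    and "(\<integral>\<^sup>+\<omega>. indicator L \<omega> * f (path X (t + s) \<omega>) \<partial>law X x)
      = (\<integral>\<^sup>+\<omega>. indicator L \<omega> * (\<integral>\<^sup>+\<omega>'. f (path X s \<omega>') \<partial>law X (path X t \<omega>)) \<partial>law X x)"
proof -
  define Q where "Q y = distr (law X y) state_borel (path X s)" for y
  have eQ: "emeasure (Q y) B = emeasure (law X y) {\<omega> \<in> sample_space X. path X s \<omega> \<in> B}" if "B \<in> sets state_borel" for y B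
  proof -
    have "path X s -` B \<inter> sample_space X = {\<omega> \<in> sample_space X. path X s \<omega> \<in> B}" by blast
    then show ?thesis using that by (simp add: Q_def emeasure_distr)
  qed
  have iQ: "(\<integral>\<^sup>+z. f z \<partial>Q y) = (\<integral>\<^sup>+\<omega>. f (path X s \<omega>) \<partial>law X y)" for y
    using f by (simp add: Q_def nn_integral_distr)
  have sQ: "subprob_space (Q y)" "sets (Q y) = sets state_borel" for y
    using prob_space_imp_subprob_space[OF prob_space.prob_space_distr[OF prob_law path_measurable_law]]
    by (simp_all add: Q_def)
  note T = path_measurable_law[of "t + s" x] and Y = path_measurable_law[of t x]
  have L': "L \<in> sets (law X x)" using L sets_filt_subset by auto
  have m: "(\<lambda>y. emeasure (Q y) B) \<in> borel_measurable state_borel" if "B \<in> sets state_borel" for B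
    using law_path_measurable[OF that] by (simp add: eQ[OF that])
  have eq: "emeasure (law X x) (L \<inter> (path X (t + s) -` B \<inter> space (law X x)))
      = (\<integral>\<^sup>+\<omega>. indicator L \<omega> * emeasure (Q (path X t \<omega>)) B \<partial>law X x)" if "B \<in> sets state_borel" for B
  proof -
    have "path X (t + s) -` B \<inter> space (law X x) = {\<omega> \<in> sample_space X. path X (t + s) \<omega> \<in> B}" by auto
    then show ?thesis by (simp only: eQ[OF that] Markov_one_time[OF L that, of x s])
  qed
  show "(\<lambda>y. \<integral>\<^sup>+\<omega>. f (path X s \<omega>) \<partial>law X y) \<in> borel_measurable state_borel"
    "(\<integral>\<^sup>+\<omega>. indicator L \<omega> * f (path X (t + s) \<omega>) \<partial>law X x)
      = (\<integral>\<^sup>+\<omega>. indicator L \<omega> * (\<integral>\<^sup>+\<omega>'. f (path X s \<omega>') \<partial>law X (path X t \<omega>)) \<partial>law X x)"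
    using nn_integral_disintegrate[OF sQ m T Y L' _ eq f, unfolded iQ] sample_space_nonempty
    unfolding space_law by blast+
qed

section \<open>The Markov property for events of the whole path\<close>

abbreviation "natural \<equiv> natural_filtration X"

lemma space_natural [simp]: "space (natural t) = sample_space X"
  unfolding natural_filtration_def by (rule space_measure_of) auto

lemma sets_natural:
  "sets (natural t) = sigma_sets (sample_space X)
     (\<Union>s\<in>{..t}. {path X s -` B \<inter> sample_space X | B. B \<in> sets state_borel})"
  unfolding natural_filtration_def by (rule sets_measure_of) auto

lemma natural_subset_filt: "sets (natural t) \<subseteq> sets (filt t)"
  unfolding sets_natural filt.space_F[of t, symmetric]
proof (rule sets.sigma_sets_subset, safe)
  fix s B assume "s \<le> t" "B \<in> sets (state_borel :: 'a option measure)"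
  from path_event_filt[OF this] show "path X s -` B \<inter> space (filt t) \<in> sets (filt t)"
    by (simp add: filt.space_F vimage_def Int_def conj_commute)
qed

lemma natural_mono: "s \<le> t \<Longrightarrow> sets (natural s) \<subseteq> sets (natural t)"
  unfolding sets_natural by (intro sigma_sets_mono') force

lemma natural_subset_law: "sets (natural t) \<subseteq> sets (law X x)"
  using natural_subset_filt sets_filt_subset by blast

lemma path_natural: "s \<le> t \<Longrightarrow> path X s \<in> natural t \<rightarrow>\<^sub>M state_borel"
  by (rule measurableI) (auto simp: sets_natural intro!: sigma_sets.Basic)

lemma path_event_natural:
  "s \<le> t \<Longrightarrow> B \<in> sets state_borel \<Longrightarrow> {\<omega>\<in>sample_space X. path X s \<omega> \<in> B} \<in> sets (natural t)"
  using measurable_sets[OF path_natural, of s t B] by (simp add: vimage_def Int_def conj_commute)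

text \<open>Constraints are kept in a list so that concatenation gives intersection and the length
  allows induction; the times need not be ordered or distinct.\<close>

definition cylinder :: "(ennreal \<times> 'a option set) list \<Rightarrow> 'w set" where
  "cylinder l = {\<omega> \<in> sample_space X. \<forall>(r, B)\<in>set l. path X r \<omega> \<in> B}"

lemma cylinder_natural:
  assumes "\<forall>(r, B)\<in>set l. B \<in> sets state_borel \<and> r \<le> t"
  shows "cylinder l \<in> sets (natural t)"
  using assms
proof (induction l)
  case Nil
  then show ?case using sets.top[of "natural t"] by (simp add: cylinder_def)
next
  case (Cons a l)
  obtain r B where a: "a = (r, B)" by force
  have "cylinder (a # l) = {\<omega>\<in>sample_space X. path X r \<omega> \<in> B} \<inter> cylinder l"
    by (auto simp: cylinder_def a)
  then show ?case using Cons path_event_natural[of r t B] by (auto simp: a)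
qed

text \<open>Isolating the earliest constraint leaves constraints on the path restarted at
  \<open>r0\<close>. The truncated subtraction of extended times is harmless:
  \<open>r - r0 + r0 = r\<close> because \<open>r0\<close> is minimal.\<close>

lemma cylinder_first:
  assumes l: "(r0, B0) \<in> set l" and min: "\<forall>(r, B)\<in>set l. r0 \<le> r"
  shows "\<omega> \<in> sample_space X \<Longrightarrow> shift X t \<omega> \<in> cylinder l \<longleftrightarrow>
     path X (t + r0) \<omega> \<in> B0 \<and> shift X (t + r0) \<omega> \<in> cylinder (map (\<lambda>(r, B). (r - r0, B)) (remove1 (r0, B0) l))"
    (is "_ \<Longrightarrow> _ \<longleftrightarrow> _ \<and> _ \<in> cylinder ?l'")
    and "cylinder l = {\<omega>\<in>sample_space X. path X r0 \<omega> \<in> B0} \<inter>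
      (shift X r0 -` cylinder (map (\<lambda>(r, B). (r - r0, B)) (remove1 (r0, B0) l)) \<inter> sample_space X)"
proof -
  have sl: "set l = insert (r0, B0) (set (remove1 (r0, B0) l))"
    using l by (induction l) auto
  have *: "(\<forall>(r, B)\<in>set ?l'. path X (r + (t + r0)) \<omega> \<in> B) \<longleftrightarrow> (\<forall>(r, B)\<in>set (remove1 (r0, B0) l). path X (r + t) \<omega> \<in> B)" for \<omega> t
  proof -
    have "(r - r0) + (t + r0) = r + t" if "(r, B) \<in> set (remove1 (r0, B0) l)" for r B
    proof -
      have "r0 \<le> r" using min that notin_set_remove1 by fastforce
      then show ?thesis using diff_add_cancel_ennreal[of r0 r] by (metis add.assoc add.commute)
    qed
    then have "(path X (r - r0 + (t + r0)) \<omega> \<in> B) = (path X (r + t) \<omega> \<in> B)" if "(r, B) \<in> set (remove1 (r0, B0) l)" for r B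
      using that by metis
    then have "(\<forall>(r, B)\<in>set (remove1 (r0, B0) l). path X (r - r0 + (t + r0)) \<omega> \<in> B) \<longleftrightarrow> (\<forall>(r, B)\<in>set (remove1 (r0, B0) l). path X (r + t) \<omega> \<in> B)"
      by (intro ball_cong) auto
    moreover have "(\<forall>(r, B)\<in>set ?l'. path X (r + (t + r0)) \<omega> \<in> B) \<longleftrightarrow> (\<forall>(r, B)\<in>set (remove1 (r0, B0) l). path X (r - r0 + (t + r0)) \<omega> \<in> B)"
      unfolding set_map by (simp add: case_prod_beta)
    ultimately show ?thesis by (rule trans[rotated])
  qed
  have sh: "shift X t \<omega> \<in> cylinder l \<longleftrightarrow> path X (t + r0) \<omega> \<in> B0 \<and> shift X (t + r0) \<omega> \<in> cylinder ?l'"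
    if "\<omega> \<in> sample_space X" for t \<omega>
  proof -
    have "shift X t \<omega> \<in> cylinder l \<longleftrightarrow> (\<forall>(r, B)\<in>set l. path X (r + t) \<omega> \<in> B)"
      using that by (simp add: cylinder_def shift_space path_shift)
    also have "\<dots> \<longleftrightarrow> path X (t + r0) \<omega> \<in> B0 \<and> (\<forall>(r, B)\<in>set (remove1 (r0, B0) l). path X (r + t) \<omega> \<in> B)"
      by (subst sl) (auto simp: add.commute)
    also have "\<dots> \<longleftrightarrow> path X (t + r0) \<omega> \<in> B0 \<and> shift X (t + r0) \<omega> \<in> cylinder ?l'"
      unfolding *[symmetric] using that by (simp add: cylinder_def shift_space path_shift)
    finally show ?thesis .
  qed
  then show "\<omega> \<in> sample_space X \<Longrightarrow> shift X t \<omega> \<in> cylinder l \<longleftrightarrow>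
     path X (t + r0) \<omega> \<in> B0 \<and> shift X (t + r0) \<omega> \<in> cylinder ?l'" .
  have "\<omega> \<in> cylinder l \<longleftrightarrow> path X r0 \<omega> \<in> B0 \<and> shift X r0 \<omega> \<in> cylinder ?l'" if "\<omega> \<in> sample_space X" for \<omega>
    using sh[OF that, of 0] that by (simp add: cylinder_def shift_space path_shift)
  moreover have "cylinder l \<subseteq> sample_space X" by (auto simp: cylinder_def)
  ultimately show "cylinder l = {\<omega>\<in>sample_space X. path X r0 \<omega> \<in> B0} \<inter> (shift X r0 -` cylinder ?l' \<inter> sample_space X)"
    by blast
qed

lemma shift_natural: "shift X t \<in> natural \<top> \<rightarrow>\<^sub>M natural \<top>"
proof (rule measurable_sigma_sets[OF sets_natural])
  show "shift X t \<in> space (natural \<top>) \<rightarrow> sample_space X"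
    by (auto intro: shift_space)
  fix L assume "L \<in> (\<Union>s\<in>{..\<top>}. {path X s -` B \<inter> sample_space X | B. B \<in> sets state_borel})"
  then obtain s B where B: "B \<in> sets state_borel" and L: "L = path X s -` B \<inter> sample_space X" by auto
  have "shift X t -` L \<inter> space (natural \<top>) = {\<omega> \<in> sample_space X. path X (s + t) \<omega> \<in> B}"
    unfolding L by (auto simp: shift_space path_shift)
  then show "shift X t -` L \<inter> space (natural \<top>) \<in> sets (natural \<top>)"
    using path_event_natural[OF _ B] by simp
qed auto

text \<open>Measurability in the starting point is part of the predicate because the integrals on
  the right are manipulated at every closure step of the Dynkin argument.\<close>

definition Markov_event :: "'w set \<Rightarrow> bool" where
  "Markov_event \<Gamma> \<longleftrightarrow> (\<lambda>y. emeasure (law X y) \<Gamma>) \<in> borel_measurable state_borel \<and>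
     (\<forall>x t. \<forall>L\<in>sets (filt t). emeasure (law X x) (L \<inter> (shift X t -` \<Gamma> \<inter> sample_space X))
        = (\<integral>\<^sup>+\<omega>. indicator L \<omega> * emeasure (law X (path X t \<omega>)) \<Gamma> \<partial>law X x))"

text \<open>Induction on the number of constraints. The Markov property of the shorter cylinder at
  time \<open>t + r0\<close>, applied to \<open>L\<close> together with the first constraint, leaves
  a function of the position at \<open>t + r0\<close>; the one-time property then goes back from
  \<open>t + r0\<close> to \<open>t\<close>.\<close>

lemma Markov_event_cylinder:
  "(\<And>r B. (r, B) \<in> set l \<Longrightarrow> B \<in> sets state_borel) \<Longrightarrow> Markov_event (cylinder l)"
proof (induction "length l" arbitrary: l)
  case 0
  have "cylinder l = sample_space X" using 0 by (simp add: cylinder_def)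
  moreover have "emeasure (law X y) (sample_space X) = 1" for y
    using prob_space.emeasure_space_1[OF prob_law] by simp
  moreover have "L \<inter> (shift X t -` sample_space X \<inter> sample_space X) = L" if "L \<in> sets (filt t)" for L t
    using sets.sets_into_space[OF that] shift_space by (auto simp: filt.space_F)
  moreover have "(\<integral>\<^sup>+\<omega>. indicator L \<omega> \<partial>law X x) = emeasure (law X x) L" if "L \<in> sets (filt t)" for L t x
    using that sets_filt_subset by (intro nn_integral_indicator) blast
  ultimately show ?case
    unfolding Markov_event_def by simp
next
  case (Suc n)
  define r0 where "r0 = Min (fst ` set l)"
  have "set l \<noteq> {}" using Suc(2) by auto
  then have "r0 \<in> fst ` set l" unfolding r0_def by (intro Min_in) auto
  then obtain B0 where l: "(r0, B0) \<in> set l" by force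
  have min: "\<forall>(r, B)\<in>set l. r0 \<le> r" unfolding r0_def by (force intro!: Min_le)
  define l' where "l' = map (\<lambda>(r, B). (r - r0, B)) (remove1 (r0, B0) l)"
  have len: "n = length l'" using Suc(2) l by (simp add: l'_def length_remove1)
  have B: "B \<in> sets state_borel" if rB: "(r, B) \<in> set l'" for r B
  proof -
    obtain r' where "(r', B) \<in> set (remove1 (r0, B0) l)" using rB by (auto simp: l'_def)
    then have "(r', B) \<in> set l" by (metis notin_set_remove1)
    then show ?thesis using Suc(3) by blast
  qed
  have IH: "Markov_event (cylinder l')" by (rule Suc(1)[OF len B])
  have B0: "B0 \<in> sets state_borel" using Suc(3) l by blast
  note cyl = cylinder_first[OF l min, folded l'_def]
  define \<phi> where "\<phi> z = indicator B0 z * emeasure (law X z) (cylinder l')" for z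
  have \<phi>: "\<phi> \<in> borel_measurable state_borel"
    using IH B0 unfolding \<phi>_def Markov_event_def by auto
  have step: "emeasure (law X x) (L \<inter> (shift X t -` cylinder l \<inter> sample_space X))
     = (\<integral>\<^sup>+\<omega>. indicator L \<omega> * \<phi> (path X (t + r0) \<omega>) \<partial>law X x)" if L: "L \<in> sets (filt t)" for x t L
  proof -
    let ?L = "L \<inter> {\<omega>\<in>sample_space X. path X (t + r0) \<omega> \<in> B0}"
    have "L \<in> sets (filt (t + r0))"
      using L filt.sets_F_mono[of t "t + r0"] by (simp add: subset_eq)
    then have L': "?L \<in> sets (filt (t + r0))"
      using path_event_filt[OF order_refl B0, of "t + r0"] by (rule sets.Int)
    have "L \<inter> (shift X t -` cylinder l \<inter> sample_space X)
      = ?L \<inter> (shift X (t + r0) -` cylinder l' \<inter> sample_space X)"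
      using cyl(1)[of _ t] by blast
    also have "emeasure (law X x) \<dots> = (\<integral>\<^sup>+\<omega>. indicator ?L \<omega> * emeasure (law X (path X (t + r0) \<omega>)) (cylinder l') \<partial>law X x)"
      using IH L' unfolding Markov_event_def by blast
    also have "\<dots> = (\<integral>\<^sup>+\<omega>. indicator L \<omega> * \<phi> (path X (t + r0) \<omega>) \<partial>law X x)"
      by (intro nn_integral_cong) (simp add: \<phi>_def indicator_def)
    finally show ?thesis .
  qed
  \<comment> \<open>Shifting by 0 leaves the path unchanged, hence also membership in a cylinder, so
    the law of the cylinder itself is the case of time 0 with the full event.\<close>
  have \<phi>0: "emeasure (law X y) (cylinder l) = (\<integral>\<^sup>+\<omega>. \<phi> (path X r0 \<omega>) \<partial>law X y)" for y
  proof -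
    have "sample_space X \<in> sets (filt 0)" using sets.top[of "filt 0"] by (simp add: filt.space_F)
    note * = step[OF this, of y]
    have "sample_space X \<inter> (shift X 0 -` cylinder l \<inter> sample_space X) = cylinder l"
      unfolding cylinder_def by (auto simp: shift_space path_shift)
    then have "emeasure (law X y) (cylinder l) = (\<integral>\<^sup>+\<omega>. indicator (sample_space X) \<omega> * \<phi> (path X (0 + r0) \<omega>) \<partial>law X y)"
      using * by simp
    also have "\<dots> = (\<integral>\<^sup>+\<omega>. \<phi> (path X r0 \<omega>) \<partial>law X y)" by (intro nn_integral_cong) simp
    finally show ?thesis .
  qed
  show ?case unfolding Markov_event_def
  proof (intro conjI allI ballI)
    show "(\<lambda>y. emeasure (law X y) (cylinder l)) \<in> borel_measurable state_borel"
      unfolding \<phi>0 by (rule Markov_one_time_fun(1)[OF sets.empty_sets \<phi>])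
    fix x t L assume L: "L \<in> sets (filt t)"
    show "emeasure (law X x) (L \<inter> (shift X t -` cylinder l \<inter> sample_space X))
        = (\<integral>\<^sup>+\<omega>. indicator L \<omega> * emeasure (law X (path X t \<omega>)) (cylinder l) \<partial>law X x)"
      unfolding step[OF L] \<phi>0 by (rule Markov_one_time_fun(2)[OF L \<phi>])
  qed
qed

text \<open>Dynkin's theorem: cylinders form an intersection-stable generator of the path events,
  and \<open>Markov_event\<close> is closed under complements and countable disjoint unions.\<close>

lemma Markov_event_natural: "\<Gamma> \<in> sets (natural \<top>) \<Longrightarrow> Markov_event \<Gamma>"
proof -
  let ?P = "{cylinder l | l. \<forall>(r, B)\<in>set l. B \<in> sets state_borel}"
  have P: "?P \<subseteq> sets (natural \<top>)"
    using cylinder_natural[of _ \<top>] by fastforce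
  have sig: "sets (natural \<top>) = sigma_sets (sample_space X) ?P"
  proof (rule antisym)
    show "sigma_sets (sample_space X) ?P \<subseteq> sets (natural \<top>)"
      using sets.sigma_sets_subset[OF P] by simp
    have "path X s -` B \<inter> sample_space X \<in> ?P" if "B \<in> sets state_borel" for s B
      by (intro CollectI exI[of _ "[(s, B)]"]) (use that in \<open>auto simp: cylinder_def\<close>)
    then show "sets (natural \<top>) \<subseteq> sigma_sets (sample_space X) ?P"
      unfolding sets_natural by (intro sigma_sets_mono') blast
  qed
  have Int: "Int_stable ?P"
  proof (rule Int_stableI, safe)
    fix l1 l2 :: "(ennreal \<times> 'a option set) list"
    assume "\<forall>(r, B)\<in>set l1. B \<in> sets state_borel" "\<forall>(r, B)\<in>set l2. B \<in> sets state_borel"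
    then show "\<exists>l. cylinder l1 \<inter> cylinder l2 = cylinder l \<and> (\<forall>(r, B)\<in>set l. B \<in> sets state_borel)"
      by (intro exI[of _ "l1 @ l2"]) (auto simp: cylinder_def)
  qed
  have PP: "?P \<subseteq> Pow (sample_space X)" by (auto simp: cylinder_def)
  have me: "\<Gamma> \<in> sets (law X x)" if "\<Gamma> \<in> sigma_sets (sample_space X) ?P" for \<Gamma> x
    using that natural_subset_law sig by blast
  have ms: "shift X t -` \<Gamma> \<inter> sample_space X \<in> sets (law X x)" if "\<Gamma> \<in> sigma_sets (sample_space X) ?P" for \<Gamma> x t
    using that natural_subset_law sig measurable_sets[OF shift_natural, of \<Gamma> t] by auto
  have mL: "L \<in> sets (law X x)" if "L \<in> sets (filt t)" for L x t
    using that sets_filt_subset by blast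
  assume "\<Gamma> \<in> sets (natural \<top>)"
  then have "\<Gamma> \<in> sigma_sets (sample_space X) ?P" by (simp only: sig)
  then show ?thesis
  proof (induction \<Gamma> rule: sigma_sets_induct_disjoint[OF Int PP, consumes 1, case_names basic empty compl union])
    case (basic A)
    then show ?case using Markov_event_cylinder by blast
  next
    case empty
    then show ?case by (simp add: Markov_event_def)
  next
    case (compl \<Gamma>)
    have f1: "finite_measure (law X y)" for y using prob_law[of y] by (rule prob_space.finite_measure)
    have c: "emeasure (law X y) (sample_space X - \<Gamma>) = 1 - emeasure (law X y) \<Gamma>" for y
      using prob_space.emeasure_space_1[OF prob_law, of y] emeasure_compl[OF me[OF compl(1)], of y] finite_measure.emeasure_finite[OF f1] by simp
    have le1: "emeasure (law X y) \<Gamma> \<le> 1" for y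
      by (rule subprob_space.subprob_emeasure_le_1[OF prob_space_imp_subprob_space[OF prob_law]])
    have mm: "(\<lambda>y. emeasure (law X y) \<Gamma>) \<in> borel_measurable state_borel"
      using compl by (simp add: Markov_event_def)
    show ?case unfolding Markov_event_def c
    proof (intro conjI allI ballI)
      show "(\<lambda>y. 1 - emeasure (law X y) \<Gamma>) \<in> borel_measurable state_borel"
        using mm by simp
      fix x t L assume L: "L \<in> sets (filt t)"
      have [measurable]: "L \<in> sets (law X x)" by (rule mL[OF L])
      let ?S = "shift X t -` \<Gamma> \<inter> sample_space X"
      have [measurable]: "(\<lambda>\<omega>. emeasure (law X (path X t \<omega>)) \<Gamma>) \<in> borel_measurable (law X x)"
        by (rule measurable_compose[OF path_measurable_law mm])
      have ih: "emeasure (law X x) (L \<inter> ?S) = (\<integral>\<^sup>+\<omega>. indicator L \<omega> * emeasure (law X (path X t \<omega>)) \<Gamma> \<partial>law X x)"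
        using compl(2) L unfolding Markov_event_def by blast
      have "L \<inter> (shift X t -` (sample_space X - \<Gamma>) \<inter> sample_space X) = L - (L \<inter> ?S)"
        using sets.sets_into_space[OF L] shift_space by (auto simp: filt.space_F)
      then have "emeasure (law X x) (L \<inter> (shift X t -` (sample_space X - \<Gamma>) \<inter> sample_space X)) = emeasure (law X x) L - emeasure (law X x) (L \<inter> ?S)"
        using ms[OF compl(1)] mL[OF L] finite_measure.emeasure_finite[OF f1] by (simp add: emeasure_Diff)
      also have "\<dots> = (\<integral>\<^sup>+\<omega>. indicator L \<omega> \<partial>law X x) - (\<integral>\<^sup>+\<omega>. indicator L \<omega> * emeasure (law X (path X t \<omega>)) \<Gamma> \<partial>law X x)"
        by (simp add: ih)
      also have "\<dots> = (\<integral>\<^sup>+\<omega>. indicator L \<omega> - indicator L \<omega> * emeasure (law X (path X t \<omega>)) \<Gamma> \<partial>law X x)"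
      proof (rule nn_integral_diff[symmetric])
        show "(\<integral>\<^sup>+\<omega>. indicator L \<omega> * emeasure (law X (path X t \<omega>)) \<Gamma> \<partial>law X x) \<noteq> \<infinity>"
          unfolding ih[symmetric] using finite_measure.emeasure_finite[OF f1] by simp
        show "AE \<omega> in law X x. indicator L \<omega> * emeasure (law X (path X t \<omega>)) \<Gamma> \<le> indicator L \<omega>"
          by (rule AE_I2) (simp add: indicator_def le1)
        show "(\<lambda>\<omega>. indicator L \<omega> * emeasure (law X (path X t \<omega>)) \<Gamma>) \<in> borel_measurable (law X x)"
          by measurable
      qed simp
      also have "\<dots> = (\<integral>\<^sup>+\<omega>. indicator L \<omega> * (1 - emeasure (law X (path X t \<omega>)) \<Gamma>) \<partial>law X x)"
        by (intro nn_integral_cong) (simp add: indicator_def)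
      finally show "emeasure (law X x) (L \<inter> (shift X t -` (sample_space X - \<Gamma>) \<inter> sample_space X)) = (\<integral>\<^sup>+\<omega>. indicator L \<omega> * (1 - emeasure (law X (path X t \<omega>)) \<Gamma>) \<partial>law X x)" .
    qed
  next
    case (union A)
    have Am: "range A \<subseteq> sets (law X y)" for y using union(2) me by blast
    have u: "emeasure (law X y) (\<Union>i. A i) = (\<Sum>i. emeasure (law X y) (A i))" for y
      using suminf_emeasure[OF Am union(1)] by simp
    have mm: "(\<lambda>y. emeasure (law X y) (A i)) \<in> borel_measurable state_borel" for i
      using union by (simp add: Markov_event_def)
    show ?case unfolding Markov_event_def u
    proof (intro conjI allI ballI)
      show "(\<lambda>y. \<Sum>i. emeasure (law X y) (A i)) \<in> borel_measurable state_borel"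
        by (rule borel_measurable_suminf_order[OF mm])
      fix x t L assume L: "L \<in> sets (filt t)"
      have [measurable]: "L \<in> sets (law X x)" by (rule mL[OF L])
      have [measurable]: "(\<lambda>\<omega>. emeasure (law X (path X t \<omega>)) (A i)) \<in> borel_measurable (law X x)" for i
        by (rule measurable_compose[OF path_measurable_law mm])
      have pm: "(\<lambda>\<omega>. indicator L \<omega> * emeasure (law X (path X t \<omega>)) (A i)) \<in> borel_measurable (law X x)" for i
        by measurable
      have ih: "emeasure (law X x) (L \<inter> (shift X t -` A i \<inter> sample_space X)) = (\<integral>\<^sup>+\<omega>. indicator L \<omega> * emeasure (law X (path X t \<omega>)) (A i) \<partial>law X x)" for i
        using union(3)[of i] L unfolding Markov_event_def by blast
      have "L \<inter> (shift X t -` (\<Union>i. A i) \<inter> sample_space X) = (\<Union>i. L \<inter> (shift X t -` A i \<inter> sample_space X))"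
        by auto
      also have "emeasure (law X x) \<dots> = (\<Sum>i. emeasure (law X x) (L \<inter> (shift X t -` A i \<inter> sample_space X)))"
      proof (rule suminf_emeasure[symmetric])
        show "range (\<lambda>i. L \<inter> (shift X t -` A i \<inter> sample_space X)) \<subseteq> sets (law X x)"
        proof (rule image_subsetI)
          fix i
          have "shift X t -` A i \<inter> sample_space X \<in> sets (law X x)"
            using ms[of "A i" t x] union(2) by blast
          then show "L \<inter> (shift X t -` A i \<inter> sample_space X) \<in> sets (law X x)"
            by (rule sets.Int[OF mL[OF L]])
        qed
        show "disjoint_family (\<lambda>i. L \<inter> (shift X t -` A i \<inter> sample_space X))"
          using union(1) unfolding disjoint_family_on_def by blast
      qed
      also have "\<dots> = (\<integral>\<^sup>+\<omega>. indicator L \<omega> * (\<Sum>i. emeasure (law X (path X t \<omega>)) (A i)) \<partial>law X x)"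
        unfolding ih ennreal_suminf_cmult[symmetric] by (rule nn_integral_suminf[symmetric, OF pm])
      finally show "emeasure (law X x) (L \<inter> (shift X t -` (\<Union>i. A i) \<inter> sample_space X)) = (\<integral>\<^sup>+\<omega>. indicator L \<omega> * (\<Sum>i. emeasure (law X (path X t \<omega>)) (A i)) \<partial>law X x)" .
    qed
  qed
qed

lemma Markov_natural:
  assumes L: "L \<in> sets (filt t)" and f: "f \<in> borel_measurable (natural \<top>)"
  shows "(\<lambda>y. \<integral>\<^sup>+\<omega>. f \<omega> \<partial>law X y) \<in> borel_measurable state_borel"
    and "(\<integral>\<^sup>+\<omega>. indicator L \<omega> * f (shift X t \<omega>) \<partial>law X x)
      = (\<integral>\<^sup>+\<omega>. indicator L \<omega> * (\<integral>\<^sup>+\<omega>'. f \<omega>' \<partial>law X (path X t \<omega>)) \<partial>law X x)"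
proof -
  \<comment> \<open>The laws live on \<open>events X\<close>, which may be larger than the path
    events; \<open>Q\<close> is their restriction.\<close>
  define Q where "Q y = distr (law X y) (natural \<top>) (\<lambda>\<omega>. \<omega>)" for y
  have id: "(\<lambda>\<omega>. \<omega>) \<in> law X y \<rightarrow>\<^sub>M natural \<top>" for y
  proof (rule measurableI)
    fix A assume A: "A \<in> sets (natural \<top>)"
    then have "(\<lambda>\<omega>. \<omega>) -` A \<inter> space (law X y) = A" using sets.sets_into_space[OF A] by auto
    then show "(\<lambda>\<omega>. \<omega>) -` A \<inter> space (law X y) \<in> sets (law X y)" using A natural_subset_law by auto
  qed simp
  have eQ: "emeasure (Q y) \<Gamma> = emeasure (law X y) \<Gamma>" if "\<Gamma> \<in> sets (natural \<top>)" for y \<Gamma>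
    using sets.sets_into_space[OF that] unfolding Q_def emeasure_distr[OF id that] by (simp add: Int_absorb2)
  have iQ: "(\<integral>\<^sup>+z. f z \<partial>Q y) = (\<integral>\<^sup>+\<omega>. f \<omega> \<partial>law X y)" for y
    using f by (simp add: Q_def nn_integral_distr[OF id])
  have sQ: "subprob_space (Q y)" "sets (Q y) = sets (natural \<top>)" for y
    using prob_space_imp_subprob_space[OF prob_space.prob_space_distr[OF prob_law id]]
    by (simp_all add: Q_def)
  note T = measurable_compose[OF id[of x] shift_natural[of t]] and Y = path_measurable_law[of t x]
  have L': "L \<in> sets (law X x)" using L sets_filt_subset by auto
  have m: "(\<lambda>y. emeasure (Q y) \<Gamma>) \<in> borel_measurable state_borel" if "\<Gamma> \<in> sets (natural \<top>)" for \<Gamma>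
    using Markov_event_natural[OF that] by (simp add: eQ[OF that] Markov_event_def)
  have eq: "emeasure (law X x) (L \<inter> (shift X t -` \<Gamma> \<inter> space (law X x)))
      = (\<integral>\<^sup>+\<omega>. indicator L \<omega> * emeasure (Q (path X t \<omega>)) \<Gamma> \<partial>law X x)" if "\<Gamma> \<in> sets (natural \<top>)" for \<Gamma>
    using Markov_event_natural[OF that] L unfolding Markov_event_def eQ[OF that] space_law by blast
  show "(\<lambda>y. \<integral>\<^sup>+\<omega>. f \<omega> \<partial>law X y) \<in> borel_measurable state_borel"
    "(\<integral>\<^sup>+\<omega>. indicator L \<omega> * f (shift X t \<omega>) \<partial>law X x)
      = (\<integral>\<^sup>+\<omega>. indicator L \<omega> * (\<integral>\<^sup>+\<omega>'. f \<omega>' \<partial>law X (path X t \<omega>)) \<partial>law X x)"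
    using nn_integral_disintegrate[OF sQ m T Y L' _ eq f, unfolded iQ] sample_space_nonempty
    unfolding space_law by blast+
qed

end

section \<open>Completed laws and the augmented filtration\<close>

lemma measurable_completion_AE:
  assumes f: "f \<in> completion M \<rightarrow>\<^sub>M N" and ae: "AE x in M. f x = g x" and g: "g \<in> space M \<rightarrow> space N"
  shows "g \<in> completion M \<rightarrow>\<^sub>M N"
proof (rule measurableI)
  fix A assume A: "A \<in> sets N"
  show "g -` A \<inter> space (completion M) \<in> sets (completion M)"
  proof (rule completion.in_sets_AE)
    show "f -` A \<inter> space (completion M) \<in> sets (completion M)"
      using f A by (rule measurable_sets)
    show "AE x in completion M. (x \<in> f -` A \<inter> space (completion M)) = (x \<in> g -` A \<inter> space (completion M))"
      using AE_completion[OF ae] by eventually_elim simp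
  qed simp
qed (use g in auto)

lemma AE_emeasure_0D: "emeasure M N = 0 \<Longrightarrow> N \<in> sets M \<Longrightarrow> AE x in M. x \<notin> N"
  by (rule AE_not_in) (simp add: null_sets_def)

context standard_proc
begin

abbreviation "augm \<equiv> minimum_augmented_filtration X"
abbreviation "Pr x \<equiv> completion (law X x)"

lemma space_augm [simp]: "space (augm t) = sample_space X"
  unfolding minimum_augmented_filtration_def by (rule space_measure_of) auto

lemma sets_augm: "sets (augm t) = sigma_sets (sample_space X) {L. L \<subseteq> sample_space X \<and>
         (\<forall>\<nu>. prob_space \<nu> \<and> sets \<nu> = sets state_borel \<longrightarrow>
            (\<exists>L'\<in>sets (natural t). sym_diff L L' \<in> null_sets (completion (law_initial X \<nu>))))}"
  unfolding minimum_augmented_filtration_def by (rule sets_measure_of) auto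

lemma natural_subset_augm: "sets (natural t) \<subseteq> sets (augm t)"
proof
  fix L assume L: "L \<in> sets (natural t)"
  show "L \<in> sets (augm t)"
    unfolding sets_augm using sets.sets_into_space[OF L] L
    by (intro sigma_sets.Basic CollectI conjI allI impI bexI[of _ L]) auto
qed

lemma augm_mono: "s \<le> t \<Longrightarrow> sets (augm s) \<subseteq> sets (augm t)"
  unfolding sets_augm using natural_mono[of s t] by (intro sigma_sets_mono') blast

lemma path_augm: "s \<le> t \<Longrightarrow> path X s \<in> augm t \<rightarrow>\<^sub>M state_borel"
  using path_natural[of s t] natural_subset_augm[of t] by (auto simp: measurable_def)

lemma emeasure_law_measurable:
  "\<Gamma> \<in> sets (natural \<top>) \<Longrightarrow> (\<lambda>y. emeasure (law X y) \<Gamma>) \<in> borel_measurable state_borel"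
  using Markov_event_natural by (simp add: Markov_event_def)

lemma sets_law_initial [simp]: "sets (law_initial X \<nu>) = sets (natural \<top>)"
  and space_law_initial [simp]: "space (law_initial X \<nu>) = sample_space X"
proof -
  have "sets (natural \<top>) \<subseteq> Pow (sample_space X)" using sets.space_closed[of "natural \<top>"] by simp
  moreover have "sigma_sets (sample_space X) (sets (natural \<top>)) = sets (natural \<top>)"
    using sets.sigma_sets_eq[of "natural \<top>"] by simp
  ultimately show "sets (law_initial X \<nu>) = sets (natural \<top>)" "space (law_initial X \<nu>) = sample_space X"
    by (simp_all add: law_initial_def)
qed

lemma emeasure_law_initial:
  assumes \<nu>: "sets \<nu> = sets state_borel" and L: "L \<in> sets (natural \<top>)"
  shows "emeasure (law_initial X \<nu>) L = (\<integral>\<^sup>+x. emeasure (law X x) L \<partial>\<nu>)"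
proof (rule emeasure_measure_of)
  show "law_initial X \<nu> = measure_of (sample_space X) (sets (natural \<top>)) (\<lambda>L. \<integral>\<^sup>+x. emeasure (law X x) L \<partial>\<nu>)"
    by (simp add: law_initial_def)
  show "sets (natural \<top>) \<subseteq> Pow (sample_space X)" using sets.space_closed[of "natural \<top>"] by simp
  show "positive (sets (law_initial X \<nu>)) (\<lambda>L. \<integral>\<^sup>+x. emeasure (law X x) L \<partial>\<nu>)"
    by (simp add: positive_def)
  show "countably_additive (sets (law_initial X \<nu>)) (\<lambda>L. \<integral>\<^sup>+x. emeasure (law X x) L \<partial>\<nu>)"
  proof (rule countably_additiveI)
    fix A :: "nat \<Rightarrow> 'w set"
    assume A: "range A \<subseteq> sets (law_initial X \<nu>)" "disjoint_family A"
    have Am: "range A \<subseteq> sets (law X x)" for x using A(1) natural_subset_law by fastforce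
    have "(\<lambda>x. emeasure (law X x) (A i)) \<in> borel_measurable \<nu>" for i
      using emeasure_law_measurable[of "A i"] A(1) \<nu> by (auto cong: measurable_cong_sets)
    then have "(\<Sum>i. \<integral>\<^sup>+x. emeasure (law X x) (A i) \<partial>\<nu>) = (\<integral>\<^sup>+x. (\<Sum>i. emeasure (law X x) (A i)) \<partial>\<nu>)"
      by (intro nn_integral_suminf[symmetric])
    then show "(\<Sum>i. \<integral>\<^sup>+x. emeasure (law X x) (A i) \<partial>\<nu>) = (\<integral>\<^sup>+x. emeasure (law X x) (\<Union> (range A)) \<partial>\<nu>)"
      by (simp add: suminf_emeasure[OF Am A(2)])
  qed
  show "L \<in> sets (law_initial X \<nu>)" using L by simp
qed

lemma null_law_initialE:
  assumes \<nu>: "sets \<nu> = sets state_borel" and N: "N \<in> null_sets (completion (law_initial X \<nu>))"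
  obtains N' where "N' \<in> sets (natural \<top>)" "N \<subseteq> N'" "(\<integral>\<^sup>+x. emeasure (law X x) N' \<partial>\<nu>) = 0"
proof -
  obtain N' where N': "N' \<in> null_sets (law_initial X \<nu>)" "N \<subseteq> N'"
    using N unfolding null_sets_completion_iff2 by blast
  have "N' \<in> sets (natural \<top>)" "emeasure (law_initial X \<nu>) N' = 0"
    using N'(1) by (auto simp: null_sets_def)
  then show thesis using that[of N'] N'(2) emeasure_law_initial[OF \<nu>, of N'] by simp
qed

lemma augm_subset_completion_initial:
  assumes "prob_space \<nu>" "sets \<nu> = sets state_borel"
  shows "sets (augm \<top>) \<subseteq> sets (completion (law_initial X \<nu>))"
proof -
  have sp: "sample_space X = space (completion (law_initial X \<nu>))" by simp
  show ?thesis unfolding sets_augm sp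
  proof (rule sets.sigma_sets_subset, rule subsetI, elim CollectE conjE)
    fix L assume *: "\<forall>\<nu>. prob_space \<nu> \<and> sets \<nu> = sets state_borel \<longrightarrow>
            (\<exists>L'\<in>sets (natural \<top>). sym_diff L L' \<in> null_sets (completion (law_initial X \<nu>)))"
    then obtain L' where L': "L' \<in> sets (natural \<top>)" "sym_diff L L' \<in> null_sets (completion (law_initial X \<nu>))"
      using assms by blast
    have n: "L - L' \<in> null_sets (completion (law_initial X \<nu>))" "L' - L \<in> null_sets (completion (law_initial X \<nu>))"
      by (rule null_sets_completion_subset[OF _ L'(2)]; blast)+
    have "L = (L' - (L' - L)) \<union> (L - L')" by blast
    moreover have "L' \<in> sets (completion (law_initial X \<nu>))" using L'(1) by simp
    ultimately show "L \<in> sets (completion (law_initial X \<nu>))"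
      using n by (metis null_setsD2 sets.Diff sets.Un)
  qed
qed

text \<open>Equality, up to a null set of the single law \<open>law X x\<close>, with an event of
  the same time \<open>t\<close>. The generators of the augmented filtration have this property and
  it defines a sigma-algebra, so every augmented event has it. Keeping the time \<open>t\<close> is
  what lets the Markov property at \<open>t\<close> be applied to the replacement.\<close>

definition almost_natural :: "ennreal \<Rightarrow> 'a option \<Rightarrow> 'w set set" where
  "almost_natural t x = {L. L \<subseteq> sample_space X \<and> (\<exists>L'\<in>sets (natural t). AE \<omega> in law X x. \<omega> \<in> L \<longleftrightarrow> \<omega> \<in> L')}"

lemma sigma_algebra_almost_natural: "sigma_algebra (sample_space X) (almost_natural t x)"
  unfolding sigma_algebra_iff2
proof (intro conjI ballI allI impI)
  show "almost_natural t x \<subseteq> Pow (sample_space X)" by (auto simp: almost_natural_def)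
  show "{} \<in> almost_natural t x" by (auto simp: almost_natural_def intro!: bexI[of _ "{}"])
  fix L assume "L \<in> almost_natural t x"
  then obtain L' where L': "L' \<in> sets (natural t)" and ae: "AE \<omega> in law X x. \<omega> \<in> L \<longleftrightarrow> \<omega> \<in> L'"
    by (auto simp: almost_natural_def)
  have "AE \<omega> in law X x. \<omega> \<in> sample_space X - L \<longleftrightarrow> \<omega> \<in> sample_space X - L'"
    using ae by eventually_elim auto
  moreover have "sample_space X - L' \<in> sets (natural t)"
    using sets.compl_sets[OF L'] by simp
  ultimately show "sample_space X - L \<in> almost_natural t x"
    unfolding almost_natural_def by (intro CollectI conjI bexI) auto
next
  fix A :: "nat \<Rightarrow> 'w set" assume "range A \<subseteq> almost_natural t x"
  then have "\<forall>i. A i \<subseteq> sample_space X \<and> (\<exists>L'\<in>sets (natural t). AE \<omega> in law X x. \<omega> \<in> A i \<longleftrightarrow> \<omega> \<in> L')"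
    by (auto simp: almost_natural_def)
  then obtain B where B: "\<And>i. A i \<subseteq> sample_space X" "\<And>i. B i \<in> sets (natural t)"
      "\<And>i. AE \<omega> in law X x. \<omega> \<in> A i \<longleftrightarrow> \<omega> \<in> B i"
    by metis
  have "AE \<omega> in law X x. \<forall>i. \<omega> \<in> A i \<longleftrightarrow> \<omega> \<in> B i"
    using B(3) by (simp add: AE_all_countable)
  then have "AE \<omega> in law X x. \<omega> \<in> (\<Union>i. A i) \<longleftrightarrow> \<omega> \<in> (\<Union>i. B i)"
    by eventually_elim auto
  moreover have "(\<Union>i. B i) \<in> sets (natural t)" using B(2) by auto
  ultimately show "(\<Union>i. A i) \<in> almost_natural t x"
    using B(1) unfolding almost_natural_def by (intro CollectI conjI bexI) auto
qed

lemma augm_subset_almost_natural: "sets (augm t) \<subseteq> almost_natural t x"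
  unfolding sets_augm
proof (rule sigma_algebra.sigma_sets_subset[OF sigma_algebra_almost_natural], safe)
  fix L assume L: "L \<subseteq> sample_space X" and *: "\<forall>\<nu>. prob_space \<nu> \<and> sets \<nu> = sets state_borel \<longrightarrow>
            (\<exists>L'\<in>sets (natural t). sym_diff L L' \<in> null_sets (completion (law_initial X \<nu>)))"
  \<comment> \<open>For the Dirac measure at \<open>x\<close> the mixture of the laws is
    \<open>law X x\<close> on path events, so its null sets are null for
    \<open>law X x\<close>.\<close>
  let ?\<nu> = "return state_borel x"
  have \<nu>: "prob_space ?\<nu>" "sets ?\<nu> = sets state_borel" by (auto intro: prob_space_return)
  obtain L' where L': "L' \<in> sets (natural t)" "sym_diff L L' \<in> null_sets (completion (law_initial X ?\<nu>))"
    using * \<nu> by blast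
  from null_law_initialE[OF \<nu>(2) L'(2)] obtain N where N: "N \<in> sets (natural \<top>)" "sym_diff L L' \<subseteq> N"
      "(\<integral>\<^sup>+x. emeasure (law X x) N \<partial>?\<nu>) = 0" .
  have "emeasure (law X x) N = 0"
    using N(3) emeasure_law_measurable[OF N(1)] by (simp add: nn_integral_return)
  moreover have "N \<in> sets (law X x)" using N(1) natural_subset_law by blast
  ultimately have "AE \<omega> in law X x. \<omega> \<notin> N" by (rule AE_emeasure_0D)
  then have "AE \<omega> in law X x. \<omega> \<in> L \<longleftrightarrow> \<omega> \<in> L'"
    by eventually_elim (use N(2) in blast)
  then show "L \<in> almost_natural t x" using L L'(1) by (auto simp: almost_natural_def)
qed

lemma almost_natural_subset: "almost_natural t x \<subseteq> sets (Pr x)"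
proof
  fix L assume "L \<in> almost_natural t x"
  then obtain L' where L: "L \<subseteq> sample_space X" and L': "L' \<in> sets (natural t)" and ae: "AE \<omega> in law X x. \<omega> \<in> L \<longleftrightarrow> \<omega> \<in> L'"
    by (auto simp: almost_natural_def)
  have "L' \<in> sets (Pr x)" using L' natural_subset_law by auto
  then show "L \<in> sets (Pr x)"
    by (rule completion.in_sets_AE[rotated]) (use AE_completion[OF ae] L in auto)
qed

lemma augm_subset_Pr: "sets (augm t) \<subseteq> sets (Pr x)"
  using augm_subset_almost_natural almost_natural_subset by blast

lemma natural_measurable_law: "f \<in> natural t \<rightarrow>\<^sub>M N \<Longrightarrow> f \<in> law X x \<rightarrow>\<^sub>M N"
  using natural_subset_law[of t x] by (auto simp: measurable_def)

lemma augm_measurable_Pr: "f \<in> augm t \<rightarrow>\<^sub>M N \<Longrightarrow> f \<in> Pr x \<rightarrow>\<^sub>M N"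
  using augm_subset_Pr[of t x] by (auto simp: measurable_def)

lemma augm_measurable_mono: "s \<le> t \<Longrightarrow> f \<in> augm s \<rightarrow>\<^sub>M N \<Longrightarrow> f \<in> augm t \<rightarrow>\<^sub>M N"
  using augm_mono[of s t] by (auto simp: measurable_def)

text \<open>The mixture is taken with the distribution \<open>\<nu>\<close> of the position at time
  \<open>t\<close> under \<open>law X x\<close>. A version \<open>Z'\<close> of \<open>Z\<close>
  measurable for the path events differs from \<open>Z\<close> on a null set of that mixture; this
  is a null set of \<open>law X (path X t \<omega>)\<close> for almost every \<open>\<omega>\<close>
  and, by the Markov property, its preimage under the shift is null for \<open>law X x\<close>. This
  is where the augmentation by all initial distributions enters.\<close>

lemma Markov_augm_event:
  fixes Z :: "'w \<Rightarrow> ennreal"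
  assumes Z: "Z \<in> borel_measurable (augm \<top>)"
  shows "(\<lambda>\<omega>. Z (shift X t \<omega>)) \<in> borel_measurable (Pr x)" (is ?A)
    and "(\<lambda>\<omega>. \<integral>\<^sup>+\<omega>'. Z \<omega>' \<partial>law X (path X t \<omega>)) \<in> borel_measurable (Pr x)" (is ?B)
    and "L \<in> sets (augm t) \<Longrightarrow> (\<integral>\<^sup>+\<omega>. indicator L \<omega> * Z (shift X t \<omega>) \<partial>Pr x)
      = (\<integral>\<^sup>+\<omega>. indicator L \<omega> * (\<integral>\<^sup>+\<omega>'. Z \<omega>' \<partial>law X (path X t \<omega>)) \<partial>Pr x)" (is "_ \<Longrightarrow> ?C")
proof -
  define \<nu> where "\<nu> = distr (law X x) state_borel (path X t)"
  have \<nu>: "prob_space \<nu>" "sets \<nu> = sets state_borel"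
    using prob_space.prob_space_distr[OF prob_law path_measurable_law] by (simp_all add: \<nu>_def)
  have "Z \<in> borel_measurable (completion (law_initial X \<nu>))"
    using Z augm_subset_completion_initial[OF \<nu>] by (auto simp: measurable_def)
  from completion_ex_borel_measurable[OF this] obtain Z' where
    Z'0: "Z' \<in> borel_measurable (law_initial X \<nu>)" and ae: "AE \<omega> in law_initial X \<nu>. Z \<omega> = Z' \<omega>" by blast
  have Z': "Z' \<in> borel_measurable (natural \<top>)"
    using Z'0 by (simp cong: measurable_cong_sets)
  obtain N where N: "N \<in> sets (natural \<top>)" "{\<omega> \<in> sample_space X. Z \<omega> \<noteq> Z' \<omega>} \<subseteq> N" "emeasure (law_initial X \<nu>) N = 0"
    by (rule AE_E[OF ae]) (simp only: sets_law_initial space_law_initial)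
  have Nl: "N \<in> sets (law X y)" for y using N(1) natural_subset_law by blast
  have eN: "(\<integral>\<^sup>+\<omega>. emeasure (law X (path X t \<omega>)) N \<partial>law X x) = 0"
    using N(3) unfolding emeasure_law_initial[OF \<nu>(2) N(1)]
    by (simp add: \<nu>_def nn_integral_distr emeasure_law_measurable[OF N(1)])
  have "AE \<omega> in law X x. emeasure (law X (path X t \<omega>)) N = 0"
    using eN measurable_compose[OF path_measurable_law emeasure_law_measurable[OF N(1)]]
    by (subst (asm) nn_integral_0_iff_AE) auto
  then have ae1: "AE \<omega> in law X x. (\<integral>\<^sup>+\<omega>'. Z' \<omega>' \<partial>law X (path X t \<omega>)) = (\<integral>\<^sup>+\<omega>'. Z \<omega>' \<partial>law X (path X t \<omega>))"
  proof eventually_elim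
    case (elim \<omega>)
    have "AE \<omega>' in law X (path X t \<omega>). \<omega>' \<notin> N" using elim Nl by (rule AE_emeasure_0D)
    moreover have "AE \<omega>' in law X (path X t \<omega>). \<omega>' \<in> sample_space X" by (rule AE_I2) simp
    ultimately have "AE \<omega>' in law X (path X t \<omega>). Z' \<omega>' = Z \<omega>'"
      by eventually_elim (use N(2) in force)
    then show ?case by (rule nn_integral_cong_AE)
  qed
  have Om: "sample_space X \<in> sets (filt t)" using sets.top[of "filt t"] by (simp add: filt.space_F)
  have "emeasure (law X x) (shift X t -` N \<inter> sample_space X) = 0"
  proof -
    have "emeasure (law X x) (shift X t -` N \<inter> sample_space X) = emeasure (law X x) (sample_space X \<inter> (shift X t -` N \<inter> sample_space X))"
      by (rule arg_cong[where f="emeasure (law X x)"]) auto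
    also have "\<dots> = (\<integral>\<^sup>+\<omega>. indicator (sample_space X) \<omega> * emeasure (law X (path X t \<omega>)) N \<partial>law X x)"
      using Markov_event_natural[OF N(1)] Om unfolding Markov_event_def by blast
    also have "\<dots> = (\<integral>\<^sup>+\<omega>. emeasure (law X (path X t \<omega>)) N \<partial>law X x)"
      by (intro nn_integral_cong) simp
    finally show ?thesis using eN by simp
  qed
  moreover have sN: "shift X t -` N \<inter> sample_space X \<in> sets (law X x)"
    using measurable_sets[OF shift_natural N(1), of t] natural_subset_law by auto
  ultimately have "AE \<omega> in law X x. \<omega> \<notin> shift X t -` N \<inter> sample_space X" by (rule AE_emeasure_0D)
  moreover have "AE \<omega> in law X x. \<omega> \<in> sample_space X" by (rule AE_I2) simp
  ultimately have ae2: "AE \<omega> in law X x. Z' (shift X t \<omega>) = Z (shift X t \<omega>)"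
    by eventually_elim (use N(2) shift_space in force)
  have ms: "(\<lambda>\<omega>. Z' (shift X t \<omega>)) \<in> borel_measurable (Pr x)"
    by (rule measurable_completion[OF natural_measurable_law[OF measurable_compose[OF shift_natural Z']]])
  show ?A by (rule measurable_completion_AE[OF ms ae2]) simp
  have mp: "(\<lambda>\<omega>. \<integral>\<^sup>+\<omega>'. Z' \<omega>' \<partial>law X (path X t \<omega>)) \<in> borel_measurable (Pr x)"
    by (intro measurable_completion measurable_compose[OF path_measurable_law Markov_natural(1)[OF sets.empty_sets Z']])
  show ?B by (rule measurable_completion_AE[OF mp ae1]) simp
  assume "L \<in> sets (augm t)"
  then obtain L' where L': "L' \<in> sets (natural t)" and ae3: "AE \<omega> in law X x. \<omega> \<in> L \<longleftrightarrow> \<omega> \<in> L'"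
    using augm_subset_almost_natural[of t x] by (auto simp: almost_natural_def)
  have "AE \<omega> in law X x. indicator L \<omega> * Z (shift X t \<omega>) = indicator L' \<omega> * Z' (shift X t \<omega>)"
    using ae2 ae3 by eventually_elim (simp add: indicator_def)
  then have "(\<integral>\<^sup>+\<omega>. indicator L \<omega> * Z (shift X t \<omega>) \<partial>Pr x) = (\<integral>\<^sup>+\<omega>. indicator L' \<omega> * Z' (shift X t \<omega>) \<partial>law X x)"
    unfolding nn_integral_completion by (rule nn_integral_cong_AE)
  also have "\<dots> = (\<integral>\<^sup>+\<omega>. indicator L' \<omega> * (\<integral>\<^sup>+\<omega>'. Z' \<omega>' \<partial>law X (path X t \<omega>)) \<partial>law X x)"
    using L' natural_subset_filt by (intro Markov_natural(2)[OF _ Z']) blast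
  also have "\<dots> = (\<integral>\<^sup>+\<omega>. indicator L \<omega> * (\<integral>\<^sup>+\<omega>'. Z \<omega>' \<partial>law X (path X t \<omega>)) \<partial>Pr x)"
  proof -
    have "AE \<omega> in law X x. indicator L' \<omega> * (\<integral>\<^sup>+\<omega>'. Z' \<omega>' \<partial>law X (path X t \<omega>)) = indicator L \<omega> * (\<integral>\<^sup>+\<omega>'. Z \<omega>' \<partial>law X (path X t \<omega>))"
      using ae1 ae3 by eventually_elim (simp add: indicator_def)
    then show ?thesis unfolding nn_integral_completion by (rule nn_integral_cong_AE)
  qed
  finally show ?C .
qed

text \<open>Both sides are integrals of \<open>Y\<close> for measures on \<open>augm t\<close> with
  the densities \<open>g1\<close> and \<open>g2\<close>. These measures agree on events, so no
  approximation of \<open>Y\<close> is required.\<close>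

lemma Markov_augm:
  fixes Y Z :: "'w \<Rightarrow> ennreal"
  assumes Y: "Y \<in> borel_measurable (augm t)" and Z: "Z \<in> borel_measurable (augm \<top>)"
  shows "(\<integral>\<^sup>+\<omega>. Y \<omega> * Z (shift X t \<omega>) \<partial>Pr x)
      = (\<integral>\<^sup>+\<omega>. Y \<omega> * (\<integral>\<^sup>+\<omega>'. Z \<omega>' \<partial>Pr (path X t \<omega>)) \<partial>Pr x)"
proof -
  define g1 where "g1 \<omega> = Z (shift X t \<omega>)" for \<omega>
  define g2 where "g2 \<omega> = (\<integral>\<^sup>+\<omega>'. Z \<omega>' \<partial>law X (path X t \<omega>))" for \<omega>
  have [measurable]: "g1 \<in> borel_measurable (Pr x)" "g2 \<in> borel_measurable (Pr x)"
    unfolding g1_def g2_def using Markov_augm_event[OF Z] by blast+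
  have id: "(\<lambda>\<omega>. \<omega>) \<in> Pr x \<rightarrow>\<^sub>M augm t"
    by (rule augm_measurable_Pr[of _ t]) (auto intro: measurable_ident_sets)
  have [measurable]: "Y \<in> borel_measurable (Pr x)" by (rule augm_measurable_Pr[OF Y])
  have d: "distr (density (Pr x) g1) (augm t) (\<lambda>\<omega>. \<omega>) = distr (density (Pr x) g2) (augm t) (\<lambda>\<omega>. \<omega>)"
  proof (rule measure_eqI)
    fix L assume "L \<in> sets (distr (density (Pr x) g1) (augm t) (\<lambda>\<omega>. \<omega>))"
    then have L: "L \<in> sets (augm t)" by simp
    have L' [measurable]: "L \<in> sets (Pr x)" using L augm_subset_Pr by blast
    have *: "emeasure (distr (density (Pr x) g) (augm t) (\<lambda>\<omega>. \<omega>)) L = (\<integral>\<^sup>+\<omega>. indicator L \<omega> * g \<omega> \<partial>Pr x)"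
      if [measurable]: "g \<in> borel_measurable (Pr x)" for g
    proof -
      have "emeasure (distr (density (Pr x) g) (augm t) (\<lambda>\<omega>. \<omega>)) L = emeasure (density (Pr x) g) L"
        using id L sets.sets_into_space[OF L'] by (subst emeasure_distr) (auto simp: Int_absorb2)
      also have "\<dots> = (\<integral>\<^sup>+\<omega>. g \<omega> * indicator L \<omega> \<partial>Pr x)" by (rule emeasure_density) measurable
      finally show ?thesis by (simp add: mult.commute)
    qed
    show "emeasure (distr (density (Pr x) g1) (augm t) (\<lambda>\<omega>. \<omega>)) L = emeasure (distr (density (Pr x) g2) (augm t) (\<lambda>\<omega>. \<omega>)) L"
      using Markov_augm_event(3)[OF Z L, of x] by (simp add: * g1_def[symmetric] g2_def[symmetric])
  qed simp
  have *: "(\<integral>\<^sup>+\<omega>. Y \<omega> * g \<omega> \<partial>Pr x) = (\<integral>\<^sup>+\<omega>. Y \<omega> \<partial>distr (density (Pr x) g) (augm t) (\<lambda>\<omega>. \<omega>))"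
    if [measurable]: "g \<in> borel_measurable (Pr x)" for g
  proof -
    have "(\<integral>\<^sup>+\<omega>. Y \<omega> \<partial>distr (density (Pr x) g) (augm t) (\<lambda>\<omega>. \<omega>)) = (\<integral>\<^sup>+\<omega>. Y \<omega> \<partial>density (Pr x) g)"
      using id Y by (subst nn_integral_distr) auto
    also have "\<dots> = (\<integral>\<^sup>+\<omega>. g \<omega> * Y \<omega> \<partial>Pr x)" by (rule nn_integral_density) measurable
    finally show ?thesis by (simp add: mult.commute)
  qed
  have "(\<integral>\<^sup>+\<omega>. Y \<omega> * g1 \<omega> \<partial>Pr x) = (\<integral>\<^sup>+\<omega>. Y \<omega> * g2 \<omega> \<partial>Pr x)"
    by (simp only: * d \<open>g1 \<in> borel_measurable (Pr x)\<close> \<open>g2 \<in> borel_measurable (Pr x)\<close>)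
  then show ?thesis by (simp add: g1_def g2_def nn_integral_completion)
qed

end

section \<open>Stieltjes integrals along clocks\<close>

lemma interval_measure_eqI:
  assumes M: "sets M = sets borel"
    and F: "\<And>x y. x \<le> y \<Longrightarrow> F x \<le> F y" "\<And>a. continuous (at_right a) F"
    and eq: "\<And>a b. a \<le> b \<Longrightarrow> emeasure M {a<..b} = ennreal (F b - F a)"
  shows "M = interval_measure F"
proof (rule measure_eqI_generator_eq[where E="range (\<lambda>(a, b). {a<..b::real})" and \<Omega>=UNIV and A="\<lambda>i::nat. {- real i<..real i}"])
  have Ioc: "sigma_sets UNIV (range (\<lambda>(a, b). {a<..b::real})) = sets borel"
    by (subst borel_sigma_sets_Ioc) simp
  show "sets M = sigma_sets UNIV (range (\<lambda>(a, b). {a<..b::real}))"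
    "sets (interval_measure F) = sigma_sets UNIV (range (\<lambda>(a, b). {a<..b::real}))"
    using M Ioc by simp_all
  show "Int_stable (range (\<lambda>(a, b). {a<..b::real}))"
  proof (rule Int_stableI, safe)
    fix a b c d :: real
    show "{a<..b} \<inter> {c<..d} \<in> range (\<lambda>(a, b). {a<..b::real})"
      by (intro image_eqI[of _ _ "(max a c, min b d)"]) auto
  qed
  show "emeasure M Y = emeasure (interval_measure F) Y" if "Y \<in> range (\<lambda>(a, b). {a<..b::real})" for Y
  proof -
    obtain a b where Y: "Y = {a<..b}" using \<open>Y \<in> _\<close> by auto
    show ?thesis
    proof (cases "a \<le> b")
      case True
      then show ?thesis using eq F by (simp add: Y emeasure_interval_measure_Ioc)
    qed (simp add: Y)
  qed
  show "(\<Union>i::nat. {- real i<..real i}) = UNIV"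
  proof -
    have "x \<in> (\<Union>i::nat. {- real i<..real i})" for x :: real
    proof -
      obtain n :: nat where "\<bar>x\<bar> < real n" using reals_Archimedean2 by blast
      then have "x \<in> {- real n<..real n}" by auto
      then show ?thesis by blast
    qed
    then show ?thesis by blast
  qed
  show "emeasure M {- real i<..real i} \<noteq> \<infinity>" for i :: nat
    using eq[of "- real i" "real i"] by simp
qed auto

text \<open>Rounding up, not down: paths are right-continuous, so values at the rounded times
  converge, and an increment over a cell is known at its right end, where the Markov property is
  applied.\<close>

definition dyadic_ceil :: "nat \<Rightarrow> real \<Rightarrow> real" where
  "dyadic_ceil m t = of_int \<lceil>t * 2 ^ m\<rceil> / 2 ^ m"

lemma dyadic_ceil_ge: "t \<le> dyadic_ceil m t"
  by (simp add: dyadic_ceil_def field_simps)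

lemma dyadic_ceil_less: "dyadic_ceil m t < t + 1 / 2 ^ m"
proof -
  have "of_int \<lceil>t * 2 ^ m\<rceil> < t * 2 ^ m + 1" by linarith
  then show ?thesis by (simp add: dyadic_ceil_def field_simps)
qed

lemma dyadic_ceil_mono: "s \<le> t \<Longrightarrow> dyadic_ceil m s \<le> dyadic_ceil m t"
  by (simp add: dyadic_ceil_def divide_right_mono ceiling_mono)

lemma dyadic_ceil_eq:
  "real i / 2 ^ m < t \<Longrightarrow> t \<le> real (Suc i) / 2 ^ m \<Longrightarrow> dyadic_ceil m t = real (Suc i) / 2 ^ m"
proof -
  assume "real i / 2 ^ m < t" "t \<le> real (Suc i) / 2 ^ m"
  then have "\<lceil>t * 2 ^ m\<rceil> = int (Suc i)"
    by (intro ceiling_unique) (auto simp: field_simps)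
  then show ?thesis by (simp add: dyadic_ceil_def)
qed

text \<open>The grids are nested, so rounding to a finer grid first has no effect. This allows an
  integrand sampled on a coarse grid to be integrated over fine cells.\<close>

lemma dyadic_ceil_dyadic_ceil:
  assumes "m \<le> n"
  shows "dyadic_ceil m (dyadic_ceil n t) = dyadic_ceil m t"
proof -
  have "dyadic_ceil n t \<le> dyadic_ceil m t"
  proof -
    have "t * 2 ^ n \<le> of_int (\<lceil>t * 2 ^ m\<rceil> * 2 ^ (n - m))"
    proof -
      have "t * 2 ^ n = (t * 2 ^ m) * 2 ^ (n - m)" using assms by (simp flip: power_add)
      also have "\<dots> \<le> of_int \<lceil>t * 2 ^ m\<rceil> * 2 ^ (n - m)" by (rule mult_right_mono) auto
      finally show ?thesis by simp
    qed
    then have "\<lceil>t * 2 ^ n\<rceil> \<le> \<lceil>t * 2 ^ m\<rceil> * 2 ^ (n - m)" by (simp only: ceiling_le_iff)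
    then have "(of_int \<lceil>t * 2 ^ n\<rceil> :: real) \<le> of_int (\<lceil>t * 2 ^ m\<rceil> * 2 ^ (n - m))" by (simp only: of_int_le_iff)
    then have "(of_int \<lceil>t * 2 ^ n\<rceil> :: real) \<le> of_int \<lceil>t * 2 ^ m\<rceil> * 2 ^ (n - m)" by simp
    moreover have "(2::real) ^ n = 2 ^ m * 2 ^ (n - m)" using assms by (simp flip: power_add)
    ultimately show ?thesis by (simp add: dyadic_ceil_def field_simps)
  qed
  then have "dyadic_ceil m (dyadic_ceil n t) \<le> dyadic_ceil m (dyadic_ceil m t)" by (rule dyadic_ceil_mono)
  also have "\<dots> = dyadic_ceil m t" by (simp add: dyadic_ceil_def)
  finally show ?thesis
    using dyadic_ceil_mono[OF dyadic_ceil_ge, of m t n] by simp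
qed

lemma dyadic_ceil_antimono: "m \<le> n \<Longrightarrow> dyadic_ceil n t \<le> dyadic_ceil m t"
  using dyadic_ceil_ge[of "dyadic_ceil n t" m] by (simp add: dyadic_ceil_dyadic_ceil)

lemma dyadic_ceil_measurable [measurable]: "dyadic_ceil m \<in> borel_measurable borel"
  unfolding dyadic_ceil_def by measurable

lemma dyadic_ceil_tendsto: "(\<lambda>m. dyadic_ceil m t) \<longlonglongrightarrow> t"
proof (rule tendsto_sandwich[OF always_eventually always_eventually])
  show "\<forall>m. t \<le> dyadic_ceil m t" "\<forall>m. dyadic_ceil m t \<le> t + 1 / 2 ^ m"
    using dyadic_ceil_ge dyadic_ceil_less by (auto intro: less_imp_le)
  have "(\<lambda>m. t + (1 / 2) ^ m) \<longlonglongrightarrow> t + 0"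
    by (intro tendsto_add tendsto_const LIMSEQ_power_zero) simp
  then show "(\<lambda>m. t + 1 / 2 ^ m) \<longlonglongrightarrow> t" by (simp add: power_one_over)
qed simp

lemma right_cont_tendsto_sequentially:
  fixes h :: "real \<Rightarrow> 'b::topological_space"
  assumes h: "(h \<longlongrightarrow> h t) (at_right t)" and ge: "\<And>m. t \<le> r m" and lim: "r \<longlonglongrightarrow> t"
  shows "(\<lambda>m. h (r m)) \<longlonglongrightarrow> h t"
proof (rule topological_tendstoI)
  fix S assume "open S" "h t \<in> S"
  then have "eventually (\<lambda>y. h y \<in> S) (at_right t)" by (rule topological_tendstoD[OF h])
  then obtain b where b: "t < b" "\<And>y. t < y \<Longrightarrow> y < b \<Longrightarrow> h y \<in> S"
    by (auto simp: eventually_at_right[OF less_add_one])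
  have "eventually (\<lambda>m. r m < b) sequentially" using order_tendstoD(2)[OF lim b(1)] .
  then show "eventually (\<lambda>m. h (r m) \<in> S) sequentially"
    by eventually_elim (use b ge \<open>h t \<in> S\<close> in \<open>metis le_less\<close>)
qed

lemma tendsto_dyadic_ceil:
  fixes h :: "real \<Rightarrow> 'b::topological_space"
  assumes "(h \<longlongrightarrow> h t) (at_right t)"
  shows "(\<lambda>m. h (dyadic_ceil m t)) \<longlonglongrightarrow> h t"
  using assms dyadic_ceil_ge dyadic_ceil_tendsto by (rule right_cont_tendsto_sequentially)

lemma right_cont_measurable:
  fixes h :: "real \<Rightarrow> 'b::metric_space"
  assumes "\<And>t. (h \<longlongrightarrow> h t) (at_right t)"
  shows "h \<in> borel_measurable borel"
proof (rule borel_measurable_LIMSEQ_metric)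
  show "(\<lambda>t. h (dyadic_ceil m t)) \<in> borel_measurable borel" for m
  proof -
    have "(\<lambda>t::real. h (of_int \<lceil>t * 2 ^ m\<rceil> / 2 ^ m)) \<in> borel_measurable borel"
      by (rule measurable_compose[where g="\<lambda>k. h (of_int k / 2 ^ m)" and N="count_space UNIV"]) auto
    then show ?thesis by (simp add: dyadic_ceil_def)
  qed
  show "(\<lambda>m. h (dyadic_ceil m t)) \<longlonglongrightarrow> h t" if "t \<in> space borel" for t
    using assms by (rule tendsto_dyadic_ceil)
qed

text \<open>The half-open cells partition the positive half-line, and on each of them the rounded
  time is constant, equal to the right end.\<close>

lemma nn_integral_dyadic_cells:
  fixes \<phi> :: "real \<Rightarrow> ennreal"
  assumes M: "sets M = sets borel" and \<phi>: "\<phi> \<in> borel_measurable borel"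
  shows "(\<integral>\<^sup>+t\<in>{0<..}. \<phi> (dyadic_ceil m t) \<partial>M)
    = (\<Sum>i. \<phi> (real (Suc i) / 2 ^ m) * emeasure M {real i / 2 ^ m<..real (Suc i) / 2 ^ m})"
proof -
  note [measurable_cong] = M
  note \<phi>[measurable]
  let ?I = "\<lambda>i. {real i / 2 ^ m<..real (Suc i) / 2 ^ m}"
  have disj: "disjoint_family ?I"
    unfolding disjoint_family_on_def
  proof (intro ballI impI)
    have *: "?I i \<inter> ?I j = {}" if "i < j" for i j
    proof -
      have "real (Suc i) / 2 ^ m \<le> real j / 2 ^ m"
        using that by (intro divide_right_mono) auto
      then show ?thesis by (auto simp del: of_nat_Suc)
    qed
    fix i j :: nat assume "i \<noteq> j"
    then show "?I i \<inter> ?I j = {}" using *[of i j] *[of j i] by (cases "i < j") auto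
  qed
  have un: "(\<Union>i. ?I i) = {0<..}"
  proof (intro equalityI subsetI)
    fix t :: real assume t: "t \<in> {0<..}"
    define k where "k = nat \<lceil>t * 2 ^ m\<rceil>"
    have "0 < \<lceil>t * 2 ^ m\<rceil>" using t by simp
    then obtain i where i: "k = Suc i" by (cases k) (auto simp: k_def)
    then have "\<lceil>t * 2 ^ m\<rceil> = int (Suc i)" using \<open>0 < _\<close> by (simp add: k_def)
    then have "of_int (int (Suc i)) - 1 < t * 2 ^ m" "t * 2 ^ m \<le> of_int (int (Suc i))" by linarith+
    then have "t \<in> ?I i" by (auto simp: field_simps)
    then show "t \<in> (\<Union>i. ?I i)" by blast
  next
    fix t assume "t \<in> (\<Union>i. ?I i)"
    then obtain i where i: "real i / 2 ^ m < t" by auto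
    have "0 \<le> real i / 2 ^ m" by simp
    then have "0 < t" using i by (rule le_less_trans)
    then show "t \<in> {0<..}" by simp
  qed
  have "(\<integral>\<^sup>+t\<in>{0<..}. \<phi> (dyadic_ceil m t) \<partial>M) = (\<integral>\<^sup>+t. (\<Sum>i. \<phi> (dyadic_ceil m t) * indicator (?I i) t) \<partial>M)"
    unfolding un[symmetric] by (intro nn_integral_cong) (simp only: ennreal_suminf_cmult suminf_indicator[OF disj])
  also have "\<dots> = (\<Sum>i. \<integral>\<^sup>+t. \<phi> (dyadic_ceil m t) * indicator (?I i) t \<partial>M)"
    by (rule nn_integral_suminf) measurable
  also have "\<dots> = (\<Sum>i. \<integral>\<^sup>+t. \<phi> (real (Suc i) / 2 ^ m) * indicator (?I i) t \<partial>M)"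
    by (intro suminf_cong nn_integral_cong) (auto simp: indicator_def dyadic_ceil_eq simp del: of_nat_Suc)
  also have "\<dots> = (\<Sum>i. \<phi> (real (Suc i) / 2 ^ m) * emeasure M (?I i))"
    by (intro suminf_cong nn_integral_cmult_indicator) (simp add: M)
  finally show ?thesis .
qed

text \<open>The product measure of the plane is split along the diagonal, which is a null set
  because \<open>M'\<close> has no atoms. In terms of distribution functions this is integration by
  parts without a jump term.\<close>

lemma nn_integral_double_tail:
  fixes M M' :: "real measure"
  assumes M: "finite_measure M" "sets M = sets borel" and M': "finite_measure M'" "sets M' = sets borel"
    and na: "\<And>t. emeasure M' {t} = 0"
  shows "(\<integral>\<^sup>+t. emeasure M' {t<..} \<partial>M) + (\<integral>\<^sup>+t. emeasure M {t<..} \<partial>M') = emeasure M UNIV * emeasure M' UNIV"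
proof -
  interpret M: finite_measure M by fact
  interpret M': finite_measure M' by fact
  interpret P: pair_sigma_finite M M' ..
  note [measurable_cong] = M(2) M'(2)
  have sp: "space M = UNIV" "space M' = UNIV" using M(2) M'(2) by (auto dest: sets_eq_imp_space_eq)
  have s: "sets (M \<Otimes>\<^sub>M M') = sets (borel :: (real \<times> real) measure)"
    unfolding borel_prod[symmetric] by (rule sets_pair_measure_cong[OF M(2) M'(2)])
  have "{z :: real \<times> real. fst z < snd z} \<in> sets borel" "{z :: real \<times> real. snd z < fst z} \<in> sets borel"
    by (auto intro!: borel_open open_Collect_less continuous_intros)
  then have L: "{z. fst z < snd z} \<in> sets (M \<Otimes>\<^sub>M M')" and G: "{z. snd z < fst z} \<in> sets (M \<Otimes>\<^sub>M M')"
    by (simp_all add: s)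
  have E: "{z. fst z = snd z} \<in> sets (M \<Otimes>\<^sub>M M')"
    unfolding s by (intro borel_closed closed_Collect_eq continuous_intros)
  have "emeasure M UNIV * emeasure M' UNIV = emeasure (M \<Otimes>\<^sub>M M') (UNIV \<times> UNIV)"
    using sets.top[of M] sets.top[of M'] by (subst M'.emeasure_pair_measure_Times) (auto simp: sp)
  also have "UNIV \<times> UNIV = {z::real\<times>real. fst z < snd z} \<union> ({z. snd z < fst z} \<union> {z. fst z = snd z})" by auto
  also have "emeasure (M \<Otimes>\<^sub>M M') \<dots> = emeasure (M \<Otimes>\<^sub>M M') {z. fst z < snd z} + (emeasure (M \<Otimes>\<^sub>M M') {z. snd z < fst z} + emeasure (M \<Otimes>\<^sub>M M') {z. fst z = snd z})"
  proof -
    have "emeasure (M \<Otimes>\<^sub>M M') {z. snd z < fst z} + emeasure (M \<Otimes>\<^sub>M M') {z. fst z = snd z} = emeasure (M \<Otimes>\<^sub>M M') ({z. snd z < fst z} \<union> {z. fst z = snd z})"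
      by (rule plus_emeasure[OF G E]) auto
    moreover have "emeasure (M \<Otimes>\<^sub>M M') {z. fst z < snd z} + emeasure (M \<Otimes>\<^sub>M M') ({z. snd z < fst z} \<union> {z. fst z = snd z})
       = emeasure (M \<Otimes>\<^sub>M M') ({z. fst z < snd z} \<union> ({z. snd z < fst z} \<union> {z. fst z = snd z}))"
      using G E by (intro plus_emeasure[OF L] sets.Un) auto
    ultimately show ?thesis by simp
  qed
  also have "emeasure (M \<Otimes>\<^sub>M M') {z. fst z = snd z} = (\<integral>\<^sup>+t. emeasure M' {t} \<partial>M)"
    by (subst M'.emeasure_pair_measure_alt[OF E]) (auto intro!: nn_integral_cong arg_cong[where f="emeasure M'"])
  also have "\<dots> = 0" by (simp add: na)
  also have "emeasure (M \<Otimes>\<^sub>M M') {z. fst z < snd z} = (\<integral>\<^sup>+t. emeasure M' {t<..} \<partial>M)"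
    by (subst M'.emeasure_pair_measure_alt[OF L]) (auto intro!: nn_integral_cong arg_cong[where f="emeasure M'"])
  also have "emeasure (M \<Otimes>\<^sub>M M') {z. snd z < fst z} = (\<integral>\<^sup>+t. emeasure M {t<..} \<partial>M')"
    by (subst P.emeasure_pair_measure_alt2[OF G]) (auto intro!: nn_integral_cong arg_cong[where f="emeasure M"])
  finally show ?thesis by simp
qed

section \<open>Clocks: trajectories of additive functionals\<close>

definition clock :: "(real \<Rightarrow> ennreal) \<Rightarrow> bool" where
  "clock a \<longleftrightarrow> a 0 = 0 \<and> continuous_on {0..} a \<and> (\<forall>s t. 0 \<le> s \<longrightarrow> s \<le> t \<longrightarrow> a s \<le> a t) \<and> (\<forall>t\<ge>0. a t < \<top>)"

text \<open>\<open>max t 0\<close> extends the clock to negative times, as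
  \<open>interval_measure\<close> needs a function on the whole line; the extension is constant
  there and adds no mass.\<close>

definition clock_measure :: "(real \<Rightarrow> ennreal) \<Rightarrow> real measure" where
  "clock_measure a = interval_measure (\<lambda>t. enn2real (a (max t 0)))"

lemma sets_clock_measure [simp, measurable_cong]: "sets (clock_measure a) = sets borel"
  and space_clock_measure [simp]: "space (clock_measure a) = UNIV"
  by (simp_all add: clock_measure_def)

lemma clockD:
  assumes "clock a"
  shows "a 0 = 0" "continuous_on {0..} a" "0 \<le> s \<Longrightarrow> s \<le> t \<Longrightarrow> a s \<le> a t" "0 \<le> t \<Longrightarrow> a t < \<top>"
  using assms by (auto simp: clock_def)

lemma clock_distribution:
  assumes a: "clock a"
  shows "x \<le> y \<Longrightarrow> enn2real (a (max x 0)) \<le> enn2real (a (max y 0))"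
    and "continuous_on UNIV (\<lambda>t. enn2real (a (max t 0)))"
    and "continuous (at_right x) (\<lambda>t. enn2real (a (max t 0)))"
proof -
  show "x \<le> y \<Longrightarrow> enn2real (a (max x 0)) \<le> enn2real (a (max y 0))"
    using clockD[OF a] by (intro enn2real_mono) auto
  have c: "continuous_on UNIV (\<lambda>t. a (max t 0))"
    by (rule continuous_on_compose2[OF clockD(2)[OF a]]) (auto intro!: continuous_intros)
  show c': "continuous_on UNIV (\<lambda>t. enn2real (a (max t 0)))"
    unfolding continuous_on_def
  proof
    fix x
    have "a (max x 0) = ennreal (enn2real (a (max x 0)))" using clockD(4)[OF a, of "max x 0"] by simp
    then have "((\<lambda>t. a (max t 0)) \<longlongrightarrow> ennreal (enn2real (a (max x 0)))) (at x)"
      using c by (simp add: continuous_on_def)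
    then show "((\<lambda>t. enn2real (a (max t 0))) \<longlongrightarrow> enn2real (a (max x 0))) (at x)"
      by (rule tendsto_enn2real) simp
  qed
  then show "continuous (at_right x) (\<lambda>t. enn2real (a (max t 0)))"
    by (rule continuous_at_imp_continuous_at_within[OF continuous_on_interior]) simp
qed

lemma emeasure_clock_Ioc:
  assumes a: "clock a" and "x \<le> y"
  shows "emeasure (clock_measure a) {x<..y} = a (max y 0) - a (max x 0)"
proof -
  have "emeasure (clock_measure a) {x<..y} = ennreal (enn2real (a (max y 0)) - enn2real (a (max x 0)))"
    unfolding clock_measure_def using clock_distribution[OF a] \<open>x \<le> y\<close> by (intro emeasure_interval_measure_Ioc) auto
  also have "\<dots> = a (max y 0) - a (max x 0)"
    using clockD(4)[OF a] by (simp add: ennreal_minus[symmetric])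
  finally show ?thesis .
qed

lemma emeasure_clock_singleton:
  assumes a: "clock a"
  shows "emeasure (clock_measure a) {t} = 0"
  using emeasure_interval_measure_Icc[of t t "\<lambda>t. enn2real (a (max t 0))"] clock_distribution[OF a]
  by (simp add: clock_measure_def)

lemma sigma_finite_clock_measure: "clock a \<Longrightarrow> sigma_finite_measure (clock_measure a)"
  unfolding clock_measure_def using clock_distribution by (intro sigma_finite_interval_measure) auto

lemma AE_clock_pos:
  assumes a: "clock a"
  shows "AE t in clock_measure a. 0 < t"
proof -
  have "emeasure (clock_measure a) {- real n<..0} = 0" for n
    using emeasure_clock_Ioc[OF a, of "- real n" 0] by (simp add: clockD(1)[OF a])
  then have "AE t in clock_measure a. \<forall>n::nat. t \<notin> {- real n<..0}"
    unfolding AE_all_countable by (intro allI AE_not_in) (simp add: null_sets_def)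
  then show ?thesis
  proof eventually_elim
    case (elim t)
    obtain n :: nat where "- t < real n" using reals_Archimedean2 by blast
    then show ?case using elim[rule_format, of n] by auto
  qed
qed

text \<open>Stopping the clock at \<open>u\<close> restricts its measure to \<open>{..u}\<close>. A
  clock is finite, so every \<open>u \<ge> 0\<close> is admissible and the supremum exhausts the
  half-line; time 0 and negative times carry no mass.\<close>

lemma Stieltjes_integral_clock:
  assumes a: "clock a" and g: "g \<in> borel_measurable borel"
  shows "Stieltjes_integral a g = (\<integral>\<^sup>+t. g t \<partial>clock_measure a)"
proof -
  note g[measurable]
  have part: "(\<integral>\<^sup>+t\<in>{0..u}. g t \<partial>interval_measure (\<lambda>t. enn2real (a (min (max t 0) u)))) = (\<integral>\<^sup>+t\<in>{0..u}. g t \<partial>clock_measure a)"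
    if u: "0 \<le> u" for u
  proof -
    let ?F = "\<lambda>t. enn2real (a (max t 0))"
    have eqF: "(\<lambda>t. enn2real (a (min (max t 0) u))) = (\<lambda>t. ?F (min t u))"
      using u by (intro ext) (simp add: min_def max_def)
    have "density (clock_measure a) (indicator {..u}) = interval_measure (\<lambda>t. ?F (min t u))"
    proof (rule interval_measure_eqI)
      show "?F (min x u) \<le> ?F (min y u)" if "x \<le> y" for x y
        using that by (intro clock_distribution(1)[OF a]) simp
      have "continuous_on UNIV (\<lambda>t. ?F (min t u))"
        by (rule continuous_on_compose2[OF clock_distribution(2)[OF a]]) (auto intro!: continuous_intros)
      then show "continuous (at_right x) (\<lambda>t. ?F (min t u))" for x
        by (rule continuous_at_imp_continuous_at_within[OF continuous_on_interior]) simp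
      fix x y :: real assume "x \<le> y"
      have "emeasure (density (clock_measure a) (indicator {..u})) {x<..y} = emeasure (clock_measure a) {min x u<..min y u}"
        by (subst emeasure_density) (auto simp: indicator_inter_arith[symmetric] intro!: arg_cong[where f="emeasure (clock_measure a)"])
      also have "\<dots> = ennreal (?F (min y u) - ?F (min x u))"
        unfolding clock_measure_def using clock_distribution[OF a] \<open>x \<le> y\<close> by (intro emeasure_interval_measure_Ioc) auto
      finally show "emeasure (density (clock_measure a) (indicator {..u})) {x<..y} = ennreal (?F (min y u) - ?F (min x u))" .
    qed simp
    then have "(\<integral>\<^sup>+t\<in>{0..u}. g t \<partial>interval_measure (\<lambda>t. enn2real (a (min (max t 0) u)))) = (\<integral>\<^sup>+t\<in>{0..u}. g t \<partial>density (clock_measure a) (indicator {..u}))"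
      by (simp only: eqF)
    also have "\<dots> = (\<integral>\<^sup>+t\<in>{0..u}. g t \<partial>clock_measure a)"
      by (subst nn_integral_density) (auto intro!: nn_integral_cong simp: indicator_def)
    finally show ?thesis .
  qed
  have "Stieltjes_integral a g = (SUP u\<in>{0..}. \<integral>\<^sup>+t\<in>{0..u}. g t \<partial>clock_measure a)"
    unfolding Stieltjes_integral_def using clockD(4)[OF a] by (intro SUP_cong) (auto simp: part)
  also have "\<dots> = (SUP n::nat. \<integral>\<^sup>+t\<in>{0..real n}. g t \<partial>clock_measure a)"
  proof (intro antisym SUP_least)
    fix u :: real assume "u \<in> {0..}"
    obtain n :: nat where "u \<le> real n" using real_arch_simple by blast
    then have "(\<integral>\<^sup>+t\<in>{0..u}. g t \<partial>clock_measure a) \<le> (\<integral>\<^sup>+t\<in>{0..real n}. g t \<partial>clock_measure a)"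
      by (intro nn_integral_mono) (auto simp: indicator_def)
    then show "(\<integral>\<^sup>+t\<in>{0..u}. g t \<partial>clock_measure a) \<le> (SUP n::nat. \<integral>\<^sup>+t\<in>{0..real n}. g t \<partial>clock_measure a)"
      by (rule SUP_upper2[OF UNIV_I])
  qed (auto intro!: SUP_upper)
  also have "\<dots> = (\<integral>\<^sup>+t. (SUP n::nat. g t * indicator {0..real n} t) \<partial>clock_measure a)"
    by (rule nn_integral_monotone_convergence_SUP[symmetric]) (auto simp: incseq_def le_fun_def indicator_def)
  also have "\<dots> = (\<integral>\<^sup>+t. g t \<partial>clock_measure a)"
  proof (rule nn_integral_cong_AE)
    show "AE t in clock_measure a. (SUP n::nat. g t * indicator {0..real n} t) = g t"
      using AE_clock_pos[OF a]
    proof eventually_elim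
      case (elim t)
      obtain n :: nat where "t \<le> real n" using real_arch_simple by blast
      then have "g t * indicator {0..real n} t = g t" using elim by simp
      then show ?case by (intro antisym SUP_least) (auto simp: indicator_def intro!: SUP_upper2[of n])
    qed
  qed
  finally show ?thesis .
qed

lemma ennreal_add_diff_add_cancel_left:
  fixes x y z :: ennreal
  assumes "x < \<top>"
  shows "(x + y) - (x + z) = y - z"
  using assms by (cases x y z rule: ennreal3_cases)
    (auto simp: ennreal_minus top_add add_top minus_top_ennreal simp flip: ennreal_plus)

text \<open>Additivity says that the measure of \<open>b\<close> is the measure of \<open>a\<close>
  on \<open>{r<..}\<close> moved back by \<open>r\<close>, which is checked on half-open
  intervals.\<close>

lemma nn_integral_clock_shift:
  assumes a: "clock a" and b: "clock b" and r: "0 \<le> r"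
    and add: "\<And>s. 0 \<le> s \<Longrightarrow> a (r + s) = a r + b s" and f: "f \<in> borel_measurable borel"
  shows "(\<integral>\<^sup>+s. f s \<partial>clock_measure b) = (\<integral>\<^sup>+s\<in>{r<..}. f (s - r) \<partial>clock_measure a)"
proof -
  note f[measurable]
  have "distr (density (clock_measure a) (indicator {r<..})) borel (\<lambda>s. s - r) = clock_measure b"
    unfolding clock_measure_def[of b]
  proof (rule interval_measure_eqI)
    fix x y :: real assume "x \<le> y"
    let ?u = "max x 0" and ?v = "max y 0"
    have uv: "0 \<le> ?u" "?u \<le> ?v" using \<open>x \<le> y\<close> by auto
    have "emeasure (distr (density (clock_measure a) (indicator {r<..})) borel (\<lambda>s. s - r)) {x<..y}
       = emeasure (clock_measure a) ({r<..} \<inter> (\<lambda>s. s - r) -` {x<..y})"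
    proof -
      have v: "(\<lambda>s. s - r) -` {x<..y} = {x + r<..y + r}" by auto
      have "emeasure (distr (density (clock_measure a) (indicator {r<..})) borel (\<lambda>s. s - r)) {x<..y} = emeasure (density (clock_measure a) (indicator {r<..})) {x + r<..y + r}"
        by (subst emeasure_distr) (auto simp: v)
      also have "\<dots> = emeasure (clock_measure a) ({r<..} \<inter> {x + r<..y + r})"
        by (subst emeasure_density) (auto simp: indicator_inter_arith[symmetric])
      finally show ?thesis by (simp only: v)
    qed
    also have "{r<..} \<inter> (\<lambda>s. s - r) -` {x<..y} = {r + ?u<..r + ?v}" by auto
    also have "emeasure (clock_measure a) \<dots> = a (r + ?v) - a (r + ?u)"
      using emeasure_clock_Ioc[OF a, of "r + ?u" "r + ?v"] r uv by simp
    also have "\<dots> = (a r + b ?v) - (a r + b ?u)" using add uv by simp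
    also have "\<dots> = ennreal (enn2real (b ?v)) - ennreal (enn2real (b ?u))"
      using clockD(4)[OF a r] clockD(4)[OF b, of ?u] clockD(4)[OF b, of ?v]
      by (simp add: ennreal_add_diff_add_cancel_left)
    also have "\<dots> = ennreal (enn2real (b ?v) - enn2real (b ?u))" by (simp add: ennreal_minus)
    finally show "emeasure (distr (density (clock_measure a) (indicator {r<..})) borel (\<lambda>s. s - r)) {x<..y} = ennreal (enn2real (b ?v) - enn2real (b ?u))" .
  qed (use clock_distribution[OF b] in auto)
  then have "(\<integral>\<^sup>+s. f s \<partial>clock_measure b) = (\<integral>\<^sup>+s. f s \<partial>distr (density (clock_measure a) (indicator {r<..})) borel (\<lambda>s. s - r))"
    by simp
  also have "\<dots> = (\<integral>\<^sup>+s\<in>{r<..}. f (s - r) \<partial>clock_measure a)"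
    by (simp add: nn_integral_distr nn_integral_density mult.commute)
  finally show ?thesis .
qed

text \<open>Only countably many values of the clock and the integrand occur, all at times up to
  \<open>t\<close>, so that measurability in the sample point and adaptedness are visible. Cells
  beyond \<open>t\<close> collapse and contribute 0.\<close>

definition riemann_sum :: "(real \<Rightarrow> ennreal) \<Rightarrow> (real \<Rightarrow> ennreal) \<Rightarrow> real \<Rightarrow> nat \<Rightarrow> ennreal" where
  "riemann_sum \<phi> a t m = (\<Sum>i. \<phi> (min (real (Suc i) / 2 ^ m) t) *
      (a (min (real (Suc i) / 2 ^ m) t) - a (min (real i / 2 ^ m) t)))"

text \<open>The sum is an exact integral of the integrand sampled at the rounded time cut off at
  \<open>t\<close>. Right-continuity gives pointwise convergence, and the bound \<open>B\<close>
  together with the finite mass of (0,t] allows dominated convergence.\<close>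

lemma riemann_sum_tendsto:
  assumes a: "clock a" and t: "0 \<le> t" and \<phi>: "\<phi> \<in> borel_measurable borel"
    and rc: "\<And>s. 0 \<le> s \<Longrightarrow> (\<phi> \<longlongrightarrow> \<phi> s) (at_right s)"
    and bd: "\<And>s. 0 \<le> s \<Longrightarrow> \<phi> s \<le> B" and B: "B < \<top>"
  shows "(\<lambda>m. riemann_sum \<phi> a t m) \<longlonglongrightarrow> (\<integral>\<^sup>+s\<in>{0<..t}. \<phi> s \<partial>clock_measure a)"
proof -
  note \<phi>[measurable]
  let ?M = "density (clock_measure a) (indicator {0<..t})"
  have rs: "riemann_sum \<phi> a t m = (\<integral>\<^sup>+s\<in>{0<..t}. \<phi> (min (dyadic_ceil m s) t) \<partial>clock_measure a)" for m
  proof -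
    have "(\<integral>\<^sup>+s\<in>{0<..t}. \<phi> (min (dyadic_ceil m s) t) \<partial>clock_measure a) = (\<integral>\<^sup>+s\<in>{0<..}. \<phi> (min (dyadic_ceil m s) t) \<partial>?M)"
      by (subst nn_integral_density) (auto intro!: nn_integral_cong simp: indicator_def)
    also have "\<dots> = (\<Sum>i. \<phi> (min (real (Suc i) / 2 ^ m) t) * emeasure ?M {real i / 2 ^ m<..real (Suc i) / 2 ^ m})"
      by (rule nn_integral_dyadic_cells[where \<phi>="\<lambda>s. \<phi> (min s t)"]) auto
    also have "\<dots> = riemann_sum \<phi> a t m"
      unfolding riemann_sum_def
    proof (intro suminf_cong arg_cong2[where f="(*)"] refl)
      fix i
      let ?u = "min (real i / 2 ^ m) t" and ?v = "min (real (Suc i) / 2 ^ m) t"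
      have uv: "0 \<le> ?u" "?u \<le> ?v" using t by (auto simp: divide_right_mono min.coboundedI1 simp del: of_nat_Suc)
      have "emeasure ?M {real i / 2 ^ m<..real (Suc i) / 2 ^ m} = emeasure (clock_measure a) ({0<..t} \<inter> {real i / 2 ^ m<..real (Suc i) / 2 ^ m})"
        by (subst emeasure_density) (auto simp: indicator_inter_arith[symmetric])
      also have "{0<..t} \<inter> {real i / 2 ^ m<..real (Suc i) / 2 ^ m} = {?u<..?v}"
      proof -
        have "0 \<le> real i / 2 ^ m" by simp
        then show ?thesis using t by (auto simp del: of_nat_Suc zero_le_divide_iff)
      qed
      also have "emeasure (clock_measure a) \<dots> = a ?v - a ?u"
        using emeasure_clock_Ioc[OF a uv(2)] uv by (simp add: max_absorb1)
      finally show "emeasure ?M {real i / 2 ^ m<..real (Suc i) / 2 ^ m} = a ?v - a ?u" .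
    qed
    finally show ?thesis ..
  qed
  show ?thesis unfolding rs
  proof (rule nn_integral_dominated_convergence)
    show "AE s in clock_measure a. \<phi> (min (dyadic_ceil m s) t) * indicator {0<..t} s \<le> B * indicator {0<..t} s" for m
    proof (rule AE_I2)
      fix s
      show "\<phi> (min (dyadic_ceil m s) t) * indicator {0<..t} s \<le> B * indicator {0<..t} s"
        using bd[of "min (dyadic_ceil m s) t"] dyadic_ceil_ge[of s m] t by (auto simp: indicator_def)
    qed
    have "(\<integral>\<^sup>+s. B * indicator {0<..t} s \<partial>clock_measure a) = B * (a t - a 0)"
      using emeasure_clock_Ioc[OF a t] t by (simp add: nn_integral_cmult_indicator)
    also have "\<dots> < \<infinity>" using B clockD(4)[OF a t] clockD(1)[OF a] by (simp add: ennreal_mult_less_top)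
    finally show "(\<integral>\<^sup>+s. B * indicator {0<..t} s \<partial>clock_measure a) < \<infinity>" .
    show "AE s in clock_measure a. (\<lambda>m. \<phi> (min (dyadic_ceil m s) t) * indicator {0<..t} s) \<longlonglongrightarrow> \<phi> s * indicator {0<..t} s"
    proof (rule AE_I2)
      fix s
      show "(\<lambda>m. \<phi> (min (dyadic_ceil m s) t) * indicator {0<..t} s) \<longlonglongrightarrow> \<phi> s * indicator {0<..t} s"
      proof (cases "s \<in> {0<..t}")
        case True
        have "(\<lambda>m. min (dyadic_ceil m s) t) \<longlonglongrightarrow> min s t"
          by (intro tendsto_min dyadic_ceil_tendsto tendsto_const)
        then have "(\<lambda>m. \<phi> (min (dyadic_ceil m s) t)) \<longlonglongrightarrow> \<phi> s"
          using True dyadic_ceil_ge[of s]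
          by (intro right_cont_tendsto_sequentially[where h=\<phi> and t=s and r="\<lambda>m. min (dyadic_ceil m s) t"] rc) auto
        then show ?thesis using True by simp
      qed simp
    qed
  qed measurable
qed

text \<open>With M(ds) = e^(-s) a(ds), the value a(t) is the integral of e^s over (0,t] against M.
  Writing e^s as 1 plus the integral of e^r over 0 \<le> r < s and exchanging the integrals gives
  the formula. Tail masses in place of distribution functions keep every term non-negative.\<close>

lemma clock_eq_exp_integral:
  assumes a: "clock a" and t: "0 \<le> t" and w: "w \<in> borel_measurable borel"
    and ww: "\<And>s. 0 < s \<Longrightarrow> s \<le> t \<Longrightarrow> w s = ennreal (exp (- s))"
  defines "M \<equiv> density (clock_measure a) w"
  shows "a t = emeasure M {0<..t} + (\<integral>\<^sup>+r\<in>{0..t}. ennreal (exp r) * emeasure M {r<..t} \<partial>lborel)"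
proof -
  note w[measurable]
  interpret C: sigma_finite_measure "clock_measure a" by (rule sigma_finite_clock_measure[OF a])
  interpret P: pair_sigma_finite "clock_measure a" lborel ..
  \<comment> \<open>Half-open at \<open>s\<close>, to match the tail masses of
    \<open>{r<..t}\<close> after the exchange of integrals.\<close>
  have exp_eq: "ennreal (exp s) = 1 + (\<integral>\<^sup>+r. ennreal (exp r) * indicator {0..<s} r \<partial>lborel)" if "0 < s" for s :: real
  proof -
    have "(\<integral>\<^sup>+r. ennreal (exp r) * indicator {0..s} r \<partial>lborel) = exp s - exp 0"
      using that by (intro nn_integral_FTC_Icc) (auto intro!: derivative_eq_intros simp: has_real_derivative_iff_has_vector_derivative[symmetric] DERIV_subset)
    moreover have "(\<integral>\<^sup>+r. ennreal (exp r) * indicator {0..s} r \<partial>lborel) = (\<integral>\<^sup>+r. ennreal (exp r) * indicator {0..<s} r \<partial>lborel)"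
    proof (rule nn_integral_cong_AE)
      have "AE r in lborel. r \<noteq> s" by (rule AE_lborel_singleton)
      then show "AE r in lborel. ennreal (exp r) * indicator {0..s} r = ennreal (exp r) * indicator {0..<s} r"
        by eventually_elim (auto simp: indicator_def)
    qed
    ultimately have "(\<integral>\<^sup>+r. ennreal (exp r) * indicator {0..<s} r \<partial>lborel) = ennreal (exp s - 1)" by simp
    moreover have "1 + ennreal (exp s - 1) = ennreal (exp s)"
      using that by (subst ennreal_1[symmetric], subst ennreal_plus[symmetric]) auto
    ultimately show ?thesis by simp
  qed
  have Mi: "emeasure M {r<..t} = (\<integral>\<^sup>+s. w s * indicator {r<..t} s \<partial>clock_measure a)" for r
    unfolding M_def by (rule emeasure_density) auto
  have "a t = (\<integral>\<^sup>+s. indicator {0<..t} s \<partial>clock_measure a)"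
    using emeasure_clock_Ioc[OF a t] t clockD(1)[OF a] by simp
  also have "\<dots> = (\<integral>\<^sup>+s. w s * indicator {0<..t} s + (\<integral>\<^sup>+r. ennreal (exp r) * indicator {0..<s} r * (w s * indicator {0<..t} s) \<partial>lborel) \<partial>clock_measure a)"
  proof (intro nn_integral_cong)
    fix s
    show "indicator {0<..t} s = w s * indicator {0<..t} s + (\<integral>\<^sup>+r. ennreal (exp r) * indicator {0..<s} r * (w s * indicator {0<..t} s) \<partial>lborel)"
    proof (cases "s \<in> {0<..t}")
      case True
      have "w s + (\<integral>\<^sup>+r. ennreal (exp r) * indicator {0..<s} r * w s \<partial>lborel) = w s * (1 + (\<integral>\<^sup>+r. ennreal (exp r) * indicator {0..<s} r \<partial>lborel))"
        by (subst nn_integral_multc) (auto simp: distrib_left mult.commute)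
      also have "\<dots> = ennreal (exp (- s)) * ennreal (exp s)" using True exp_eq ww by simp
      also have "\<dots> = 1" by (simp add: ennreal_mult[symmetric] exp_minus)
      finally show ?thesis using True by simp
    qed simp
  qed
  also have "\<dots> = (\<integral>\<^sup>+s. w s * indicator {0<..t} s \<partial>clock_measure a) +
     (\<integral>\<^sup>+s. (\<integral>\<^sup>+r. ennreal (exp r) * indicator {0..<s} r * (w s * indicator {0<..t} s) \<partial>lborel) \<partial>clock_measure a)"
    unfolding indicator_def atLeastLessThan_iff greaterThanAtMost_iff by (rule nn_integral_add) measurable
  also have "(\<integral>\<^sup>+s. (\<integral>\<^sup>+r. ennreal (exp r) * indicator {0..<s} r * (w s * indicator {0<..t} s) \<partial>lborel) \<partial>clock_measure a)
    = (\<integral>\<^sup>+r. (\<integral>\<^sup>+s. ennreal (exp r) * indicator {0..<s} r * (w s * indicator {0<..t} s) \<partial>clock_measure a) \<partial>lborel)"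
    unfolding indicator_def atLeastLessThan_iff greaterThanAtMost_iff by (rule P.Fubini'[symmetric]) measurable
  also have "\<dots> = (\<integral>\<^sup>+r\<in>{0..t}. ennreal (exp r) * emeasure M {r<..t} \<partial>lborel)"
  proof (intro nn_integral_cong)
    fix r :: real
    have "(\<integral>\<^sup>+s. ennreal (exp r) * indicator {0..<s} r * (w s * indicator {0<..t} s) \<partial>clock_measure a)
       = (\<integral>\<^sup>+s. (ennreal (exp r) * indicator {0..t} r) * (w s * indicator {r<..t} s) \<partial>clock_measure a)"
      by (intro nn_integral_cong) (auto simp: indicator_def)
    also have "\<dots> = (ennreal (exp r) * indicator {0..t} r) * emeasure M {r<..t}"
      unfolding Mi by (rule nn_integral_cmult) measurable
    finally show "(\<integral>\<^sup>+s. ennreal (exp r) * indicator {0..<s} r * (w s * indicator {0<..t} s) \<partial>clock_measure a) = ennreal (exp r) * emeasure M {r<..t} * indicator {0..t} r"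
      by (simp add: mult_ac)
  qed
  finally show ?thesis by (simp add: Mi)
qed

text \<open>If the masses of all (0,r] differ by at most \<open>c\<close>, those of (r,t] differ by
  at most \<open>2 * c\<close>. Inserted in \<open>clock_eq_exp_integral\<close> this gives the
  error c + 2c(e^t - 1), which is at most 2c e^t.\<close>

lemma clock_le_of_weighted_le:
  assumes a: "clock a" and b: "clock b" and t: "0 \<le> t" and w: "w \<in> borel_measurable borel"
    and ww: "\<And>s. 0 < s \<Longrightarrow> s \<le> t \<Longrightarrow> w s = ennreal (exp (- s))"
    and le: "\<And>r. 0 \<le> r \<Longrightarrow> r \<le> t \<Longrightarrow> emeasure (density (clock_measure a) w) {0<..r} \<le> emeasure (density (clock_measure b) w) {0<..r} + ennreal c"
    and ge: "\<And>r. 0 \<le> r \<Longrightarrow> r \<le> t \<Longrightarrow> emeasure (density (clock_measure b) w) {0<..r} \<le> emeasure (density (clock_measure a) w) {0<..r} + ennreal c"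
    and c: "0 \<le> c"
  shows "a t \<le> b t + ennreal (2 * c * exp t)"
proof -
  note w[measurable]
  let ?M = "density (clock_measure a) w" and ?N = "density (clock_measure b) w"
  have fin: "emeasure (density (clock_measure d) w) {0<..r} < \<top>" if "clock d" "0 \<le> r" "r \<le> t" for d r
  proof -
    have "emeasure (density (clock_measure d) w) {0<..r} = (\<integral>\<^sup>+s. w s * indicator {0<..r} s \<partial>clock_measure d)"
      by (rule emeasure_density) auto
    also have "\<dots> \<le> (\<integral>\<^sup>+s. indicator {0<..r} s \<partial>clock_measure d)"
      using ww that by (intro nn_integral_mono) (auto simp: indicator_def ennreal_le_1)
    also have "\<dots> < \<top>" using emeasure_clock_Ioc[OF that(1,2)] clockD(4)[OF that(1)] that by (simp add: clockD(1)[OF that(1)])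
    finally show ?thesis .
  qed
  have split: "emeasure (density (clock_measure d) w) {0<..t} = emeasure (density (clock_measure d) w) {0<..r} + emeasure (density (clock_measure d) w) {r<..t}"
    if "0 \<le> r" "r \<le> t" for d r
    using that by (subst plus_emeasure) (auto intro!: arg_cong[where f="emeasure _"])
  have tail: "emeasure ?M {r<..t} \<le> emeasure ?N {r<..t} + ennreal (2 * c)" if r: "0 \<le> r" "r \<le> t" for r
  proof -
    have "emeasure ?M {0<..r} + emeasure ?M {r<..t} \<le> emeasure ?N {0<..r} + emeasure ?N {r<..t} + ennreal c"
      using le[of t] t by (simp add: split[OF r, symmetric])
    also have "\<dots> \<le> emeasure ?M {0<..r} + ennreal c + emeasure ?N {r<..t} + ennreal c"
      using ge[OF r] by (intro add_mono order_refl)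
    also have "\<dots> = emeasure ?M {0<..r} + (emeasure ?N {r<..t} + ennreal (2 * c))"
    proof -
      have "ennreal (2 * c) = ennreal c + ennreal c" using c by (simp add: ennreal_plus[symmetric])
      then show ?thesis by (simp add: add_ac)
    qed
    finally show ?thesis using fin[OF a r] by (auto simp: ennreal_add_left_cancel_le)
  qed
  have I: "(\<integral>\<^sup>+r\<in>{0..t}. ennreal (exp r) \<partial>lborel) = ennreal (exp t - 1)"
    using nn_integral_FTC_Icc[of exp 0 t exp] t
    by (auto intro!: derivative_eq_intros simp: has_real_derivative_iff_has_vector_derivative[symmetric] DERIV_subset)
  have mN: "(\<lambda>r. emeasure ?N {r<..t}) \<in> borel_measurable borel"
  proof -
    interpret C: sigma_finite_measure "clock_measure b" by (rule sigma_finite_clock_measure[OF b])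
    have "(\<lambda>r. \<integral>\<^sup>+s. w s * indicator {r<..t} s \<partial>clock_measure b) \<in> borel_measurable borel"
      unfolding indicator_def atLeastLessThan_iff greaterThanAtMost_iff by (rule C.borel_measurable_nn_integral) measurable
    moreover have "emeasure ?N {r<..t} = (\<integral>\<^sup>+s. w s * indicator {r<..t} s \<partial>clock_measure b)" for r
      by (rule emeasure_density) auto
    ultimately show ?thesis by simp
  qed
  have "a t = emeasure ?M {0<..t} + (\<integral>\<^sup>+r\<in>{0..t}. ennreal (exp r) * emeasure ?M {r<..t} \<partial>lborel)"
    by (rule clock_eq_exp_integral[OF a t w ww])
  also have "\<dots> \<le> emeasure ?N {0<..t} + ennreal c + (\<integral>\<^sup>+r. ennreal (exp r) * emeasure ?N {r<..t} * indicator {0..t} r + ennreal (2 * c) * (ennreal (exp r) * indicator {0..t} r) \<partial>lborel)"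
  proof (intro add_mono nn_integral_mono le order_refl t)
    fix r :: real
    show "ennreal (exp r) * emeasure ?M {r<..t} * indicator {0..t} r \<le> ennreal (exp r) * emeasure ?N {r<..t} * indicator {0..t} r + ennreal (2 * c) * (ennreal (exp r) * indicator {0..t} r)"
    proof (cases "r \<in> {0..t}")
      case True
      then have "ennreal (exp r) * emeasure ?M {r<..t} \<le> ennreal (exp r) * (emeasure ?N {r<..t} + ennreal (2 * c))"
        by (intro mult_left_mono tail) auto
      then show ?thesis using True by (simp add: distrib_left mult_ac)
    qed simp
  qed
  also have "\<dots> = emeasure ?N {0<..t} + ennreal c + ((\<integral>\<^sup>+r\<in>{0..t}. ennreal (exp r) * emeasure ?N {r<..t} \<partial>lborel) + ennreal (2 * c) * ennreal (exp t - 1))"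
    using mN by (subst nn_integral_add) (auto simp: nn_integral_cmult I)
  also have "\<dots> = b t + (ennreal c + ennreal (2 * c) * ennreal (exp t - 1))"
  proof -
    have *: "n + c1 + (i + d) = b t + (c1 + d)" if "b t = n + i" for n i c1 d :: ennreal
      unfolding that by (simp only: add_ac)
    show ?thesis by (rule *[OF clock_eq_exp_integral[OF b t w ww]])
  qed
  also have "ennreal c + ennreal (2 * c) * ennreal (exp t - 1) = ennreal (c + 2 * c * (exp t - 1))"
    using c t by (subst ennreal_mult[symmetric]) (auto simp flip: ennreal_plus)
  also have "b t + \<dots> \<le> b t + ennreal (2 * c * exp t)"
    using c by (intro add_left_mono ennreal_leI) (simp add: algebra_simps)
  finally show ?thesis .
qed

section \<open>Hitting and exit times\<close>

lemma topspace_state_topology [simp]: "topspace (state_topology :: 'a::topological_space option topology) = UNIV"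
  by (auto simp: UNIV_option_conv)

lemma openin_state_Compl_compact:
  fixes K :: "'a::t2_space set"
  assumes "compact K"
  shows "openin state_topology (- Some ` K)"
proof -
  have "closedin (state_topology :: 'a option topology) (Some ` K)"
    using assms by (simp add: compact_imp_closed)
  then show ?thesis unfolding closedin_def topspace_state_topology Compl_eq_Diff_UNIV by blast
qed

lemma compact_subset_incseq_open:
  fixes V :: "nat \<Rightarrow> 'a::topological_space set"
  assumes V: "incseq V" "\<And>k. open (V k)" and K: "compact K" "K \<subseteq> (\<Union>k. V k)"
  obtains k where "K \<subseteq> V k"
proof -
  obtain D where D: "finite D" "K \<subseteq> (\<Union>k\<in>D. V k)"
  proof (rule compactE_image[OF K(1), of UNIV V])
    show "open (V k)" for k by (rule V(2))
    show "K \<subseteq> (\<Union>k. V k)" by (rule K(2))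
  qed (rule that)
  have "V k \<subseteq> V (Max D)" if "k \<in> D" for k
    by (rule incseqD[OF V(1) Max_ge[OF D(1) that]])
  then have "K \<subseteq> V (Max D)" using D(2) by blast
  then show thesis by (rule that)
qed

context standard_proc
begin

lemma path_open_right:
  assumes \<omega>: "\<omega> \<in> sample_space X" and t: "t < \<top>" and U: "openin state_topology U" "path X t \<omega> \<in> U"
  obtains b where "t < b" "\<And>s. t < s \<Longrightarrow> s < b \<Longrightarrow> path X s \<omega> \<in> U"
proof -
  have "limitin state_topology (\<lambda>s. path X s \<omega>) (path X t \<omega>) (at_right t)"
    using path_right_cont[OF \<omega>, of t] t by simp
  from limitinD[OF this U] have "\<exists>b>t. \<forall>s>t. s < b \<longrightarrow> path X s \<omega> \<in> U"
    by (simp add: eventually_at_right[OF t])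
  then show thesis using that by blast
qed

text \<open>The window is half-open at \<open>b\<close>: right-continuity moves a visit to an open
  set to slightly later times, which have to remain inside the window.\<close>

definition hit :: "'a option set \<Rightarrow> ennreal \<Rightarrow> ennreal \<Rightarrow> 'w set" where
  "hit U a b = {\<omega> \<in> sample_space X. \<exists>s\<ge>a. s < b \<and> path X s \<omega> \<in> U}"

text \<open>A visit to an open set lasts for a short time, so it is seen at a rational time.
  Negative rationals occur in the union too; \<open>ennreal\<close> sends them to time 0.\<close>

lemma hit_rational:
  assumes U: "openin state_topology U"
  shows "hit U a b = (\<Union>r\<in>{r::rat. a \<le> ennreal (of_rat r) \<and> ennreal (of_rat r) < b}. {\<omega> \<in> sample_space X. path X (ennreal (of_rat r)) \<omega> \<in> U})"
proof (intro equalityI subsetI)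
  fix \<omega> assume "\<omega> \<in> hit U a b"
  then obtain s where s: "\<omega> \<in> sample_space X" "a \<le> s" "s < b" "path X s \<omega> \<in> U" by (auto simp: hit_def)
  have "s < \<top>" using s(3) by (rule less_le_trans) simp
  then obtain c where c: "s < c" "\<And>r. s < r \<Longrightarrow> r < c \<Longrightarrow> path X r \<omega> \<in> U"
    using path_open_right[OF s(1) _ U s(4)] by blast
  obtain r :: rat where r: "s < ennreal (of_rat r)" "ennreal (of_rat r) < min b c"
    using ennreal_rat_dense[of s "min b c"] s(3) c(1) by auto
  then have "path X (ennreal (of_rat r)) \<omega> \<in> U" "a \<le> ennreal (of_rat r)" "ennreal (of_rat r) < b"
    using c(2) s(2) by (auto intro: le_less_trans less_imp_le)
  then show "\<omega> \<in> (\<Union>r\<in>{r::rat. a \<le> ennreal (of_rat r) \<and> ennreal (of_rat r) < b}. {\<omega> \<in> sample_space X. path X (ennreal (of_rat r)) \<omega> \<in> U})"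
    using s(1) by blast
qed (auto simp: hit_def)

lemma hit_natural:
  assumes U: "openin state_topology U" and b: "b \<le> t"
  shows "hit U a b \<in> sets (natural t)"
  unfolding hit_rational[OF U]
proof (intro sets.countable_UN' image_subsetI)
  fix r assume "r \<in> {r::rat. a \<le> ennreal (of_rat r) \<and> ennreal (of_rat r) < b}"
  then show "{\<omega> \<in> sample_space X. path X (ennreal (of_rat r)) \<omega> \<in> U} \<in> sets (natural t)"
    using b openin_state_borel[OF U] by (intro path_event_natural) auto
qed simp

section \<open>Exit times and the lifetime\<close>

lemma exit_time_less_iff:
  "\<omega> \<in> sample_space X \<Longrightarrow> exit_time X E \<omega> < s \<longleftrightarrow> \<omega> \<in> hit (- Some ` E) 0 s"
proof -
  assume "\<omega> \<in> sample_space X"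
  moreover have "t < s \<Longrightarrow> t < \<top>" for t :: ennreal
    by (erule less_le_trans) simp
  ultimately show ?thesis
    unfolding exit_time_def Inf_less_iff hit_def by auto
qed

text \<open>For s > t the event is an intersection over n of the events that the exit occurs before
  t + 1/(n+1) and before s, each in \<open>filt s\<close>; right-continuity of the filtration then
  lets s decrease to t. Compactness of \<open>E\<close> makes its complement, cemetery included,
  open in the compactification.\<close>

lemma exit_time_stopping:
  assumes E: "compact E"
  shows "stopping_time filt (exit_time X E)"
proof
  fix t
  show "Measurable.pred (filt t) (\<lambda>\<omega>. exit_time X E \<omega> \<le> t)"
  proof (cases "t < \<top>")
    case False
    then have "t = \<top>" by (simp add: less_top[symmetric])
    then show ?thesis by simp
  next
    case True
    have "{\<omega> \<in> sample_space X. exit_time X E \<omega> \<le> t} \<in> sets (filt s)" if s: "t < s" for s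
    proof -
      have eq: "{\<omega> \<in> sample_space X. exit_time X E \<omega> \<le> t} = (\<Inter>n::nat. hit (- Some ` E) 0 (min s (t + ennreal (1 / Suc n))))"
      proof (intro equalityI subsetI)
        fix \<omega> assume "\<omega> \<in> {\<omega> \<in> sample_space X. exit_time X E \<omega> \<le> t}"
        then have \<omega>: "\<omega> \<in> sample_space X" "exit_time X E \<omega> \<le> t" by auto
        have "exit_time X E \<omega> < min s (t + ennreal (1 / Suc n))" for n
        proof -
          have "t < t + ennreal (1 / Suc n)"
            using True by (cases t) (auto simp: ennreal_less_iff simp flip: ennreal_plus)
          then show ?thesis using \<omega>(2) s by (auto intro: le_less_trans)
        qed
        then show "\<omega> \<in> (\<Inter>n::nat. hit (- Some ` E) 0 (min s (t + ennreal (1 / Suc n))))"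
          using exit_time_less_iff[OF \<omega>(1)] by blast
      next
        fix \<omega> assume *: "\<omega> \<in> (\<Inter>n::nat. hit (- Some ` E) 0 (min s (t + ennreal (1 / Suc n))))"
        then have \<omega>: "\<omega> \<in> sample_space X" by (auto simp: hit_def)
        have le: "exit_time X E \<omega> \<le> t + ennreal (1 / Suc n)" for n
        proof -
          have "\<omega> \<in> hit (- Some ` E) 0 (min s (t + ennreal (1 / Suc n)))" using * by blast
          then show ?thesis unfolding exit_time_less_iff[OF \<omega>, symmetric] by (simp add: less_imp_le)
        qed
        have "(\<lambda>n. t + ennreal (1 / Suc n)) \<longlonglongrightarrow> t + ennreal 0"
          by (intro tendsto_add tendsto_const tendsto_ennrealI LIMSEQ_Suc[OF lim_1_over_n])
        then have "exit_time X E \<omega> \<le> t + ennreal 0"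
          by (rule LIMSEQ_le_const) (use le in blast)
        then show "\<omega> \<in> {\<omega> \<in> sample_space X. exit_time X E \<omega> \<le> t}" using \<omega> by simp
      qed
      have "hit (- Some ` E) 0 (min s (t + ennreal (1 / Suc n))) \<in> sets (filt s)" for n
        using hit_natural[OF openin_state_Compl_compact[OF E], of "min s (t + ennreal (1 / Suc n))" s 0] natural_subset_filt[of s]
        by auto
      then show ?thesis unfolding eq by (intro sets.countable_INT) auto
    qed
    then have "{\<omega> \<in> sample_space X. exit_time X E \<omega> \<le> t} \<in> (\<Inter>s\<in>{t<..}. sets (filt s))" by blast
    also have "\<dots> = sets (filt t)"
      using filt(2) True unfolding right_continuous_filtration_def by simp
    finally show ?thesis by (simp add: pred_def filt.space_F)
  qed
qed

lemma exit_time_antimono: "E \<subseteq> E' \<Longrightarrow> exit_time X E \<omega> \<le> exit_time X E' \<omega>"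
  unfolding exit_time_def by (rule Inf_superset_mono) auto

text \<open>Suppose the exit times increase to a limit below the lifetime. By quasi-left-continuity
  the positions at these times converge to a point of some \<open>V k\<close>. Then for some n \<ge>
  k the path is in the open set \<open>V k\<close> at its exit time from
  \<open>closure (V n)\<close> and stays there for a while, although that time is an infimum of
  times spent outside \<open>closure (V n)\<close>, which contains \<open>V k\<close>.\<close>

lemma lifetime_le_exit_times:
  fixes V :: "nat \<Rightarrow> 'a set"
  assumes V: "incseq V" "\<And>k. open (V k)" "\<And>k. compact (closure (V k))" "(\<Union>k. V k) = UNIV"
  shows "AE \<omega> in law X x. lifetime X \<omega> \<le> (SUP n. exit_time X (closure (V n)) \<omega>)"
proof -
  let ?\<sigma> = "\<lambda>n. exit_time X (closure (V n))"
  have inc: "incseq (\<lambda>n. ?\<sigma> n \<omega>)" for \<omega>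
    using V(1) by (auto simp: incseq_def intro!: exit_time_antimono closure_mono)
  have "AE \<omega> in law X x. (SUP n. ?\<sigma> n \<omega>) < lifetime X \<omega> \<longrightarrow>
         limitin state_topology (\<lambda>n. path X (?\<sigma> n \<omega>) \<omega>) (path X (SUP n. ?\<sigma> n \<omega>) \<omega>) sequentially"
    using filt(4)[unfolded quasi_left_continuous_wrt_def, rule_format, of ?\<sigma>] exit_time_stopping[OF V(3)] inc by blast
  moreover have "AE \<omega> in law X x. \<omega> \<in> sample_space X" by (rule AE_I2) simp
  ultimately show ?thesis
  proof eventually_elim
    case (elim \<omega>)
    show ?case
    proof (rule ccontr)
      assume "\<not> lifetime X \<omega> \<le> (SUP n. ?\<sigma> n \<omega>)"
      then have less: "(SUP n. ?\<sigma> n \<omega>) < lifetime X \<omega>" by simp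
      then have lim: "limitin state_topology (\<lambda>n. path X (?\<sigma> n \<omega>) \<omega>) (path X (SUP n. ?\<sigma> n \<omega>) \<omega>) sequentially"
        using elim by blast
      have "path X (SUP n. ?\<sigma> n \<omega>) \<omega> \<noteq> None"
      proof
        assume "path X (SUP n. ?\<sigma> n \<omega>) \<omega> = None"
        then have "lifetime X \<omega> \<le> (SUP n. ?\<sigma> n \<omega>)" unfolding lifetime_def by (intro Inf_lower) simp
        then show False using less by simp
      qed
      then obtain y where y: "path X (SUP n. ?\<sigma> n \<omega>) \<omega> = Some y" by blast
      obtain k where k: "y \<in> V k" using V(4) by blast
      have "eventually (\<lambda>n. path X (?\<sigma> n \<omega>) \<omega> \<in> Some ` V k) sequentially"
        using limitinD[OF lim, of "Some ` V k"] V(2) k y by simp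
      then obtain n where n: "n \<ge> k" "path X (?\<sigma> n \<omega>) \<omega> \<in> Some ` V k"
        unfolding eventually_sequentially by (meson linear order_refl)
      have \<sigma>: "?\<sigma> n \<omega> < \<top>"
        using less SUP_upper[of n UNIV "\<lambda>n. ?\<sigma> n \<omega>"] by (metis UNIV_I le_less_trans less_le_trans top_greatest)
      have Vk: "openin state_topology (Some ` V k)" using V(2) by simp
      obtain b where b: "?\<sigma> n \<omega> < b" "\<And>s. ?\<sigma> n \<omega> < s \<Longrightarrow> s < b \<Longrightarrow> path X s \<omega> \<in> Some ` V k"
        using path_open_right[OF elim(2) \<sigma> Vk n(2)] by blast
      obtain t where t: "t < b" "t < \<infinity>" "path X t \<omega> \<notin> Some ` closure (V n)"
        using b(1) unfolding exit_time_def Inf_less_iff by blast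
      then have "?\<sigma> n \<omega> \<le> t" unfolding exit_time_def by (intro Inf_lower) simp
      then have "path X t \<omega> \<in> Some ` V k" using b(2) t(1) n(2) by (cases "t = ?\<sigma> n \<omega>") auto
      moreover have "V k \<subseteq> closure (V n)" using incseqD[OF V(1) n(1)] closure_subset by blast
      ultimately show False using t(3) by blast
    qed
  qed
qed

text \<open>Every \<open>closure (V n)\<close> is compact, hence contained in some
  \<open>V k\<close>, whose exit time is at least as late.\<close>

lemma lifetime_le_exit_times_open:
  fixes V :: "nat \<Rightarrow> 'a set"
  assumes V: "incseq V" "\<And>k. open (V k)" "\<And>k. compact (closure (V k))" "(\<Union>k. V k) = UNIV"
  shows "AE \<omega> in law X x. lifetime X \<omega> \<le> (SUP n. exit_time X (V n) \<omega>)"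
  using lifetime_le_exit_times[OF V]
proof eventually_elim
  case (elim \<omega>)
  have "exit_time X (closure (V n)) \<omega> \<le> (SUP n. exit_time X (V n) \<omega>)" for n
  proof -
    obtain k where "closure (V n) \<subseteq> V k"
      using compact_subset_incseq_open[OF V(1,2) V(3)[of n]] V(4) by auto
    then show ?thesis by (intro SUP_upper2[of k] exit_time_antimono) auto
  qed
  then have "(SUP n. exit_time X (closure (V n)) \<omega>) \<le> (SUP n. exit_time X (V n) \<omega>)" by (rule SUP_least)
  with elim show ?case by (rule order_trans)
qed

text \<open>Null sets are glued from their traces on the \<open>V k\<close>, and the
  \<open>V k\<close> themselves form the nest in the definition of smoothness, by the preceding
  comparison of exit times with the lifetime.\<close>

lemma locally_S00_smooth:
  fixes V :: "nat \<Rightarrow> 'a set"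
  assumes V: "incseq V" "\<And>k. open (V k)" "\<And>k. compact (closure (V k))" "(\<Union>k. V k) = UNIV"
    and \<mu>: "sets \<mu> = sets borel" "\<And>k. restrict_to \<mu> (V k) \<in> S00 X p"
  shows "\<mu> \<in> smooth_measures X p"
proof -
  have Vm [measurable]: "V k \<in> sets \<mu>" for k using \<mu>(1) V(2) by simp
  have em: "emeasure (restrict_to \<mu> (V k)) B = emeasure \<mu> (V k \<inter> B)" if "B \<in> sets \<mu>" for k B
    using that unfolding restrict_to_def by (subst emeasure_density) (auto simp: indicator_inter_arith[symmetric])
  have "charges_no_semipolar X \<mu>" unfolding charges_no_semipolar_def
  proof (intro allI impI)
    fix N assume "semipolar X N"
    then have "\<forall>k. N \<in> null_sets (completion (restrict_to \<mu> (V k)))"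
      using \<mu>(2) unfolding S00_def charges_no_semipolar_def by blast
    then have "\<forall>k. \<exists>N'. N' \<in> null_sets (restrict_to \<mu> (V k)) \<and> N \<subseteq> N'"
      unfolding null_sets_completion_iff2 by blast
    then obtain N' where N': "\<And>k. N' k \<in> null_sets (restrict_to \<mu> (V k))" "\<And>k. N \<subseteq> N' k" by metis
    have "N' k \<in> sets \<mu>" for k using N'(1)[of k] by (auto simp: null_sets_def restrict_to_def)
    then have "V k \<inter> N' k \<in> null_sets \<mu>" for k
      using N'(1)[of k] em[of "N' k" k] by (auto simp: null_sets_def)
    then have "(\<Union>k. V k \<inter> N' k) \<in> null_sets \<mu>" by (rule null_sets_UN)
    moreover have "N \<subseteq> (\<Union>k. V k \<inter> N' k)"
    proof
      fix z assume z: "z \<in> N"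
      have "z \<in> (\<Union>k. V k)" using V(4) by simp
      then obtain k where "z \<in> V k" by (rule UN_E)
      moreover have "z \<in> N' k" using N'(2) z by (rule subsetD)
      ultimately show "z \<in> (\<Union>k. V k \<inter> N' k)" by blast
    qed
    ultimately show "N \<in> null_sets (completion \<mu>)" unfolding null_sets_completion_iff2 by blast
  qed
  moreover have "emeasure \<mu> (V k) < \<infinity>" for k
  proof -
    have "finite_measure (restrict_to \<mu> (V k))" using \<mu>(2) by (simp add: S00_def)
    from finite_measure.emeasure_finite[OF this, of "V k"] show ?thesis
      using em[of "V k" k] Vm by (simp add: less_top)
  qed
  moreover have "(SUP x. potential p 1 (restrict_to \<mu> (V k)) x) < \<infinity>" for k
    using \<mu>(2) by (simp add: S00_def)
  ultimately show ?thesis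
    unfolding smooth_measures_def using \<mu>(1) V lifetime_le_exit_times_open[OF V]
    by (intro CollectI conjI exI[of _ V]) auto
qed

text \<open>A path in all of these events leaves every \<open>closure (V k)\<close> by time
  \<open>T\<close>, so its lifetime is finite; conservativeness makes such paths a null set, and
  continuity from above gives the limit.\<close>

lemma hit_exit_tendsto_0:
  fixes V :: "nat \<Rightarrow> 'a set"
  assumes V: "incseq V" "\<And>k. open (V k)" "\<And>k. compact (closure (V k))" "(\<Union>k. V k) = UNIV"
    and cons: "conservative X" and T: "T < \<top>"
  shows "(\<lambda>k. emeasure (law X (Some x)) (hit (- Some ` closure (V k)) 0 T)) \<longlonglongrightarrow> 0"
    and "decseq (\<lambda>k. hit (- Some ` closure (V k)) 0 T)"
proof -
  let ?h = "\<lambda>k. hit (- Some ` closure (V k)) 0 T"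
  show dec: "decseq ?h"
  proof (rule decseq_SucI)
    fix k
    have "closure (V k) \<subseteq> closure (V (Suc k))" by (rule closure_mono[OF incseqD[OF V(1)]]) simp
    then show "?h (Suc k) \<subseteq> ?h k" unfolding hit_def by blast
  qed
  have m: "?h k \<in> sets (law X (Some x))" for k
    using hit_natural[OF openin_state_Compl_compact[OF V(3)] top_greatest] natural_subset_law by blast
  have "AE \<omega> in law X (Some x). \<omega> \<notin> (\<Inter>k. ?h k)"
    using lifetime_le_exit_times[OF V] cons[unfolded conservative_def, rule_format, of x]
  proof eventually_elim
    case (elim \<omega>)
    show ?case
    proof
      assume "\<omega> \<in> (\<Inter>k. ?h k)"
      then have h: "\<omega> \<in> sample_space X" "\<And>k. \<omega> \<in> ?h k" by (auto simp: hit_def)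
      have "exit_time X (closure (V k)) \<omega> \<le> T" for k
        using h(2)[of k] unfolding exit_time_less_iff[OF h(1), symmetric] by simp
      then have "(SUP k. exit_time X (closure (V k)) \<omega>) \<le> T" by (rule SUP_least)
      then have "lifetime X \<omega> \<le> T" using elim(1) by simp
      then have "lifetime X \<omega> < \<top>" using T by simp
      then obtain t where "t < \<top>" "path X t \<omega> = None" unfolding lifetime_def Inf_less_iff by blast
      then show False using elim(2) by simp
    qed
  qed
  then have "emeasure (law X (Some x)) (\<Inter>k. ?h k) = 0"
    using m by (subst (asm) AE_iff_null_sets[symmetric]) auto
  moreover have "(\<lambda>k. emeasure (law X (Some x)) (?h k)) \<longlonglongrightarrow> emeasure (law X (Some x)) (\<Inter>k. ?h k)"
    using m dec finite_measure.emeasure_finite[OF prob_space.finite_measure[OF prob_law]]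
    by (intro Lim_emeasure_decseq) auto
  ultimately show "(\<lambda>k. emeasure (law X (Some x)) (?h k)) \<longlonglongrightarrow> 0" by simp
qed

end

section \<open>Localised additive functionals\<close>

text \<open>Continuous functions increasing to the indicator of the open set \<open>V\<close>. The
  whole space is treated apart because \<open>infdist\<close> to the empty set is 0.\<close>

definition bump :: "'a::metric_space set \<Rightarrow> nat \<Rightarrow> 'a \<Rightarrow> real" where
  "bump V j y = (if V = UNIV then 1 else min 1 (real j * infdist y (- V)))"

lemma bump_range: "0 \<le> bump V j y" "bump V j y \<le> 1"
  by (auto simp: bump_def infdist_nonneg)

lemma continuous_bump: "continuous_on UNIV (bump V j)"
  unfolding bump_def by (cases "V = UNIV") (auto intro!: continuous_intros)

lemma SUP_bump:
  assumes "open V"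
  shows "(SUP j. ennreal (bump V j y)) = indicator V y"
proof (cases "V = UNIV \<or> y \<notin> V")
  case True
  have "bump V j y = (if V = UNIV then 1 else 0)" for j
    using True by (auto simp: bump_def)
  then show ?thesis using True by auto
next
  case False
  then have V: "V \<noteq> UNIV" "y \<in> V" by auto
  have "closed (- V)" using assms by (simp add: closed_def)
  then have "infdist y (- V) > 0"
  proof -
    have "- V \<noteq> {}" using V(1) by auto
    then have "infdist y (- V) \<noteq> 0"
      using in_closed_iff_infdist_zero[of "- V" y] V(2) \<open>closed (- V)\<close> by simp
    then show ?thesis using infdist_nonneg[of y "- V"] by simp
  qed
  then obtain j :: nat where "1 < real j * infdist y (- V)"
    using reals_Archimedean3 by blast
  then have "ennreal (bump V j y) = 1" using V by (simp add: bump_def)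
  then have "1 \<le> (SUP j. ennreal (bump V j y))" by (metis SUP_upper UNIV_I)
  moreover have "(SUP j. ennreal (bump V j y)) \<le> 1"
    using bump_range(2) by (intro SUP_least) (simp add: ennreal_le_1)
  ultimately have "(SUP j. ennreal (bump V j y)) = 1" by (intro antisym)
  then show ?thesis using V by simp
qed

lemma incseq_bump: "incseq (\<lambda>j. ennreal (bump V j y))"
proof (rule incseq_SucI, rule ennreal_leI)
  fix j
  have "real j * infdist y (- V) \<le> real (Suc j) * infdist y (- V)"
    by (intro mult_right_mono infdist_nonneg) simp
  then show "bump V j y \<le> bump V (Suc j) y"
    by (simp add: bump_def min_le_iff_disj)
qed

lemma bump_measurable [measurable]: "bump V j \<in> borel_measurable borel"
  by (rule borel_measurable_continuous_onI[OF continuous_bump])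

section \<open>Paths on which an additive functional behaves well\<close>

context standard_proc
begin

text \<open>The position as a point of the state space itself, so that functions on it apply
  directly; on good paths it is always meaningful.\<close>

definition pos :: "'w \<Rightarrow> real \<Rightarrow> 'a" where
  "pos \<omega> s = the (path X (ennreal s) \<omega>)"

definition defining_set :: "(real \<Rightarrow> 'w \<Rightarrow> ennreal) \<Rightarrow> 'w set \<Rightarrow> bool" where
  "defining_set A \<Lambda> \<longleftrightarrow> (\<forall>t\<ge>0. shift X (ennreal t) ` \<Lambda> \<subseteq> \<Lambda>) \<and>
        (\<forall>\<omega>\<in>\<Lambda>.
           A 0 \<omega> = 0 \<and>
           continuous_on {0..} (\<lambda>t. A t \<omega>) \<and>
           (\<forall>t\<ge>0. ennreal t < lifetime X \<omega> \<longrightarrow> A t \<omega> < \<infinity>) \<and>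
           (\<forall>s\<ge>0. \<forall>t\<ge>0. A (t + s) \<omega> = A t \<omega> + A s (shift X (ennreal t) \<omega>)))"

lemma defining_setD:
  assumes "defining_set A \<Lambda>" "\<omega> \<in> \<Lambda>"
  shows "0 \<le> t \<Longrightarrow> shift X (ennreal t) \<omega> \<in> \<Lambda>"
    and "A 0 \<omega> = 0" "continuous_on {0..} (\<lambda>t. A t \<omega>)"
    and "0 \<le> t \<Longrightarrow> ennreal t < lifetime X \<omega> \<Longrightarrow> A t \<omega> < \<infinity>"
    and "0 \<le> s \<Longrightarrow> 0 \<le> t \<Longrightarrow> A (t + s) \<omega> = A t \<omega> + A s (shift X (ennreal t) \<omega>)"
proof -
  have S: "\<forall>t\<ge>0. shift X (ennreal t) ` \<Lambda> \<subseteq> \<Lambda>"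
    using assms(1) unfolding defining_set_def by (rule conjunct1)
  show "0 \<le> t \<Longrightarrow> shift X (ennreal t) \<omega> \<in> \<Lambda>"
    using S[rule_format, of t] imageI[OF assms(2)] by (rule subsetD)
  have P: "A 0 \<omega> = 0 \<and> continuous_on {0..} (\<lambda>t. A t \<omega>) \<and>
           (\<forall>t\<ge>0. ennreal t < lifetime X \<omega> \<longrightarrow> A t \<omega> < \<infinity>) \<and>
           (\<forall>s\<ge>0. \<forall>t\<ge>0. A (t + s) \<omega> = A t \<omega> + A s (shift X (ennreal t) \<omega>))"
    using assms(1)[unfolded defining_set_def, THEN conjunct2] assms(2) by (rule bspec)
  then show "A 0 \<omega> = 0" "continuous_on {0..} (\<lambda>t. A t \<omega>)" by simp_all
  show "0 \<le> t \<Longrightarrow> ennreal t < lifetime X \<omega> \<Longrightarrow> A t \<omega> < \<infinity>" using P by simp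
  show "0 \<le> s \<Longrightarrow> 0 \<le> t \<Longrightarrow> A (t + s) \<omega> = A t \<omega> + A s (shift X (ennreal t) \<omega>)" using P by simp
qed

text \<open>Collects what holds on almost every path of a conservative process and is stable under
  shifts, so that pathwise identities may be applied to the restarted path as well. The defining set
  may depend on the path.\<close>

definition good :: "(real \<Rightarrow> 'w \<Rightarrow> ennreal) \<Rightarrow> 'w \<Rightarrow> bool" where
  "good A \<omega> \<longleftrightarrow> \<omega> \<in> sample_space X \<and> (\<forall>t<\<top>. path X t \<omega> \<noteq> None) \<and> (\<exists>\<Lambda>. defining_set A \<Lambda> \<and> \<omega> \<in> \<Lambda>)"

lemma goodD:
  assumes "good A \<omega>"
  shows "\<omega> \<in> sample_space X" "path X (ennreal s) \<omega> = Some (pos \<omega> s)"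
    and "0 \<le> t \<Longrightarrow> good A (shift X (ennreal t) \<omega>)"
    and "0 \<le> s \<Longrightarrow> 0 \<le> t \<Longrightarrow> A (t + s) \<omega> = A t \<omega> + A s (shift X (ennreal t) \<omega>)"
    and "clock (\<lambda>t. A t \<omega>)"
proof -
  obtain \<Lambda> where L: "defining_set A \<Lambda>" "\<omega> \<in> \<Lambda>"
    using assms unfolding good_def by blast
  note P = defining_setD[OF L]
  show s: "\<omega> \<in> sample_space X" using assms by (simp add: good_def)
  have ne: "path X t \<omega> \<noteq> None" if "t < \<top>" for t using assms that by (simp add: good_def)
  show "path X (ennreal s) \<omega> = Some (pos \<omega> s)" using ne[of "ennreal s"] by (simp add: pos_def)
  show add: "A (t + s) \<omega> = A t \<omega> + A s (shift X (ennreal t) \<omega>)" if "0 \<le> s" "0 \<le> t" for s t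
    using P(5) that .
  show "good A (shift X (ennreal t) \<omega>)" if t: "0 \<le> t"
    unfolding good_def
  proof (intro conjI exI[of _ \<Lambda>] allI impI)
    show "shift X (ennreal t) \<omega> \<in> sample_space X" by (rule shift_space[OF s])
    show "shift X (ennreal t) \<omega> \<in> \<Lambda>" by (rule P(1)[OF t])
    show "path X r (shift X (ennreal t) \<omega>) \<noteq> None" if "r < \<top>" for r
      using ne[of "r + ennreal t"] that by (simp add: path_shift[OF s] less_top[symmetric])
  qed (rule L(1))
  have life: "lifetime X \<omega> = \<top>"
  proof -
    have "t = \<top>" if "path X t \<omega> = None" for t using ne[of t] that less_top[of t] by blast
    then show ?thesis unfolding lifetime_def by (intro antisym top_greatest Inf_greatest) auto
  qed
  show "clock (\<lambda>t. A t \<omega>)" unfolding clock_def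
  proof (intro conjI allI impI)
    fix r t :: real assume rt: "0 \<le> r" "r \<le> t"
    have "A t \<omega> = A r \<omega> + A (t - r) (shift X (ennreal r) \<omega>)" using add[of "t - r" r] rt by simp
    then show "A r \<omega> \<le> A t \<omega>" by simp
  next
    fix t :: real assume "0 \<le> t"
    then show "A t \<omega> < \<top>" using P(4) life by simp
  qed (use P in auto)
qed

lemma AE_good:
  assumes A: "PCAF X A" and c: "conservative X"
  shows "AE \<omega> in law X (Some x). good A \<omega>"
proof -
  obtain \<Lambda> where L: "\<forall>x. AE \<omega> in law X (Some x). \<omega> \<in> \<Lambda>"
    and S: "\<forall>t\<ge>0. shift X (ennreal t) ` \<Lambda> \<subseteq> \<Lambda>"
    and P: "\<forall>\<omega>\<in>\<Lambda>.
           A 0 \<omega> = 0 \<and>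
           continuous_on {0..} (\<lambda>t. A t \<omega>) \<and>
           (\<forall>t\<ge>0. ennreal t < lifetime X \<omega> \<longrightarrow> A t \<omega> < \<infinity>) \<and>
           (\<forall>t\<ge>0. lifetime X \<omega> \<le> ennreal t \<longrightarrow> A t \<omega> = A (enn2real (lifetime X \<omega>)) \<omega>) \<and>
           (\<forall>s\<ge>0. \<forall>t\<ge>0. A (t + s) \<omega> = A t \<omega> + A s (shift X (ennreal t) \<omega>))"
    using A unfolding PCAF_def by (elim conjE bexE)
  have D: "defining_set A \<Lambda>"
    unfolding defining_set_def using S P by simp
  have "AE \<omega> in law X (Some x). \<omega> \<in> sample_space X" by (rule AE_I2) simp
  then show ?thesis using L[rule_format, of x] c[unfolded conservative_def, rule_format, of x]
  proof eventually_elim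
    case (elim \<omega>)
    have "\<forall>t<\<top>. path X t \<omega> \<noteq> None" using elim(3) by simp
    then show ?case unfolding good_def using elim(1,2) D by blast
  qed
qed

lemma pos_shift:
  assumes "good A \<omega>" "0 \<le> r" "0 \<le> s"
  shows "pos (shift X (ennreal r) \<omega>) s = pos \<omega> (s + r)"
  using assms by (simp add: pos_def path_shift[OF goodD(1)])

lemma pos_right_cont:
  assumes g: "good A \<omega>"
  shows "(pos \<omega> \<longlongrightarrow> pos \<omega> s) (at_right s)"
proof (rule topological_tendstoI)
  fix S assume S: "open S" "pos \<omega> s \<in> S"
  have U: "openin state_topology (Some ` S)" "path X (ennreal s) \<omega> \<in> Some ` S"
    using S goodD(2)[OF g] by auto
  obtain b where b: "ennreal s < b" "\<And>r. ennreal s < r \<Longrightarrow> r < b \<Longrightarrow> path X r \<omega> \<in> Some ` S"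
    using path_open_right[OF goodD(1)[OF g] _ U] by auto
  have "((\<lambda>r. ennreal r) \<longlongrightarrow> ennreal s) (at_right s)" by (intro tendsto_intros)
  then have "eventually (\<lambda>r. ennreal r < b) (at_right s)" using b(1) by (rule order_tendstoD(2))
  moreover have "eventually (\<lambda>r. s < r) (at_right s)" by (rule eventually_at_right_less)
  ultimately show "eventually (\<lambda>r. pos \<omega> r \<in> S) (at_right s)"
  proof eventually_elim
    case (elim r)
    have "ennreal s \<le> ennreal r" using elim(2) by (intro ennreal_leI) simp
    then have "path X (ennreal r) \<omega> \<in> Some ` S" using b(2) elim(1) U(2) by (cases "ennreal s = ennreal r") auto
    then show ?case using goodD(2)[OF g, of r] by auto
  qed
qed

lemma pos_measurable: "good A \<omega> \<Longrightarrow> pos \<omega> \<in> borel_measurable borel"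
  by (rule right_cont_measurable[OF pos_right_cont])

section \<open>The discounted functional localised to an open set\<close>

definition weight :: "'a set \<Rightarrow> 'w \<Rightarrow> real \<Rightarrow> ennreal" where
  "weight V \<omega> s = ennreal (exp (- s)) * indicator V (pos \<omega> s)"

definition weighted :: "'a set \<Rightarrow> (real \<Rightarrow> 'w \<Rightarrow> ennreal) \<Rightarrow> 'w \<Rightarrow> real measure" where
  "weighted V A \<omega> = density (clock_measure (\<lambda>t. A t \<omega>)) (weight V \<omega>)"

lemma sets_weighted [simp, measurable_cong]: "sets (weighted V A \<omega>) = sets borel"
  and space_weighted [simp]: "space (weighted V A \<omega>) = UNIV"
  by (simp_all add: weighted_def)

lemma weight_measurable:
  assumes "good A \<omega>" "open V"
  shows "weight V \<omega> \<in> borel_measurable borel"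
proof -
  have "(\<lambda>s. indicator V (pos \<omega> s) :: ennreal) \<in> borel_measurable borel"
    using assms(2) by (intro measurable_compose[OF pos_measurable[OF assms(1)]]) simp
  then show ?thesis unfolding weight_def by measurable
qed

text \<open>The measure \<open>weighted V A \<omega>\<close> is built path by path, and its
  measurability in the sample point is not visible. The present expression agrees with its mass of
  (0,t] on good paths, by \<open>functional_eq\<close>, and is a countable combination of variables
  known at time \<open>t\<close>. Bumps replace the indicator of \<open>V\<close>, which need not be
  right-continuous along a path; the limit superior provides a value on the remaining paths.\<close>

definition functional :: "'a set \<Rightarrow> (real \<Rightarrow> 'w \<Rightarrow> ennreal) \<Rightarrow> real \<Rightarrow> 'w \<Rightarrow> ennreal" where
  "functional V A t \<omega> = (SUP j. limsup (\<lambda>m. riemann_sum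
     (\<lambda>s. ennreal (exp (- s)) * extend_zero (\<lambda>y. ennreal (bump V j y)) (path X (ennreal s) \<omega>)) (\<lambda>s. A s \<omega>) t m))"

definition total :: "'a set \<Rightarrow> (real \<Rightarrow> 'w \<Rightarrow> ennreal) \<Rightarrow> 'w \<Rightarrow> ennreal" where
  "total V A \<omega> = (SUP n::nat. functional V A (real n) \<omega>)"

lemma functional_measurable:
  assumes A: "PCAF X A" and t: "0 \<le> t"
  shows "functional V A t \<in> borel_measurable (augm (ennreal t))"
proof -
  have As: "A s \<in> borel_measurable (augm (ennreal t))" if "0 \<le> s" "s \<le> t" for s
    using A[unfolded PCAF_def, THEN conjunct1] that(1)
    by (intro augm_measurable_mono[OF ennreal_leI[OF that(2)]]) blast
  have ps: "(\<lambda>\<omega>. extend_zero (\<lambda>y. ennreal (bump V j y)) (path X (ennreal s) \<omega>)) \<in> borel_measurable (augm (ennreal t))"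
    if "s \<le> t" for s j
    by (rule measurable_compose[OF path_augm[OF ennreal_leI[OF that]] extend_zero_measurable]) measurable
  have "(\<lambda>\<omega>. riemann_sum (\<lambda>s. ennreal (exp (- s)) * extend_zero (\<lambda>y. ennreal (bump V j y)) (path X (ennreal s) \<omega>)) (\<lambda>s. A s \<omega>) t m)
      \<in> borel_measurable (augm (ennreal t))" for j m
    unfolding riemann_sum_def
  proof (rule borel_measurable_suminf_order)
    fix i
    let ?u = "min (real i / 2 ^ m) t" and ?v = "min (real (Suc i) / 2 ^ m) t"
    have [measurable]: "A ?u \<in> borel_measurable (augm (ennreal t))" "A ?v \<in> borel_measurable (augm (ennreal t))"
      using t by (auto intro!: As)
    have [measurable]: "(\<lambda>\<omega>. extend_zero (\<lambda>y. ennreal (bump V j y)) (path X (ennreal ?v) \<omega>)) \<in> borel_measurable (augm (ennreal t))"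
      by (rule ps) simp
    show "(\<lambda>\<omega>. ennreal (exp (- ?v)) * extend_zero (\<lambda>y. ennreal (bump V j y)) (path X (ennreal ?v) \<omega>) * (A ?v \<omega> - A ?u \<omega>)) \<in> borel_measurable (augm (ennreal t))"
      by measurable
  qed
  then show ?thesis
    unfolding functional_def by (intro borel_measurable_SUP borel_measurable_limsup) auto
qed

lemma total_measurable:
  assumes A: "PCAF X A"
  shows "total V A \<in> borel_measurable (augm \<top>)"
  unfolding total_def
  by (intro borel_measurable_SUP augm_measurable_mono[OF top_greatest functional_measurable[OF A]]) auto

text \<open>For each continuous bump the Riemann sums converge along the right-continuous path;
  monotone convergence in \<open>j\<close> then recovers the indicator of \<open>V\<close>.\<close>

lemma functional_eq:
  assumes g: "good A \<omega>" and V: "open V" and t: "0 \<le> t"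
  shows "functional V A t \<omega> = emeasure (weighted V A \<omega>) {0<..t}"
proof -
  have path: "path X (ennreal s) \<omega> = Some (pos \<omega> s)" for s by (rule goodD(2)[OF g])
  let ?\<phi> = "\<lambda>j s. ennreal (exp (- s)) * ennreal (bump V j (pos \<omega> s))"
  note [measurable] = pos_measurable[OF g] weight_measurable[OF g V]
  have "(\<lambda>m. riemann_sum (?\<phi> j) (\<lambda>s. A s \<omega>) t m) \<longlonglongrightarrow> (\<integral>\<^sup>+s\<in>{0<..t}. ?\<phi> j s \<partial>clock_measure (\<lambda>s. A s \<omega>))" for j
  proof (rule riemann_sum_tendsto[OF goodD(5)[OF g] t, where B=1])
    show "?\<phi> j \<in> borel_measurable borel" by measurable
    fix s :: real assume s: "0 \<le> s"
    have "((\<lambda>r. bump V j (pos \<omega> r)) \<longlongrightarrow> bump V j (pos \<omega> s)) (at_right s)"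
      using continuous_bump by (rule continuous_on_tendsto_compose[OF _ pos_right_cont[OF g]]) auto
    moreover have "((\<lambda>r. exp (- r)) \<longlongrightarrow> exp (- s)) (at_right s)" by (intro tendsto_intros)
    ultimately have "((\<lambda>r. ennreal (exp (- r) * bump V j (pos \<omega> r))) \<longlongrightarrow> ennreal (exp (- s) * bump V j (pos \<omega> s))) (at_right s)"
      by (intro tendsto_ennrealI tendsto_mult)
    then show "(?\<phi> j \<longlongrightarrow> ?\<phi> j s) (at_right s)"
      by (simp add: ennreal_mult'' bump_range(1))
    have "exp (- s) * bump V j (pos \<omega> s) \<le> 1 * 1"
      using s bump_range by (intro mult_mono) auto
    then show "?\<phi> j s \<le> 1"
      using bump_range(1) by (subst ennreal_mult[symmetric]) (auto simp: ennreal_le_1)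
  qed simp
  then have "limsup (\<lambda>m. riemann_sum (?\<phi> j) (\<lambda>s. A s \<omega>) t m) = (\<integral>\<^sup>+s\<in>{0<..t}. ?\<phi> j s \<partial>clock_measure (\<lambda>s. A s \<omega>))" for j
    by (intro lim_imp_Limsup) auto
  then have "functional V A t \<omega> = (SUP j. \<integral>\<^sup>+s\<in>{0<..t}. ?\<phi> j s \<partial>clock_measure (\<lambda>s. A s \<omega>))"
    unfolding functional_def path extend_zero_simps by simp
  also have "\<dots> = (\<integral>\<^sup>+s. (SUP j. ?\<phi> j s * indicator {0<..t} s) \<partial>clock_measure (\<lambda>s. A s \<omega>))"
  proof (rule nn_integral_monotone_convergence_SUP[symmetric])
    show "incseq (\<lambda>j s. ?\<phi> j s * indicator {0<..t} s)"
      using incseq_bump[of V] by (auto simp: incseq_def le_fun_def intro!: mult_mono)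
  qed measurable
  also have "\<dots> = (\<integral>\<^sup>+s. weight V \<omega> s * indicator {0<..t} s \<partial>clock_measure (\<lambda>s. A s \<omega>))"
  proof (intro nn_integral_cong)
    fix s
    have "(SUP j. ?\<phi> j s * indicator {0<..t} s) = (ennreal (exp (- s)) * indicator {0<..t} s) * (SUP j. ennreal (bump V j (pos \<omega> s)))"
      unfolding SUP_mult_left_ennreal by (intro SUP_cong) (auto simp: mult_ac)
    then show "(SUP j. ?\<phi> j s * indicator {0<..t} s) = weight V \<omega> s * indicator {0<..t} s"
      unfolding SUP_bump[OF V] weight_def by (simp add: mult_ac)
  qed
  also have "\<dots> = emeasure (weighted V A \<omega>) {0<..t}"
    unfolding weighted_def by (rule emeasure_density[symmetric]) auto
  finally show ?thesis .
qed

lemma emeasure_weighted_nonpos: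
  assumes g: "good A \<omega>" and V: "open V" and B: "B \<in> sets borel" "B \<subseteq> {..0}"
  shows "emeasure (weighted V A \<omega>) B = 0"
proof -
  note [measurable] = weight_measurable[OF g V]
  have "emeasure (weighted V A \<omega>) B = (\<integral>\<^sup>+s. weight V \<omega> s * indicator B s \<partial>clock_measure (\<lambda>t. A t \<omega>))"
    unfolding weighted_def using B(1) by (intro emeasure_density) auto
  also have "\<dots> = (\<integral>\<^sup>+s. 0 \<partial>clock_measure (\<lambda>t. A t \<omega>))"
    using AE_clock_pos[OF goodD(5)[OF g]] B(2)
    by (intro nn_integral_cong_AE) (auto elim!: eventually_mono simp: indicator_def)
  finally show ?thesis by simp
qed

lemma emeasure_weighted_singleton:
  assumes g: "good A \<omega>" and V: "open V"
  shows "emeasure (weighted V A \<omega>) {t} = 0"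
proof -
  have "{t} \<in> null_sets (clock_measure (\<lambda>t. A t \<omega>))"
    using emeasure_clock_singleton[OF goodD(5)[OF g]] by (simp add: null_sets_def)
  then have "AE s in clock_measure (\<lambda>t. A t \<omega>). s \<notin> {t}" by (rule AE_not_in)
  then have "(\<integral>\<^sup>+s. weight V \<omega> s * indicator {t} s \<partial>clock_measure (\<lambda>t. A t \<omega>)) = (\<integral>\<^sup>+s. 0 \<partial>clock_measure (\<lambda>t. A t \<omega>))"
    by (intro nn_integral_cong_AE) (auto elim!: eventually_mono)
  moreover have "emeasure (weighted V A \<omega>) {t} = (\<integral>\<^sup>+s. weight V \<omega> s * indicator {t} s \<partial>clock_measure (\<lambda>t. A t \<omega>))"
    unfolding weighted_def using weight_measurable[OF g V] by (intro emeasure_density) auto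
  ultimately show ?thesis by simp
qed

lemma emeasure_weighted_split:
  assumes g: "good A \<omega>" and V: "open V" and "0 \<le> t"
  shows "emeasure (weighted V A \<omega>) UNIV = emeasure (weighted V A \<omega>) {0<..t} + emeasure (weighted V A \<omega>) {t<..}"
proof -
  have "emeasure (weighted V A \<omega>) UNIV = emeasure (weighted V A \<omega>) ({..0} \<union> {0<..t} \<union> {t<..})"
    using \<open>0 \<le> t\<close> by (intro arg_cong[where f="emeasure _"]) auto
  also have "\<dots> = emeasure (weighted V A \<omega>) ({..0} \<union> {0<..t}) + emeasure (weighted V A \<omega>) {t<..}"
    using \<open>0 \<le> t\<close> by (intro plus_emeasure[symmetric]) auto
  also have "emeasure (weighted V A \<omega>) ({..0} \<union> {0<..t}) = emeasure (weighted V A \<omega>) {..0} + emeasure (weighted V A \<omega>) {0<..t}"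
    by (intro plus_emeasure[symmetric]) auto
  also have "emeasure (weighted V A \<omega>) {..0} = 0"
    using emeasure_weighted_nonpos[OF g V, of "{..0}"] by simp
  finally show ?thesis by simp
qed

lemma total_eq:
  assumes g: "good A \<omega>" and V: "open V"
  shows "total V A \<omega> = emeasure (weighted V A \<omega>) UNIV"
proof -
  have "total V A \<omega> = (SUP n::nat. emeasure (weighted V A \<omega>) {0<..real n})"
    unfolding total_def by (simp add: functional_eq[OF g V])
  also have "\<dots> = emeasure (weighted V A \<omega>) (\<Union>n::nat. {0<..real n})"
    by (rule SUP_emeasure_incseq) (auto simp: incseq_def)
  also have "(\<Union>n::nat. {0<..real n}) = {0<..}" by (auto intro: real_arch_simple)
  also have "emeasure (weighted V A \<omega>) {0<..} = emeasure (weighted V A \<omega>) UNIV"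
    using emeasure_weighted_split[OF g V, of 0] by simp
  finally show ?thesis .
qed

text \<open>Restarting the path at \<open>t\<close> restarts the discount too: the weight of the
  shifted path at s - t is e^t times the original weight at s, and the factor e^(-t)
  compensates.\<close>

lemma emeasure_weighted_tail:
  assumes g: "good A \<omega>" and V: "open V" and t: "0 \<le> t"
  shows "emeasure (weighted V A \<omega>) {t<..} = ennreal (exp (- t)) * total V A (shift X (ennreal t) \<omega>)"
proof -
  let ?\<omega>' = "shift X (ennreal t) \<omega>"
  note g' = goodD(3)[OF g t]
  note [measurable] = weight_measurable[OF g V] weight_measurable[OF g' V]
  have "emeasure (weighted V A ?\<omega>') UNIV = (\<integral>\<^sup>+s. weight V ?\<omega>' s \<partial>clock_measure (\<lambda>t. A t ?\<omega>'))"
    unfolding weighted_def by (subst emeasure_density) auto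
  also have "\<dots> = (\<integral>\<^sup>+s\<in>{t<..}. weight V ?\<omega>' (s - t) \<partial>clock_measure (\<lambda>t. A t \<omega>))"
    by (rule nn_integral_clock_shift[OF goodD(5)[OF g] goodD(5)[OF g'] t]) (use goodD(4)[OF g _ t] in auto)
  finally have "ennreal (exp (- t)) * total V A ?\<omega>' = ennreal (exp (- t)) * (\<integral>\<^sup>+s\<in>{t<..}. weight V ?\<omega>' (s - t) \<partial>clock_measure (\<lambda>t. A t \<omega>))"
    by (simp add: total_eq[OF g' V])
  also have "\<dots> = (\<integral>\<^sup>+s. ennreal (exp (- t)) * (weight V ?\<omega>' (s - t) * indicator {t<..} s) \<partial>clock_measure (\<lambda>t. A t \<omega>))"
    by (rule nn_integral_cmult[symmetric]) measurable
  also have "\<dots> = (\<integral>\<^sup>+s\<in>{t<..}. weight V \<omega> s \<partial>clock_measure (\<lambda>t. A t \<omega>))"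
  proof (intro nn_integral_cong)
    fix s
    show "ennreal (exp (- t)) * (weight V ?\<omega>' (s - t) * indicator {t<..} s) = weight V \<omega> s * indicator {t<..} s"
    proof (cases "t < s")
      case True
      then have "pos ?\<omega>' (s - t) = pos \<omega> s" using pos_shift[OF g t, of "s - t"] by simp
      moreover have "ennreal (exp (- t)) * ennreal (exp (- (s - t))) = ennreal (exp (- s))"
        by (simp add: ennreal_mult[symmetric] exp_add[symmetric])
      ultimately show ?thesis using True by (simp add: weight_def mult.assoc[symmetric])
    qed simp
  qed
  also have "\<dots> = emeasure (weighted V A \<omega>) {t<..}"
    unfolding weighted_def by (rule emeasure_density[symmetric]) auto
  finally show ?thesis ..
qed

lemma total_split:
  assumes g: "good A \<omega>" and V: "open V" and t: "0 \<le> t"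
  shows "total V A \<omega> = functional V A t \<omega> + ennreal (exp (- t)) * total V A (shift X (ennreal t) \<omega>)"
  using emeasure_weighted_split[OF assms] by (simp add: total_eq[OF g V] functional_eq[OF assms] emeasure_weighted_tail[OF assms])

text \<open>The weight is at most 1, so the mass of (0,t] is bounded by the value of the PCAF at
  \<open>t\<close>.\<close>

lemma functional_finite:
  assumes g: "good A \<omega>" and V: "open V" and t: "0 \<le> t"
  shows "functional V A t \<omega> < \<top>"
proof -
  note [measurable] = weight_measurable[OF g V]
  have "emeasure (weighted V A \<omega>) {0<..t} = (\<integral>\<^sup>+s. weight V \<omega> s * indicator {0<..t} s \<partial>clock_measure (\<lambda>t. A t \<omega>))"
    unfolding weighted_def by (rule emeasure_density) auto
  also have "\<dots> \<le> (\<integral>\<^sup>+s. indicator {0<..t} s \<partial>clock_measure (\<lambda>t. A t \<omega>))"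
    by (intro nn_integral_mono) (auto simp: indicator_def weight_def ennreal_le_1)
  also have "\<dots> = A t \<omega>"
    using emeasure_clock_Ioc[OF goodD(5)[OF g] t] t clockD(1)[OF goodD(5)[OF g]] by simp
  also have "\<dots> < \<top>" using clockD(4)[OF goodD(5)[OF g] t] .
  finally show ?thesis by (simp add: functional_eq[OF assms])
qed

end

section \<open>Potentials and the Revuz correspondence\<close>

definition jointly_measurable_density :: "(real \<Rightarrow> 'a::topological_space \<Rightarrow> 'a \<Rightarrow> ennreal) \<Rightarrow> bool" where
  "jointly_measurable_density p \<longleftrightarrow>
     (\<lambda>(t, x, y). p t x y) \<in> borel_measurable (restrict_space borel {0<..} \<Otimes>\<^sub>M (borel \<Otimes>\<^sub>M borel))"

lemma resolvent_density_measurable: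
  assumes p: "jointly_measurable_density p"
  shows "(\<lambda>(x, y). resolvent_density p \<alpha> x y) \<in> borel_measurable (borel \<Otimes>\<^sub>M borel)"
proof -
  \<comment> \<open>\<open>p\<close> is known to be measurable only on positive times. All other
    times are sent to 1, which the indicator of \<open>{0<..}\<close> in the resolvent makes
    invisible.\<close>
  define \<phi> :: "real \<Rightarrow> real" where "\<phi> = (\<lambda>t. if 0 < t then t else 1)"
  have "\<phi> \<in> borel_measurable borel" unfolding \<phi>_def by measurable
  then have \<phi>: "\<phi> \<in> borel \<rightarrow>\<^sub>M restrict_space borel {0<..}"
    by (intro measurable_restrict_space2) (auto simp: \<phi>_def)
  have "(\<lambda>(z, t). (\<phi> t, z)) \<in> (borel \<Otimes>\<^sub>M borel) \<Otimes>\<^sub>M lborel \<rightarrow>\<^sub>M restrict_space borel {0<..} \<Otimes>\<^sub>M ((borel :: 'a measure) \<Otimes>\<^sub>M borel)"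
    using \<phi> by measurable
  from measurable_compose[OF this p[unfolded jointly_measurable_density_def]]
  have [measurable]: "(\<lambda>(z, t). p (\<phi> t) (fst z) (snd z)) \<in> borel_measurable ((borel \<Otimes>\<^sub>M borel) \<Otimes>\<^sub>M lborel)"
    by (simp add: case_prod_beta')
  have "(\<lambda>z. \<integral>\<^sup>+t. ennreal (exp (- \<alpha> * t)) * p (\<phi> t) (fst z) (snd z) * indicator {0<..} t \<partial>lborel) \<in> borel_measurable (borel \<Otimes>\<^sub>M borel)"
    by (rule lborel.borel_measurable_nn_integral) measurable
  moreover have "(\<integral>\<^sup>+t. ennreal (exp (- \<alpha> * t)) * p (\<phi> t) x y * indicator {0<..} t \<partial>lborel) = resolvent_density p \<alpha> x y" for x y
    unfolding resolvent_density_def by (intro nn_integral_cong) (simp add: \<phi>_def indicator_def)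
  ultimately show ?thesis unfolding case_prod_beta' by (simp only:)
qed

lemma resolvent_density_measurable1:
  assumes p: "jointly_measurable_density p"
  shows "resolvent_density p \<alpha> x \<in> borel_measurable borel"
  using measurable_compose[OF measurable_Pair1' resolvent_density_measurable[OF p], of x] by simp

lemma potential_measurable:
  assumes p: "jointly_measurable_density p" and \<mu>: "sets \<mu> = sets borel" "finite_measure \<mu>"
  shows "potential p \<alpha> \<mu> \<in> borel_measurable borel"
proof -
  interpret finite_measure \<mu> by fact
  have "(\<lambda>(x, y). resolvent_density p \<alpha> x y) \<in> borel_measurable (borel \<Otimes>\<^sub>M \<mu>)"
    using resolvent_density_measurable[OF p] sets_pair_measure_cong[OF refl \<mu>(1), of "borel :: 'a measure"]
    by (simp cong: measurable_cong_sets)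
  then show ?thesis unfolding potential_def[abs_def] by (rule borel_measurable_nn_integral)
qed

lemma resolvent_density_antimono: "\<alpha> \<le> \<beta> \<Longrightarrow> resolvent_density p \<beta> x y \<le> resolvent_density p \<alpha> x y"
  unfolding resolvent_density_def
  by (intro nn_integral_mono) (auto simp: indicator_def intro!: mult_right_mono ennreal_leI)

lemma measurable_tail:
  assumes M: "finite_measure M" "sets M = sets borel"
  shows "(\<lambda>t::real. emeasure M {t<..}) \<in> borel_measurable borel"
proof -
  interpret finite_measure M by fact
  have "{z :: real \<times> real. fst z < snd z} \<in> sets borel"
    by (auto intro!: borel_open open_Collect_less continuous_intros)
  then have "{z :: real \<times> real. fst z < snd z} \<in> sets (borel \<Otimes>\<^sub>M M)"
    using sets_pair_measure_cong[OF refl M(2), of "borel :: real measure"] unfolding borel_prod by simp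
  from measurable_emeasure_Pair[OF this] show ?thesis by (simp add: vimage_def greaterThan_def)
qed

section \<open>Expectations given by the Revuz correspondence\<close>

locale Revuz_setting = standard_proc X
  for X :: "('w, 'a::{metric_space, second_countable_topology}) process" +
  fixes p :: "real \<Rightarrow> 'a \<Rightarrow> 'a \<Rightarrow> ennreal"
  assumes conservative: "conservative X"
    and strong_Feller: "strong_Feller X"
    and density_measurable: "jointly_measurable_density p"
begin

lemma RevuzD:
  assumes "Revuz_correspondence X p A \<mu>"
  shows "PCAF X A" "\<mu> \<in> smooth_measures X p" "sets \<mu> = sets borel"
    and "\<alpha> > 0 \<Longrightarrow> f \<in> borel_measurable borel \<Longrightarrow>
        (\<integral>\<^sup>+\<omega>. Stieltjes_integral (\<lambda>t. A t \<omega>)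
            (\<lambda>t. ennreal (exp (- \<alpha> * t)) * extend_zero f (path X (ennreal t) \<omega>)) \<partial>Pr (Some x))
        = (\<integral>\<^sup>+y. resolvent_density p \<alpha> x y * f y \<partial>\<mu>)"
proof -
  note R = assms[unfolded Revuz_correspondence_def]
  show "PCAF X A" by (rule R[THEN conjunct1])
  show s: "\<mu> \<in> smooth_measures X p" by (rule R[THEN conjunct2, THEN conjunct1])
  then show "sets \<mu> = sets borel" unfolding smooth_measures_def by blast
  show "(\<integral>\<^sup>+\<omega>. Stieltjes_integral (\<lambda>t. A t \<omega>)
            (\<lambda>t. ennreal (exp (- \<alpha> * t)) * extend_zero f (path X (ennreal t) \<omega>)) \<partial>Pr (Some x))
        = (\<integral>\<^sup>+y. resolvent_density p \<alpha> x y * f y \<partial>\<mu>)" if "\<alpha> > 0" "f \<in> borel_measurable borel"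
    using R[THEN conjunct2, THEN conjunct2, rule_format, OF that] .
qed

lemma AE_good_Pr: "PCAF X A \<Longrightarrow> AE \<omega> in Pr (Some x). good A \<omega>"
  using AE_good[OF _ conservative] by (simp add: AE_completion_iff)

lemma prob_Pr: "prob_space (Pr x)"
  by (rule prob_spaceI) (simp add: prob_space.emeasure_space_1[OF prob_law, unfolded space_law])

text \<open>On good paths the truncated Stieltjes integral of the Revuz formula is an ordinary
  integral for the clock measure.\<close>

lemma Revuz_expectation:
  assumes R: "Revuz_correspondence X p A \<mu>" and "\<alpha> > 0" and f: "f \<in> borel_measurable borel"
  shows "(\<integral>\<^sup>+\<omega>. (\<integral>\<^sup>+s. ennreal (exp (- \<alpha> * s)) * f (pos \<omega> s) \<partial>clock_measure (\<lambda>t. A t \<omega>)) \<partial>Pr (Some x))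
      = (\<integral>\<^sup>+y. resolvent_density p \<alpha> x y * f y \<partial>\<mu>)"
proof -
  have "(\<integral>\<^sup>+\<omega>. (\<integral>\<^sup>+s. ennreal (exp (- \<alpha> * s)) * f (pos \<omega> s) \<partial>clock_measure (\<lambda>t. A t \<omega>)) \<partial>Pr (Some x))
    = (\<integral>\<^sup>+\<omega>. Stieltjes_integral (\<lambda>t. A t \<omega>)
            (\<lambda>t. ennreal (exp (- \<alpha> * t)) * extend_zero f (path X (ennreal t) \<omega>)) \<partial>Pr (Some x))"
  proof (rule nn_integral_cong_AE)
    show "AE \<omega> in Pr (Some x). (\<integral>\<^sup>+s. ennreal (exp (- \<alpha> * s)) * f (pos \<omega> s) \<partial>clock_measure (\<lambda>t. A t \<omega>))
        = Stieltjes_integral (\<lambda>t. A t \<omega>) (\<lambda>t. ennreal (exp (- \<alpha> * t)) * extend_zero f (path X (ennreal t) \<omega>))"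
      using AE_good_Pr[OF RevuzD(1)[OF R]]
    proof eventually_elim
      case (elim \<omega>)
      have [measurable]: "(\<lambda>s. f (pos \<omega> s)) \<in> borel_measurable borel"
        by (rule measurable_compose[OF pos_measurable[OF elim] f])
      have "(\<lambda>t. ennreal (exp (- \<alpha> * t)) * f (pos \<omega> t)) \<in> borel_measurable borel" by measurable
      then show ?case
        using Stieltjes_integral_clock[OF goodD(5)[OF elim]] by (simp add: goodD(2)[OF elim])
    qed
  qed
  then show ?thesis using RevuzD(4)[OF R \<open>\<alpha> > 0\<close> f] by simp
qed

abbreviation "pot V \<mu> \<equiv> potential p 1 (restrict_to \<mu> V)"

lemma nn_integral_restrict_to:
  assumes "sets \<mu> = sets borel" "V \<in> sets borel" "f \<in> borel_measurable borel"
  shows "(\<integral>\<^sup>+y. f y \<partial>restrict_to \<mu> V) = (\<integral>\<^sup>+y. f y * indicator V y \<partial>\<mu>)"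
proof -
  note [measurable_cong] = assms(1)
  note [measurable] = assms(2,3)
  show ?thesis unfolding restrict_to_def by (subst nn_integral_density) (auto simp: mult.commute)
qed

text \<open>The rate 2 arises as a sum: one factor e^(-s) belongs to the integrand and one is built
  into \<open>weighted\<close>.\<close>

lemma weighted_expectation:
  assumes R: "Revuz_correspondence X p A \<mu>" and V: "open V" and g: "g \<in> borel_measurable borel"
  shows "(\<integral>\<^sup>+\<omega>. (\<integral>\<^sup>+s. ennreal (exp (- s)) * g (pos \<omega> s) \<partial>weighted V A \<omega>) \<partial>Pr (Some x))
      = (\<integral>\<^sup>+y. resolvent_density p 2 x y * g y \<partial>restrict_to \<mu> V)"
proof -
  note [measurable] = g resolvent_density_measurable1[OF density_measurable]
  have Vm [measurable]: "V \<in> sets borel" using V by simp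
  have "(\<integral>\<^sup>+\<omega>. (\<integral>\<^sup>+s. ennreal (exp (- s)) * g (pos \<omega> s) \<partial>weighted V A \<omega>) \<partial>Pr (Some x))
     = (\<integral>\<^sup>+\<omega>. (\<integral>\<^sup>+s. ennreal (exp (- 2 * s)) * (g (pos \<omega> s) * indicator V (pos \<omega> s)) \<partial>clock_measure (\<lambda>t. A t \<omega>)) \<partial>Pr (Some x))"
  proof (rule nn_integral_cong_AE)
    show "AE \<omega> in Pr (Some x). (\<integral>\<^sup>+s. ennreal (exp (- s)) * g (pos \<omega> s) \<partial>weighted V A \<omega>)
       = (\<integral>\<^sup>+s. ennreal (exp (- 2 * s)) * (g (pos \<omega> s) * indicator V (pos \<omega> s)) \<partial>clock_measure (\<lambda>t. A t \<omega>))"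
      using AE_good_Pr[OF RevuzD(1)[OF R]]
    proof eventually_elim
      case (elim \<omega>)
      note [measurable] = weight_measurable[OF elim V]
      have [measurable]: "(\<lambda>s. g (pos \<omega> s)) \<in> borel_measurable borel"
        by (rule measurable_compose[OF pos_measurable[OF elim] g])
      have "(\<integral>\<^sup>+s. ennreal (exp (- s)) * g (pos \<omega> s) \<partial>weighted V A \<omega>)
        = (\<integral>\<^sup>+s. weight V \<omega> s * (ennreal (exp (- s)) * g (pos \<omega> s)) \<partial>clock_measure (\<lambda>t. A t \<omega>))"
        unfolding weighted_def by (rule nn_integral_density) measurable
      also have "\<dots> = (\<integral>\<^sup>+s. ennreal (exp (- 2 * s)) * (g (pos \<omega> s) * indicator V (pos \<omega> s)) \<partial>clock_measure (\<lambda>t. A t \<omega>))"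
      proof (intro nn_integral_cong)
        fix s
        have "ennreal (exp (- s)) * ennreal (exp (- s)) = ennreal (exp (- 2 * s))"
          by (simp add: ennreal_mult[symmetric] exp_add[symmetric])
        then show "weight V \<omega> s * (ennreal (exp (- s)) * g (pos \<omega> s)) = ennreal (exp (- 2 * s)) * (g (pos \<omega> s) * indicator V (pos \<omega> s))"
          unfolding weight_def by (metis mult.assoc mult.commute)
      qed
      finally show ?case .
    qed
  qed
  also have "\<dots> = (\<integral>\<^sup>+y. resolvent_density p 2 x y * (g y * indicator V y) \<partial>\<mu>)"
    by (rule Revuz_expectation[OF R]) auto
  also have "\<dots> = (\<integral>\<^sup>+y. resolvent_density p 2 x y * g y \<partial>restrict_to \<mu> V)"
    by (subst nn_integral_restrict_to[OF RevuzD(3)[OF R] Vm]) (auto simp: mult_ac)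
  finally show ?thesis .
qed

lemma total_expectation:
  assumes R: "Revuz_correspondence X p A \<mu>" and V: "open V"
  shows "(\<integral>\<^sup>+\<omega>. total V A \<omega> \<partial>Pr (Some x)) = pot V \<mu> x"
proof -
  note [measurable] = resolvent_density_measurable1[OF density_measurable]
  have Vm [measurable]: "V \<in> sets borel" using V by simp
  have "(\<integral>\<^sup>+\<omega>. total V A \<omega> \<partial>Pr (Some x)) = (\<integral>\<^sup>+\<omega>. (\<integral>\<^sup>+s. ennreal (exp (- 1 * s)) * indicator V (pos \<omega> s) \<partial>clock_measure (\<lambda>t. A t \<omega>)) \<partial>Pr (Some x))"
  proof (rule nn_integral_cong_AE)
    show "AE \<omega> in Pr (Some x). total V A \<omega> = (\<integral>\<^sup>+s. ennreal (exp (- 1 * s)) * indicator V (pos \<omega> s) \<partial>clock_measure (\<lambda>t. A t \<omega>))"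
      using AE_good_Pr[OF RevuzD(1)[OF R]]
    proof eventually_elim
      case (elim \<omega>)
      show ?case
        unfolding total_eq[OF elim V] weighted_def using weight_measurable[OF elim V]
        by (subst emeasure_density) (auto simp: weight_def)
    qed
  qed
  also have "\<dots> = (\<integral>\<^sup>+y. resolvent_density p 1 x y * indicator V y \<partial>\<mu>)"
    by (rule Revuz_expectation[OF R]) auto
  also have "\<dots> = pot V \<mu> x"
    unfolding potential_def by (subst nn_integral_restrict_to[OF RevuzD(3)[OF R] Vm]) auto
  finally show ?thesis .
qed

lemma S00D:
  assumes "\<nu> \<in> S00 X p"
  obtains B where "0 \<le> B" "\<And>x. potential p 1 \<nu> x \<le> ennreal B"
proof -
  have "(SUP x. potential p 1 \<nu> x) < \<top>" using assms by (simp add: S00_def)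
  then obtain B where B: "0 \<le> B" "(SUP x. potential p 1 \<nu> x) = ennreal B"
    by (cases "SUP x. potential p 1 \<nu> x") auto
  have "potential p 1 \<nu> x \<le> ennreal B" for x
    unfolding B(2)[symmetric] by (rule SUP_upper) simp
  then show thesis by (rule that[OF B(1)])
qed

lemma S00_potential_measurable:
  assumes "\<nu> \<in> S00 X p"
  shows "potential p \<alpha> \<nu> \<in> borel_measurable borel"
  by (rule potential_measurable[OF density_measurable]) (use assms in \<open>simp_all add: S00_def\<close>)

text \<open>\<open>Markov_augm\<close> speaks of the path in the compactification, so
  \<open>f\<close> is first extended by 0; conservativeness makes the extension agree with
  \<open>f\<close> along almost every path.\<close>

lemma semigroup_step:
  assumes f: "f \<in> borel_measurable borel" and Y: "Y \<in> borel_measurable (augm (ennreal r))" and r: "0 \<le> r" and t: "0 \<le> t"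
  shows "(\<integral>\<^sup>+\<omega>. Y \<omega> * f (pos \<omega> (t + r)) \<partial>Pr (Some x)) =
    (\<integral>\<^sup>+\<omega>. Y \<omega> * (\<integral>\<^sup>+\<omega>'. f (pos \<omega>' t) \<partial>Pr (Some (pos \<omega> r))) \<partial>Pr (Some x))"
proof -
  define Z where "Z \<omega> = extend_zero f (path X (ennreal t) \<omega>)" for \<omega>
  have Z: "Z \<in> borel_measurable (augm \<top>)"
    unfolding Z_def by (rule measurable_compose[OF path_augm[OF top_greatest] extend_zero_measurable[OF f]])
  have ne: "AE \<omega> in Pr (Some y). path X (ennreal s) \<omega> = Some (pos \<omega> s)" for y s
    using conservative[unfolded conservative_def, rule_format, of y]
    unfolding AE_completion_iff by (rule eventually_mono) (simp add: pos_def)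
  have "AE \<omega> in Pr (Some x). \<omega> \<in> sample_space X" by (rule AE_I2) simp
  then have "(\<integral>\<^sup>+\<omega>. Y \<omega> * f (pos \<omega> (t + r)) \<partial>Pr (Some x)) = (\<integral>\<^sup>+\<omega>. Y \<omega> * Z (shift X (ennreal r) \<omega>) \<partial>Pr (Some x))"
    using ne[of "t + r" x]
    by (intro nn_integral_cong_AE) (auto elim!: eventually_elim2 simp: Z_def path_shift r t ennreal_plus[symmetric] simp del: ennreal_plus)
  also have "\<dots> = (\<integral>\<^sup>+\<omega>. Y \<omega> * (\<integral>\<^sup>+\<omega>'. Z \<omega>' \<partial>Pr (path X (ennreal r) \<omega>)) \<partial>Pr (Some x))"
    by (rule Markov_augm[OF Y Z])
  also have "\<dots> = (\<integral>\<^sup>+\<omega>. Y \<omega> * (\<integral>\<^sup>+\<omega>'. f (pos \<omega>' t) \<partial>Pr (Some (pos \<omega> r))) \<partial>Pr (Some x))"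
  proof (rule nn_integral_cong_AE)
    have *: "(\<integral>\<^sup>+\<omega>'. Z \<omega>' \<partial>Pr (Some y)) = (\<integral>\<^sup>+\<omega>'. f (pos \<omega>' t) \<partial>Pr (Some y))" for y
      using ne[of t y] by (intro nn_integral_cong_AE) (auto elim!: eventually_mono simp: Z_def)
    show "AE \<omega> in Pr (Some x). Y \<omega> * (\<integral>\<^sup>+\<omega>'. Z \<omega>' \<partial>Pr (path X (ennreal r) \<omega>)) = Y \<omega> * (\<integral>\<^sup>+\<omega>'. f (pos \<omega>' t) \<partial>Pr (Some (pos \<omega> r)))"
      using ne[of r x] by (rule eventually_mono) (simp add: *)
  qed
  finally show ?thesis .
qed

end

section \<open>The energy identity\<close>

context Revuz_setting
begin

lemma AE_path_pos: "AE \<omega> in Pr (Some y). path X (ennreal s) \<omega> = Some (pos \<omega> s)"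
  using conservative[unfolded conservative_def, rule_format, of y]
  unfolding AE_completion_iff by (rule eventually_mono) (simp add: pos_def)

lemma pos_borel_measurable:
  assumes f: "f \<in> borel_measurable borel"
  shows "(\<lambda>\<omega>. f (pos \<omega> s) :: ennreal) \<in> borel_measurable (Pr (Some x))"
proof (rule measurable_completion_AE)
  show "(\<lambda>\<omega>. extend_zero f (path X (ennreal s) \<omega>)) \<in> borel_measurable (Pr (Some x))"
    by (rule measurable_completion[OF measurable_compose[OF path_measurable_law extend_zero_measurable[OF f]]])
  show "AE \<omega> in law X (Some x). extend_zero f (path X (ennreal s) \<omega>) = f (pos \<omega> s)"
    using AE_path_pos[of s x] unfolding AE_completion_iff by (rule eventually_mono) simp
qed simp

definition incr :: "'a set \<Rightarrow> (real \<Rightarrow> 'w \<Rightarrow> ennreal) \<Rightarrow> nat \<Rightarrow> nat \<Rightarrow> 'w \<Rightarrow> ennreal" where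
  "incr V A m i \<omega> = functional V A (real (Suc i) / 2 ^ m) \<omega> - functional V A (real i / 2 ^ m) \<omega>"

lemma incr_measurable:
  assumes A: "PCAF X A"
  shows "incr V A m i \<in> borel_measurable (augm (ennreal (real (Suc i) / 2 ^ m)))"
proof -
  have "functional V A (real i / 2 ^ m) \<in> borel_measurable (augm (ennreal (real (Suc i) / 2 ^ m)))"
  proof (rule augm_measurable_mono[OF ennreal_leI functional_measurable[OF A]])
    show "real i / 2 ^ m \<le> real (Suc i) / 2 ^ m" by (rule divide_right_mono) auto
  qed simp
  moreover have "functional V A (real (Suc i) / 2 ^ m) \<in> borel_measurable (augm (ennreal (real (Suc i) / 2 ^ m)))"
    by (rule functional_measurable[OF A]) simp
  ultimately show ?thesis unfolding incr_def[abs_def] by measurable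
qed

lemma incr_measurable_Pr: "PCAF X A \<Longrightarrow> incr V A m i \<in> borel_measurable (Pr x)"
  by (rule augm_measurable_Pr[OF incr_measurable])

lemma incr_eq:
  assumes g: "good A \<omega>" and V: "open V"
  shows "emeasure (weighted V A \<omega>) {real i / 2 ^ m<..real (Suc i) / 2 ^ m} = incr V A m i \<omega>"
proof -
  let ?u = "real i / 2 ^ m" and ?v = "real (Suc i) / 2 ^ m"
  have uv: "0 \<le> ?u" "?u \<le> ?v" "0 \<le> ?v" by (auto intro: divide_right_mono)
  have un: "{0<..?u} \<union> {?u<..?v} = {0<..?v}" using uv(1,2) by (intro ivl_disj_un) auto
  have "functional V A ?v \<omega> = emeasure (weighted V A \<omega>) ({0<..?u} \<union> {?u<..?v})"
    by (simp only: un functional_eq[OF g V uv(3)])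
  also have "\<dots> = emeasure (weighted V A \<omega>) {0<..?u} + emeasure (weighted V A \<omega>) {?u<..?v}"
    by (rule plus_emeasure[symmetric]) auto
  finally have "functional V A ?v \<omega> = functional V A ?u \<omega> + emeasure (weighted V A \<omega>) {?u<..?v}"
    by (simp only: functional_eq[OF g V uv(1)])
  then show ?thesis
    unfolding incr_def using functional_finite[OF g V uv(1)] by (simp add: less_top)
qed

lemma grid_integral:
  assumes g: "good A \<omega>" and V: "open V" and \<phi>: "\<phi> \<in> borel_measurable borel"
  shows "(\<integral>\<^sup>+s. \<phi> (dyadic_ceil m s) \<partial>weighted V A \<omega>) = (\<Sum>i. \<phi> (real (Suc i) / 2 ^ m) * incr V A m i \<omega>)"
proof -
  have "AE s in weighted V A \<omega>. s \<notin> {..0}"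
    by (rule AE_not_in) (simp add: null_sets_def emeasure_weighted_nonpos[OF g V])
  then have "(\<integral>\<^sup>+s. \<phi> (dyadic_ceil m s) \<partial>weighted V A \<omega>) = (\<integral>\<^sup>+s\<in>{0<..}. \<phi> (dyadic_ceil m s) \<partial>weighted V A \<omega>)"
    by (intro nn_integral_cong_AE) (auto elim!: eventually_mono simp: indicator_def)
  also have "\<dots> = (\<Sum>i. \<phi> (real (Suc i) / 2 ^ m) * emeasure (weighted V A \<omega>) {real i / 2 ^ m<..real (Suc i) / 2 ^ m})"
    by (rule nn_integral_dyadic_cells[OF sets_weighted \<phi>])
  finally show ?thesis by (simp only: incr_eq[OF g V])
qed

text \<open>A Riemann sum for the integral of e^(-s) v(X_s) against the localised functional, with
  the integrand sampled on the grid of level \<open>m\<close> but the increments taken on level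
  \<open>n\<close>. Two levels are used so that the sums of different grids can be compared cell by
  cell.\<close>

definition gridsum :: "'a set \<Rightarrow> (real \<Rightarrow> 'w \<Rightarrow> ennreal) \<Rightarrow> ('a \<Rightarrow> ennreal) \<Rightarrow> nat \<Rightarrow> nat \<Rightarrow> 'w \<Rightarrow> ennreal" where
  "gridsum V A v m n \<omega> = (\<Sum>i. ennreal (exp (- dyadic_ceil m (real (Suc i) / 2 ^ n))) *
     v (pos \<omega> (dyadic_ceil m (real (Suc i) / 2 ^ n))) * incr V A n i \<omega>)"

lemma gridsum_term_measurable:
  assumes A: "PCAF X A" and v: "v \<in> borel_measurable borel"
  shows "(\<lambda>\<omega>. ennreal c * v (pos \<omega> r) * incr V A n i \<omega>) \<in> borel_measurable (Pr (Some x))"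
proof -
  note [measurable] = pos_borel_measurable[OF v, of r x] incr_measurable_Pr[OF A, of V n i "Some x"]
  show ?thesis by measurable
qed

lemma gridsum_measurable:
  assumes A: "PCAF X A" and v: "v \<in> borel_measurable borel"
  shows "gridsum V A v m n \<in> borel_measurable (Pr (Some x))"
  unfolding gridsum_def[abs_def]
  by (rule borel_measurable_suminf_order[OF gridsum_term_measurable[OF assms]])

text \<open>The grids being nested, a coarse sample is constant on the fine cells; the value
  therefore does not depend on \<open>n\<close> as long as \<open>m \<le> n\<close>.\<close>

lemma gridsum_eq:
  assumes g: "good A \<omega>" and V: "open V" and v: "v \<in> borel_measurable borel" and mn: "m \<le> n"
  shows "gridsum V A v m n \<omega> = (\<integral>\<^sup>+s. ennreal (exp (- dyadic_ceil m s)) * v (pos \<omega> (dyadic_ceil m s)) \<partial>weighted V A \<omega>)"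
proof -
  define \<phi> where "\<phi> s = ennreal (exp (- dyadic_ceil m s)) * v (pos \<omega> (dyadic_ceil m s))" for s
  have [measurable]: "(\<lambda>s. v (pos \<omega> s)) \<in> borel_measurable borel"
    by (rule measurable_compose[OF pos_measurable[OF g] v])
  have \<phi>: "\<phi> \<in> borel_measurable borel"
    unfolding \<phi>_def[abs_def]
    by (intro borel_measurable_times_ennreal measurable_compose[OF dyadic_ceil_measurable, where g="\<lambda>s. v (pos \<omega> s)"]) measurable
  have "\<phi> (dyadic_ceil n s) = \<phi> s" for s
    by (simp add: \<phi>_def dyadic_ceil_dyadic_ceil[OF mn])
  then have "(\<integral>\<^sup>+s. \<phi> s \<partial>weighted V A \<omega>) = (\<integral>\<^sup>+s. \<phi> (dyadic_ceil n s) \<partial>weighted V A \<omega>)" by simp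
  also have "\<dots> = (\<Sum>i. \<phi> (real (Suc i) / 2 ^ n) * incr V A n i \<omega>)"
    by (rule grid_integral[OF g V \<phi>])
  finally show ?thesis by (simp add: \<phi>_def gridsum_def)
qed

text \<open>The discount rate is 1, the rate of the potentials \<open>pot V \<mu>\<close>.\<close>

definition supermedian :: "('a \<Rightarrow> ennreal) \<Rightarrow> bool" where
  "supermedian v \<longleftrightarrow> (\<forall>h\<ge>0. \<forall>y. ennreal (exp (- h)) * (\<integral>\<^sup>+\<omega>. v (pos \<omega> h) \<partial>Pr (Some y)) \<le> v y)"

text \<open>On a fine cell with right end \<open>r\<close> the coarse grid samples at a time
  \<open>h + r\<close> that may be later. The increment is known at \<open>r\<close>, so the Markov
  property replaces the later value by its mean from the position at \<open>r\<close>, and after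
  discounting this is at most the value at \<open>r\<close>.\<close>

lemma gridsum_mono:
  assumes A: "PCAF X A" and V: "open V" and v: "v \<in> borel_measurable borel" and s: "supermedian v" and mn: "m \<le> n"
  shows "(\<integral>\<^sup>+\<omega>. gridsum V A v m m \<omega> \<partial>Pr (Some x)) \<le> (\<integral>\<^sup>+\<omega>. gridsum V A v n n \<omega> \<partial>Pr (Some x))"
proof -
  let ?t = "\<lambda>i. real (Suc i) / 2 ^ n"
  have "(\<integral>\<^sup>+\<omega>. gridsum V A v m m \<omega> \<partial>Pr (Some x)) = (\<integral>\<^sup>+\<omega>. gridsum V A v m n \<omega> \<partial>Pr (Some x))"
  proof (rule nn_integral_cong_AE)
    show "AE \<omega> in Pr (Some x). gridsum V A v m m \<omega> = gridsum V A v m n \<omega>"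
      using AE_good_Pr[OF A] by (rule eventually_mono) (simp only: gridsum_eq[OF _ V v order_refl] gridsum_eq[OF _ V v mn])
  qed
  also have "\<dots> = (\<Sum>i. \<integral>\<^sup>+\<omega>. ennreal (exp (- dyadic_ceil m (?t i))) * v (pos \<omega> (dyadic_ceil m (?t i))) * incr V A n i \<omega> \<partial>Pr (Some x))"
    unfolding gridsum_def by (rule nn_integral_suminf[OF gridsum_term_measurable[OF A v]])
  also have "\<dots> \<le> (\<Sum>i. \<integral>\<^sup>+\<omega>. ennreal (exp (- dyadic_ceil n (?t i))) * v (pos \<omega> (dyadic_ceil n (?t i))) * incr V A n i \<omega> \<partial>Pr (Some x))"
  proof (intro suminf_le summableI)
    fix i
    define r where "r = ?t i"
    define h where "h = dyadic_ceil m r - r"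
    have r: "0 \<le> r" and h: "0 \<le> h" using dyadic_ceil_ge by (auto simp: r_def h_def)
    have nr: "dyadic_ceil n (?t i) = r"
      unfolding r_def by (rule dyadic_ceil_eq) (auto intro: divide_strict_right_mono)
    have mr: "dyadic_ceil m (?t i) = h + r" by (simp add: r_def h_def)
    have Y: "incr V A n i \<in> borel_measurable (augm (ennreal r))"
      unfolding r_def by (rule incr_measurable[OF A])
    have e: "ennreal (exp (- (h + r))) = ennreal (exp (- r)) * ennreal (exp (- h))"
      by (simp add: ennreal_mult[symmetric] exp_add[symmetric])
    have "(\<integral>\<^sup>+\<omega>. ennreal (exp (- (h + r))) * v (pos \<omega> (h + r)) * incr V A n i \<omega> \<partial>Pr (Some x))
      = (\<integral>\<^sup>+\<omega>. (ennreal (exp (- (h + r))) * incr V A n i \<omega>) * v (pos \<omega> (h + r)) \<partial>Pr (Some x))"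
      by (intro nn_integral_cong) (simp only: mult_ac)
    also have "\<dots> = (\<integral>\<^sup>+\<omega>. (ennreal (exp (- (h + r))) * incr V A n i \<omega>) * (\<integral>\<^sup>+\<omega>'. v (pos \<omega>' h) \<partial>Pr (Some (pos \<omega> r))) \<partial>Pr (Some x))"
      by (rule semigroup_step[OF v borel_measurable_times_ennreal[OF borel_measurable_const Y] r h])
    also have "\<dots> \<le> (\<integral>\<^sup>+\<omega>. ennreal (exp (- r)) * v (pos \<omega> r) * incr V A n i \<omega> \<partial>Pr (Some x))"
    proof (intro nn_integral_mono)
      fix \<omega>
      have "ennreal (exp (- h)) * (\<integral>\<^sup>+\<omega>'. v (pos \<omega>' h) \<partial>Pr (Some (pos \<omega> r))) \<le> v (pos \<omega> r)"
        using s h unfolding supermedian_def by blast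
      then have "ennreal (exp (- r)) * incr V A n i \<omega> * (ennreal (exp (- h)) * (\<integral>\<^sup>+\<omega>'. v (pos \<omega>' h) \<partial>Pr (Some (pos \<omega> r))))
         \<le> ennreal (exp (- r)) * incr V A n i \<omega> * v (pos \<omega> r)" by (rule mult_left_mono) simp
      then show "ennreal (exp (- (h + r))) * incr V A n i \<omega> * (\<integral>\<^sup>+\<omega>'. v (pos \<omega>' h) \<partial>Pr (Some (pos \<omega> r)))
         \<le> ennreal (exp (- r)) * v (pos \<omega> r) * incr V A n i \<omega>"
        unfolding e by (simp only: mult_ac)
    qed
    finally show "(\<integral>\<^sup>+\<omega>. ennreal (exp (- dyadic_ceil m (?t i))) * v (pos \<omega> (dyadic_ceil m (?t i))) * incr V A n i \<omega> \<partial>Pr (Some x))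
      \<le> (\<integral>\<^sup>+\<omega>. ennreal (exp (- dyadic_ceil n (?t i))) * v (pos \<omega> (dyadic_ceil n (?t i))) * incr V A n i \<omega> \<partial>Pr (Some x))"
      by (simp only: nr mr)
  qed
  also have "\<dots> = (\<integral>\<^sup>+\<omega>. gridsum V A v n n \<omega> \<partial>Pr (Some x))"
    unfolding gridsum_def by (rule nn_integral_suminf[OF gridsum_term_measurable[OF A v], symmetric])
  finally show ?thesis .
qed

text \<open>Dominated convergence is used twice, along a path with its finite total mass and then in
  expectation with the bound \<open>B\<close> times the total. Continuity of \<open>h\<close> and
  right-continuity of the path give the pointwise limit.\<close>

lemma gridsum_tendsto:
  assumes R: "Revuz_correspondence X p A \<mu>" and V: "open V" and S: "restrict_to \<mu> V \<in> S00 X p"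
    and h: "continuous_on UNIV h" "\<And>y. 0 \<le> h y" "\<And>y. h y \<le> B"
  shows "(\<lambda>m. \<integral>\<^sup>+\<omega>. gridsum V A (\<lambda>y. ennreal (h y)) m m \<omega> \<partial>Pr (Some x))
     \<longlonglongrightarrow> (\<integral>\<^sup>+y. resolvent_density p 2 x y * ennreal (h y) \<partial>restrict_to \<mu> V)"
proof -
  let ?v = "\<lambda>y. ennreal (h y)"
  note A = RevuzD(1)[OF R]
  have v [measurable]: "?v \<in> borel_measurable borel"
    using borel_measurable_continuous_onI[OF h(1)] by measurable
  note [measurable] = gridsum_measurable[OF A v] augm_measurable_Pr[OF total_measurable[OF A]]
  have B: "0 \<le> B" using h(2,3) order_trans by blast
  obtain C where C: "\<And>y. pot V \<mu> y \<le> ennreal C" using S00D[OF S] by blast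
  have fin: "(\<integral>\<^sup>+\<omega>. total V A \<omega> \<partial>Pr (Some x)) < \<top>"
    unfolding total_expectation[OF R V] using C[of x] by (rule le_less_trans) simp
  have tfin: "AE \<omega> in Pr (Some x). total V A \<omega> < \<top>"
    using nn_integral_noteq_infinite[of "total V A" "Pr (Some x)"] fin by (simp add: less_top)
  have lim: "AE \<omega> in Pr (Some x). (\<lambda>m. gridsum V A ?v m m \<omega>) \<longlonglongrightarrow> (\<integral>\<^sup>+s. ennreal (exp (- s)) * ?v (pos \<omega> s) \<partial>weighted V A \<omega>)"
    using AE_good_Pr[OF A] tfin
  proof eventually_elim
    case (elim \<omega>)
    have [measurable]: "(\<lambda>s. ?v (pos \<omega> s)) \<in> borel_measurable borel"
      by (rule measurable_compose[OF pos_measurable[OF elim(1)] v])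
    have [measurable]: "(\<lambda>s. ?v (pos \<omega> (dyadic_ceil m s))) \<in> borel_measurable borel" for m
      by (rule measurable_compose[OF dyadic_ceil_measurable, where g="\<lambda>s. ?v (pos \<omega> s)"]) measurable
    show ?case unfolding gridsum_eq[OF elim(1) V v order_refl]
    proof (rule nn_integral_dominated_convergence)
      have pos: "AE s in weighted V A \<omega>. 0 < s"
        by (rule AE_not_in[of "{..0}", THEN eventually_mono]) (auto simp: null_sets_def emeasure_weighted_nonpos[OF elim(1) V])
      show "AE s in weighted V A \<omega>. ennreal (exp (- dyadic_ceil m s)) * ?v (pos \<omega> (dyadic_ceil m s)) \<le> ennreal B" for m
        using pos
      proof eventually_elim
        case (elim s)
        have "0 \<le> dyadic_ceil m s" using elim dyadic_ceil_ge[of s m] by simp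
        then have "exp (- dyadic_ceil m s) * h (pos \<omega> (dyadic_ceil m s)) \<le> 1 * B"
          using h by (intro mult_mono) auto
        then show ?case using h(2) by (simp add: ennreal_mult[symmetric] ennreal_leI)
      qed
      show "(\<integral>\<^sup>+s. ennreal B \<partial>weighted V A \<omega>) < \<infinity>"
        using elim(2) by (simp add: total_eq[OF elim(1) V] ennreal_mult_less_top)
      show "AE s in weighted V A \<omega>. (\<lambda>m. ennreal (exp (- dyadic_ceil m s)) * ?v (pos \<omega> (dyadic_ceil m s))) \<longlonglongrightarrow> ennreal (exp (- s)) * ?v (pos \<omega> s)"
      proof (rule AE_I2)
        fix s
        have "((\<lambda>r. h (pos \<omega> r)) \<longlongrightarrow> h (pos \<omega> s)) (at_right s)"
          using h(1) by (rule continuous_on_tendsto_compose[OF _ pos_right_cont[OF elim(1)]]) auto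
        then have "(\<lambda>m. h (pos \<omega> (dyadic_ceil m s))) \<longlonglongrightarrow> h (pos \<omega> s)"
          by (rule tendsto_dyadic_ceil)
        moreover have "(\<lambda>m. exp (- dyadic_ceil m s)) \<longlonglongrightarrow> exp (- s)"
          by (intro tendsto_intros dyadic_ceil_tendsto)
        ultimately have "(\<lambda>m. ennreal (exp (- dyadic_ceil m s) * h (pos \<omega> (dyadic_ceil m s)))) \<longlonglongrightarrow> ennreal (exp (- s) * h (pos \<omega> s))"
          by (intro tendsto_ennrealI tendsto_mult)
        then show "(\<lambda>m. ennreal (exp (- dyadic_ceil m s)) * ?v (pos \<omega> (dyadic_ceil m s))) \<longlonglongrightarrow> ennreal (exp (- s)) * ?v (pos \<omega> s)"
          by (simp add: ennreal_mult'' h(2))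
      qed
    qed measurable
  qed
  \<comment> \<open>The limit superior is measurable by construction and equals the pathwise limit
    almost surely.\<close>
  have "(\<lambda>m. \<integral>\<^sup>+\<omega>. gridsum V A ?v m m \<omega> \<partial>Pr (Some x)) \<longlonglongrightarrow> (\<integral>\<^sup>+\<omega>. limsup (\<lambda>m. gridsum V A ?v m m \<omega>) \<partial>Pr (Some x))"
  proof (rule nn_integral_dominated_convergence)
    show "AE \<omega> in Pr (Some x). gridsum V A ?v m m \<omega> \<le> ennreal B * total V A \<omega>" for m
      using AE_good_Pr[OF A]
    proof eventually_elim
      case (elim \<omega>)
      have pos: "AE s in weighted V A \<omega>. 0 < s"
        by (rule AE_not_in[of "{..0}", THEN eventually_mono]) (auto simp: null_sets_def emeasure_weighted_nonpos[OF elim V])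
      have "gridsum V A ?v m m \<omega> \<le> (\<integral>\<^sup>+s. ennreal B \<partial>weighted V A \<omega>)"
        unfolding gridsum_eq[OF elim V v order_refl]
      proof (rule nn_integral_mono_AE)
        show "AE s in weighted V A \<omega>. ennreal (exp (- dyadic_ceil m s)) * ?v (pos \<omega> (dyadic_ceil m s)) \<le> ennreal B"
          using pos
        proof eventually_elim
          case (elim s)
          have "0 \<le> dyadic_ceil m s" using elim dyadic_ceil_ge[of s m] by simp
          then have "exp (- dyadic_ceil m s) * h (pos \<omega> (dyadic_ceil m s)) \<le> 1 * B"
            using h by (intro mult_mono) auto
          then show ?case using h(2) by (simp add: ennreal_mult[symmetric] ennreal_leI)
        qed
      qed
      then show ?case by (simp add: total_eq[OF elim V])
    qed
    have "(\<integral>\<^sup>+\<omega>. ennreal B * total V A \<omega> \<partial>Pr (Some x)) = ennreal B * (\<integral>\<^sup>+\<omega>. total V A \<omega> \<partial>Pr (Some x))"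
      by (rule nn_integral_cmult) measurable
    then show "(\<integral>\<^sup>+\<omega>. ennreal B * total V A \<omega> \<partial>Pr (Some x)) < \<infinity>" using fin by (simp add: ennreal_mult_less_top)
    show "AE \<omega> in Pr (Some x). (\<lambda>m. gridsum V A ?v m m \<omega>) \<longlonglongrightarrow> limsup (\<lambda>m. gridsum V A ?v m m \<omega>)"
      using lim
    proof (rule eventually_mono)
      fix \<omega> assume l: "(\<lambda>m. gridsum V A ?v m m \<omega>) \<longlonglongrightarrow> (\<integral>\<^sup>+s. ennreal (exp (- s)) * ?v (pos \<omega> s) \<partial>weighted V A \<omega>)"
      show "(\<lambda>m. gridsum V A ?v m m \<omega>) \<longlonglongrightarrow> limsup (\<lambda>m. gridsum V A ?v m m \<omega>)"
        using l lim_imp_Limsup[OF _ l] by simp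
    qed
  qed measurable
  also have "(\<integral>\<^sup>+\<omega>. limsup (\<lambda>m. gridsum V A ?v m m \<omega>) \<partial>Pr (Some x)) = (\<integral>\<^sup>+\<omega>. (\<integral>\<^sup>+s. ennreal (exp (- s)) * ?v (pos \<omega> s) \<partial>weighted V A \<omega>) \<partial>Pr (Some x))"
    using lim by (intro nn_integral_cong_AE) (auto elim!: eventually_mono intro!: lim_imp_Limsup)
  also have "\<dots> = (\<integral>\<^sup>+y. resolvent_density p 2 x y * ?v y \<partial>restrict_to \<mu> V)"
    by (rule weighted_expectation[OF R V v])
  finally show ?thesis .
qed

text \<open>The function e^(-t) P_t u is the mean mass of the localised functional after time t.
  This makes it non-increasing in t, with limit u as t tends to 0, and hence supermedian by the
  semigroup property; the strong Feller property makes it continuous for t > 0. The times 1/(k+1)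
  give the sequence.\<close>

lemma potential_approximation:
  assumes R: "Revuz_correspondence X p A \<mu>" and V: "open V" and S: "restrict_to \<mu> V \<in> S00 X p"
  obtains h :: "nat \<Rightarrow> 'a \<Rightarrow> real" and B where
    "\<And>k. continuous_on UNIV (h k)" "\<And>k y. 0 \<le> h k y" "\<And>k y. h k y \<le> B"
    "\<And>k. supermedian (\<lambda>y. ennreal (h k y))" "\<And>y. incseq (\<lambda>k. ennreal (h k y))"
    "\<And>y. (SUP k. ennreal (h k y)) = pot V \<mu> y"
proof -
  note A = RevuzD(1)[OF R]
  let ?u = "pot V \<mu>"
  have u [measurable]: "?u \<in> borel_measurable borel" by (rule S00_potential_measurable[OF S])
  obtain B where B: "0 \<le> B" "\<And>y. ?u y \<le> ennreal B" using S00D[OF S] by blast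
  define q where "q t y = ennreal (exp (- t)) * (\<integral>\<^sup>+\<omega>. ?u (pos \<omega> t) \<partial>Pr (Some y))" for t y
  have q1: "q t y = (\<integral>\<^sup>+\<omega>. emeasure (weighted V A \<omega>) {t<..} \<partial>Pr (Some y))" if t: "0 \<le> t" for t y
  proof -
    note [measurable] = Markov_augm_event(1)[OF total_measurable[OF A]]
    have "(\<integral>\<^sup>+\<omega>. emeasure (weighted V A \<omega>) {t<..} \<partial>Pr (Some y)) = (\<integral>\<^sup>+\<omega>. ennreal (exp (- t)) * total V A (shift X (ennreal t) \<omega>) \<partial>Pr (Some y))"
      using AE_good_Pr[OF A, of y] by (intro nn_integral_cong_AE) (auto elim!: eventually_mono simp: emeasure_weighted_tail[OF _ V t])
    also have "\<dots> = (\<integral>\<^sup>+\<omega>. ennreal (exp (- t)) * (\<integral>\<^sup>+\<omega>'. total V A \<omega>' \<partial>Pr (path X (ennreal t) \<omega>)) \<partial>Pr (Some y))"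
      by (rule Markov_augm[OF _ total_measurable[OF A]]) simp
    also have "\<dots> = (\<integral>\<^sup>+\<omega>. ennreal (exp (- t)) * ?u (pos \<omega> t) \<partial>Pr (Some y))"
      using AE_path_pos[of t y] by (intro nn_integral_cong_AE) (auto elim!: eventually_mono simp: total_expectation[OF R V])
    also have "\<dots> = q t y"
      unfolding q_def by (rule nn_integral_cmult[OF pos_borel_measurable[OF u]])
    finally show ?thesis ..
  qed
  have tail_measurable: "(\<lambda>\<omega>. emeasure (weighted V A \<omega>) {t<..}) \<in> borel_measurable (Pr (Some y))" if t: "0 \<le> t" for t y
  proof (rule measurable_completion_AE)
    show "(\<lambda>\<omega>. ennreal (exp (- t)) * total V A (shift X (ennreal t) \<omega>)) \<in> borel_measurable (Pr (Some y))"
      using Markov_augm_event(1)[OF total_measurable[OF A]] by measurable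
    show "AE \<omega> in law X (Some y). ennreal (exp (- t)) * total V A (shift X (ennreal t) \<omega>) = emeasure (weighted V A \<omega>) {t<..}"
      using AE_good_Pr[OF A, of y] unfolding AE_completion_iff
      by (rule eventually_mono) (simp add: emeasure_weighted_tail[OF _ V t])
  qed simp
  have q_anti: "q t y \<le> q s y" if "0 \<le> s" "s \<le> t" for s t y
    using that by (simp add: q1) (intro nn_integral_mono emeasure_mono, auto)
  have q_le: "q t y \<le> ennreal B" if "0 \<le> t" for t y
  proof -
    have "(\<integral>\<^sup>+\<omega>. ?u (pos \<omega> t) \<partial>Pr (Some y)) \<le> (\<integral>\<^sup>+\<omega>. ennreal B \<partial>Pr (Some y))"
      by (intro nn_integral_mono B)
    also have "\<dots> = ennreal B" using prob_space.emeasure_space_1[OF prob_Pr] by simp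
    finally have "q t y \<le> ennreal (exp (- t)) * ennreal B" unfolding q_def by (rule mult_left_mono) simp
    also have "\<dots> \<le> 1 * ennreal B" using that by (intro mult_right_mono) (auto simp: ennreal_le_1)
    finally show ?thesis by simp
  qed
  have q_super: "supermedian (q t)" if t: "0 \<le> t" for t
    unfolding supermedian_def
  proof (intro allI impI)
    fix h y assume h: "(0::real) \<le> h"
    have "ennreal (exp (- h)) * (\<integral>\<^sup>+\<omega>. q t (pos \<omega> h) \<partial>Pr (Some y)) = q (t + h) y"
    proof -
      have m: "(\<lambda>\<omega>. \<integral>\<^sup>+\<omega>'. ?u (pos \<omega>' t) \<partial>Pr (Some (pos \<omega> h))) \<in> borel_measurable (Pr (Some y))"
      proof (rule measurable_completion_AE)
        define Z where "Z \<omega> = extend_zero ?u (path X (ennreal t) \<omega>)" for \<omega>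
        have Z: "Z \<in> borel_measurable (augm \<top>)"
          unfolding Z_def by (rule measurable_compose[OF path_augm[OF top_greatest] extend_zero_measurable[OF u]])
        show "(\<lambda>\<omega>. \<integral>\<^sup>+\<omega>'. Z \<omega>' \<partial>law X (path X (ennreal h) \<omega>)) \<in> borel_measurable (Pr (Some y))"
          by (rule Markov_augm_event(2)[OF Z])
        have *: "(\<integral>\<^sup>+\<omega>'. Z \<omega>' \<partial>law X (Some z)) = (\<integral>\<^sup>+\<omega>'. ?u (pos \<omega>' t) \<partial>Pr (Some z))" for z
          using AE_path_pos[of t z] unfolding nn_integral_completion AE_completion_iff
          by (intro nn_integral_cong_AE) (auto elim!: eventually_mono simp: Z_def)
        show "AE \<omega> in law X (Some y). (\<integral>\<^sup>+\<omega>'. Z \<omega>' \<partial>law X (path X (ennreal h) \<omega>)) = (\<integral>\<^sup>+\<omega>'. ?u (pos \<omega>' t) \<partial>Pr (Some (pos \<omega> h)))"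
          using AE_path_pos[of h y] unfolding AE_completion_iff by (rule eventually_mono) (simp add: *)
      qed simp
      have "(\<integral>\<^sup>+\<omega>. q t (pos \<omega> h) \<partial>Pr (Some y)) = ennreal (exp (- t)) * (\<integral>\<^sup>+\<omega>. (\<integral>\<^sup>+\<omega>'. ?u (pos \<omega>' t) \<partial>Pr (Some (pos \<omega> h))) \<partial>Pr (Some y))"
        unfolding q_def by (rule nn_integral_cmult[OF m])
      also have "(\<integral>\<^sup>+\<omega>. (\<integral>\<^sup>+\<omega>'. ?u (pos \<omega>' t) \<partial>Pr (Some (pos \<omega> h))) \<partial>Pr (Some y)) = (\<integral>\<^sup>+\<omega>. ?u (pos \<omega> (t + h)) \<partial>Pr (Some y))"
        using semigroup_step[OF u, of "\<lambda>_. 1" h t y] h t by simp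
      finally have "ennreal (exp (- h)) * (\<integral>\<^sup>+\<omega>. q t (pos \<omega> h) \<partial>Pr (Some y)) = (ennreal (exp (- h)) * ennreal (exp (- t))) * (\<integral>\<^sup>+\<omega>. ?u (pos \<omega> (t + h)) \<partial>Pr (Some y))"
        by (simp only: mult.assoc)
      also have "ennreal (exp (- h)) * ennreal (exp (- t)) = ennreal (exp (- (t + h)))"
        by (simp add: ennreal_mult[symmetric] exp_add[symmetric])
      finally show ?thesis by (simp only: q_def)
    qed
    also have "\<dots> \<le> q t y" using h t by (intro q_anti) auto
    finally show "ennreal (exp (- h)) * (\<integral>\<^sup>+\<omega>. q t (pos \<omega> h) \<partial>Pr (Some y)) \<le> q t y" .
  qed
  \<comment> \<open>A real-valued version of the potential, because the strong Feller property
    speaks of bounded real functions.\<close>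
  define f where "f y = enn2real (?u y)" for y
  have f: "f \<in> borel_measurable borel" unfolding f_def by measurable
  have fb: "0 \<le> f y" "f y \<le> B" for y
    using B(2)[of y] B(1) by (auto simp: f_def intro: enn2real_leI)
  have uf: "?u y = ennreal (f y)" for y
    using le_less_trans[OF B(2)[of y]] by (simp add: f_def)
  define h where "h k y = exp (- (1 / Suc k)) * transition X (1 / Suc k) (extend_zero f) (Some y)" for k :: nat and y
  have hq: "ennreal (h k y) = q (1 / Suc k) y" and h0: "0 \<le> h k y" for k y
  proof -
    let ?t = "1 / real (Suc k)"
    have em: "(\<lambda>\<omega>. extend_zero f (path X (ennreal ?t) \<omega>)) \<in> borel_measurable (law X (Some y))"
      by (rule measurable_compose[OF path_measurable_law extend_zero_measurable[OF f]])
    have eb: "0 \<le> extend_zero f z" "extend_zero f z \<le> B" for z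
      using fb B(1) by (auto simp: extend_zero_def split: option.splits)
    have int: "integrable (law X (Some y)) (\<lambda>\<omega>. extend_zero f (path X (ennreal ?t) \<omega>))"
      using eb by (intro finite_measure.integrable_const_bound[OF prob_space.finite_measure[OF prob_law] _ em, of B]) auto
    have "ennreal (transition X ?t (extend_zero f) (Some y)) = (\<integral>\<^sup>+\<omega>. ennreal (extend_zero f (path X (ennreal ?t) \<omega>)) \<partial>law X (Some y))"
      unfolding transition_def using eb by (intro nn_integral_eq_integral[symmetric] int) auto
    also have "\<dots> = (\<integral>\<^sup>+\<omega>. ?u (pos \<omega> ?t) \<partial>Pr (Some y))"
      using AE_path_pos[of ?t y] unfolding nn_integral_completion AE_completion_iff
      by (intro nn_integral_cong_AE) (auto elim!: eventually_mono simp: uf)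
    finally have *: "ennreal (transition X ?t (extend_zero f) (Some y)) = (\<integral>\<^sup>+\<omega>. ?u (pos \<omega> ?t) \<partial>Pr (Some y))" .
    have t0: "0 \<le> transition X ?t (extend_zero f) (Some y)"
      unfolding transition_def using eb by (intro Bochner_Integration.integral_nonneg) auto
    then show "0 \<le> h k y" by (simp add: h_def)
    show "ennreal (h k y) = q ?t y"
      unfolding h_def q_def *[symmetric] using t0 by (intro ennreal_mult) auto
  qed
  show thesis
  proof (rule that[of h B])
    show "continuous_on UNIV (h k)" for k
    proof -
      have "bounded (range f)" by (rule boundedI[of _ B]) (use fb in auto)
      then have "continuous_on UNIV (\<lambda>x. transition X (1 / Suc k) (extend_zero f) (Some x))"
        using strong_Feller[unfolded strong_Feller_def, rule_format, of "1 / Suc k" f] f by simp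
      then show ?thesis unfolding h_def[abs_def] by (intro continuous_intros)
    qed
    show "0 \<le> h k y" for k y by (rule h0)
    show "h k y \<le> B" for k y
      using q_le[of "1 / Suc k" y] B(1) unfolding hq[symmetric] by (simp add: ennreal_le_iff)
    show "supermedian (\<lambda>y. ennreal (h k y))" for k
      unfolding hq using q_super[of "1 / Suc k"] by simp
    show inc: "incseq (\<lambda>k. ennreal (h k y))" for y
      unfolding hq by (intro incseq_SucI q_anti) (auto simp: field_simps)
    show "(SUP k. ennreal (h k y)) = ?u y" for y
    proof -
      have "(SUP k. q (1 / Suc k) y) = (\<integral>\<^sup>+\<omega>. (SUP k::nat. emeasure (weighted V A \<omega>) {1 / Suc k<..}) \<partial>Pr (Some y))"
        unfolding q1[OF divide_nonneg_nonneg[OF zero_le_one of_nat_0_le_iff]]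
      proof (rule nn_integral_monotone_convergence_SUP[symmetric])
        show "incseq (\<lambda>k \<omega>. emeasure (weighted V A \<omega>) {1 / real (Suc k)<..})"
          by (intro incseq_SucI le_funI emeasure_mono) (auto simp: field_simps elim!: order_trans[rotated] le_less_trans[rotated])
      qed (rule tail_measurable, simp)
      also have "\<dots> = (\<integral>\<^sup>+\<omega>. total V A \<omega> \<partial>Pr (Some y))"
      proof (rule nn_integral_cong_AE)
        show "AE \<omega> in Pr (Some y). (SUP k::nat. emeasure (weighted V A \<omega>) {1 / real (Suc k)<..}) = total V A \<omega>"
          using AE_good_Pr[OF A]
        proof eventually_elim
          case (elim \<omega>)
          have "(SUP k::nat. emeasure (weighted V A \<omega>) {1 / real (Suc k)<..}) = emeasure (weighted V A \<omega>) (\<Union>k::nat. {1 / real (Suc k)<..})"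
            by (rule SUP_emeasure_incseq) (auto intro!: incseq_SucI simp: field_simps elim!: order_trans[rotated] le_less_trans[rotated])
          also have "(\<Union>k::nat. {1 / real (Suc k)<..}) = {0<..}"
          proof (intro equalityI subsetI)
            fix s :: real assume "s \<in> {0<..}"
            then obtain k where "1 / real (Suc k) < s" using nat_approx_posE[of s] by auto
            then show "s \<in> (\<Union>k::nat. {1 / real (Suc k)<..})" by blast
          next
            fix s :: real assume "s \<in> (\<Union>k::nat. {1 / real (Suc k)<..})"
            then obtain k where "1 / real (Suc k) < s" by auto
            moreover have "0 \<le> 1 / real (Suc k)" by simp
            ultimately show "s \<in> {0<..}" unfolding greaterThan_iff by (rule le_less_trans[rotated])
          qed
          also have "emeasure (weighted V A \<omega>) {0<..} = total V A \<omega>"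
            using emeasure_weighted_split[OF elim V, of 0] by (simp add: total_eq[OF elim V])
          finally show ?case .
        qed
      qed
      also have "\<dots> = ?u y" by (rule total_expectation[OF R V])
      finally show ?thesis unfolding hq .
    qed
  qed
qed

end

lemma two_mult_le_sum_squares_ennreal:
  fixes x :: ennreal
  assumes "0 \<le> c"
  shows "ennreal (2 * c) * x \<le> ennreal (c\<^sup>2) + x\<^sup>2"
proof (cases x)
  case (real r)
  have "2 * c * r \<le> c\<^sup>2 + r\<^sup>2" using sum_squares_bound[of c r] by simp
  then show ?thesis using real assms
    by (simp add: ennreal_mult[symmetric] ennreal_power ennreal_leI flip: ennreal_plus)
qed (simp add: top_power_ennreal)

section \<open>Mixed second moments of the totals\<close>

context Revuz_setting
begin

text \<open>The potential is an increasing limit of continuous supermedian functions. For each of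
  these the expected grid sums increase to the integral; exchanging the two suprema carries the
  limit over to the potential, which need not be continuous.\<close>

lemma gridsum_SUP:
  assumes R: "Revuz_correspondence X p A \<mu>" and V: "open V" and S: "restrict_to \<mu> V \<in> S00 X p"
    and R': "Revuz_correspondence X p A' \<mu>'" and S': "restrict_to \<mu>' V \<in> S00 X p"
  shows "(SUP m. \<integral>\<^sup>+\<omega>. gridsum V A (pot V \<mu>') m m \<omega> \<partial>Pr (Some x))
    = (\<integral>\<^sup>+y. resolvent_density p 2 x y * pot V \<mu>' y \<partial>restrict_to \<mu> V)"
proof -
  note A = RevuzD(1)[OF R]
  obtain h :: "nat \<Rightarrow> 'a \<Rightarrow> real" and B where h:
    "\<And>k. continuous_on UNIV (h k)" "\<And>k y. 0 \<le> h k y" "\<And>k y. h k y \<le> B"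
    "\<And>k. supermedian (\<lambda>y. ennreal (h k y))" "\<And>y. incseq (\<lambda>k. ennreal (h k y))"
    "\<And>y. (SUP k. ennreal (h k y)) = pot V \<mu>' y"
    using potential_approximation[OF R' V S'] by blast
  let ?v = "\<lambda>k y. ennreal (h k y)"
  have v: "?v k \<in> borel_measurable borel" for k
    using borel_measurable_continuous_onI[OF h(1)[of k]] by measurable
  have inc: "incseq (\<lambda>k. ennreal c * ?v k (pos \<omega> r) * incr V A n i \<omega>)" for c \<omega> r n i
    using h(5) by (auto simp: incseq_def intro!: mult_left_mono mult_right_mono)
  have gs: "gridsum V A (pot V \<mu>') m m \<omega> = (SUP k. gridsum V A (?v k) m m \<omega>)" for m \<omega>
    unfolding gridsum_def h(6)[symmetric]
    by (subst ennreal_suminf_SUP_eq[OF inc, symmetric]) (simp only: SUP_mult_left_ennreal SUP_mult_right_ennreal)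
  have ginc: "incseq (\<lambda>k. gridsum V A (?v k) m m)" for m
    unfolding gridsum_def[abs_def] using inc
    by (auto simp: incseq_def le_fun_def intro!: suminf_le summableI)
  have "(SUP m. \<integral>\<^sup>+\<omega>. gridsum V A (pot V \<mu>') m m \<omega> \<partial>Pr (Some x)) = (SUP m. SUP k. \<integral>\<^sup>+\<omega>. gridsum V A (?v k) m m \<omega> \<partial>Pr (Some x))"
    unfolding gs by (intro SUP_cong refl nn_integral_monotone_convergence_SUP[OF ginc gridsum_measurable[OF A v]])
  also have "\<dots> = (SUP k. SUP m. \<integral>\<^sup>+\<omega>. gridsum V A (?v k) m m \<omega> \<partial>Pr (Some x))"
    by (rule SUP_commute)
  also have "\<dots> = (SUP k. \<integral>\<^sup>+y. resolvent_density p 2 x y * ?v k y \<partial>restrict_to \<mu> V)"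
  proof (intro SUP_cong refl)
    fix k
    have "incseq (\<lambda>m. \<integral>\<^sup>+\<omega>. gridsum V A (?v k) m m \<omega> \<partial>Pr (Some x))"
      using gridsum_mono[OF A V v h(4)] by (auto simp: incseq_def)
    from LIMSEQ_SUP[OF this] gridsum_tendsto[OF R V S h(1,2,3)]
    show "(SUP m. \<integral>\<^sup>+\<omega>. gridsum V A (?v k) m m \<omega> \<partial>Pr (Some x)) = (\<integral>\<^sup>+y. resolvent_density p 2 x y * ?v k y \<partial>restrict_to \<mu> V)"
      by (rule LIMSEQ_unique)
  qed
  also have "\<dots> = (\<integral>\<^sup>+y. (SUP k. resolvent_density p 2 x y * ?v k y) \<partial>restrict_to \<mu> V)"
  proof (rule nn_integral_monotone_convergence_SUP[symmetric])
    show "incseq (\<lambda>k y. resolvent_density p 2 x y * ?v k y)"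
      using h(5) by (auto simp: incseq_def le_fun_def intro!: mult_left_mono)
    have "sets (restrict_to \<mu> V) = sets borel" using S by (simp add: S00_def)
    then show "(\<lambda>y. resolvent_density p 2 x y * ?v k y) \<in> borel_measurable (restrict_to \<mu> V)" for k
      using resolvent_density_measurable1[OF density_measurable, of 2 x] v[of k]
      by (intro borel_measurable_times_ennreal) (simp_all cong: measurable_cong_sets)
  qed
  also have "\<dots> = (\<integral>\<^sup>+y. resolvent_density p 2 x y * pot V \<mu>' y \<partial>restrict_to \<mu> V)"
    by (simp only: h(6)[symmetric] SUP_mult_left_ennreal)
  finally show ?thesis .
qed

lemma total_finite:
  assumes R: "Revuz_correspondence X p A \<mu>" and V: "open V" and S: "restrict_to \<mu> V \<in> S00 X p"
  shows "AE \<omega> in Pr (Some x). total V A \<omega> < \<top>"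
proof -
  obtain C where C: "\<And>y. pot V \<mu> y \<le> ennreal C" using S00D[OF S] by blast
  have "(\<integral>\<^sup>+\<omega>. total V A \<omega> \<partial>Pr (Some x)) < \<top>"
    unfolding total_expectation[OF R V] using C[of x] by (rule le_less_trans) simp
  then show ?thesis
    using nn_integral_noteq_infinite[OF augm_measurable_Pr[OF total_measurable[OF RevuzD(1)[OF R]]], of "Some x" V]
    by (simp add: less_top)
qed

text \<open>A Riemann sum for the integral of the \<open>A'\<close>-mass after time s against the
  functional of \<open>A\<close>. The mass after a grid time is written as the discounted total of
  the shifted path, to which the Markov property applies.\<close>

definition tailsum :: "'a set \<Rightarrow> (real \<Rightarrow> 'w \<Rightarrow> ennreal) \<Rightarrow> (real \<Rightarrow> 'w \<Rightarrow> ennreal) \<Rightarrow> nat \<Rightarrow> 'w \<Rightarrow> ennreal" where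
  "tailsum V A A' m \<omega> = (\<Sum>i. ennreal (exp (- (real (Suc i) / 2 ^ m))) * incr V A m i \<omega> *
      total V A' (shift X (ennreal (real (Suc i) / 2 ^ m)) \<omega>))"

lemma tailsum_term_measurable:
  assumes A: "PCAF X A" "PCAF X A'"
  shows "(\<lambda>\<omega>. ennreal c * incr V A m i \<omega> * total V A' (shift X t \<omega>)) \<in> borel_measurable (Pr x)"
proof -
  note [measurable] = incr_measurable_Pr[OF A(1), of V m i x] Markov_augm_event(1)[OF total_measurable[OF A(2)], of V t x]
  show ?thesis by measurable
qed

lemma tailsum_measurable:
  assumes A: "PCAF X A" "PCAF X A'"
  shows "tailsum V A A' m \<in> borel_measurable (Pr x)"
  unfolding tailsum_def[abs_def] by (rule borel_measurable_suminf_order[OF tailsum_term_measurable[OF A]])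

lemma tailsum_eq:
  assumes g: "good A \<omega>" "good A' \<omega>" and V: "open V" and fin: "total V A' \<omega> < \<top>"
  shows "tailsum V A A' m \<omega> = (\<integral>\<^sup>+s. emeasure (weighted V A' \<omega>) {dyadic_ceil m s<..} \<partial>weighted V A \<omega>)"
proof -
  have "finite_measure (weighted V A' \<omega>)"
    by (rule finite_measureI) (use fin in \<open>simp add: total_eq[OF g(2) V, symmetric] less_top\<close>)
  then have m: "(\<lambda>s. emeasure (weighted V A' \<omega>) {s<..}) \<in> borel_measurable borel"
    by (rule measurable_tail) simp
  have "(\<integral>\<^sup>+s. emeasure (weighted V A' \<omega>) {dyadic_ceil m s<..} \<partial>weighted V A \<omega>)
    = (\<Sum>i. emeasure (weighted V A' \<omega>) {real (Suc i) / 2 ^ m<..} * incr V A m i \<omega>)"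
    by (rule grid_integral[OF g(1) V m])
  also have "\<dots> = tailsum V A A' m \<omega>"
    unfolding tailsum_def by (intro suminf_cong) (simp add: emeasure_weighted_tail[OF g(2) V] mult_ac del: of_nat_Suc)
  finally show ?thesis ..
qed

text \<open>The increment over a cell is known at its right end, so the Markov property there turns
  the total of the shifted path into the potential at the current position.\<close>

lemma tailsum_expectation:
  assumes R: "Revuz_correspondence X p A \<mu>" and V: "open V" and S: "restrict_to \<mu> V \<in> S00 X p"
    and R': "Revuz_correspondence X p A' \<mu>'" and S': "restrict_to \<mu>' V \<in> S00 X p"
  shows "(\<integral>\<^sup>+\<omega>. tailsum V A A' m \<omega> \<partial>Pr (Some x)) = (\<integral>\<^sup>+\<omega>. gridsum V A (pot V \<mu>') m m \<omega> \<partial>Pr (Some x))"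
proof -
  note A = RevuzD(1)[OF R] RevuzD(1)[OF R']
  have "(\<integral>\<^sup>+\<omega>. tailsum V A A' m \<omega> \<partial>Pr (Some x)) = (\<Sum>i. \<integral>\<^sup>+\<omega>. ennreal (exp (- (real (Suc i) / 2 ^ m))) * incr V A m i \<omega> *
      total V A' (shift X (ennreal (real (Suc i) / 2 ^ m)) \<omega>) \<partial>Pr (Some x))"
    unfolding tailsum_def by (rule nn_integral_suminf[OF tailsum_term_measurable[OF A]])
  also have "\<dots> = (\<Sum>i. \<integral>\<^sup>+\<omega>. ennreal (exp (- dyadic_ceil m (real (Suc i) / 2 ^ m))) *
     pot V \<mu>' (pos \<omega> (dyadic_ceil m (real (Suc i) / 2 ^ m))) * incr V A m i \<omega> \<partial>Pr (Some x))"
  proof (intro suminf_cong)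
    fix i
    define r where "r = real (Suc i) / 2 ^ m"
    have nr: "dyadic_ceil m r = r"
      unfolding r_def by (rule dyadic_ceil_eq) (auto intro: divide_strict_right_mono)
    have Y: "incr V A m i \<in> borel_measurable (augm (ennreal r))"
      unfolding r_def by (rule incr_measurable[OF A(1)])
    have "(\<integral>\<^sup>+\<omega>. ennreal (exp (- r)) * incr V A m i \<omega> * total V A' (shift X (ennreal r) \<omega>) \<partial>Pr (Some x))
      = (\<integral>\<^sup>+\<omega>. ennreal (exp (- r)) * incr V A m i \<omega> * (\<integral>\<^sup>+\<omega>'. total V A' \<omega>' \<partial>Pr (path X (ennreal r) \<omega>)) \<partial>Pr (Some x))"
      by (rule Markov_augm[OF borel_measurable_times_ennreal[OF borel_measurable_const Y] total_measurable[OF A(2)]])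
    also have "\<dots> = (\<integral>\<^sup>+\<omega>. ennreal (exp (- r)) * pot V \<mu>' (pos \<omega> r) * incr V A m i \<omega> \<partial>Pr (Some x))"
      using AE_path_pos[of r x]
      by (intro nn_integral_cong_AE) (auto elim!: eventually_mono simp: total_expectation[OF R' V] mult_ac)
    finally show "(\<integral>\<^sup>+\<omega>. ennreal (exp (- (real (Suc i) / 2 ^ m))) * incr V A m i \<omega> *
      total V A' (shift X (ennreal (real (Suc i) / 2 ^ m)) \<omega>) \<partial>Pr (Some x)) = (\<integral>\<^sup>+\<omega>. ennreal (exp (- dyadic_ceil m (real (Suc i) / 2 ^ m))) *
      pot V \<mu>' (pos \<omega> (dyadic_ceil m (real (Suc i) / 2 ^ m))) * incr V A m i \<omega> \<partial>Pr (Some x))"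
      unfolding r_def[symmetric] nr .
  qed
  also have "\<dots> = (\<integral>\<^sup>+\<omega>. gridsum V A (pot V \<mu>') m m \<omega> \<partial>Pr (Some x))"
    unfolding gridsum_def
    by (rule nn_integral_suminf[OF gridsum_term_measurable[OF A(1) S00_potential_measurable[OF S']], symmetric])
  finally show ?thesis .
qed

text \<open>The rounded-up times decrease to \<open>s\<close>, so the tails that start at them
  increase to the open tail after \<open>s\<close>.\<close>

lemma tailsum_SUP:
  assumes g: "good A \<omega>" "good A' \<omega>" and V: "open V" and fin: "total V A' \<omega> < \<top>"
  shows "incseq (\<lambda>m. tailsum V A A' m \<omega>)"
    and "(SUP m. tailsum V A A' m \<omega>) = (\<integral>\<^sup>+s. emeasure (weighted V A' \<omega>) {s<..} \<partial>weighted V A \<omega>)"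
proof -
  have "finite_measure (weighted V A' \<omega>)"
    by (rule finite_measureI) (use fin in \<open>simp add: total_eq[OF g(2) V, symmetric] less_top\<close>)
  then have m: "(\<lambda>s. emeasure (weighted V A' \<omega>) {s<..}) \<in> borel_measurable borel"
    by (rule measurable_tail) simp
  have inc: "incseq (\<lambda>m s. emeasure (weighted V A' \<omega>) {dyadic_ceil m s<..})"
    by (intro incseq_SucI le_funI emeasure_mono) (auto intro: dyadic_ceil_antimono)
  show "incseq (\<lambda>m. tailsum V A A' m \<omega>)"
    unfolding tailsum_eq[OF assms] using inc by (auto simp: incseq_def le_fun_def intro!: nn_integral_mono)
  have "(SUP m. tailsum V A A' m \<omega>) = (\<integral>\<^sup>+s. (SUP m. emeasure (weighted V A' \<omega>) {dyadic_ceil m s<..}) \<partial>weighted V A \<omega>)"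
    unfolding tailsum_eq[OF assms]
    by (rule nn_integral_monotone_convergence_SUP[OF inc, symmetric])
       (use measurable_compose[OF dyadic_ceil_measurable m] in \<open>simp cong: measurable_cong_sets\<close>)
  also have "\<dots> = (\<integral>\<^sup>+s. emeasure (weighted V A' \<omega>) {s<..} \<partial>weighted V A \<omega>)"
  proof (intro nn_integral_cong)
    fix s
    have "(SUP m. emeasure (weighted V A' \<omega>) {dyadic_ceil m s<..}) = emeasure (weighted V A' \<omega>) (\<Union>m. {dyadic_ceil m s<..})"
      by (rule SUP_emeasure_incseq) (auto intro!: incseq_SucI intro: dyadic_ceil_antimono)
    also have "(\<Union>m. {dyadic_ceil m s<..}) = {s<..}"
    proof (intro equalityI subsetI)
      fix r assume "r \<in> {s<..}"
      then have "eventually (\<lambda>m. dyadic_ceil m s < r) sequentially"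
        by (intro order_tendstoD(2)[OF dyadic_ceil_tendsto]) simp
      then obtain m where "dyadic_ceil m s < r" by (auto simp: eventually_sequentially)
      then show "r \<in> (\<Union>m. {dyadic_ceil m s<..})" by blast
    next
      fix r assume "r \<in> (\<Union>m. {dyadic_ceil m s<..})"
      then obtain m where "dyadic_ceil m s < r" by blast
      with dyadic_ceil_ge[of s m] show "r \<in> {s<..}" by simp
    qed
    finally show "(SUP m. emeasure (weighted V A' \<omega>) {dyadic_ceil m s<..}) = emeasure (weighted V A' \<omega>) {s<..}" .
  qed
  finally show "(SUP m. tailsum V A A' m \<omega>) = (\<integral>\<^sup>+s. emeasure (weighted V A' \<omega>) {s<..} \<partial>weighted V A \<omega>)" .
qed

lemma SUP_tailsum_expectation:
  assumes R: "Revuz_correspondence X p A \<mu>" and V: "open V" and S: "restrict_to \<mu> V \<in> S00 X p"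
    and R': "Revuz_correspondence X p A' \<mu>'" and S': "restrict_to \<mu>' V \<in> S00 X p"
  shows "(\<integral>\<^sup>+\<omega>. (SUP m. tailsum V A A' m \<omega>) \<partial>Pr (Some x)) = (\<integral>\<^sup>+y. resolvent_density p 2 x y * pot V \<mu>' y \<partial>restrict_to \<mu> V)"
proof -
  note A = RevuzD(1)[OF R] RevuzD(1)[OF R']
  have "(\<integral>\<^sup>+\<omega>. (SUP m. tailsum V A A' m \<omega>) \<partial>Pr (Some x)) = (SUP m. \<integral>\<^sup>+\<omega>. tailsum V A A' m \<omega> \<partial>Pr (Some x))"
  proof (rule nn_integral_monotone_convergence_SUP_AE)
    show "AE \<omega> in Pr (Some x). tailsum V A A' m \<omega> \<le> tailsum V A A' (Suc m) \<omega>" for m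
      using AE_good_Pr[OF A(1), of x] AE_good_Pr[OF A(2), of x] total_finite[OF R' V S', of x]
      by eventually_elim (rule incseq_SucD[OF tailsum_SUP(1)[OF _ _ V]])
  qed (rule tailsum_measurable[OF A])
  then show ?thesis
    by (simp only: tailsum_expectation[OF assms] gridsum_SUP[OF assms])
qed

text \<open>Path by path the product of the two totals is the sum of the integrals of each tail
  against the other measure, with no diagonal term because the functionals are continuous. The
  expectation of each integral is a supremum of expected tail sums.\<close>

lemma energy:
  assumes R: "Revuz_correspondence X p A \<mu>" and V: "open V" and S: "restrict_to \<mu> V \<in> S00 X p"
    and R': "Revuz_correspondence X p A' \<mu>'" and S': "restrict_to \<mu>' V \<in> S00 X p"
  shows "(\<integral>\<^sup>+\<omega>. total V A \<omega> * total V A' \<omega> \<partial>Pr (Some x)) =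
     (\<integral>\<^sup>+y. resolvent_density p 2 x y * pot V \<mu>' y \<partial>restrict_to \<mu> V) +
     (\<integral>\<^sup>+y. resolvent_density p 2 x y * pot V \<mu> y \<partial>restrict_to \<mu>' V)"
proof -
  note A = RevuzD(1)[OF R] RevuzD(1)[OF R']
  have "(\<integral>\<^sup>+\<omega>. total V A \<omega> * total V A' \<omega> \<partial>Pr (Some x)) = (\<integral>\<^sup>+\<omega>. (SUP m. tailsum V A A' m \<omega>) + (SUP m. tailsum V A' A m \<omega>) \<partial>Pr (Some x))"
  proof (rule nn_integral_cong_AE)
    show "AE \<omega> in Pr (Some x). total V A \<omega> * total V A' \<omega> = (SUP m. tailsum V A A' m \<omega>) + (SUP m. tailsum V A' A m \<omega>)"
      using AE_good_Pr[OF A(1), of x] AE_good_Pr[OF A(2), of x] total_finite[OF R V S, of x] total_finite[OF R' V S', of x]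
    proof eventually_elim
      case (elim \<omega>)
      have f: "finite_measure (weighted V A \<omega>)" "finite_measure (weighted V A' \<omega>)"
        using elim(3,4) by (auto intro!: finite_measureI simp: total_eq[OF elim(1) V, symmetric] total_eq[OF elim(2) V, symmetric])
      show ?case
        unfolding tailsum_SUP(2)[OF elim(1,2) V elim(4)] tailsum_SUP(2)[OF elim(2,1) V elim(3)] total_eq[OF elim(1) V] total_eq[OF elim(2) V]
        by (rule nn_integral_double_tail[symmetric, OF f(1) sets_weighted f(2) sets_weighted emeasure_weighted_singleton[OF elim(2) V]])
    qed
  qed
  also have "\<dots> = (\<integral>\<^sup>+\<omega>. (SUP m. tailsum V A A' m \<omega>) \<partial>Pr (Some x)) + (\<integral>\<^sup>+\<omega>. (SUP m. tailsum V A' A m \<omega>) \<partial>Pr (Some x))"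
    by (intro nn_integral_add borel_measurable_SUP) (auto intro: tailsum_measurable A)
  finally show ?thesis
    by (simp only: SUP_tailsum_expectation[OF R V S R' S'] SUP_tailsum_expectation[OF R' V S' R S])
qed

section \<open>Bounds from the energy identity\<close>

lemma resolvent_two_le_pot: "(\<integral>\<^sup>+y. resolvent_density p 2 x y \<partial>restrict_to \<mu> V) \<le> pot V \<mu> x"
  unfolding potential_def by (intro nn_integral_mono resolvent_density_antimono) simp

text \<open>The comparison is required only almost everywhere for the measure that is integrated.
  The error is \<open>c\<close> times the 2-potential, which the 1-potential dominates.\<close>

lemma resolvent_two_le_mult:
  assumes S: "restrict_to \<mu> V \<in> S00 X p" and le: "AE y in restrict_to \<mu> V. f y \<le> g y + ennreal c"
    and g: "g \<in> borel_measurable borel"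
  shows "(\<integral>\<^sup>+y. resolvent_density p 2 x y * f y \<partial>restrict_to \<mu> V)
     \<le> (\<integral>\<^sup>+y. resolvent_density p 2 x y * g y \<partial>restrict_to \<mu> V) + ennreal c * pot V \<mu> x"
proof -
  have s: "sets (restrict_to \<mu> V) = sets borel" using S by (simp add: S00_def)
  note [measurable_cong] = s
  note [measurable] = g resolvent_density_measurable1[OF density_measurable, of 2 x]
  have "(\<integral>\<^sup>+y. resolvent_density p 2 x y * f y \<partial>restrict_to \<mu> V)
     \<le> (\<integral>\<^sup>+y. resolvent_density p 2 x y * g y + ennreal c * resolvent_density p 2 x y \<partial>restrict_to \<mu> V)"
    using le
  proof (intro nn_integral_mono_AE, elim eventually_mono)
    fix y assume "f y \<le> g y + ennreal c"
    then have "resolvent_density p 2 x y * f y \<le> resolvent_density p 2 x y * (g y + ennreal c)" by (rule mult_left_mono) simp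
    then show "resolvent_density p 2 x y * f y \<le> resolvent_density p 2 x y * g y + ennreal c * resolvent_density p 2 x y"
      by (simp add: distrib_left distrib_right mult.commute)
  qed
  also have "\<dots> = (\<integral>\<^sup>+y. resolvent_density p 2 x y * g y \<partial>restrict_to \<mu> V) + ennreal c * (\<integral>\<^sup>+y. resolvent_density p 2 x y \<partial>restrict_to \<mu> V)"
    by (subst nn_integral_add) (auto simp: nn_integral_cmult)
  also have "\<dots> \<le> (\<integral>\<^sup>+y. resolvent_density p 2 x y * g y \<partial>restrict_to \<mu> V) + ennreal c * pot V \<mu> x"
    by (intro add_left_mono mult_left_mono resolvent_two_le_pot) simp
  finally show ?thesis .
qed

text \<open>A maximum principle with the constant 2: the second moment of the total is at most
  \<open>2 M\<close> times its mean when the potential is at most \<open>M\<close> almost everywhere, and it dominates the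
  square of the mean.\<close>

lemma pot_le_twice:
  assumes R: "Revuz_correspondence X p A \<mu>" and V: "open V" and S: "restrict_to \<mu> V \<in> S00 X p"
    and le: "AE y in restrict_to \<mu> V. pot V \<mu> y \<le> ennreal M" and M: "0 \<le> M"
  shows "pot V \<mu> x \<le> ennreal (2 * M)"
proof -
  obtain C where C: "\<And>y. pot V \<mu> y \<le> ennreal C" using S00D[OF S] by blast
  define c where "c = enn2real (pot V \<mu> x)"
  have c: "pot V \<mu> x = ennreal c" "0 \<le> c"
    using le_less_trans[OF C[of x]] by (simp_all add: c_def)
  note [measurable] = augm_measurable_Pr[OF total_measurable[OF RevuzD(1)[OF R]], of V "Some x"]
  interpret P: prob_space "Pr (Some x)" by (rule prob_Pr)
  have "(\<integral>\<^sup>+\<omega>. ennreal (2 * c) * total V A \<omega> \<partial>Pr (Some x)) \<le> (\<integral>\<^sup>+\<omega>. ennreal (c\<^sup>2) + total V A \<omega> * total V A \<omega> \<partial>Pr (Some x))"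
    using two_mult_le_sum_squares_ennreal[OF c(2)] by (intro nn_integral_mono) (simp add: power2_eq_square)
  also have "\<dots> = ennreal (c\<^sup>2) + (\<integral>\<^sup>+\<omega>. total V A \<omega> * total V A \<omega> \<partial>Pr (Some x))"
    by (subst nn_integral_add) (auto simp: P.emeasure_space_1[simplified])
  also have "(\<integral>\<^sup>+\<omega>. total V A \<omega> * total V A \<omega> \<partial>Pr (Some x)) \<le> ennreal M * pot V \<mu> x + ennreal M * pot V \<mu> x"
    unfolding energy[OF R V S R S]
    using resolvent_two_le_mult[OF S, of "pot V \<mu>" "\<lambda>_. 0" M x] le by (intro add_mono) simp_all
  also have "(\<integral>\<^sup>+\<omega>. ennreal (2 * c) * total V A \<omega> \<partial>Pr (Some x)) = ennreal (2 * c) * ennreal c"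
    by (subst nn_integral_cmult) (simp_all add: total_expectation[OF R V] c)
  finally have "ennreal (2 * c) * ennreal c \<le> ennreal (c\<^sup>2) + (ennreal M * ennreal c + ennreal M * ennreal c)"
    by (simp add: c add_left_mono)
  then have "ennreal (2 * c * c) \<le> ennreal (c\<^sup>2 + (M * c + M * c))"
    using c M by (simp add: ennreal_mult[symmetric] flip: ennreal_plus)
  then have "2 * c * c \<le> c\<^sup>2 + (M * c + M * c)" using c M by (simp add: ennreal_le_iff del: ennreal_plus)
  then have "c * c \<le> (2 * M) * c" by (simp add: power2_eq_square)
  then have "c \<le> 2 * M" using c(2) M by (cases "c = 0") auto
  then show ?thesis by (simp add: c ennreal_leI)
qed

text \<open>Each second moment is twice an integral of a potential against its own measure.
  Exchanging that potential for the other one costs \<open>c\<close> times a potential and produces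
  the cross term. The first potential is at most 2(B + c) by \<open>pot_le_twice\<close>, since it
  is at most B + c almost everywhere on its own measure; the total cost is 2c * 2(B + c) + 2c *
  B.\<close>

lemma energy_difference:
  assumes R: "Revuz_correspondence X p A \<mu>" and V: "open V" and S: "restrict_to \<mu> V \<in> S00 X p"
    and R': "Revuz_correspondence X p A' \<mu>'" and S': "restrict_to \<mu>' V \<in> S00 X p"
    and le: "AE y in restrict_to \<mu> V. pot V \<mu> y \<le> pot V \<mu>' y + ennreal c"
    and ge: "AE y in restrict_to \<mu>' V. pot V \<mu>' y \<le> pot V \<mu> y + ennreal c"
    and B: "\<And>y. pot V \<mu>' y \<le> ennreal B" "0 \<le> B" and c: "0 \<le> c"
  shows "(\<integral>\<^sup>+\<omega>. ennreal ((enn2real (total V A \<omega>) - enn2real (total V A' \<omega>))\<^sup>2) \<partial>Pr (Some x)) \<le> ennreal (2 * c * (3 * B + 2 * c))"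
proof -
  note A = RevuzD(1)[OF R] RevuzD(1)[OF R']
  note [measurable] = augm_measurable_Pr[OF total_measurable[OF A(1)], of V "Some x"] augm_measurable_Pr[OF total_measurable[OF A(2)], of V "Some x"]
  let ?I = "\<lambda>f \<nu>. \<integral>\<^sup>+y. resolvent_density p 2 x y * f y \<partial>restrict_to \<nu> V"
  let ?E = "\<lambda>f. \<integral>\<^sup>+\<omega>. f \<omega> \<partial>Pr (Some x)"
  have B2: "pot V \<mu> y \<le> ennreal (2 * (B + c))" for y
  proof (rule pot_le_twice[OF R V S])
    show "AE y in restrict_to \<mu> V. pot V \<mu> y \<le> ennreal (B + c)"
      using le
    proof eventually_elim
      case (elim y)
      then have "pot V \<mu> y \<le> ennreal B + ennreal c" using B(1)[of y] by (meson add_right_mono order_trans)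
      then show ?case using B(2) c by simp
    qed
  qed (use B c in simp)
  have cross: "?E (\<lambda>\<omega>. total V A \<omega> * total V A' \<omega>) = ?I (pot V \<mu>') \<mu> + ?I (pot V \<mu>) \<mu>'"
    by (rule energy[OF R V S R' S'])
  \<comment> \<open>In place of a subtraction the cross term stands on both sides of the estimate
    below; being finite, it can be cancelled.\<close>
  have fin: "?E (\<lambda>\<omega>. total V A \<omega> * total V A' \<omega>) < \<top>"
  proof -
    have "?I (pot V \<mu>') \<mu> \<le> ?I (\<lambda>_. 0) \<mu> + ennreal B * pot V \<mu> x"
      by (rule resolvent_two_le_mult[OF S]) (use B in auto)
    also have "\<dots> \<le> ennreal B * ennreal (2 * (B + c))" using B2[of x] by (simp add: mult_left_mono)
    finally have 1: "?I (pot V \<mu>') \<mu> < \<top>" by (rule le_less_trans) (simp add: ennreal_mult_less_top)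
    have "?I (pot V \<mu>) \<mu>' \<le> ?I (\<lambda>_. 0) \<mu>' + ennreal (2 * (B + c)) * pot V \<mu>' x"
      by (rule resolvent_two_le_mult[OF S']) (use B2 in auto)
    also have "\<dots> \<le> ennreal (2 * (B + c)) * ennreal B" using B(1)[of x] by (simp add: mult_left_mono)
    finally have 2: "?I (pot V \<mu>) \<mu>' < \<top>" by (rule le_less_trans) (simp add: ennreal_mult_less_top)
    show ?thesis unfolding cross using 1 2 by simp
  qed
  let ?D = "\<lambda>\<omega>. ennreal ((enn2real (total V A \<omega>) - enn2real (total V A' \<omega>))\<^sup>2)"
  have "?E ?D + 2 * ?E (\<lambda>\<omega>. total V A \<omega> * total V A' \<omega>) = ?E (\<lambda>\<omega>. ?D \<omega> + 2 * (total V A \<omega> * total V A' \<omega>))"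
    by (subst nn_integral_add) (auto simp: nn_integral_cmult)
  also have "\<dots> = ?E (\<lambda>\<omega>. total V A \<omega> * total V A \<omega> + total V A' \<omega> * total V A' \<omega>)"
  proof (rule nn_integral_cong_AE)
    show "AE \<omega> in Pr (Some x). ?D \<omega> + 2 * (total V A \<omega> * total V A' \<omega>) = total V A \<omega> * total V A \<omega> + total V A' \<omega> * total V A' \<omega>"
      using total_finite[OF R V S, of x] total_finite[OF R' V S', of x]
    proof eventually_elim
      case (elim \<omega>)
      define a b where "a = enn2real (total V A \<omega>)" and "b = enn2real (total V A' \<omega>)"
      have ab: "total V A \<omega> = ennreal a" "total V A' \<omega> = ennreal b" "0 \<le> a" "0 \<le> b"
        using elim by (simp_all add: a_def b_def)
      have "ennreal ((a - b)\<^sup>2) + 2 * (ennreal a * ennreal b) = ennreal ((a - b)\<^sup>2 + 2 * (a * b))"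
        using ab(3,4) by (simp add: ennreal_mult)
      also have "(a - b)\<^sup>2 + 2 * (a * b) = a * a + b * b" by (simp add: power2_eq_square algebra_simps)
      finally show ?case using ab(3,4) by (simp add: ab(1,2) ennreal_mult a_def[symmetric] b_def[symmetric])
    qed
  qed
  also have "\<dots> = ?E (\<lambda>\<omega>. total V A \<omega> * total V A \<omega>) + ?E (\<lambda>\<omega>. total V A' \<omega> * total V A' \<omega>)"
    by (rule nn_integral_add) measurable
  also have "\<dots> = 2 * ?I (pot V \<mu>) \<mu> + 2 * ?I (pot V \<mu>') \<mu>'"
    unfolding energy[OF R V S R S] energy[OF R' V S' R' S'] by (simp add: mult_2)
  also have "\<dots> \<le> 2 * (?I (pot V \<mu>') \<mu> + ennreal c * pot V \<mu> x) + 2 * (?I (pot V \<mu>) \<mu>' + ennreal c * pot V \<mu>' x)"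
    by (intro add_mono mult_left_mono resolvent_two_le_mult[OF S le] resolvent_two_le_mult[OF S' ge] S00_potential_measurable S S') auto
  also have "\<dots> \<le> 2 * (?I (pot V \<mu>') \<mu> + ennreal c * ennreal (2 * (B + c))) + 2 * (?I (pot V \<mu>) \<mu>' + ennreal c * ennreal B)"
    by (intro add_mono mult_left_mono B2 B order_refl) auto
  also have "\<dots> = (2 * (ennreal c * ennreal (2 * (B + c))) + 2 * (ennreal c * ennreal B)) + 2 * ?E (\<lambda>\<omega>. total V A \<omega> * total V A' \<omega>)"
    unfolding cross by (simp add: distrib_left add_ac)
  also have "2 * (ennreal c * ennreal (2 * (B + c))) + 2 * (ennreal c * ennreal B) = ennreal (2 * c * (3 * B + 2 * c))"
  proof -
    have "2 * (ennreal c * ennreal (2 * (B + c))) + 2 * (ennreal c * ennreal B) = ennreal (2 * (c * (2 * (B + c))) + 2 * (c * B))"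
      using B(2) c by (simp add: ennreal_mult)
    then show ?thesis by (simp add: algebra_simps)
  qed
  finally have le2: "2 * ?E (\<lambda>\<omega>. total V A \<omega> * total V A' \<omega>) + ?E ?D
     \<le> 2 * ?E (\<lambda>\<omega>. total V A \<omega> * total V A' \<omega>) + ennreal (2 * c * (3 * B + 2 * c))"
    by (simp only: add.commute)
  have "2 * ?E (\<lambda>\<omega>. total V A \<omega> * total V A' \<omega>) \<noteq> \<top>"
    using fin by (simp add: ennreal_mult_eq_top_iff)
  then show ?thesis using ennreal_add_left_cancel_le[THEN iffD1, OF le2] unfolding infinity_ennreal_def by blast
qed

end

section \<open>The maximal inequality\<close>

definition dyadics :: "real set" where
  "dyadics = range (\<lambda>(i, m). real i / 2 ^ m)"

lemma countable_dyadics: "countable dyadics"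
  unfolding dyadics_def by (intro countable_image) simp

lemma dyadics_nonneg: "t \<in> dyadics \<Longrightarrow> 0 \<le> t"
  by (auto simp: dyadics_def)

lemma dyadic_ceil_in_dyadics: "0 \<le> t \<Longrightarrow> dyadic_ceil m t \<in> dyadics"
proof -
  assume "0 \<le> t"
  then have "dyadic_ceil m t = real (nat \<lceil>t * 2 ^ m\<rceil>) / 2 ^ m"
    by (simp add: dyadic_ceil_def)
  then show ?thesis unfolding dyadics_def by (intro image_eqI[of _ _ "(nat \<lceil>t * 2 ^ m\<rceil>, m)"]) auto
qed

section \<open>An inequality of Ottaviani type\<close>

context Revuz_setting
begin

text \<open>The union is decomposed by the first time of \<open>J\<close> at which \<open>B\<close>
  occurs. By the Markov property at that time the restarted path lies in \<open>G\<close> with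
  conditional probability at least 1/2, wherever it is, and then \<open>H\<close> occurs. The pieces
  are disjoint, so the bounds add up.\<close>

lemma Ottaviani_finite:
  assumes J: "finite J" "\<And>t. t \<in> J \<Longrightarrow> 0 \<le> t"
    and B: "\<And>t. t \<in> J \<Longrightarrow> B t \<in> sets (augm (ennreal t))"
    and G: "\<And>t. t \<in> J \<Longrightarrow> G t \<in> sets (augm \<top>)"
    and half: "\<And>t y. t \<in> J \<Longrightarrow> 1 \<le> 2 * emeasure (Pr (Some y)) (G t)"
    and H: "H \<in> sets (Pr (Some x))"
    and inc: "\<And>t. t \<in> J \<Longrightarrow> AE \<omega> in Pr (Some x). \<omega> \<in> B t \<and> shift X (ennreal t) \<omega> \<in> G t \<longrightarrow> \<omega> \<in> H"
  shows "emeasure (Pr (Some x)) (\<Union>t\<in>J. B t) \<le> 2 * emeasure (Pr (Some x)) H"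
proof -
  define E where "E t = B t - (\<Union>s\<in>{s\<in>J. s < t}. B s)" for t
  have E: "E t \<in> sets (augm (ennreal t))" if t: "t \<in> J" for t
  proof -
    have "B s \<in> sets (augm (ennreal t))" if "s \<in> {s\<in>J. s < t}" for s
      using B[of s] augm_mono[OF ennreal_leI[of s t]] that by auto
    then show ?thesis unfolding E_def using B[OF t] J(1) by (intro sets.Diff sets.finite_UN) auto
  qed
  have EP [measurable]: "E t \<in> sets (Pr (Some x))" if "t \<in> J" for t
    using E[OF that] augm_subset_Pr by blast
  have un: "(\<Union>t\<in>J. B t) = (\<Union>t\<in>J. E t)"
  proof (intro equalityI subsetI)
    fix \<omega> assume "\<omega> \<in> (\<Union>t\<in>J. B t)"
    then have ne: "{t\<in>J. \<omega> \<in> B t} \<noteq> {}" by auto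
    have f: "finite {t\<in>J. \<omega> \<in> B t}" using J(1) by simp
    have m: "Min {t\<in>J. \<omega> \<in> B t} \<in> {t\<in>J. \<omega> \<in> B t}" by (rule Min_in[OF f ne])
    have "\<omega> \<notin> B s" if "s \<in> J" "s < Min {t\<in>J. \<omega> \<in> B t}" for s
      using Min_le[OF f, of s] that by auto
    then have "\<omega> \<in> E (Min {t\<in>J. \<omega> \<in> B t})" using m by (auto simp: E_def)
    then show "\<omega> \<in> (\<Union>t\<in>J. E t)" using m by blast
  qed (auto simp: E_def)
  have disj: "disjoint_family_on (\<lambda>t. E t \<inter> H) J"
    unfolding disjoint_family_on_def
  proof (intro ballI impI)
    fix s t assume "s \<in> J" "t \<in> J" "s \<noteq> t"
    then show "(E s \<inter> H) \<inter> (E t \<inter> H) = {}" by (cases "s < t") (auto simp: E_def)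
  qed
  have step: "emeasure (Pr (Some x)) (E t) \<le> 2 * emeasure (Pr (Some x)) (E t \<inter> H)" if t: "t \<in> J" for t
  proof -
    have Y: "(indicator (E t) :: 'w \<Rightarrow> ennreal) \<in> borel_measurable (augm (ennreal t))"
      using E[OF t] by simp
    have Z: "(indicator (G t) :: 'w \<Rightarrow> ennreal) \<in> borel_measurable (augm \<top>)"
      using G[OF t] by simp
    note [measurable] = Markov_augm_event(2)[OF Z, of "ennreal t" "Some x"] EP[OF t] H
    have GP: "(\<integral>\<^sup>+\<omega>'. indicator (G t) \<omega>' \<partial>Pr z) = emeasure (Pr z) (G t)" for z
      using G[OF t] augm_subset_Pr by (intro nn_integral_indicator) blast
    have "emeasure (Pr (Some x)) (E t) = (\<integral>\<^sup>+\<omega>. indicator (E t) \<omega> \<partial>Pr (Some x))" by simp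
    also have "\<dots> \<le> (\<integral>\<^sup>+\<omega>. 2 * (indicator (E t) \<omega> * (\<integral>\<^sup>+\<omega>'. indicator (G t) \<omega>' \<partial>law X (path X (ennreal t) \<omega>))) \<partial>Pr (Some x))"
      using AE_path_pos[of t x]
    proof (intro nn_integral_mono_AE, elim eventually_mono)
      fix \<omega> assume p: "path X (ennreal t) \<omega> = Some (pos \<omega> t)"
      have "1 \<le> 2 * (\<integral>\<^sup>+\<omega>'. indicator (G t) \<omega>' \<partial>law X (path X (ennreal t) \<omega>))"
        using half[OF t, of "pos \<omega> t"] unfolding p GP[symmetric] nn_integral_completion .
      then show "indicator (E t) \<omega> \<le> 2 * (indicator (E t) \<omega> * (\<integral>\<^sup>+\<omega>'. indicator (G t) \<omega>' \<partial>law X (path X (ennreal t) \<omega>)))"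
        by (cases "\<omega> \<in> E t") simp_all
    qed
    also have "\<dots> = 2 * (\<integral>\<^sup>+\<omega>. indicator (E t) \<omega> * (\<integral>\<^sup>+\<omega>'. indicator (G t) \<omega>' \<partial>law X (path X (ennreal t) \<omega>)) \<partial>Pr (Some x))"
      by (rule nn_integral_cmult) measurable
    also have "(\<integral>\<^sup>+\<omega>. indicator (E t) \<omega> * (\<integral>\<^sup>+\<omega>'. indicator (G t) \<omega>' \<partial>law X (path X (ennreal t) \<omega>)) \<partial>Pr (Some x))
      = (\<integral>\<^sup>+\<omega>. indicator (E t) \<omega> * indicator (G t) (shift X (ennreal t) \<omega>) \<partial>Pr (Some x))"
      using Markov_augm[OF Y Z, of "Some x"] by (simp add: nn_integral_completion)
    also have "\<dots> \<le> (\<integral>\<^sup>+\<omega>. indicator (E t \<inter> H) \<omega> \<partial>Pr (Some x))"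
      using inc[OF t] by (intro nn_integral_mono_AE) (auto elim!: eventually_mono simp: indicator_def E_def)
    also have "\<dots> = emeasure (Pr (Some x)) (E t \<inter> H)" by simp
    finally show ?thesis by (simp add: mult_left_mono)
  qed
  have "emeasure (Pr (Some x)) (\<Union>t\<in>J. B t) \<le> (\<Sum>t\<in>J. emeasure (Pr (Some x)) (E t))"
    unfolding un using EP J(1) by (intro emeasure_subadditive_finite) auto
  also have "\<dots> \<le> (\<Sum>t\<in>J. 2 * emeasure (Pr (Some x)) (E t \<inter> H))" by (rule sum_mono[OF step])
  also have "\<dots> = 2 * (\<Sum>t\<in>J. emeasure (Pr (Some x)) (E t \<inter> H))" by (rule sum_distrib_left[symmetric])
  also have "(\<Sum>t\<in>J. emeasure (Pr (Some x)) (E t \<inter> H)) = emeasure (Pr (Some x)) (\<Union>t\<in>J. E t \<inter> H)"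
    using EP H J(1) disj by (intro sum_emeasure) auto
  also have "\<dots> \<le> emeasure (Pr (Some x)) H" using H by (intro emeasure_mono) auto
  finally show ?thesis by (simp add: mult_left_mono)
qed

text \<open>The bound does not depend on the index set, so it passes from finite sets to their
  increasing union.\<close>

lemma Ottaviani:
  assumes J: "countable J" "\<And>t. t \<in> J \<Longrightarrow> 0 \<le> t"
    and B: "\<And>t. t \<in> J \<Longrightarrow> B t \<in> sets (augm (ennreal t))"
    and G: "\<And>t. t \<in> J \<Longrightarrow> G t \<in> sets (augm \<top>)"
    and half: "\<And>t y. t \<in> J \<Longrightarrow> 1 \<le> 2 * emeasure (Pr (Some y)) (G t)"
    and H: "H \<in> sets (Pr (Some x))"
    and inc: "\<And>t. t \<in> J \<Longrightarrow> AE \<omega> in Pr (Some x). \<omega> \<in> B t \<and> shift X (ennreal t) \<omega> \<in> G t \<longrightarrow> \<omega> \<in> H"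
  shows "emeasure (Pr (Some x)) (\<Union>t\<in>J. B t) \<le> 2 * emeasure (Pr (Some x)) H"
proof (cases "J = {}")
  case False
  let ?J = "\<lambda>n::nat. from_nat_into J ` {..n}"
  have sub: "?J n \<subseteq> J" for n using from_nat_into[OF False] by auto
  have "(\<Union>t\<in>J. B t) = (\<Union>n. \<Union>t\<in>?J n. B t)"
  proof (intro equalityI subsetI)
    fix \<omega> assume "\<omega> \<in> (\<Union>t\<in>J. B t)"
    then obtain t where t: "t \<in> J" "\<omega> \<in> B t" by blast
    obtain n where "from_nat_into J n = t" using from_nat_into_surj[OF J(1) t(1)] by blast
    then have "t \<in> ?J n" by auto
    then show "\<omega> \<in> (\<Union>n. \<Union>t\<in>?J n. B t)" using t(2) by blast
  qed (use sub in blast)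
  also have "emeasure (Pr (Some x)) \<dots> = (SUP n. emeasure (Pr (Some x)) (\<Union>t\<in>?J n. B t))"
  proof (rule SUP_emeasure_incseq[symmetric])
    show "range (\<lambda>n. \<Union>t\<in>?J n. B t) \<subseteq> sets (Pr (Some x))"
    proof (intro image_subsetI sets.finite_UN)
      fix n t assume "t \<in> ?J n"
      then show "B t \<in> sets (Pr (Some x))" using B[of t] sub augm_subset_Pr by blast
    qed simp
    show "incseq (\<lambda>n. \<Union>t\<in>?J n. B t)" by (intro incseq_SucI UN_mono image_mono) auto
  qed
  also have "\<dots> \<le> 2 * emeasure (Pr (Some x)) H"
    using sub by (intro SUP_least Ottaviani_finite[where G=G] assms) auto
  finally show ?thesis .
qed simp

text \<open>Rounded-up times decrease to \<open>t\<close> and the masses are finite, so continuity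
  from above applies. Bounds at dyadic times thereby extend to all times.\<close>

lemma functional_tendsto_dyadic_ceil:
  assumes g: "good A \<omega>" and V: "open V" and t: "0 \<le> t"
  shows "(\<lambda>m. functional V A (dyadic_ceil m t) \<omega>) \<longlonglongrightarrow> functional V A t \<omega>"
proof -
  have d: "0 \<le> dyadic_ceil m t" for m using t dyadic_ceil_ge[of t m] by simp
  have "(\<lambda>m. emeasure (weighted V A \<omega>) {0<..dyadic_ceil m t}) \<longlonglongrightarrow> emeasure (weighted V A \<omega>) (\<Inter>m. {0<..dyadic_ceil m t})"
  proof (rule Lim_emeasure_decseq)
    show "decseq (\<lambda>m. {0<..dyadic_ceil m t})"
      by (intro decseq_SucI) (auto intro: order_trans[OF _ dyadic_ceil_antimono[OF le_SucI[OF order_refl]]])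
    show "emeasure (weighted V A \<omega>) {0<..dyadic_ceil m t} \<noteq> \<infinity>" for m
      using functional_finite[OF g V d[of m]] by (simp add: functional_eq[OF g V d[of m]] less_top)
  qed auto
  moreover have "(\<Inter>m. {0<..dyadic_ceil m t}) = {0<..t}"
  proof (intro equalityI subsetI)
    fix s assume s: "s \<in> (\<Inter>m. {0<..dyadic_ceil m t})"
    then have "s \<le> t" by (intro LIMSEQ_le_const[OF dyadic_ceil_tendsto]) auto
    then show "s \<in> {0<..t}" using s by auto
  qed (auto intro: order_trans[OF _ dyadic_ceil_ge])
  ultimately show ?thesis by (simp add: functional_eq[OF g V] t d)
qed

text \<open>While the path stays in \<open>V\<close> the weight is e^(-s), so
  \<open>clock_le_of_weighted_le\<close> removes the discount. Rounding up may pass beyond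
  \<open>t\<close>, which is why closeness is assumed at all dyadic times. The conclusion is
  one-sided; exchanging the two functionals gives the other side.\<close>

lemma PCAF_le_of_functional_close:
  assumes g: "good A \<omega>" "good A' \<omega>" and V: "open V" and T: "0 \<le> t" "t \<le> T"
    and inV: "\<And>s. 0 < s \<Longrightarrow> s \<le> T \<Longrightarrow> pos \<omega> s \<in> V"
    and close: "\<And>r. r \<in> dyadics \<Longrightarrow> \<bar>enn2real (functional V A r \<omega>) - enn2real (functional V A' r \<omega>)\<bar> \<le> c"
  shows "A t \<omega> \<le> A' t \<omega> + ennreal (2 * c * exp t)"
proof -
  have "0 \<in> dyadics" unfolding dyadics_def by (intro image_eqI[of _ _ "(0, 0)"]) auto
  from close[OF this] have c: "0 \<le> c" by linarith
  have le: "functional V D r \<omega> \<le> functional V D' r \<omega> + ennreal c"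
    if r: "0 \<le> r" and gD: "good D \<omega>" "good D' \<omega>"
      and cl: "\<And>r. r \<in> dyadics \<Longrightarrow> \<bar>enn2real (functional V D r \<omega>) - enn2real (functional V D' r \<omega>)\<bar> \<le> c" for r D D'
  proof (rule LIMSEQ_le)
    show "(\<lambda>m. functional V D (dyadic_ceil m r) \<omega>) \<longlonglongrightarrow> functional V D r \<omega>"
      by (rule functional_tendsto_dyadic_ceil[OF gD(1) V r])
    show "(\<lambda>m. functional V D' (dyadic_ceil m r) \<omega> + ennreal c) \<longlonglongrightarrow> functional V D' r \<omega> + ennreal c"
      by (intro tendsto_add tendsto_const functional_tendsto_dyadic_ceil[OF gD(2) V r])
    have "functional V D (dyadic_ceil m r) \<omega> \<le> functional V D' (dyadic_ceil m r) \<omega> + ennreal c" for m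
    proof -
      have d: "0 \<le> dyadic_ceil m r" using r dyadic_ceil_ge[of r m] by simp
      define a b where "a = enn2real (functional V D (dyadic_ceil m r) \<omega>)" and "b = enn2real (functional V D' (dyadic_ceil m r) \<omega>)"
      have ab: "functional V D (dyadic_ceil m r) \<omega> = ennreal a" "functional V D' (dyadic_ceil m r) \<omega> = ennreal b" "0 \<le> a" "0 \<le> b"
        using functional_finite[OF gD(1) V d] functional_finite[OF gD(2) V d] by (simp_all add: a_def b_def)
      have "a \<le> b + c" using cl[OF dyadic_ceil_in_dyadics[OF r, of m]] by (simp add: a_def b_def)
      then have "ennreal a \<le> ennreal (b + c)" by (rule ennreal_leI)
      then show ?thesis using ab c by simp
    qed
    then show "\<exists>N. \<forall>n\<ge>N. functional V D (dyadic_ceil n r) \<omega> \<le> functional V D' (dyadic_ceil n r) \<omega> + ennreal c" by blast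
  qed
  have close': "\<And>r. r \<in> dyadics \<Longrightarrow> \<bar>enn2real (functional V A' r \<omega>) - enn2real (functional V A r \<omega>)\<bar> \<le> c"
    using close by (simp add: abs_minus_commute)
  show ?thesis
  proof (rule clock_le_of_weighted_le[OF goodD(5)[OF g(1)] goodD(5)[OF g(2)] T(1) weight_measurable[OF g(1) V] _ _ _ c])
    show "weight V \<omega> s = ennreal (exp (- s))" if "0 < s" "s \<le> t" for s
      using inV[of s] that T by (simp add: weight_def)
    show "emeasure (density (clock_measure (\<lambda>t. A t \<omega>)) (weight V \<omega>)) {0<..r} \<le> emeasure (density (clock_measure (\<lambda>t. A' t \<omega>)) (weight V \<omega>)) {0<..r} + ennreal c"
      if "0 \<le> r" for r
      using le[OF that g close] by (simp add: functional_eq[OF g(1) V that] functional_eq[OF g(2) V that] weighted_def)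
    show "emeasure (density (clock_measure (\<lambda>t. A' t \<omega>)) (weight V \<omega>)) {0<..r} \<le> emeasure (density (clock_measure (\<lambda>t. A t \<omega>)) (weight V \<omega>)) {0<..r} + ennreal c"
      if "0 \<le> r" for r
      using le[OF that g(2,1) close'] by (simp add: functional_eq[OF g(1) V that] functional_eq[OF g(2) V that] weighted_def)
  qed
qed

section \<open>Uniform deviation of two localised functionals\<close>

definition deviation :: "'a set \<Rightarrow> (real \<Rightarrow> 'w \<Rightarrow> ennreal) \<Rightarrow> (real \<Rightarrow> 'w \<Rightarrow> ennreal) \<Rightarrow> real \<Rightarrow> real \<Rightarrow> 'w set" where
  "deviation V A A' c t = {\<omega> \<in> sample_space X. c < \<bar>enn2real (functional V A t \<omega>) - enn2real (functional V A' t \<omega>)\<bar>}"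

lemma deviation_augm:
  assumes "PCAF X A" "PCAF X A'" "0 \<le> t"
  shows "deviation V A A' c t \<in> sets (augm (ennreal t))"
proof -
  note [measurable] = functional_measurable[OF assms(1,3), of V] functional_measurable[OF assms(2,3), of V]
  have "{\<omega> \<in> space (augm (ennreal t)). c < \<bar>enn2real (functional V A t \<omega>) - enn2real (functional V A' t \<omega>)\<bar>} \<in> sets (augm (ennreal t))"
    by measurable
  then show ?thesis by (simp add: deviation_def)
qed

text \<open>\<open>H\<close> is the event that the totals differ by more than \<open>l\<close>; by
  Chebyshev's inequality its probability is at most 1/2 for every starting point. If the functionals
  differ by more than \<open>2 * l\<close> at \<open>t\<close> and the restarted totals by at most
  \<open>l\<close>, then the totals differ by more than \<open>l\<close>, because the restarted
  totals enter with the factor e^(-t) \<le> 1.\<close>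

lemma maximal_deviation:
  assumes R: "Revuz_correspondence X p A \<mu>" and V: "open V" and S: "restrict_to \<mu> V \<in> S00 X p"
    and R': "Revuz_correspondence X p A' \<mu>'" and S': "restrict_to \<mu>' V \<in> S00 X p"
    and le: "AE y in restrict_to \<mu> V. pot V \<mu> y \<le> pot V \<mu>' y + ennreal c"
    and ge: "AE y in restrict_to \<mu>' V. pot V \<mu>' y \<le> pot V \<mu> y + ennreal c"
    and B: "\<And>y. pot V \<mu>' y \<le> ennreal B" "0 \<le> B" and c: "0 \<le> c"
    and l: "0 < l" and small: "2 * c * (3 * B + 2 * c) / l\<^sup>2 \<le> 1 / 2"
  shows "emeasure (Pr (Some x)) (\<Union>t\<in>dyadics. deviation V A A' (2 * l) t) \<le> ennreal (2 * (2 * c * (3 * B + 2 * c) / l\<^sup>2))"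
proof -
  note A = RevuzD(1)[OF R] RevuzD(1)[OF R']
  let ?d = "\<lambda>\<omega>. \<bar>enn2real (total V A \<omega>) - enn2real (total V A' \<omega>)\<bar>"
  let ?q = "2 * c * (3 * B + 2 * c) / l\<^sup>2"
  have q: "0 \<le> ?q" using B(2) c by simp
  define H where "H = {\<omega> \<in> sample_space X. l < ?d \<omega>}"
  note [measurable] = total_measurable[OF A(1), of V] total_measurable[OF A(2), of V]
  have H: "H \<in> sets (augm \<top>)"
  proof -
    have "{\<omega> \<in> space (augm \<top>). l < ?d \<omega>} \<in> sets (augm \<top>)" by measurable
    then show ?thesis by (simp add: H_def)
  qed
  have HP: "H \<in> sets (Pr z)" for z using H augm_subset_Pr by blast
  have PH: "emeasure (Pr (Some y)) H \<le> ennreal ?q" for y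
  proof -
    note [measurable] = augm_measurable_Pr[OF total_measurable[OF A(1)], of V "Some y"] augm_measurable_Pr[OF total_measurable[OF A(2)], of V "Some y"]
    have "emeasure (Pr (Some y)) H \<le> emeasure (Pr (Some y)) {\<omega> \<in> space (Pr (Some y)). 1 \<le> ennreal (1 / l\<^sup>2) * ennreal ((?d \<omega>)\<^sup>2)}"
    proof (rule emeasure_mono)
      show "H \<subseteq> {\<omega> \<in> space (Pr (Some y)). 1 \<le> ennreal (1 / l\<^sup>2) * ennreal ((?d \<omega>)\<^sup>2)}"
      proof
        fix \<omega> assume "\<omega> \<in> H"
        then have \<omega>: "\<omega> \<in> sample_space X" "l < ?d \<omega>" by (auto simp: H_def)
        have "l\<^sup>2 \<le> (?d \<omega>)\<^sup>2" using \<omega>(2) l by (intro power_mono) auto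
        then have "1 \<le> 1 / l\<^sup>2 * (?d \<omega>)\<^sup>2" using l by (simp add: field_simps)
        then have "ennreal 1 \<le> ennreal (1 / l\<^sup>2 * (?d \<omega>)\<^sup>2)" by (rule ennreal_leI)
        also have "\<dots> = ennreal (1 / l\<^sup>2) * ennreal ((?d \<omega>)\<^sup>2)" by (rule ennreal_mult) auto
        finally have "1 \<le> ennreal (1 / l\<^sup>2) * ennreal ((?d \<omega>)\<^sup>2)" by (simp only: ennreal_1)
        then show "\<omega> \<in> {\<omega> \<in> space (Pr (Some y)). 1 \<le> ennreal (1 / l\<^sup>2) * ennreal ((?d \<omega>)\<^sup>2)}"
          using \<omega>(1) by simp
      qed
    qed measurable
    also have "\<dots> \<le> ennreal (1 / l\<^sup>2) * (\<integral>\<^sup>+\<omega>. ennreal ((?d \<omega>)\<^sup>2) * indicator (space (Pr (Some y))) \<omega> \<partial>Pr (Some y))"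
      by (rule nn_integral_Markov_inequality) measurable
    also have "(\<integral>\<^sup>+\<omega>. ennreal ((?d \<omega>)\<^sup>2) * indicator (space (Pr (Some y))) \<omega> \<partial>Pr (Some y)) = (\<integral>\<^sup>+\<omega>. ennreal ((enn2real (total V A \<omega>) - enn2real (total V A' \<omega>))\<^sup>2) \<partial>Pr (Some y))"
      by (intro nn_integral_cong) simp
    also have "ennreal (1 / l\<^sup>2) * \<dots> \<le> ennreal (1 / l\<^sup>2) * ennreal (2 * c * (3 * B + 2 * c))"
      by (intro mult_left_mono energy_difference[OF R V S R' S' le ge B c]) simp
    also have "\<dots> = ennreal ?q" using B(2) c by (simp add: ennreal_mult[symmetric])
    finally show ?thesis .
  qed
  have "emeasure (Pr (Some x)) (\<Union>t\<in>dyadics. deviation V A A' (2 * l) t) \<le> 2 * emeasure (Pr (Some x)) H"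
  proof (rule Ottaviani[OF countable_dyadics, where G="\<lambda>_. sample_space X - H"])
    show "0 \<le> t" if "t \<in> dyadics" for t using that by (rule dyadics_nonneg)
    show "deviation V A A' (2 * l) t \<in> sets (augm (ennreal t))" if "t \<in> dyadics" for t
      by (rule deviation_augm[OF A dyadics_nonneg[OF that]])
    show "sample_space X - H \<in> sets (augm \<top>)"
      using sets.compl_sets[OF H] by simp
    show "H \<in> sets (Pr (Some x))" by (rule HP)
    show "1 \<le> 2 * emeasure (Pr (Some y)) (sample_space X - H)" for y
    proof -
      interpret P: prob_space "Pr (Some y)" by (rule prob_Pr)
      have "ennreal (measure (Pr (Some y)) H) \<le> ennreal ?q"
        using PH[of y] by (simp only: P.emeasure_eq_measure)
      then have "measure (Pr (Some y)) H \<le> 1 / 2" using small q by (subst (asm) ennreal_le_iff) auto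
      then have "1 \<le> 2 * measure (Pr (Some y)) (sample_space X - H)"
        using P.prob_compl[OF HP] by simp
      then have "ennreal 1 \<le> ennreal (2 * measure (Pr (Some y)) (sample_space X - H))" by (rule ennreal_leI)
      then show ?thesis by (simp add: ennreal_mult P.emeasure_eq_measure)
    qed
    fix t assume "t \<in> dyadics"
    then have t: "0 \<le> t" by (rule dyadics_nonneg)
    show "AE \<omega> in Pr (Some x). \<omega> \<in> deviation V A A' (2 * l) t \<and> shift X (ennreal t) \<omega> \<in> sample_space X - H \<longrightarrow> \<omega> \<in> H"
      using AE_good_Pr[OF A(1), of x] AE_good_Pr[OF A(2), of x] total_finite[OF R V S, of x] total_finite[OF R' V S', of x]
    proof eventually_elim
      case (elim \<omega>)
      show ?case
      proof
        assume *: "\<omega> \<in> deviation V A A' (2 * l) t \<and> shift X (ennreal t) \<omega> \<in> sample_space X - H"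
        let ?\<omega>' = "shift X (ennreal t) \<omega>"
        have split: "enn2real (total V D \<omega>) = enn2real (functional V D t \<omega>) + exp (- t) * enn2real (total V D ?\<omega>')"
          if g: "good D \<omega>" and fin: "total V D \<omega> < \<top>" for D
        proof -
          have s: "total V D \<omega> = functional V D t \<omega> + ennreal (exp (- t)) * total V D ?\<omega>'"
            by (rule total_split[OF g V t])
          have "ennreal (exp (- t)) * total V D ?\<omega>' < \<top>" using fin unfolding s by simp
          then show ?thesis
            unfolding s using functional_finite[OF g V t] by (simp add: enn2real_plus enn2real_mult)
        qed
        have 1: "2 * l < \<bar>enn2real (functional V A t \<omega>) - enn2real (functional V A' t \<omega>)\<bar>"
          using * by (simp add: deviation_def)
        have "?d ?\<omega>' \<le> l" using * by (auto simp: H_def)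
        then have "exp (- t) * ?d ?\<omega>' \<le> 1 * l" using t l by (intro mult_mono) auto
        moreover have "enn2real (total V A \<omega>) - enn2real (total V A' \<omega>) = (enn2real (functional V A t \<omega>) - enn2real (functional V A' t \<omega>))
            + exp (- t) * (enn2real (total V A ?\<omega>') - enn2real (total V A' ?\<omega>'))"
          unfolding split[OF elim(1,3)] split[OF elim(2,4)] by (simp add: algebra_simps)
        moreover have "\<bar>exp (- t) * (enn2real (total V A ?\<omega>') - enn2real (total V A' ?\<omega>'))\<bar> = exp (- t) * ?d ?\<omega>'"
          by (simp add: abs_mult)
        ultimately have "l < ?d \<omega>" using 1 by linarith
        then show "\<omega> \<in> H" using goodD(1)[OF elim(1)] by (simp add: H_def)
      qed
    qed
  qed
  also have "\<dots> \<le> 2 * ennreal ?q" by (intro mult_left_mono PH) simp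
  also have "\<dots> = ennreal (2 * ?q)" unfolding ennreal_mult[OF zero_le_numeral q] by simp
  finally show ?thesis .
qed

text \<open>Outside the two exceptional events the path stays in \<open>F \<subseteq> V\<close> up
  to time \<open>T\<close> and the localised functionals are within \<open>2 * l\<close> at all
  dyadic times; removing the discount gives a difference of at most 2(2l)e^T. The horizon is
  \<open>T + 1\<close> because \<open>hit\<close> excludes its right end and time \<open>T\<close>
  itself must be covered.\<close>

lemma local_estimate:
  assumes R: "Revuz_correspondence X p A \<mu>" and V: "open V" and S: "restrict_to \<mu> V \<in> S00 X p"
    and R': "Revuz_correspondence X p A' \<mu>'" and S': "restrict_to \<mu>' V \<in> S00 X p"
    and le: "AE y in restrict_to \<mu> V. pot V \<mu> y \<le> pot V \<mu>' y + ennreal c"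
    and ge: "AE y in restrict_to \<mu>' V. pot V \<mu>' y \<le> pot V \<mu> y + ennreal c"
    and B: "\<And>y. pot V \<mu>' y \<le> ennreal B" "0 \<le> B" and c: "0 \<le> c"
    and l: "0 < l" and small: "2 * c * (3 * B + 2 * c) / l\<^sup>2 \<le> 1 / 2"
    and T: "0 \<le> T" and e: "4 * l * exp T \<le> e" and F: "compact F" "F \<subseteq> V"
  shows "emeasure (Pr (Some x)) {\<omega> \<in> sample_space X.
             ereal e < (SUP t\<in>{0..T}. \<bar>enn2ereal (A t \<omega>) - enn2ereal (A' t \<omega>)\<bar>)}
     \<le> emeasure (law X (Some x)) (hit (- Some ` F) 0 (ennreal (T + 1))) + ennreal (2 * (2 * c * (3 * B + 2 * c) / l\<^sup>2))"
    (is "emeasure _ ?bad \<le> emeasure _ ?hit + _")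
proof -
  note A = RevuzD(1)[OF R] RevuzD(1)[OF R']
  let ?dev = "\<Union>t\<in>dyadics. deviation V A A' (2 * l) t"
  have hit: "?hit \<in> sets (Pr (Some x))"
    using hit_natural[OF openin_state_Compl_compact[OF F(1)] top_greatest] natural_subset_augm augm_subset_Pr by blast
  have hl: "?hit \<in> sets (law X (Some x))"
    using hit_natural[OF openin_state_Compl_compact[OF F(1)] top_greatest] natural_subset_law by blast
  have dev: "?dev \<in> sets (Pr (Some x))"
  proof (rule sets.countable_UN'[OF countable_dyadics], rule image_subsetI)
    show "deviation V A A' (2 * l) t \<in> sets (Pr (Some x))" if "t \<in> dyadics" for t
      using deviation_augm[OF A dyadics_nonneg[OF that]] augm_subset_Pr by blast
  qed
  have "emeasure (Pr (Some x)) ?bad \<le> emeasure (Pr (Some x)) (?hit \<union> ?dev)"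
  proof (rule emeasure_mono_AE)
    show "AE \<omega> in Pr (Some x). \<omega> \<in> ?bad \<longrightarrow> \<omega> \<in> ?hit \<union> ?dev"
      using AE_good_Pr[OF A(1), of x] AE_good_Pr[OF A(2), of x]
    proof eventually_elim
      case (elim \<omega>)
      show ?case
      proof (rule impI, rule ccontr)
        assume bad: "\<omega> \<in> ?bad" and "\<omega> \<notin> ?hit \<union> ?dev"
        then have nh: "\<omega> \<notin> ?hit" and nd: "\<omega> \<notin> ?dev" by auto
        have om: "\<omega> \<in> sample_space X" by (rule goodD(1)[OF elim(1)])
        have inV: "pos \<omega> s \<in> V" if "0 < s" "s \<le> T" for s
        proof -
          have "ennreal s < ennreal (T + 1)" using that by (intro ennreal_lessI) auto
          then have "path X (ennreal s) \<omega> \<in> Some ` F" using nh om by (auto simp: hit_def)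
          then show ?thesis using goodD(2)[OF elim(1), of s] F(2) by auto
        qed
        have close: "\<bar>enn2real (functional V A r \<omega>) - enn2real (functional V A' r \<omega>)\<bar> \<le> 2 * l" if "r \<in> dyadics" for r
          using nd om that by (force simp: deviation_def)
        have close': "\<bar>enn2real (functional V A' r \<omega>) - enn2real (functional V A r \<omega>)\<bar> \<le> 2 * l" if "r \<in> dyadics" for r
          using close[OF that] by (simp add: abs_minus_commute)
        have "(SUP t\<in>{0..T}. \<bar>enn2ereal (A t \<omega>) - enn2ereal (A' t \<omega>)\<bar>) \<le> ereal e"
        proof (rule SUP_least)
          fix t assume "t \<in> {0..T}"
          then have t: "0 \<le> t" "t \<le> T" by auto
          define a b where "a = enn2real (A t \<omega>)" and "b = enn2real (A' t \<omega>)"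
          have ab: "A t \<omega> = ennreal a" "A' t \<omega> = ennreal b" "0 \<le> a" "0 \<le> b"
            using clockD(4)[OF goodD(5)[OF elim(1)] t(1)] clockD(4)[OF goodD(5)[OF elim(2)] t(1)] by (simp_all add: a_def b_def)
          have ex: "2 * (2 * l) * exp t \<le> e"
          proof -
            have "4 * l * exp t \<le> 4 * l * exp T" using l t by (intro mult_left_mono) auto
            then show ?thesis using e by simp
          qed
          have e0: "0 \<le> 2 * (2 * l) * exp t" using l by simp
          have "ennreal a \<le> ennreal (b + 2 * (2 * l) * exp t)"
            using PCAF_le_of_functional_close[OF elim(1,2) V t inV close] ab e0 by simp
          then have 1: "a \<le> b + e" using ab(4) e0 ex by (subst (asm) ennreal_le_iff) auto
          have "ennreal b \<le> ennreal (a + 2 * (2 * l) * exp t)"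
            using PCAF_le_of_functional_close[OF elim(2,1) V t inV close'] ab e0 by simp
          then have 2: "b \<le> a + e" using ab(3) e0 ex by (subst (asm) ennreal_le_iff) auto
          show "\<bar>enn2ereal (A t \<omega>) - enn2ereal (A' t \<omega>)\<bar> \<le> ereal e"
            using 1 2 ab by (simp add: enn2ereal_ennreal)
        qed
        moreover have "ereal e < (SUP t\<in>{0..T}. \<bar>enn2ereal (A t \<omega>) - enn2ereal (A' t \<omega>)\<bar>)"
          using bad by blast
        ultimately show False by (rule leD[THEN notE])
      qed
    qed
    show "?hit \<union> ?dev \<in> sets (Pr (Some x))" using hit dev by (rule sets.Un)
  qed
  also have "\<dots> \<le> emeasure (Pr (Some x)) ?hit + emeasure (Pr (Some x)) ?dev"
    using hit dev by (rule emeasure_subadditive)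
  also have "\<dots> \<le> emeasure (law X (Some x)) ?hit + ennreal (2 * (2 * c * (3 * B + 2 * c) / l\<^sup>2))"
    using hl by (intro add_mono maximal_deviation[OF R V S R' S' le ge B c l small]) simp
  finally show ?thesis .
qed

end

section \<open>Excessive functions of a Feller process\<close>

lemma continuous_map_state_borel:
  fixes f :: "'a::topological_space option \<Rightarrow> real"
  assumes "continuous_map state_topology euclideanreal f"
  shows "f \<in> borel_measurable state_borel"
proof (rule borel_measurableI)
  fix S :: "real set" assume "open S"
  then have "openin state_topology {z \<in> topspace state_topology. f z \<in> S}"
    using assms by (auto simp: continuous_map_def)
  then show "f -` S \<inter> space state_borel \<in> sets state_borel"
    by (intro openin_state_borel) (simp add: vimage_def del: topspace_Alexandroff_compactification)
qed

lemma limitin_state_None: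
  fixes y :: "nat \<Rightarrow> 'a::topological_space"
  assumes "\<And>C. compact C \<Longrightarrow> eventually (\<lambda>n. y n \<notin> C) sequentially"
  shows "limitin state_topology (\<lambda>n. Some (y n)) None sequentially"
  unfolding limitin_def topspace_state_topology
proof (intro conjI allI impI UNIV_I)
  fix U :: "'a option set" assume U: "openin state_topology U \<and> None \<in> U"
  then obtain C where C: "compact C" "U = insert None (Some ` (UNIV - C))"
    unfolding openin_Alexandroff_compactification by auto
  show "eventually (\<lambda>n. Some (y n) \<in> U) sequentially"
    using assms[OF C(1)] by eventually_elim (simp add: C(2))
qed

lemma nn_integral_exp_minus: "(\<integral>\<^sup>+r\<in>{0..}. ennreal (exp (- r)) \<partial>lborel) = 1"
proof -
  have "(\<integral>\<^sup>+r. ennreal (exp (- r)) * indicator {0..} r \<partial>lborel) = ennreal (0 - (- exp (- 0)))"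
  proof (rule nn_integral_FTC_atLeast)
    show "((\<lambda>r::real. - exp (- r)) \<longlongrightarrow> 0) at_top"
      using tendsto_minus[OF filterlim_compose[OF exp_at_bot filterlim_uminus_at_bot_at_top]] by simp
  qed (auto intro!: derivative_eq_intros)
  then show ?thesis by simp
qed

text \<open>Dini's theorem on a compact set: the open sets \<open>{x. h k x < e}\<close> increase
  with \<open>k\<close> and cover \<open>K\<close>, so one of them contains it.\<close>

lemma decseq_uniformly_small:
  fixes h :: "nat \<Rightarrow> 'a::topological_space \<Rightarrow> real"
  assumes K: "compact K" and h: "\<And>k. continuous_on UNIV (h k)" and dec: "\<And>x. decseq (\<lambda>k. h k x)"
    and lim: "\<And>x. (\<lambda>k. h k x) \<longlonglongrightarrow> 0" and e: "0 < e"
  obtains k where "\<And>x. x \<in> K \<Longrightarrow> h k x < e"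
proof -
  have op: "open {x. h k x < e}" for k
    by (intro open_Collect_less h continuous_intros)
  have inc: "incseq (\<lambda>k. {x. h k x < e})"
    using dec by (auto simp: incseq_def decseq_def intro: le_less_trans)
  have "K \<subseteq> (\<Union>k. {x. h k x < e})"
  proof
    fix x
    have "eventually (\<lambda>k. h k x < e) sequentially" using order_tendstoD(2)[OF lim e] .
    then show "x \<in> (\<Union>k. {x. h k x < e})" by (auto simp: eventually_sequentially)
  qed
  from compact_subset_incseq_open[OF inc op K this] obtain k where "K \<subseteq> {x. h k x < e}" .
  then show thesis using that by blast
qed

locale Feller_setting = Revuz_setting X p
  for X :: "('w, 'a::{metric_space, second_countable_topology}) process" and p +
  fixes V :: "nat \<Rightarrow> 'a set"
  assumes Feller: "Feller X"
    and V: "incseq V" "\<And>k. open (V k)" "\<And>k. compact (closure (V k))" "(\<Union>k. V k) = UNIV"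
begin

lemma compact_subset_V:
  assumes "compact K"
  obtains k where "K \<subseteq> V k"
  using compact_subset_incseq_open[OF V(1,2) assms] V(4) by auto

text \<open>Sequences suffice because the state space is metric and exhausted by the
  \<open>V k\<close>. If the complement of a preimage lay in no \<open>closure (V k)\<close>, points
  of it chosen outside each of these sets would leave every compact set, against the second
  condition; so the complement is compact and the preimage is a neighbourhood of the
  cemetery.\<close>

lemma continuous_map_stateI:
  fixes g :: "'a option \<Rightarrow> real"
  assumes 1: "\<And>y z. y \<longlonglongrightarrow> z \<Longrightarrow> (\<lambda>n. g (Some (y n))) \<longlonglongrightarrow> g (Some z)"
    and 2: "\<And>y. (\<And>C. compact C \<Longrightarrow> eventually (\<lambda>n. y n \<notin> C) sequentially) \<Longrightarrow> (\<lambda>n. g (Some (y n))) \<longlonglongrightarrow> g None"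
  shows "continuous_map state_topology euclideanreal g"
  unfolding continuous_map_def topspace_state_topology
proof (intro conjI allI impI)
  fix S :: "real set" assume "openin euclideanreal S"
  then have S: "open S" by simp
  have c: "continuous_on UNIV (\<lambda>y. g (Some y))"
    unfolding continuous_on_sequentially comp_def using 1 by blast
  then have op: "open {y. g (Some y) \<in> S}"
    using S by (simp add: continuous_on_open_vimage vimage_def)
  show "openin state_topology {z \<in> UNIV. g z \<in> S}"
  proof (cases "g None \<in> S")
    case False
    then have "{z \<in> UNIV. g z \<in> S} = Some ` {y. g (Some y) \<in> S}"
    proof (intro set_eqI)
      show "(z \<in> {z \<in> UNIV. g z \<in> S}) = (z \<in> Some ` {y. g (Some y) \<in> S})" for z
        using False by (cases z) auto
    qed
    then show ?thesis using op by simp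
  next
    case True
    let ?C = "- {y. g (Some y) \<in> S}"
    have cl: "closed ?C" using op by (simp add: closed_def)
    have "\<exists>k. ?C \<subseteq> closure (V k)"
    proof (rule ccontr)
      assume "\<nexists>k. ?C \<subseteq> closure (V k)"
      then have "\<forall>k. \<exists>y. g (Some y) \<notin> S \<and> y \<notin> closure (V k)" by blast
      then obtain y where y: "\<And>k. g (Some (y k)) \<notin> S" "\<And>k. y k \<notin> closure (V k)" by metis
      have "(\<lambda>n. g (Some (y n))) \<longlonglongrightarrow> g None"
      proof (rule 2)
        fix C :: "'a set" assume "compact C"
        then obtain k where k: "C \<subseteq> V k" by (rule compact_subset_V)
        have "y n \<notin> C" if "n \<ge> k" for n
          using y(2)[of n] k incseqD[OF V(1) that] closure_subset[of "V n"] by blast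
        then show "eventually (\<lambda>n. y n \<notin> C) sequentially" by (auto simp: eventually_sequentially)
      qed
      then have "eventually (\<lambda>n. g (Some (y n)) \<in> S) sequentially"
        using S True by (rule topological_tendstoD)
      then show False using y(1) by simp
    qed
    then obtain k where "?C \<subseteq> closure (V k)" by blast
    then have "compact ?C" using compact_Int_closed[OF V(3)[of k] cl] by (simp add: Int_absorb1)
    moreover have "{z \<in> UNIV. g z \<in> S} = - Some ` ?C"
    proof (rule set_eqI)
      show "(z \<in> {z \<in> UNIV. g z \<in> S}) = (z \<in> - Some ` ?C)" for z
        using True by (cases z) auto
    qed
    ultimately show ?thesis using openin_state_Compl_compact by metis
  qed
qed auto

lemma continuous_map_stateD:
  fixes g :: "'a option \<Rightarrow> real"
  assumes g: "continuous_map state_topology euclideanreal g"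
  shows "y \<longlonglongrightarrow> z \<Longrightarrow> (\<lambda>n. g (Some (y n))) \<longlonglongrightarrow> g (Some z)"
    and "(\<And>C. compact C \<Longrightarrow> eventually (\<lambda>n. y n \<notin> C) sequentially) \<Longrightarrow> (\<lambda>n. g (Some (y n))) \<longlonglongrightarrow> g None"
proof -
  assume "y \<longlonglongrightarrow> z"
  then have "limitin euclidean y z sequentially" by simp
  from continuous_map_limit[OF continuous_map_Some this]
  have "limitin state_topology (\<lambda>n. Some (y n)) (Some z) sequentially" by (simp add: comp_def)
  from continuous_map_limit[OF g this] show "(\<lambda>n. g (Some (y n))) \<longlonglongrightarrow> g (Some z)" by (simp add: comp_def)
next
  assume "\<And>C. compact C \<Longrightarrow> eventually (\<lambda>n. y n \<notin> C) sequentially"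
  from continuous_map_limit[OF g limitin_state_None[OF this]]
  show "(\<lambda>n. g (Some (y n))) \<longlonglongrightarrow> g None" by (simp add: comp_def)
qed

section \<open>Excessive functions and their second moments\<close>

definition C01 :: "('a option \<Rightarrow> real) set" where
  "C01 = {g. continuous_map state_topology euclideanreal g \<and> g None = 0 \<and> (\<forall>z. 0 \<le> g z \<and> g z \<le> 1)}"

lemma C01D:
  assumes "g \<in> C01"
  shows "continuous_map state_topology euclideanreal g" "g None = 0" "0 \<le> g z" "g z \<le> 1"
    and "g \<in> borel_measurable state_borel"
  using assms continuous_map_state_borel by (auto simp: C01_def)

lemma integrable_C01:
  assumes "g \<in> C01"
  shows "integrable (law X z) (\<lambda>\<omega>. g (path X t \<omega>))"
proof (rule finite_measure.integrable_const_bound[OF prob_space.finite_measure[OF prob_law], where B=1])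
  show "(\<lambda>\<omega>. g (path X t \<omega>)) \<in> borel_measurable (law X z)"
    by (rule measurable_compose[OF path_measurable_law C01D(5)[OF assms]])
qed (use C01D(3,4)[OF assms] in auto)

lemma transition_C01:
  assumes "g \<in> C01"
  shows "0 \<le> transition X t g z" "transition X t g z \<le> 1"
    and "ennreal (transition X t g z) = (\<integral>\<^sup>+\<omega>. ennreal (g (path X (ennreal t) \<omega>)) \<partial>law X z)"
proof -
  interpret prob_space "law X z" by (rule prob_law)
  show "0 \<le> transition X t g z"
    unfolding transition_def using C01D(3)[OF assms] by (intro Bochner_Integration.integral_nonneg) auto
  have "transition X t g z \<le> (\<integral>\<omega>. 1 \<partial>law X z)"
    unfolding transition_def by (rule integral_mono[OF integrable_C01[OF assms]]) (use C01D(4)[OF assms] in auto)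
  then show "transition X t g z \<le> 1" using prob_space by simp
  show "ennreal (transition X t g z) = (\<integral>\<^sup>+\<omega>. ennreal (g (path X (ennreal t) \<omega>)) \<partial>law X z)"
    unfolding transition_def using C01D(3)[OF assms] by (intro nn_integral_eq_integral[symmetric] integrable_C01 assms) auto
qed

lemma transition_continuous: "g \<in> C01 \<Longrightarrow> 0 < t \<Longrightarrow> continuous_map state_topology euclideanreal (transition X t g)"
  and transition_tendsto: "g \<in> C01 \<Longrightarrow> ((\<lambda>t. transition X t g z) \<longlongrightarrow> g z) (at_right 0)"
  using Feller unfolding Feller_def C01_def by blast+

definition excessive_rate :: "real \<Rightarrow> ('a option \<Rightarrow> real) \<Rightarrow> bool" where
  "excessive_rate \<alpha> g \<longleftrightarrow> (\<forall>t>0. \<forall>z. exp (- \<alpha> * t) * transition X t g z \<le> g z)"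

lemma sample_space_filt: "sample_space X \<in> sets (filt t)"
  using sets.top[of "filt t"] by (simp add: filt.space_F)

lemma transition_add:
  assumes g: "g \<in> C01" and "0 \<le> s" "0 \<le> t"
  shows "ennreal (transition X (s + t) g z) = (\<integral>\<^sup>+\<omega>. ennreal (transition X t g (path X (ennreal s) \<omega>)) \<partial>law X z)"
proof -
  have m: "(\<lambda>z. ennreal (g z)) \<in> borel_measurable state_borel"
    using C01D(5)[OF g] by measurable
  have "(\<integral>\<^sup>+\<omega>. ennreal (g (path X (ennreal (s + t)) \<omega>)) \<partial>law X z) = (\<integral>\<^sup>+\<omega>. indicator (sample_space X) \<omega> * ennreal (g (path X (ennreal s + ennreal t) \<omega>)) \<partial>law X z)"
    using assms by (intro nn_integral_cong) simp
  also have "\<dots> = (\<integral>\<^sup>+\<omega>. indicator (sample_space X) \<omega> * (\<integral>\<^sup>+\<omega>'. ennreal (g (path X (ennreal t) \<omega>')) \<partial>law X (path X (ennreal s) \<omega>)) \<partial>law X z)"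
    by (rule Markov_one_time_fun(2)[OF sample_space_filt m])
  also have "\<dots> = (\<integral>\<^sup>+\<omega>. ennreal (transition X t g (path X (ennreal s) \<omega>)) \<partial>law X z)"
    by (intro nn_integral_cong) (simp add: transition_C01(3)[OF g])
  finally show ?thesis by (simp only: transition_C01(3)[OF g])
qed

text \<open>By the semigroup property T_t g = T_s (T_(t-s) g), and the excessive inequality is
  applied to the inner factor.\<close>

lemma excessive_rate_antimono:
  assumes g: "g \<in> C01" and ex: "excessive_rate \<alpha> g" and st: "0 < s" "s < t"
  shows "exp (- \<alpha> * t) * transition X t g z \<le> exp (- \<alpha> * s) * transition X s g z"
proof -
  let ?r = "t - s"
  have le: "transition X ?r g y \<le> exp (\<alpha> * ?r) * g y" for y
  proof -
    have "exp (- \<alpha> * ?r) * transition X ?r g y \<le> g y"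
      using ex st unfolding excessive_rate_def by simp
    then have "exp (\<alpha> * ?r) * (exp (- \<alpha> * ?r) * transition X ?r g y) \<le> exp (\<alpha> * ?r) * g y"
      by (rule mult_left_mono) simp
    then show ?thesis by (simp add: mult.assoc[symmetric] exp_add[symmetric])
  qed
  have m: "(\<lambda>\<omega>. ennreal (g (path X (ennreal s) \<omega>))) \<in> borel_measurable (law X z)"
    using measurable_compose[OF path_measurable_law C01D(5)[OF g]] by measurable
  have "ennreal (transition X t g z) = (\<integral>\<^sup>+\<omega>. ennreal (transition X ?r g (path X (ennreal s) \<omega>)) \<partial>law X z)"
    using transition_add[OF g, of s ?r z] st by simp
  also have "\<dots> \<le> (\<integral>\<^sup>+\<omega>. ennreal (exp (\<alpha> * ?r)) * ennreal (g (path X (ennreal s) \<omega>)) \<partial>law X z)"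
    using le C01D(3)[OF g] by (intro nn_integral_mono) (simp add: ennreal_mult[symmetric] ennreal_leI)
  also have "\<dots> = ennreal (exp (\<alpha> * ?r)) * ennreal (transition X s g z)"
    unfolding transition_C01(3)[OF g] by (rule nn_integral_cmult[OF m])
  also have "\<dots> = ennreal (exp (\<alpha> * ?r) * transition X s g z)"
    using transition_C01(1)[OF g] by (simp add: ennreal_mult)
  finally have "transition X t g z \<le> exp (\<alpha> * ?r) * transition X s g z"
    using transition_C01(1)[OF g] by (subst (asm) ennreal_le_iff) auto
  then have "exp (- \<alpha> * t) * transition X t g z \<le> exp (- \<alpha> * t) * (exp (\<alpha> * ?r) * transition X s g z)"
    by (rule mult_left_mono) simp
  also have "\<dots> = exp (- \<alpha> * s) * transition X s g z"
  proof -
    have "- \<alpha> * t + \<alpha> * ?r = - \<alpha> * s" by (simp add: algebra_simps)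
    then have "exp (- \<alpha> * t) * exp (\<alpha> * ?r) = exp (- \<alpha> * s)" by (simp only: exp_add[symmetric])
    then show ?thesis by (simp only: mult.assoc[symmetric])
  qed
  finally show ?thesis .
qed

text \<open>Dini's theorem: the increase of \<open>e\<^sup>-\<^sup>\<alpha>\<^sup>t T\<^sub>t g\<close> to \<open>g\<close> is uniform on the compact space.\<close>

lemma excessive_uniform:
  assumes g: "g \<in> C01" and ex: "excessive_rate \<alpha> g" and e: "0 < e"
  obtains d where "0 < d" "\<And>s z. 0 < s \<Longrightarrow> s < d \<Longrightarrow> g z - exp (- \<alpha> * s) * transition X s g z < e"
proof -
  let ?D = "\<lambda>n::nat. {z. g z - exp (- \<alpha> * (1 / Suc n)) * transition X (1 / Suc n) g z < e}"
  have op: "openin state_topology (?D n)" for n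
  proof -
    have "continuous_map state_topology euclideanreal (\<lambda>z. g z - exp (- \<alpha> * (1 / Suc n)) * transition X (1 / Suc n) g z)"
      by (intro continuous_map_diff continuous_map_real_mult continuous_map_const[THEN iffD2] C01D(1)[OF g] transition_continuous[OF g]) auto
    then have "openin state_topology {z \<in> topspace state_topology. g z - exp (- \<alpha> * (1 / Suc n)) * transition X (1 / Suc n) g z \<in> {..<e}}"
      by (rule openin_continuous_map_preimage) simp
    then show ?thesis unfolding topspace_state_topology by simp
  qed
  have cov: "topspace (state_topology :: 'a option topology) \<subseteq> \<Union> (range ?D)"
  proof
    fix z
    have "((\<lambda>t. g z - exp (- \<alpha> * t) * transition X t g z) \<longlongrightarrow> g z - exp (- \<alpha> * 0) * g z) (at_right 0)"
      by (intro tendsto_intros transition_tendsto[OF g])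
    then have "eventually (\<lambda>t. g z - exp (- \<alpha> * t) * transition X t g z < e) (at_right 0)"
      using e by (intro order_tendstoD(2)) auto
    then obtain b where b: "0 < b" "\<And>t. 0 < t \<Longrightarrow> t < b \<Longrightarrow> g z - exp (- \<alpha> * t) * transition X t g z < e"
      by (auto simp: eventually_at_right[OF zero_less_one])
    obtain n where "1 / real (Suc n) < b" using nat_approx_posE[OF b(1)] .
    then have "z \<in> ?D n" using b(2)[of "1 / Suc n"] by simp
    then show "z \<in> \<Union> (range ?D)" by blast
  qed
  obtain \<F> where F: "finite \<F>" "\<F> \<subseteq> range ?D" "topspace (state_topology :: 'a option topology) \<subseteq> \<Union>\<F>"
    using compact_space_Alexandroff_compactification[of "euclidean :: 'a topology", unfolded compact_space_alt, rule_format, of "range ?D"] op cov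
    by (auto simp del: topspace_Alexandroff_compactification)
  then obtain N where N: "finite N" "\<F> = ?D ` N" by (meson finite_subset_image)
  define M where "M = Max (insert 0 N)"
  have nM: "n \<le> M" if "n \<in> N" for n unfolding M_def using N(1) that by simp
  show thesis
  proof (rule that[of "1 / Suc M"])
    fix s z assume s: "0 < s" "s < 1 / real (Suc M)"
    have "z \<in> \<Union>\<F>" using F(3) unfolding topspace_state_topology by blast
    then obtain n where n: "n \<in> N" "z \<in> ?D n" using N(2) by blast
    have "1 / real (Suc M) \<le> 1 / real (Suc n)" using nM[OF n(1)] by (simp add: field_simps)
    then have "s < 1 / real (Suc n)" using s(2) by simp
    from excessive_rate_antimono[OF g ex s(1) this, of z] n(2)
    show "g z - exp (- \<alpha> * s) * transition X s g z < e" by simp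
  qed simp
qed

text \<open>The transform is 1 - (1 - g)^2, an increasing concave map of [0,1] into itself that
  fixes 0.\<close>

lemma C01_concave_transform:
  assumes g: "g \<in> C01"
  shows "(\<lambda>z. 2 * g z - (g z)\<^sup>2) \<in> C01"
  unfolding C01_def
proof (intro CollectI conjI allI)
  show "continuous_map state_topology euclideanreal (\<lambda>z. 2 * g z - (g z)\<^sup>2)"
    by (intro continuous_map_diff continuous_map_real_mult continuous_map_real_pow continuous_map_const[THEN iffD2] C01D(1)[OF g]) auto
  show "2 * g None - (g None)\<^sup>2 = 0" using C01D(2)[OF g] by simp
  fix z
  have "(g z)\<^sup>2 \<le> 1 * g z" unfolding power2_eq_square using C01D(3,4)[OF g, of z] by (intro mult_right_mono)
  then show "0 \<le> 2 * g z - (g z)\<^sup>2" using C01D(3)[OF g, of z] by simp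
  have "0 \<le> (1 - g z)\<^sup>2" by simp
  then show "2 * g z - (g z)\<^sup>2 \<le> 1" by (simp add: power2_eq_square algebra_simps)
qed

lemma transition_concave_transform:
  assumes g: "g \<in> C01"
  shows "integrable (law X z) (\<lambda>\<omega>. (g (path X t \<omega>))\<^sup>2)"
    and "transition X t (\<lambda>z. 2 * g z - (g z)\<^sup>2) z = 2 * transition X t g z - (\<integral>\<omega>. (g (path X (ennreal t) \<omega>))\<^sup>2 \<partial>law X z)"
    and "(transition X t g z)\<^sup>2 \<le> (\<integral>\<omega>. (g (path X (ennreal t) \<omega>))\<^sup>2 \<partial>law X z)"
proof -
  interpret prob_space "law X z" by (rule prob_law)
  have i2: "integrable (law X z) (\<lambda>\<omega>. (g (path X t \<omega>))\<^sup>2)" for t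
  proof (rule integrable_const_bound[where B=1])
    show "(\<lambda>\<omega>. (g (path X t \<omega>))\<^sup>2) \<in> borel_measurable (law X z)"
      using measurable_compose[OF path_measurable_law C01D(5)[OF g]] by measurable
  qed (use C01D(3,4)[OF g] in \<open>auto intro: power_le_one\<close>)
  then show "integrable (law X z) (\<lambda>\<omega>. (g (path X t \<omega>))\<^sup>2)" .
  note i1 = integrable_C01[OF g, of z "ennreal t"]
  show "transition X t (\<lambda>z. 2 * g z - (g z)\<^sup>2) z = 2 * transition X t g z - (\<integral>\<omega>. (g (path X (ennreal t) \<omega>))\<^sup>2 \<partial>law X z)"
    unfolding transition_def using i1 i2[of "ennreal t"] by simp
  have "0 \<le> variance (\<lambda>\<omega>. g (path X (ennreal t) \<omega>))" by (rule variance_positive)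
  then show "(transition X t g z)\<^sup>2 \<le> (\<integral>\<omega>. (g (path X (ennreal t) \<omega>))\<^sup>2 \<partial>law X z)"
    unfolding variance_eq[OF i1 i2] transition_def by simp
qed

text \<open>Jensen's inequality: an increasing concave function of a supermedian function is supermedian.
  With \<open>2 g - g\<^sup>2\<close> this makes the convergence of the second moments uniform as well.\<close>

lemma excessive_concave_transform:
  assumes g: "g \<in> C01" and ex: "excessive_rate \<alpha> g" and \<alpha>: "0 \<le> \<alpha>"
  shows "excessive_rate \<alpha> (\<lambda>z. 2 * g z - (g z)\<^sup>2)"
  unfolding excessive_rate_def
proof (intro allI impI)
  fix t :: real and z assume t: "0 < t"
  define a where "a = exp (- \<alpha> * t)"
  define m where "m = transition X t g z"
  define q where "q = (\<integral>\<omega>. (g (path X (ennreal t) \<omega>))\<^sup>2 \<partial>law X z)"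
  have a: "0 \<le> a" "a \<le> 1" using \<alpha> t by (auto simp: a_def)
  have mq: "m\<^sup>2 \<le> q" "0 \<le> m" unfolding m_def q_def using transition_concave_transform(3)[OF g] transition_C01(1)[OF g] by auto
  have am: "a * m \<le> g z" using ex t unfolding excessive_rate_def a_def m_def by simp
  have "a * (a * m\<^sup>2) \<le> a * (1 * q)"
    using a mq by (intro mult_left_mono mult_mono) auto
  then have "a * (2 * m - q) \<le> 2 * (a * m) - (a * m)\<^sup>2"
    by (simp add: algebra_simps power2_eq_square)
  also have "\<dots> \<le> 2 * g z - (g z)\<^sup>2"
  proof -
    have "0 \<le> (g z - a * m) * (2 - g z - a * m)"
      using am C01D(4)[OF g, of z] by (intro mult_nonneg_nonneg) auto
    then show ?thesis by (simp add: algebra_simps power2_eq_square)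
  qed
  finally show "exp (- \<alpha> * t) * transition X t (\<lambda>z. 2 * g z - (g z)\<^sup>2) z \<le> 2 * g z - (g z)\<^sup>2"
    unfolding transition_concave_transform(2)[OF g] a_def m_def q_def .
qed

text \<open>Expanding the square calls for a lower bound of the first moment and an upper bound of
  the second. The uniform convergence for \<open>g\<close> gives the former. In the transform 2g -
  g^2 the second moment enters with a minus sign, so the uniform lower bound for the transform gives
  the latter.\<close>

lemma second_moment_uniform:
  assumes g: "g \<in> C01" and ex: "excessive_rate \<alpha> g" and \<alpha>: "0 \<le> \<alpha>" and e: "0 < e"
  obtains d where "0 < d"
    "\<And>s z. 0 < s \<Longrightarrow> s < d \<Longrightarrow> (\<integral>\<omega>. (g (path X (ennreal s) \<omega>) - g z)\<^sup>2 \<partial>law X z) \<le> e"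
proof -
  \<comment> \<open>The final error is h + 2h + 2h, hence the division by 5; h \<le> 1 keeps the
    factor e^(\<alpha> s) below 2.\<close>
  define h where "h = min 1 (e / 5)"
  have h: "0 < h" "h \<le> 1" "5 * h \<le> e" using e by (auto simp: h_def)
  obtain d1 where d1: "0 < d1" "\<And>s z. 0 < s \<Longrightarrow> s < d1 \<Longrightarrow> g z - exp (- \<alpha> * s) * transition X s g z < h"
    using excessive_uniform[OF g ex h(1)] by blast
  obtain d2 where d2: "0 < d2" "\<And>s z. 0 < s \<Longrightarrow> s < d2 \<Longrightarrow> 2 * g z - (g z)\<^sup>2 - exp (- \<alpha> * s) * transition X s (\<lambda>z. 2 * g z - (g z)\<^sup>2) z < h"
    using excessive_uniform[OF C01_concave_transform[OF g] excessive_concave_transform[OF g ex \<alpha>] h(1)] by blast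
  have "((\<lambda>s. exp (\<alpha> * s)) \<longlongrightarrow> exp (\<alpha> * 0)) (at_right 0)" by (intro tendsto_intros)
  then have "eventually (\<lambda>s. exp (\<alpha> * s) < 1 + h) (at_right 0)"
    using h by (intro order_tendstoD(2)) auto
  then obtain d3 where d3: "0 < d3" "\<And>s. 0 < s \<Longrightarrow> s < d3 \<Longrightarrow> exp (\<alpha> * s) < 1 + h"
    by (auto simp: eventually_at_right[OF zero_less_one])
  show thesis
  proof (rule that[of "min d1 (min d2 d3)"])
    fix s z assume s: "0 < s" "s < min d1 (min d2 d3)"
    interpret prob_space "law X z" by (rule prob_law)
    define b where "b = exp (\<alpha> * s)"
    define a where "a = exp (- \<alpha> * s)"
    define m where "m = transition X s g z"
    define q where "q = (\<integral>\<omega>. (g (path X (ennreal s) \<omega>))\<^sup>2 \<partial>law X z)"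
    have ab: "a * b = 1" by (simp add: a_def b_def exp_add[symmetric])
    have b: "1 \<le> b" "b \<le> 1 + h" using d3(2)[of s] s \<alpha> by (auto simp: b_def)
    have a: "0 < a" "a \<le> 1" using \<alpha> s by (auto simp: a_def)
    have g1: "0 \<le> g z" "g z \<le> 1" using C01D(3,4)[OF g] by auto
    have am: "a * m \<le> g z" using ex s unfolding excessive_rate_def a_def m_def by simp
    have m: "g z - h \<le> m"
    proof -
      have "g z - h \<le> a * m" using d1(2)[of s z] s by (simp add: a_def m_def)
      also have "\<dots> \<le> 1 * m" using a transition_C01(1)[OF g] unfolding m_def by (intro mult_right_mono) auto
      finally show ?thesis by simp
    qed
    have q: "q \<le> b * ((g z)\<^sup>2 + h)"
    proof -
      have "2 * g z - (g z)\<^sup>2 - h \<le> a * (2 * m - q)"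
        using d2(2)[of s z] s unfolding transition_concave_transform(2)[OF g] a_def m_def q_def by simp
      then have "a * q \<le> (g z)\<^sup>2 + h" using am by (simp add: algebra_simps)
      then have "b * (a * q) \<le> b * ((g z)\<^sup>2 + h)" using b by (intro mult_left_mono) auto
      then show ?thesis using ab by (simp add: mult.assoc[symmetric] mult.commute)
    qed
    note i1 = integrable_C01[OF g, of z "ennreal s"] and i2 = transition_concave_transform(1)[OF g, of z s]
    have "(\<integral>\<omega>. (g (path X (ennreal s) \<omega>) - g z)\<^sup>2 \<partial>law X z) = (\<integral>\<omega>. (g (path X (ennreal s) \<omega>))\<^sup>2 - 2 * g z * g (path X (ennreal s) \<omega>) + (g z)\<^sup>2 \<partial>law X z)"
      by (intro Bochner_Integration.integral_cong refl) (simp add: power2_eq_square algebra_simps)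
    also have "\<dots> = q - 2 * g z * m + (g z)\<^sup>2"
      using i1 i2 by (simp add: q_def m_def transition_def prob_space[simplified])
    also have "\<dots> \<le> b * ((g z)\<^sup>2 + h) - 2 * g z * (g z - h) + (g z)\<^sup>2"
      using q m g1 by (intro add_mono diff_mono mult_left_mono) auto
    also have "\<dots> = (b - 1) * (g z)\<^sup>2 + b * h + 2 * g z * h"
      by (simp add: algebra_simps power2_eq_square)
    also have "\<dots> \<le> h * 1 + 2 * h + 2 * 1 * h"
      using b h g1 by (intro add_mono mult_mono) (auto intro: power_le_one)
    also have "\<dots> \<le> e" using h by simp
    finally show "(\<integral>\<omega>. (g (path X (ennreal s) \<omega>) - g z)\<^sup>2 \<partial>law X z) \<le> e" .
  qed (use d1 d2 d3 in auto)
qed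

section \<open>Resolvents as a source of excessive functions\<close>

lemma C01_path_right_cont:
  assumes f: "f \<in> C01" and \<omega>: "\<omega> \<in> sample_space X"
  shows "((\<lambda>s. f (path X (ennreal s) \<omega>)) \<longlongrightarrow> f (path X (ennreal s) \<omega>)) (at_right s)"
proof (rule topological_tendstoI)
  fix S assume S: "open S" "f (path X (ennreal s) \<omega>) \<in> S"
  have "openin state_topology {z \<in> topspace state_topology. f z \<in> S}"
    using C01D(1)[OF f] S(1) by (intro openin_continuous_map_preimage) auto
  then have U: "openin state_topology {z. f z \<in> S}" "path X (ennreal s) \<omega> \<in> {z. f z \<in> S}"
    using S(2) unfolding topspace_state_topology by auto
  obtain b where b: "ennreal s < b" "\<And>r. ennreal s < r \<Longrightarrow> r < b \<Longrightarrow> path X r \<omega> \<in> {z. f z \<in> S}"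
    using path_open_right[OF \<omega> _ U] by auto
  have "((\<lambda>r. ennreal r) \<longlongrightarrow> ennreal s) (at_right s)" by (intro tendsto_intros)
  then have "eventually (\<lambda>r. ennreal r < b) (at_right s)" using b(1) by (rule order_tendstoD(2))
  moreover have "eventually (\<lambda>r. s < r) (at_right s)" by (rule eventually_at_right_less)
  ultimately show "eventually (\<lambda>r. f (path X (ennreal r) \<omega>) \<in> S) (at_right s)"
  proof eventually_elim
    case (elim r)
    have "ennreal s \<le> ennreal r" using elim(2) by (intro ennreal_leI) simp
    then show ?case using b(2)[of "ennreal r"] elim(1) U(2) by (cases "ennreal s = ennreal r") auto
  qed
qed

text \<open>Sampling at rounded-up times involves countably many coordinates of the path, and
  right-continuity passes to the limit. Fubini's theorem for the resolvent rests on this.\<close>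

lemma C01_path_jointly_measurable:
  assumes f: "f \<in> C01" and c: "0 < c"
  shows "(\<lambda>(\<omega>, r). f (path X (ennreal (r / c)) \<omega>)) \<in> borel_measurable (natural \<top> \<Otimes>\<^sub>M lborel)"
proof (rule borel_measurable_LIMSEQ_metric)
  fix m
  have "(\<lambda>p :: 'w \<times> real. f (path X (ennreal (of_int \<lceil>snd p * 2 ^ m\<rceil> / 2 ^ m / c)) (fst p))) \<in> borel_measurable (natural \<top> \<Otimes>\<^sub>M lborel)"
  proof (rule measurable_compose_countable[where f="\<lambda>k (p :: 'w \<times> real). f (path X (ennreal (of_int k / 2 ^ m / c)) (fst p))" and g="\<lambda>p :: 'w \<times> real. \<lceil>snd p * 2 ^ m\<rceil>"])
    fix k :: int
    show "(\<lambda>p :: 'w \<times> real. f (path X (ennreal (of_int k / 2 ^ m / c)) (fst p))) \<in> borel_measurable (natural \<top> \<Otimes>\<^sub>M lborel)"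
      by (rule measurable_compose[OF measurable_fst measurable_compose[OF path_natural[OF top_greatest] C01D(5)[OF f]]])
  qed measurable
  then show "(\<lambda>(\<omega>, r :: real). f (path X (ennreal (dyadic_ceil m r / c)) \<omega>)) \<in> borel_measurable (natural \<top> \<Otimes>\<^sub>M lborel)"
    by (simp add: dyadic_ceil_def case_prod_beta')
next
  fix p :: "'w \<times> real" assume "p \<in> space (natural \<top> \<Otimes>\<^sub>M lborel)"
  then obtain \<omega> r where p: "p = (\<omega>, r)" "\<omega> \<in> sample_space X" by (auto simp: space_pair_measure)
  have "(\<lambda>m. f (path X (ennreal (dyadic_ceil m r / c)) \<omega>)) \<longlonglongrightarrow> f (path X (ennreal (r / c)) \<omega>)"
  proof (rule right_cont_tendsto_sequentially[where h="\<lambda>s. f (path X (ennreal s) \<omega>)" and t="r / c" and r="\<lambda>m. dyadic_ceil m r / c"])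
    show "((\<lambda>s. f (path X (ennreal s) \<omega>)) \<longlongrightarrow> f (path X (ennreal (r / c)) \<omega>)) (at_right (r / c))"
      by (rule C01_path_right_cont[OF f p(2)])
    show "r / c \<le> dyadic_ceil m r / c" for m using dyadic_ceil_ge c by (intro divide_right_mono) auto
    show "(\<lambda>m. dyadic_ceil m r / c) \<longlonglongrightarrow> r / c" using c by (intro tendsto_divide dyadic_ceil_tendsto tendsto_const) auto
  qed
  then show "(\<lambda>m. case p of (\<omega>, r) \<Rightarrow> f (path X (ennreal (dyadic_ceil m r / c)) \<omega>)) \<longlonglongrightarrow> (case p of (\<omega>, r) \<Rightarrow> f (path X (ennreal (r / c)) \<omega>))"
    by (simp add: p)
qed

definition discounted :: "('a option \<Rightarrow> real) \<Rightarrow> real \<Rightarrow> 'w \<Rightarrow> ennreal" where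
  "discounted f c \<omega> = (\<integral>\<^sup>+r\<in>{0..}. ennreal (exp (- r)) * ennreal (f (path X (ennreal (r / c)) \<omega>)) \<partial>lborel)"

text \<open>The normalised resolvent \<open>c R\<^sub>c f\<close>, after the substitution \<open>r = c s\<close>.\<close>

definition resolvent :: "('a option \<Rightarrow> real) \<Rightarrow> real \<Rightarrow> 'a option \<Rightarrow> real" where
  "resolvent f c z = enn2real (\<integral>\<^sup>+\<omega>. discounted f c \<omega> \<partial>law X z)"

lemma discounted_measurable:
  assumes f: "f \<in> C01" and c: "0 < c"
  shows "discounted f c \<in> borel_measurable (natural \<top>)"
proof -
  note [measurable] = C01_path_jointly_measurable[OF assms]
  show ?thesis unfolding discounted_def[abs_def] by (rule lborel.borel_measurable_nn_integral) measurable
qed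

lemma resolvent_eq:
  assumes f: "f \<in> C01" and c: "0 < c"
  shows "ennreal (resolvent f c z) = (\<integral>\<^sup>+\<omega>. discounted f c \<omega> \<partial>law X z)"
    and "(\<integral>\<^sup>+\<omega>. discounted f c \<omega> \<partial>law X z) = (\<integral>\<^sup>+r\<in>{0..}. ennreal (exp (- r)) * ennreal (transition X (r / c) f z) \<partial>lborel)"
    and "(\<lambda>r. ennreal (transition X (r / c) f z)) \<in> borel_measurable borel"
    and "0 \<le> resolvent f c z" "resolvent f c z \<le> 1"
proof -
  interpret P: prob_space "law X z" by (rule prob_law)
  interpret PP: pair_sigma_finite "law X z" lborel ..
  have "(\<lambda>p. p) \<in> law X z \<Otimes>\<^sub>M lborel \<rightarrow>\<^sub>M natural \<top> \<Otimes>\<^sub>M (lborel :: real measure)"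
  proof -
    have "(\<lambda>p. (fst p, snd p)) \<in> law X z \<Otimes>\<^sub>M lborel \<rightarrow>\<^sub>M natural \<top> \<Otimes>\<^sub>M (lborel :: real measure)"
      by (intro measurable_Pair measurable_compose[OF measurable_fst natural_measurable_law[OF measurable_ident_sets[OF refl]]] measurable_snd)
    then show ?thesis by simp
  qed
  from measurable_compose[OF this C01_path_jointly_measurable[OF assms]]
  have j: "(\<lambda>(\<omega>, r). f (path X (ennreal (r / c)) \<omega>)) \<in> borel_measurable (law X z \<Otimes>\<^sub>M lborel)" .
  note [measurable] = j
  have sw: "(\<lambda>(r, \<omega>). f (path X (ennreal (r / c)) \<omega>)) \<in> borel_measurable (lborel \<Otimes>\<^sub>M law X z)"
    using measurable_pair_swap[OF j] by (simp add: case_prod_beta')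
  have tr: "ennreal (transition X (r / c) f z) = (\<integral>\<^sup>+\<omega>. ennreal (f (path X (ennreal (r / c)) \<omega>)) \<partial>law X z)" for r
    by (rule transition_C01(3)[OF f])
  have "(\<lambda>r. \<integral>\<^sup>+\<omega>. ennreal (f (path X (ennreal (r / c)) \<omega>)) \<partial>law X z) \<in> borel_measurable lborel"
    using sw by (intro P.borel_measurable_nn_integral) measurable
  then show m: "(\<lambda>r. ennreal (transition X (r / c) f z)) \<in> borel_measurable borel"
    unfolding tr by simp
  have "(\<integral>\<^sup>+\<omega>. discounted f c \<omega> \<partial>law X z) = (\<integral>\<^sup>+r. (\<integral>\<^sup>+\<omega>. ennreal (exp (- r)) * ennreal (f (path X (ennreal (r / c)) \<omega>)) * indicator {0..} r \<partial>law X z) \<partial>lborel)"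
    unfolding discounted_def by (rule PP.Fubini'[symmetric]) measurable
  also have "\<dots> = (\<integral>\<^sup>+r\<in>{0..}. ennreal (exp (- r)) * ennreal (transition X (r / c) f z) \<partial>lborel)"
  proof (intro nn_integral_cong)
    fix r
    have "(\<lambda>\<omega>. ennreal (f (path X (ennreal (r / c)) \<omega>))) \<in> borel_measurable (law X z)"
      using measurable_compose[OF path_measurable_law C01D(5)[OF f]] by measurable
    then show "(\<integral>\<^sup>+\<omega>. ennreal (exp (- r)) * ennreal (f (path X (ennreal (r / c)) \<omega>)) * indicator {0..} r \<partial>law X z) = ennreal (exp (- r)) * ennreal (transition X (r / c) f z) * indicator {0..} r"
      unfolding tr by (simp add: nn_integral_cmult nn_integral_multc)
  qed
  finally show F: "(\<integral>\<^sup>+\<omega>. discounted f c \<omega> \<partial>law X z) = (\<integral>\<^sup>+r\<in>{0..}. ennreal (exp (- r)) * ennreal (transition X (r / c) f z) \<partial>lborel)" .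
  have "\<dots> \<le> (\<integral>\<^sup>+r\<in>{0..}. ennreal (exp (- r)) \<partial>lborel)"
  proof (intro nn_integral_mono mult_right_mono)
    fix r :: real
    have "ennreal (exp (- r)) * ennreal (transition X (r / c) f z) \<le> ennreal (exp (- r)) * 1"
      using transition_C01(2)[OF f] by (intro mult_left_mono) (auto simp: ennreal_le_1)
    then show "ennreal (exp (- r)) * ennreal (transition X (r / c) f z) \<le> ennreal (exp (- r))" by simp
  qed simp
  then have le: "(\<integral>\<^sup>+\<omega>. discounted f c \<omega> \<partial>law X z) \<le> 1" unfolding F nn_integral_exp_minus .
  then show "ennreal (resolvent f c z) = (\<integral>\<^sup>+\<omega>. discounted f c \<omega> \<partial>law X z)"
    unfolding resolvent_def by (intro ennreal_enn2real) (auto intro: le_less_trans)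
  show "0 \<le> resolvent f c z" by (simp add: resolvent_def)
  show "resolvent f c z \<le> 1" unfolding resolvent_def using le by (intro enn2real_leI) auto
qed

text \<open>The weight e^(-r) does not depend on the rate, so one dominated convergence serves two
  purposes: continuity of a resolvent, with a fixed rate and moving points, and convergence to
  \<open>f\<close>, with a fixed point and rates tending to infinity.\<close>

lemma resolvent_tendstoI:
  assumes f: "f \<in> C01" and c: "\<And>n. 0 < c n"
    and lim: "\<And>r. 0 < r \<Longrightarrow> (\<lambda>n. transition X (r / c n) f (z n)) \<longlonglongrightarrow> g r" and g: "g \<in> borel_measurable borel"
    and L: "(\<integral>\<^sup>+r\<in>{0..}. ennreal (exp (- r)) * ennreal (g r) \<partial>lborel) = ennreal L" "0 \<le> L"
  shows "(\<lambda>n. resolvent f (c n) (z n)) \<longlonglongrightarrow> L"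
proof -
  note [measurable] = g
  have "(\<lambda>n. \<integral>\<^sup>+r\<in>{0..}. ennreal (exp (- r)) * ennreal (transition X (r / c n) f (z n)) \<partial>lborel) \<longlonglongrightarrow> (\<integral>\<^sup>+r\<in>{0..}. ennreal (exp (- r)) * ennreal (g r) \<partial>lborel)"
  proof (rule nn_integral_dominated_convergence[where w="\<lambda>r. ennreal (exp (- r)) * indicator {0..} r"])
    show "(\<lambda>r. ennreal (exp (- r)) * ennreal (transition X (r / c n) f (z n)) * indicator {0..} r) \<in> borel_measurable lborel" for n
    proof -
      note [measurable] = resolvent_eq(3)[OF f c, of n "z n"]
      show ?thesis by measurable
    qed
    show "AE r in lborel. ennreal (exp (- r)) * ennreal (transition X (r / c n) f (z n)) * indicator {0..} r \<le> ennreal (exp (- r)) * indicator {0..} r" for n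
    proof (rule AE_I2)
      fix r :: real
      have "ennreal (exp (- r)) * ennreal (transition X (r / c n) f (z n)) \<le> ennreal (exp (- r)) * 1"
        using transition_C01(2)[OF f] by (intro mult_left_mono) (auto simp: ennreal_le_1)
      then show "ennreal (exp (- r)) * ennreal (transition X (r / c n) f (z n)) * indicator {0..} r \<le> ennreal (exp (- r)) * indicator {0..} r"
        by (intro mult_right_mono) auto
    qed
    show "(\<integral>\<^sup>+r\<in>{0..}. ennreal (exp (- r)) \<partial>lborel) < \<infinity>" unfolding nn_integral_exp_minus by simp
    have "AE r in lborel. r \<noteq> (0::real)" by (rule AE_lborel_singleton)
    then show "AE r in lborel. (\<lambda>n. ennreal (exp (- r)) * ennreal (transition X (r / c n) f (z n)) * indicator {0..} r) \<longlonglongrightarrow> ennreal (exp (- r)) * ennreal (g r) * indicator {0..} r"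
    proof eventually_elim
      case (elim r)
      show ?case
      proof (cases "0 < r")
        case True
        have "0 \<le> g r" using lim[OF True] by (rule LIMSEQ_le_const) (use transition_C01(1)[OF f] in auto)
        have "(\<lambda>n. ennreal (exp (- r) * transition X (r / c n) f (z n))) \<longlonglongrightarrow> ennreal (exp (- r) * g r)"
          by (intro tendsto_ennrealI tendsto_mult tendsto_const lim True)
        then have "(\<lambda>n. ennreal (exp (- r)) * ennreal (transition X (r / c n) f (z n))) \<longlonglongrightarrow> ennreal (exp (- r)) * ennreal (g r)"
          using transition_C01(1)[OF f] \<open>0 \<le> g r\<close> by (simp add: ennreal_mult)
        then show ?thesis using True by simp
      qed (use elim in simp)
    qed
  qed measurable
  then have "(\<lambda>n. ennreal (resolvent f (c n) (z n))) \<longlonglongrightarrow> ennreal L"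
    unfolding resolvent_eq(1)[OF f c] resolvent_eq(2)[OF f c] L(1) .
  then show ?thesis
    by (rule tendsto_ennrealD) (use resolvent_eq(4)[OF f c] L(2) in auto)
qed

text \<open>Continuity on the compactification is inherited from the Feller property at each
  positive time; r = 0 is a null set of the integral. A path started at the cemetery stays there, so
  the resolvent vanishes there with \<open>f\<close>.\<close>

lemma resolvent_C01:
  assumes f: "f \<in> C01" and c: "0 < c"
  shows "resolvent f c \<in> C01"
proof -
  have m: "(\<lambda>r. transition X (r / c) f z) \<in> borel_measurable borel" for z
  proof -
    have "(\<lambda>r. enn2real (ennreal (transition X (r / c) f z))) \<in> borel_measurable borel"
      using resolvent_eq(3)[OF f c] by measurable
    then show ?thesis using transition_C01(1)[OF f] by simp
  qed
  have L: "(\<integral>\<^sup>+r\<in>{0..}. ennreal (exp (- r)) * ennreal (transition X (r / c) f z) \<partial>lborel) = ennreal (resolvent f c z)" for z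
    by (simp only: resolvent_eq(1,2)[OF f c])
  have cont: "(\<lambda>n. resolvent f c (y n)) \<longlonglongrightarrow> resolvent f c z"
    if "\<And>t. 0 < t \<Longrightarrow> (\<lambda>n. transition X t f (y n)) \<longlonglongrightarrow> transition X t f z" for y z
    by (rule resolvent_tendstoI[OF f c _ m L resolvent_eq(4)[OF f c]]) (use c that in auto)
  have "continuous_map state_topology euclideanreal (resolvent f c)"
  proof (rule continuous_map_stateI)
    show "(\<lambda>n. resolvent f c (Some (y n))) \<longlonglongrightarrow> resolvent f c (Some z)" if "y \<longlonglongrightarrow> z" for y z
      by (rule cont[OF continuous_map_stateD(1)[OF transition_continuous[OF f] that]])
    show "(\<lambda>n. resolvent f c (Some (y n))) \<longlonglongrightarrow> resolvent f c None"
      if "\<And>C. compact C \<Longrightarrow> eventually (\<lambda>n. y n \<notin> C) sequentially" for y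
      by (rule cont[OF continuous_map_stateD(2)[OF transition_continuous[OF f] that]])
  qed
  moreover have "resolvent f c None = 0"
  proof -
    have "AE \<omega> in law X None. \<forall>t. path X t \<omega> = None"
      using path_0[of None] AE_space
    proof eventually_elim
      case (elim \<omega>)
      then show ?case using path_absorbed[of \<omega> 0] by simp
    qed
    then have "(\<integral>\<^sup>+\<omega>. discounted f c \<omega> \<partial>law X None) = (\<integral>\<^sup>+\<omega>. 0 \<partial>law X None)"
      by (intro nn_integral_cong_AE) (auto elim!: eventually_mono simp: discounted_def C01D(2)[OF f])
    then show ?thesis by (simp add: resolvent_def)
  qed
  ultimately show ?thesis unfolding C01_def using resolvent_eq(4,5)[OF f c] by blast
qed

text \<open>Pathwise, the discounted integral of the path shifted by t is e^(ct) times the part of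
  the original integral from r = ct on, hence at most e^(ct) times the whole. The Markov property
  turns this into the inequality for the semigroup.\<close>

lemma resolvent_excessive:
  assumes f: "f \<in> C01" and c: "0 < c"
  shows "excessive_rate c (resolvent f c)"
  unfolding excessive_rate_def
proof (intro allI impI)
  fix t :: real and z assume t: "0 < t"
  have sh: "discounted f c (shift X (ennreal t) \<omega>) \<le> ennreal (exp (c * t)) * discounted f c \<omega>" if \<omega>: "\<omega> \<in> sample_space X" for \<omega>
  proof -
    have [measurable]: "(\<lambda>s. f (path X (ennreal (s / c)) \<omega>)) \<in> borel_measurable borel"
    proof -
      have "(\<lambda>s. f (path X (ennreal s) \<omega>)) \<in> borel_measurable borel"
        by (rule right_cont_measurable[OF C01_path_right_cont[OF f \<omega>]])
      then show ?thesis by (rule measurable_compose[rotated]) measurable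
    qed
    let ?F = "\<lambda>s. ennreal (exp (- s)) * ennreal (f (path X (ennreal (s / c)) \<omega>)) * indicator {c * t..} s"
    have "discounted f c (shift X (ennreal t) \<omega>) = (\<integral>\<^sup>+r. ennreal (exp (c * t)) * ?F (c * t + 1 * r) \<partial>lborel)"
      unfolding discounted_def
    proof (intro nn_integral_cong)
      fix r :: real
      show "ennreal (exp (- r)) * ennreal (f (path X (ennreal (r / c)) (shift X (ennreal t) \<omega>))) * indicator {0..} r = ennreal (exp (c * t)) * ?F (c * t + 1 * r)"
      proof (cases "0 \<le> r")
        case True
        have "ennreal (r / c) + ennreal t = ennreal ((c * t + 1 * r) / c)"
          using True c t by (simp add: ennreal_plus[symmetric] field_simps del: ennreal_plus)
        moreover have "ennreal (exp (- r)) = ennreal (exp (c * t)) * ennreal (exp (- (c * t + 1 * r)))"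
          by (simp add: ennreal_mult[symmetric] exp_add[symmetric])
        ultimately show ?thesis using True by (simp add: path_shift[OF \<omega>] mult.assoc)
      qed simp
    qed
    also have "\<dots> = ennreal (exp (c * t)) * (\<integral>\<^sup>+r. ?F (c * t + 1 * r) \<partial>lborel)"
      by (rule nn_integral_cmult) measurable
    also have "(\<integral>\<^sup>+r. ?F (c * t + 1 * r) \<partial>lborel) = (\<integral>\<^sup>+s. ?F s \<partial>lborel)"
      by (subst nn_integral_real_affine[of ?F 1 "c * t"]) auto
    also have "\<dots> \<le> discounted f c \<omega>"
      unfolding discounted_def
    proof (intro nn_integral_mono mult_left_mono)
      have "0 \<le> c * t" using c t by simp
      then show "indicator {c * t..} s \<le> (indicator {0..} s :: ennreal)" for s by (auto simp: indicator_def)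
    qed simp
    finally show ?thesis by (simp add: mult_left_mono)
  qed
  note dm = discounted_measurable[OF f c]
  have "ennreal (transition X t (resolvent f c) z) = (\<integral>\<^sup>+\<omega>. ennreal (resolvent f c (path X (ennreal t) \<omega>)) \<partial>law X z)"
    by (rule transition_C01(3)[OF resolvent_C01[OF f c]])
  also have "\<dots> = (\<integral>\<^sup>+\<omega>. indicator (sample_space X) \<omega> * (\<integral>\<^sup>+\<omega>'. discounted f c \<omega>' \<partial>law X (path X (ennreal t) \<omega>)) \<partial>law X z)"
    by (intro nn_integral_cong) (simp add: resolvent_eq(1)[OF f c])
  also have "\<dots> = (\<integral>\<^sup>+\<omega>. indicator (sample_space X) \<omega> * discounted f c (shift X (ennreal t) \<omega>) \<partial>law X z)"
    by (rule Markov_natural(2)[OF sample_space_filt dm, symmetric])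
  also have "\<dots> \<le> (\<integral>\<^sup>+\<omega>. ennreal (exp (c * t)) * discounted f c \<omega> \<partial>law X z)"
    by (intro nn_integral_mono) (simp add: sh)
  also have "\<dots> = ennreal (exp (c * t)) * ennreal (resolvent f c z)"
    unfolding resolvent_eq(1)[OF f c] by (rule nn_integral_cmult[OF natural_measurable_law[OF dm]])
  also have "\<dots> = ennreal (exp (c * t) * resolvent f c z)"
    using resolvent_eq(4)[OF f c] by (simp add: ennreal_mult)
  finally have "transition X t (resolvent f c) z \<le> exp (c * t) * resolvent f c z"
    using resolvent_eq(4)[OF f c] by (subst (asm) ennreal_le_iff) auto
  then have "exp (- c * t) * transition X t (resolvent f c) z \<le> exp (- c * t) * (exp (c * t) * resolvent f c z)"
    by (rule mult_left_mono) simp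
  also have "\<dots> = resolvent f c z"
    by (simp add: mult.assoc[symmetric] exp_add[symmetric])
  finally show "exp (- c * t) * transition X t (resolvent f c) z \<le> resolvent f c z" .
qed

lemma resolvent_tendsto:
  assumes f: "f \<in> C01"
  shows "(\<lambda>n. resolvent f (real (Suc n)) z) \<longlonglongrightarrow> f z"
proof (rule resolvent_tendstoI[OF f, where g="\<lambda>_. f z"])
  show "(\<lambda>n. transition X (r / real (Suc n)) f z) \<longlonglongrightarrow> f z" if r: "0 < r" for r
  proof (rule filterlim_compose[OF transition_tendsto[OF f]])
    have "(\<lambda>n. r / real (Suc n)) \<longlonglongrightarrow> 0"
      using LIMSEQ_Suc[OF lim_const_over_n[of r]] by simp
    then show "filterlim (\<lambda>n. r / real (Suc n)) (at_right 0) sequentially"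
      using r by (auto simp: filterlim_at intro: always_eventually)
  qed
  show "(\<integral>\<^sup>+r\<in>{0..}. ennreal (exp (- r)) * ennreal (f z) \<partial>lborel) = ennreal (f z)"
  proof -
    have "(\<integral>\<^sup>+r\<in>{0..}. ennreal (exp (- r)) * ennreal (f z) \<partial>lborel) = (\<integral>\<^sup>+r. ennreal (f z) * (ennreal (exp (- r)) * indicator {0..} r) \<partial>lborel)"
      by (intro nn_integral_cong) (simp add: mult_ac)
    also have "\<dots> = ennreal (f z) * (\<integral>\<^sup>+r\<in>{0..}. ennreal (exp (- r)) \<partial>lborel)"
      by (rule nn_integral_cmult) measurable
    finally show ?thesis by (simp add: nn_integral_exp_minus)
  qed
  show "0 \<le> f z" by (rule C01D(3)[OF f])
qed auto

text \<open>A tent function at \<open>x\<close> that vanishes at \<open>y\<close> need not be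
  excessive, but its normalised resolvents are, and they converge to it pointwise; a large rate
  keeps more than half of the difference 1.\<close>

lemma separating_excessive:
  assumes y: "y \<noteq> Some x"
  obtains w \<alpha> where "w \<in> C01" "0 \<le> \<alpha>" "excessive_rate \<alpha> w" "w (Some x) - w y > 1 / 2"
proof -
  have "x \<in> (\<Union>k. V k)" using V(4) by simp
  then obtain k where k: "x \<in> V k" by blast
  obtain r1 where r1: "0 < r1" "cball x r1 \<subseteq> V k" using V(2)[of k] k open_contains_cball by blast
  \<comment> \<open>The radius excludes \<open>y\<close> if it is a point of the state space, and it
    keeps the ball in a relatively compact set, so that the tent function vanishes near the
    cemetery.\<close>
  define r where "r = (case y of None \<Rightarrow> r1 | Some y' \<Rightarrow> min r1 (dist x y'))"
  have r: "0 < r" "r \<le> r1" "\<And>y'. y = Some y' \<Longrightarrow> r \<le> dist x y'"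
    using y r1 by (auto simp: r_def split: option.splits)
  have "closed (cball x r)" by simp
  moreover have "cball x r \<subseteq> closure (V k)" using r(2) r1(2) closure_subset[of "V k"] by (force simp: subset_eq)
  ultimately have cb: "compact (cball x r)"
    using compact_Int_closed[OF V(3)[of k], of "cball x r"] by (simp add: Int_absorb1)
  define f where "f = extend_zero (\<lambda>z. max 0 (1 - dist z x / r))"
  have f: "f \<in> C01"
    unfolding C01_def
  proof (intro CollectI conjI allI)
    show "continuous_map state_topology euclideanreal f"
    proof (rule continuous_map_stateI)
      show "(\<lambda>n. f (Some (z n))) \<longlonglongrightarrow> f (Some z')" if "z \<longlonglongrightarrow> z'" for z z'
        unfolding f_def extend_zero_simps using r(1) by (intro tendsto_intros that) simp
      fix z :: "nat \<Rightarrow> 'a" assume "\<And>C. compact C \<Longrightarrow> eventually (\<lambda>n. z n \<notin> C) sequentially"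
      from this[OF cb] have "eventually (\<lambda>n. f (Some (z n)) = 0) sequentially"
      proof eventually_elim
        case (elim n)
        then have "1 - dist (z n) x / r \<le> 0" using r(1) by (simp add: dist_commute field_simps)
        then show ?case by (simp add: f_def)
      qed
      then show "(\<lambda>n. f (Some (z n))) \<longlonglongrightarrow> f None"
        by (simp add: f_def tendsto_eventually)
    qed
    show "f None = 0" by (simp add: f_def)
    show "0 \<le> f z" "f z \<le> 1" for z using r(1) by (cases z; simp add: f_def)+
  qed
  have fx: "f (Some x) = 1" by (simp add: f_def)
  have fy: "f y = 0"
    using r by (cases y) (auto simp: f_def dist_commute max_def field_simps)
  have "(\<lambda>n. resolvent f (real (Suc n)) (Some x) - resolvent f (real (Suc n)) y) \<longlonglongrightarrow> f (Some x) - f y"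
    by (intro tendsto_diff resolvent_tendsto[OF f])
  then have "eventually (\<lambda>n. resolvent f (real (Suc n)) (Some x) - resolvent f (real (Suc n)) y > 1 / 2) sequentially"
    by (rule order_tendstoD(1)) (simp add: fx fy)
  then obtain n where n: "resolvent f (real (Suc n)) (Some x) - resolvent f (real (Suc n)) y > 1 / 2"
    by (auto simp: eventually_sequentially)
  show thesis
    by (rule that[of "resolvent f (real (Suc n))" "real (Suc n)"])
       (use resolvent_C01[OF f] resolvent_excessive[OF f] n in auto)
qed

end

section \<open>Compact containment\<close>

context Feller_setting
begin

lemma hit_law: "openin state_topology U \<Longrightarrow> hit U a b \<in> sets (law X z)"
  using hit_natural[OF _ top_greatest] natural_subset_law by blast

text \<open>Chebyshev's inequality. The event is written with the position at time 0, which is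
  almost surely \<open>z\<close>, so that it does not mention the starting point and can be applied
  to the restarted path.\<close>

lemma displacement_estimate:
  assumes g: "g \<in> C01" and a: "0 < a" and mom: "(\<integral>\<omega>. (g (path X (ennreal s) \<omega>) - g z)\<^sup>2 \<partial>law X z) \<le> q * a\<^sup>2"
  shows "emeasure (law X z) {\<omega> \<in> sample_space X. a < \<bar>g (path X (ennreal s) \<omega>) - g (path X 0 \<omega>)\<bar>} \<le> ennreal q"
proof -
  interpret P: prob_space "law X z" by (rule prob_law)
  let ?u = "\<lambda>\<omega>. (g (path X (ennreal s) \<omega>) - g z)\<^sup>2"
  have gm [measurable]: "(\<lambda>\<omega>. g (path X t \<omega>)) \<in> borel_measurable (law X z)" for t
    by (rule measurable_compose[OF path_measurable_law C01D(5)[OF g]])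
  have i: "integrable (law X z) ?u"
  proof (rule P.integrable_const_bound[where B=1])
    show "AE \<omega> in law X z. norm (?u \<omega>) \<le> 1"
    proof (rule AE_I2)
      fix \<omega>
      have "\<bar>g (path X (ennreal s) \<omega>) - g z\<bar> \<le> 1"
        using C01D(3,4)[OF g, of "path X (ennreal s) \<omega>"] C01D(3,4)[OF g, of z] by linarith
      then show "norm (?u \<omega>) \<le> 1" by (simp add: abs_square_le_1)
    qed
  qed measurable
  have "emeasure (law X z) {\<omega> \<in> sample_space X. a < \<bar>g (path X (ennreal s) \<omega>) - g (path X 0 \<omega>)\<bar>}
      \<le> emeasure (law X z) {\<omega> \<in> space (law X z). 1 \<le> ennreal (1 / a\<^sup>2) * ennreal (?u \<omega>)}"
  proof (rule emeasure_mono_AE)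
    show "AE \<omega> in law X z. \<omega> \<in> {\<omega> \<in> sample_space X. a < \<bar>g (path X (ennreal s) \<omega>) - g (path X 0 \<omega>)\<bar>}
        \<longrightarrow> \<omega> \<in> {\<omega> \<in> space (law X z). 1 \<le> ennreal (1 / a\<^sup>2) * ennreal (?u \<omega>)}"
      using path_0[of z]
    proof eventually_elim
      case (elim \<omega>)
      show ?case
      proof
        assume *: "\<omega> \<in> {\<omega> \<in> sample_space X. a < \<bar>g (path X (ennreal s) \<omega>) - g (path X 0 \<omega>)\<bar>}"
        then have "a\<^sup>2 \<le> \<bar>g (path X (ennreal s) \<omega>) - g z\<bar>\<^sup>2" using a elim by (intro power_mono) auto
        then have "1 \<le> 1 / a\<^sup>2 * ?u \<omega>" using a by (simp add: field_simps)
        then have "ennreal 1 \<le> ennreal (1 / a\<^sup>2 * ?u \<omega>)" by (rule ennreal_leI)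
        also have "\<dots> = ennreal (1 / a\<^sup>2) * ennreal (?u \<omega>)" by (rule ennreal_mult) auto
        finally have "1 \<le> ennreal (1 / a\<^sup>2) * ennreal (?u \<omega>)" by (simp only: ennreal_1)
        then show "\<omega> \<in> {\<omega> \<in> space (law X z). 1 \<le> ennreal (1 / a\<^sup>2) * ennreal (?u \<omega>)}" using * by simp
      qed
    qed
  qed measurable
  also have "\<dots> \<le> ennreal (1 / a\<^sup>2) * (\<integral>\<^sup>+\<omega>. ennreal (?u \<omega>) * indicator (space (law X z)) \<omega> \<partial>law X z)"
    by (rule nn_integral_Markov_inequality) measurable
  also have "(\<integral>\<^sup>+\<omega>. ennreal (?u \<omega>) * indicator (space (law X z)) \<omega> \<partial>law X z) = (\<integral>\<^sup>+\<omega>. ennreal (?u \<omega>) \<partial>law X z)"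
    by (intro nn_integral_cong) simp
  also have "\<dots> = ennreal (\<integral>\<omega>. ?u \<omega> \<partial>law X z)"
    by (rule nn_integral_eq_integral[OF i]) simp
  also have "ennreal (1 / a\<^sup>2) * \<dots> \<le> ennreal (1 / a\<^sup>2) * ennreal (q * a\<^sup>2)"
    by (intro mult_left_mono ennreal_leI mom) simp
  also have "\<dots> = ennreal q" using a by (simp add: ennreal_mult'[symmetric])
  finally show ?thesis .
qed

text \<open>The Ottaviani bound with a fixed end time \<open>d\<close>: a path displaced by more
  than \<open>2 * a\<close> at \<open>t\<close> and by at most \<open>a\<close> over the remaining
  time \<open>d - t\<close> is displaced by more than \<open>a\<close> at \<open>d\<close>. The
  moment bound therefore enters at all positive times up to \<open>d\<close> and for all starting
  points.\<close>

lemma maximal_displacement: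
  assumes g: "g \<in> C01" and ex: "excessive_rate \<alpha> g" and \<alpha>: "0 \<le> \<alpha>" and a: "0 < a" and e: "0 < e"
  obtains d where "0 < d"
    "\<And>x. emeasure (law X (Some x)) (\<Union>t\<in>{t \<in> \<rat>. 0 \<le> t \<and> t < d}. {\<omega> \<in> sample_space X. 2 * a < \<bar>g (path X (ennreal t) \<omega>) - g (path X 0 \<omega>)\<bar>}) \<le> ennreal e"
proof -
  \<comment> \<open>A probability of at most 1/2 is the condition of the Ottaviani bound, and twice
    it is the resulting estimate.\<close>
  define q where "q = min (1 / 2) (e / 2)"
  have q: "0 < q" "q \<le> 1 / 2" "2 * q \<le> e" using e by (auto simp: q_def)
  obtain d0 where d0: "0 < d0" "\<And>s z. 0 < s \<Longrightarrow> s < d0 \<Longrightarrow> (\<integral>\<omega>. (g (path X (ennreal s) \<omega>) - g z)\<^sup>2 \<partial>law X z) \<le> q * a\<^sup>2"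
    using second_moment_uniform[OF g ex \<alpha>, of "q * a\<^sup>2"] q a by auto
  \<comment> \<open>Half of \<open>d0\<close>, so that the end time \<open>d\<close> itself lies
    strictly below \<open>d0\<close>.\<close>
  define d where "d = d0 / 2"
  have d: "0 < d" "d < d0" using d0 by (auto simp: d_def)
  define D where "D s = {\<omega> \<in> sample_space X. a < \<bar>g (path X (ennreal s) \<omega>) - g (path X 0 \<omega>)\<bar>}" for s
  define B where "B t = {\<omega> \<in> sample_space X. 2 * a < \<bar>g (path X (ennreal t) \<omega>) - g (path X 0 \<omega>)\<bar>}" for t
  let ?J = "{t \<in> \<rat>. 0 \<le> t \<and> t < d}"
  have gm: "(\<lambda>\<omega>. g (path X s \<omega>)) \<in> borel_measurable (augm t)" if "s \<le> t" for s t
    by (rule measurable_compose[OF path_augm[OF that] C01D(5)[OF g]])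
  have Dm: "D s \<in> sets (augm \<top>)" for s
  proof -
    note [measurable] = gm[OF top_greatest]
    have "{\<omega> \<in> space (augm \<top>). a < \<bar>g (path X (ennreal s) \<omega>) - g (path X 0 \<omega>)\<bar>} \<in> sets (augm \<top>)" by measurable
    then show ?thesis by (simp add: D_def)
  qed
  have Bm: "B t \<in> sets (augm (ennreal t))" for t
  proof -
    note [measurable] = gm[OF order_refl, of "ennreal t"] gm[of 0 "ennreal t"]
    have "{\<omega> \<in> space (augm (ennreal t)). 2 * a < \<bar>g (path X (ennreal t) \<omega>) - g (path X 0 \<omega>)\<bar>} \<in> sets (augm (ennreal t))" by measurable
    then show ?thesis by (simp add: B_def)
  qed
  have lm: "(\<lambda>\<omega>. g (path X s \<omega>)) \<in> borel_measurable (law X z)" for s z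
    by (rule measurable_compose[OF path_measurable_law C01D(5)[OF g]])
  have Dl: "D s \<in> sets (law X z)" and Bl: "B s \<in> sets (law X z)" for s z
  proof -
    note [measurable] = lm
    have "{\<omega> \<in> space (law X z). a < \<bar>g (path X (ennreal s) \<omega>) - g (path X 0 \<omega>)\<bar>} \<in> sets (law X z)"
      "{\<omega> \<in> space (law X z). 2 * a < \<bar>g (path X (ennreal s) \<omega>) - g (path X 0 \<omega>)\<bar>} \<in> sets (law X z)" by measurable
    then show "D s \<in> sets (law X z)" "B s \<in> sets (law X z)" by (simp_all add: D_def B_def)
  qed
  have DP: "emeasure (Pr z) (D s) \<le> ennreal q" if "0 < s" "s < d0" for s z
  proof -
    have "emeasure (Pr z) (D s) = emeasure (law X z) (D s)"
      using Dl[of s z] by (simp add: emeasure_completion)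
    also have "\<dots> \<le> ennreal q"
      unfolding D_def by (rule displacement_estimate[OF g a d0(2)[OF that]])
    finally show ?thesis .
  qed
  have cnt: "countable ?J" by (rule countable_subset[OF _ countable_rat]) auto
  have main: "emeasure (Pr (Some x)) (\<Union>t\<in>?J. B t) \<le> 2 * emeasure (Pr (Some x)) (D d)" for x
  proof (rule Ottaviani[OF cnt, where G="\<lambda>t. sample_space X - D (d - t)"])
    show "B t \<in> sets (augm (ennreal t))" for t by (rule Bm)
    show "sample_space X - D (d - t) \<in> sets (augm \<top>)" for t
      using sets.compl_sets[OF Dm, of "d - t"] by simp
    show "D d \<in> sets (Pr (Some x))" using Dm augm_subset_Pr by blast
    show "1 \<le> 2 * emeasure (Pr (Some y)) (sample_space X - D (d - t))" if t: "t \<in> ?J" for t y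
    proof -
      interpret P: prob_space "Pr (Some y)" by (rule prob_Pr)
      have DS: "D (d - t) \<in> sets (Pr (Some y))" using Dm augm_subset_Pr by blast
      have "ennreal (measure (Pr (Some y)) (D (d - t))) \<le> ennreal q"
        using DP[of "d - t" "Some y"] t d by (simp add: P.emeasure_eq_measure)
      then have "measure (Pr (Some y)) (D (d - t)) \<le> 1 / 2" using q by (subst (asm) ennreal_le_iff) auto
      then have "1 \<le> 2 * measure (Pr (Some y)) (sample_space X - D (d - t))"
        using P.prob_compl[OF DS] by simp
      then have "ennreal 1 \<le> ennreal (2 * measure (Pr (Some y)) (sample_space X - D (d - t)))" by (rule ennreal_leI)
      then show ?thesis by (simp add: ennreal_mult P.emeasure_eq_measure)
    qed
    show "AE \<omega> in Pr (Some x). \<omega> \<in> B t \<and> shift X (ennreal t) \<omega> \<in> sample_space X - D (d - t) \<longrightarrow> \<omega> \<in> D d" if t: "t \<in> ?J" for t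
    proof (rule AE_I2, rule impI)
      fix \<omega> assume *: "\<omega> \<in> B t \<and> shift X (ennreal t) \<omega> \<in> sample_space X - D (d - t)"
      then have \<omega>: "\<omega> \<in> sample_space X" by (simp add: B_def)
      have "ennreal (d - t) + ennreal t = ennreal d" using t by (simp flip: ennreal_plus)
      then have "\<bar>g (path X (ennreal d) \<omega>) - g (path X (ennreal t) \<omega>)\<bar> \<le> a"
        using * by (auto simp: D_def path_shift[OF \<omega>])
      moreover have "2 * a < \<bar>g (path X (ennreal t) \<omega>) - g (path X 0 \<omega>)\<bar>" using * by (simp add: B_def)
      ultimately have "a < \<bar>g (path X (ennreal d) \<omega>) - g (path X 0 \<omega>)\<bar>" by linarith
      then show "\<omega> \<in> D d" using \<omega> by (simp add: D_def)
    qed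
  qed auto
  show thesis
  proof (rule that[OF d(1)])
    fix x
    have "(\<Union>t\<in>?J. B t) \<in> sets (law X (Some x))"
      using Bl by (intro sets.countable_UN' cnt) auto
    then have "emeasure (law X (Some x)) (\<Union>t\<in>?J. B t) = emeasure (Pr (Some x)) (\<Union>t\<in>?J. B t)"
      by (simp add: emeasure_completion)
    also have "\<dots> \<le> 2 * ennreal q"
      using main[of x] mult_left_mono[OF DP[OF d, of "Some x"], of 2] by (rule order_trans) simp
    also have "\<dots> = ennreal (2 * q)" using q by (simp add: ennreal_mult)
    also have "\<dots> \<le> ennreal e" using q by (intro ennreal_leI) simp
    finally show "emeasure (law X (Some x)) (\<Union>t\<in>?J. {\<omega> \<in> sample_space X. 2 * a < \<bar>g (path X (ennreal t) \<omega>) - g (path X 0 \<omega>)\<bar>}) \<le> ennreal e"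
      unfolding B_def .
  qed
qed

text \<open>Early visits to \<open>U\<close> are unlikely, uniformly over starting points in
  \<open>N\<close>. The measurable cover \<open>H\<close> is there because \<open>U\<close> will be
  closed, while \<open>hit_natural\<close> gives measurability for open sets.\<close>

definition late_hit :: "'a set \<Rightarrow> 'a option set \<Rightarrow> bool" where
  "late_hit N U \<longleftrightarrow> (\<forall>e>0. \<exists>d>0. \<forall>z\<in>N. \<exists>H\<in>sets (law X (Some z)). hit U 0 (ennreal d) \<subseteq> H \<and> emeasure (law X (Some z)) H \<le> ennreal e)"

lemma hit_mono: "U \<subseteq> U' \<Longrightarrow> b \<le> b' \<Longrightarrow> hit U a b \<subseteq> hit U' a b'"
  unfolding hit_def by (auto intro: less_le_trans)

lemma late_hit_subset: "late_hit N U \<Longrightarrow> U' \<subseteq> U \<Longrightarrow> late_hit N U'"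
  unfolding late_hit_def using subset_trans[OF hit_mono[OF _ order_refl]] by metis

lemma late_hit_Int_Un:
  assumes s: "late_hit N U" "late_hit N' U'"
  shows "late_hit (N \<inter> N') (U \<union> U')"
  unfolding late_hit_def
proof (intro allI impI)
  fix e :: real assume "0 < e"
  then have e: "0 < e / 2" by simp
  obtain d where d: "0 < d" "\<And>z. z \<in> N \<Longrightarrow> \<exists>H\<in>sets (law X (Some z)). hit U 0 (ennreal d) \<subseteq> H \<and> emeasure (law X (Some z)) H \<le> ennreal (e / 2)"
    using s(1)[unfolded late_hit_def, rule_format, OF e] by metis
  obtain d' where d': "0 < d'" "\<And>z. z \<in> N' \<Longrightarrow> \<exists>H\<in>sets (law X (Some z)). hit U' 0 (ennreal d') \<subseteq> H \<and> emeasure (law X (Some z)) H \<le> ennreal (e / 2)"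
    using s(2)[unfolded late_hit_def, rule_format, OF e] by metis
  have sub: "hit (U \<union> U') 0 (ennreal (min d d')) \<subseteq> hit U 0 (ennreal d) \<union> hit U' 0 (ennreal d')"
  proof
    fix \<omega> assume "\<omega> \<in> hit (U \<union> U') 0 (ennreal (min d d'))"
    then obtain s where s: "\<omega> \<in> sample_space X" "s < ennreal (min d d')" "path X s \<omega> \<in> U \<union> U'" by (auto simp: hit_def)
    have "ennreal (min d d') \<le> ennreal d" "ennreal (min d d') \<le> ennreal d'" by (auto intro!: ennreal_leI)
    then have "s < ennreal d" "s < ennreal d'" using s(2) by (auto intro: less_le_trans)
    then show "\<omega> \<in> hit U 0 (ennreal d) \<union> hit U' 0 (ennreal d')" using s(1,3) by (auto simp: hit_def)
  qed
  show "\<exists>d>0. \<forall>z\<in>N \<inter> N'. \<exists>H\<in>sets (law X (Some z)). hit (U \<union> U') 0 (ennreal d) \<subseteq> H \<and> emeasure (law X (Some z)) H \<le> ennreal e"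
  proof (intro exI[of _ "min d d'"] conjI ballI)
    fix z assume z: "z \<in> N \<inter> N'"
    obtain H where H: "H \<in> sets (law X (Some z))" "hit U 0 (ennreal d) \<subseteq> H" "emeasure (law X (Some z)) H \<le> ennreal (e / 2)"
      using d(2)[of z] z by blast
    obtain H' where H': "H' \<in> sets (law X (Some z))" "hit U' 0 (ennreal d') \<subseteq> H'" "emeasure (law X (Some z)) H' \<le> ennreal (e / 2)"
      using d'(2)[of z] z by blast
    have "emeasure (law X (Some z)) (H \<union> H') \<le> emeasure (law X (Some z)) H + emeasure (law X (Some z)) H'"
      by (rule emeasure_subadditive[OF H(1) H'(1)])
    also have "\<dots> \<le> ennreal (e / 2) + ennreal (e / 2)"
      by (rule add_mono[OF H(3) H'(3)])
    also have "\<dots> = ennreal e" using e by (simp flip: ennreal_plus)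
    finally have "emeasure (law X (Some z)) (H \<union> H') \<le> ennreal e" .
    moreover have "hit (U \<union> U') 0 (ennreal (min d d')) \<subseteq> H \<union> H'" using sub H(2) H'(2) by blast
    ultimately show "\<exists>H\<in>sets (law X (Some z)). hit (U \<union> U') 0 (ennreal (min d d')) \<subseteq> H \<and> emeasure (law X (Some z)) H \<le> ennreal e"
      using H(1) H'(1) by blast
  qed (use d(1) d'(1) in auto)
qed

text \<open>A continuous excessive function that is larger at \<open>x\<close> than at
  \<open>y\<close> by more than 1/2 defines both neighbourhoods, with margins 1/8. Going from
  \<open>N\<close> to \<open>U\<close> then means a drop of more than 1/4 = 2 * (1/8), which is
  unlikely in a short time.\<close>

lemma late_hit_pair:
  assumes y: "y \<noteq> Some x"
  obtains N U where "open N" "x \<in> N" "openin state_topology U" "y \<in> U" "late_hit N U"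
proof -
  obtain w \<alpha> where w: "w \<in> C01" "0 \<le> \<alpha>" "excessive_rate \<alpha> w" "w (Some x) - w y > 1 / 2"
    using separating_excessive[OF y] by blast
  define U where "U = {u. w u < w y + 1 / 8}"
  define N where "N = {z. w (Some x) - 1 / 8 < w (Some z)}"
  have U: "openin state_topology U"
  proof -
    have "openin state_topology {u \<in> topspace state_topology. w u \<in> {..<w y + 1 / 8}}"
      by (rule openin_continuous_map_preimage[OF C01D(1)[OF w(1)]]) simp
    then show ?thesis unfolding topspace_state_topology U_def by simp
  qed
  have N: "open N"
  proof -
    have "continuous_on UNIV (\<lambda>z. w (Some z))"
      unfolding continuous_on_sequentially comp_def using continuous_map_stateD(1)[OF C01D(1)[OF w(1)]] by blast
    then show ?thesis unfolding N_def by (intro open_Collect_less continuous_intros)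
  qed
  have "late_hit N U"
    unfolding late_hit_def
  proof (intro allI impI)
    fix e :: real assume e: "0 < e"
    obtain d where d: "0 < d" "\<And>x. emeasure (law X (Some x)) (\<Union>t\<in>{t \<in> \<rat>. 0 \<le> t \<and> t < d}. {\<omega> \<in> sample_space X. 2 * (1 / 8) < \<bar>w (path X (ennreal t) \<omega>) - w (path X 0 \<omega>)\<bar>}) \<le> ennreal e"
      by (rule maximal_displacement[OF w(1,3,2) _ e, of "1 / 8"]) auto
    let ?B = "\<Union>t\<in>{t \<in> \<rat>. 0 \<le> t \<and> t < d}. {\<omega> \<in> sample_space X. 2 * (1 / 8) < \<bar>w (path X (ennreal t) \<omega>) - w (path X 0 \<omega>)\<bar>}"
    have "emeasure (law X (Some z)) (hit U 0 (ennreal d)) \<le> ennreal e" if z: "z \<in> N" for z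
    proof -
      have Bm: "?B \<in> sets (law X (Some z))"
      proof (rule sets.countable_UN'')
        show "countable {t \<in> \<rat>. 0 \<le> t \<and> t < d}" by (rule countable_subset[OF _ countable_rat]) auto
        fix t
        have [measurable]: "(\<lambda>\<omega>. w (path X s \<omega>)) \<in> borel_measurable (law X (Some z))" for s
          by (rule measurable_compose[OF path_measurable_law C01D(5)[OF w(1)]])
        have "{\<omega> \<in> space (law X (Some z)). 2 * (1 / 8) < \<bar>w (path X (ennreal t) \<omega>) - w (path X 0 \<omega>)\<bar>} \<in> sets (law X (Some z))" by measurable
        then show "{\<omega> \<in> sample_space X. 2 * (1 / 8) < \<bar>w (path X (ennreal t) \<omega>) - w (path X 0 \<omega>)\<bar>} \<in> sets (law X (Some z))" by simp
      qed
      have "emeasure (law X (Some z)) (hit U 0 (ennreal d)) \<le> emeasure (law X (Some z)) ?B"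
      proof (rule emeasure_mono_AE[OF _ Bm])
        show "AE \<omega> in law X (Some z). \<omega> \<in> hit U 0 (ennreal d) \<longrightarrow> \<omega> \<in> ?B"
          using path_0[of "Some z"]
        proof eventually_elim
          case (elim \<omega>)
          show ?case
          proof
            assume "\<omega> \<in> hit U 0 (ennreal d)"
            then obtain r :: rat where r: "ennreal (of_rat r) < ennreal d" "\<omega> \<in> sample_space X" "path X (ennreal (of_rat r)) \<omega> \<in> U"
              unfolding hit_rational[OF U] by blast
            \<comment> \<open>Negative rationals in the description of \<open>hit\<close> stand for
              time 0.\<close>
            define t :: real where "t = max 0 (of_rat r)"
            have t: "ennreal (of_rat r) = ennreal t" "0 \<le> t" "t \<in> \<rat>"
              by (auto simp: t_def max_def ennreal_neg)
            have "t < d" using r(1) t(1,2) by (simp add: ennreal_less_iff)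
            moreover have "2 * (1 / 8) < \<bar>w (path X (ennreal t) \<omega>) - w (path X 0 \<omega>)\<bar>"
              using r(3) z w(4) unfolding t(1) elim U_def N_def mem_Collect_eq by linarith
            ultimately show "\<omega> \<in> ?B" using t(2,3) r(2) by blast
          qed
        qed
      qed
      also have "\<dots> \<le> ennreal e" by (rule d(2))
      finally show ?thesis .
    qed
    then show "\<exists>d>0. \<forall>z\<in>N. \<exists>H\<in>sets (law X (Some z)). hit U 0 (ennreal d) \<subseteq> H \<and> emeasure (law X (Some z)) H \<le> ennreal e"
      using d(1) hit_law[OF U] by blast
  qed
  moreover have "x \<in> N" "y \<in> U" by (simp_all add: N_def U_def)
  ultimately show thesis using that N U by blast
qed

text \<open>\<open>F\<close> is compact in the compactification, so finitely many of the open sets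
  attached to its points cover it; the corresponding neighbourhoods of \<open>x\<close> are
  intersected.\<close>

lemma late_hit_point:
  assumes F: "closedin state_topology F" and x: "Some x \<notin> F"
  obtains N where "open N" "x \<in> N" "late_hit N F"
proof -
  let ?\<U> = "{U. openin state_topology U \<and> (\<exists>N. open N \<and> x \<in> N \<and> late_hit N U)}"
  have c: "compactin state_topology F"
    using closedin_compact_space[OF _ F] compact_space_Alexandroff_compactification by blast
  have cov: "F \<subseteq> \<Union>?\<U>"
  proof
    fix y assume "y \<in> F"
    then have "y \<noteq> Some x" using x by blast
    then show "y \<in> \<Union>?\<U>" by (rule late_hit_pair) blast
  qed
  obtain \<F> where \<F>: "finite \<F>" "\<F> \<subseteq> ?\<U>" "F \<subseteq> \<Union>\<F>"
    using compactinD[OF c _ cov] by auto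
  have "\<exists>N. open N \<and> x \<in> N \<and> late_hit N (\<Union>\<F>)"
    using \<F>(1,2)
  proof (induction rule: finite_induct)
    case empty
    have "late_hit UNIV {}" by (auto simp: late_hit_def hit_def intro!: exI[of _ 1] bexI[of _ "{}"])
    then show ?case by (auto intro: exI[of _ UNIV])
  next
    case (insert U \<F>)
    obtain N where N: "open N" "x \<in> N" "late_hit N U" using insert.prems by blast
    obtain N' where N': "open N'" "x \<in> N'" "late_hit N' (\<Union>\<F>)"
      using insert.IH insert.prems by blast
    have "late_hit (N \<inter> N') (\<Union>(insert U \<F>))" using late_hit_Int_Un[OF N(3) N'(3)] by simp
    moreover have "open (N \<inter> N')" "x \<in> N \<inter> N'" using N N' by auto
    ultimately show ?case by blast
  qed
  then obtain N where N: "open N" "x \<in> N" "late_hit N (\<Union>\<F>)" by blast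
  show thesis by (rule that[OF N(1,2) late_hit_subset[OF N(3) \<F>(3)]])
qed

text \<open>Compactness of \<open>K\<close> now reduces the neighbourhoods of its points to finitely
  many, and the smallest of their times serves for all.\<close>

lemma late_hit_compact:
  assumes K: "compact K" and F: "closedin state_topology F" "Some ` K \<inter> F = {}"
  shows "late_hit K F"
proof -
  have cov: "\<exists>N. open N \<and> x \<in> N \<and> late_hit N F" if "x \<in> K" for x
    using late_hit_point[OF F(1), of x] F(2) that by blast
  obtain \<N> where \<N>: "finite \<N>" "\<N> \<subseteq> {N. open N \<and> late_hit N F}" "K \<subseteq> \<Union>\<N>"
  proof (rule compactE[OF K, of "{N. open N \<and> late_hit N F}"])
    show "K \<subseteq> \<Union>{N. open N \<and> late_hit N F}"
    proof
      fix x assume "x \<in> K"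
      then show "x \<in> \<Union>{N. open N \<and> late_hit N F}" using cov[of x] by blast
    qed
  qed auto
  show ?thesis
    unfolding late_hit_def
  proof (intro allI impI)
    fix e :: real assume e: "0 < e"
    have "\<forall>N\<in>\<N>. \<exists>d>0. \<forall>z\<in>N. \<exists>H\<in>sets (law X (Some z)). hit F 0 (ennreal d) \<subseteq> H \<and> emeasure (law X (Some z)) H \<le> ennreal e"
    proof
      fix N assume "N \<in> \<N>"
      then have "late_hit N F" using \<N>(2) by blast
      from this[unfolded late_hit_def, rule_format, OF e]
      show "\<exists>d>0. \<forall>z\<in>N. \<exists>H\<in>sets (law X (Some z)). hit F 0 (ennreal d) \<subseteq> H \<and> emeasure (law X (Some z)) H \<le> ennreal e" .
    qed
    then obtain d where d: "\<And>N. N \<in> \<N> \<Longrightarrow> 0 < d N"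
        "\<And>N z. N \<in> \<N> \<Longrightarrow> z \<in> N \<Longrightarrow> \<exists>H\<in>sets (law X (Some z)). hit F 0 (ennreal (d N)) \<subseteq> H \<and> emeasure (law X (Some z)) H \<le> ennreal e"
      by metis
    define D where "D = Min (insert 1 (d ` \<N>))"
    have D: "0 < D" "\<And>N. N \<in> \<N> \<Longrightarrow> D \<le> d N" using \<N>(1) d(1) by (auto simp: D_def)
    have "\<exists>H\<in>sets (law X (Some z)). hit F 0 (ennreal D) \<subseteq> H \<and> emeasure (law X (Some z)) H \<le> ennreal e" if zK: "z \<in> K" for z
    proof -
      obtain N where N: "N \<in> \<N>" "z \<in> N" using zK \<N>(3) by blast
      have "hit F 0 (ennreal D) \<subseteq> hit F 0 (ennreal (d N))"
        by (rule hit_mono[OF order_refl ennreal_leI[OF D(2)[OF N(1)]]])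
      then show ?thesis using d(2)[OF N] by blast
    qed
    then show "\<exists>d>0. \<forall>z\<in>K. \<exists>H\<in>sets (law X (Some z)). hit F 0 (ennreal d) \<subseteq> H \<and> emeasure (law X (Some z)) H \<le> ennreal e"
      using D(1) by blast
  qed
qed

text \<open>Before the time \<open>\<delta>\<close> an exit from \<open>closure (V k)\<close> is
  also an exit from \<open>V k0\<close>, which is late. A later exit is seen by the path restarted
  at \<open>\<delta>\<close>; its probability is a continuous function of the starting point that
  decreases to 0 with \<open>k\<close>, and Dini's theorem on \<open>K\<close> selects
  \<open>k\<close>.\<close>

lemma containment:
  assumes K: "compact K" and T: "0 \<le> T" and e: "0 < e"
  obtains k where "\<And>x. x \<in> K \<Longrightarrow> emeasure (law X (Some x)) (hit (- Some ` closure (V k)) 0 (ennreal T)) \<le> ennreal e"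
proof -
  obtain k0 where k0: "K \<subseteq> V k0" using compact_subset_V[OF K] .
  have F: "closedin state_topology (- Some ` V k0)"
  proof -
    have "openin state_topology (Some ` V k0)" using V(2) by simp
    then show ?thesis unfolding closedin_def topspace_state_topology Compl_eq_Diff_UNIV
      by (simp add: double_diff)
  qed
  have "late_hit K (- Some ` V k0)" by (rule late_hit_compact[OF K F]) (use k0 in blast)
  then obtain \<delta> where \<delta>: "0 < \<delta>" "\<And>x. x \<in> K \<Longrightarrow> \<exists>H\<in>sets (law X (Some x)). hit (- Some ` V k0) 0 (ennreal \<delta>) \<subseteq> H \<and> emeasure (law X (Some x)) H \<le> ennreal (e / 2)"
    unfolding late_hit_def using half_gt_zero[OF e] by metis
  define \<Gamma> where "\<Gamma> k = hit (- Some ` closure (V k)) 0 (ennreal T)" for k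
  have \<Gamma>n: "\<Gamma> k \<in> sets (natural \<top>)" for k
    unfolding \<Gamma>_def by (rule hit_natural[OF openin_state_Compl_compact[OF V(3)] top_greatest])
  have \<Gamma>l: "\<Gamma> k \<in> sets (law X z)" for k z using \<Gamma>n natural_subset_law by blast
  note lim = hit_exit_tendsto_0[OF V conservative, of "ennreal T", simplified, folded \<Gamma>_def]
  define f where "f k y = measure (law X (Some y)) (\<Gamma> k)" for k y
  have ef: "emeasure (law X (Some y)) (\<Gamma> k) = ennreal (f k y)" for k y
    unfolding f_def using finite_measure.emeasure_eq_measure[OF prob_space.finite_measure[OF prob_law]] .
  have f01: "0 \<le> f k y" "f k y \<le> 1" for k y
    unfolding f_def using prob_space.prob_le_1[OF prob_law] by auto
  have fm [measurable]: "f k \<in> borel_measurable borel" for k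
  proof -
    have "(\<lambda>z. emeasure (law X z) (\<Gamma> k)) \<in> borel_measurable state_borel"
      using Markov_event_natural[OF \<Gamma>n] unfolding Markov_event_def by blast
    from measurable_compose[OF Some_measurable this]
    have "(\<lambda>y. enn2real (emeasure (law X (Some y)) (\<Gamma> k))) \<in> borel_measurable borel" by measurable
    then show ?thesis by (simp add: f_def[abs_def] measure_def)
  qed
  have fdec: "f k' y \<le> f k y" if "k \<le> k'" for k k' y
    unfolding f_def
    by (rule finite_measure.finite_measure_mono[OF prob_space.finite_measure[OF prob_law] decseqD[OF lim(2) that] \<Gamma>l])
  have flim: "(\<lambda>k. f k y) \<longlonglongrightarrow> 0" for y
    using lim(1)[of y] unfolding ef ennreal_0[symmetric] by (rule tendsto_ennrealD) (use f01 in auto)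
  \<comment> \<open>Continuous by the strong Feller property, since \<open>\<delta>\<close> is
    positive, although \<open>f k\<close> itself is only known to be measurable.\<close>
  define h where "h k x = transition X \<delta> (extend_zero (f k)) (Some x)" for k x
  have am: "(\<lambda>\<omega>. extend_zero (f k) (path X t \<omega>)) \<in> borel_measurable (law X z)" for k t z
    by (rule measurable_compose[OF path_measurable_law extend_zero_measurable[OF fm]])
  have b: "\<bar>extend_zero (f k) z\<bar> \<le> 1" "0 \<le> extend_zero (f k) z" for k z
    using f01 by (cases z; simp)+
  have ai: "integrable (law X z) (\<lambda>\<omega>. extend_zero (f k) (path X t \<omega>))" for k t z
    by (rule finite_measure.integrable_const_bound[OF prob_space.finite_measure[OF prob_law], where B=1, OF _ am]) (use b in auto)
  have hc: "continuous_on UNIV (h k)" for k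
  proof -
    have "bounded (range (f k))" using f01 by (intro boundedI[of _ 1]) auto
    then show ?thesis unfolding h_def[abs_def] using strong_Feller[unfolded strong_Feller_def, rule_format, of \<delta> "f k"] fm \<delta>(1) by blast
  qed
  have hdec: "decseq (\<lambda>k. h k x)" for x
  proof (rule decseq_SucI)
    fix k
    have "extend_zero (f (Suc k)) z \<le> extend_zero (f k) z" for z using fdec[of k "Suc k"] by (cases z) auto
    then show "h (Suc k) x \<le> h k x" unfolding h_def transition_def by (intro integral_mono ai)
  qed
  have hlim: "(\<lambda>k. h k x) \<longlonglongrightarrow> 0" for x
  proof -
    have "(\<lambda>k. \<integral>\<omega>. extend_zero (f k) (path X (ennreal \<delta>) \<omega>) \<partial>law X (Some x)) \<longlonglongrightarrow> (\<integral>\<omega>. 0 \<partial>law X (Some x))"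
    proof (rule integral_dominated_convergence[where w="\<lambda>_. 1"])
      show "integrable (law X (Some x)) (\<lambda>_. 1 :: real)"
        using finite_measure.integrable_const[OF prob_space.finite_measure[OF prob_law]] .
      have "(\<lambda>k. extend_zero (f k) z) \<longlonglongrightarrow> 0" for z using flim by (cases z) auto
      then show "AE \<omega> in law X (Some x). (\<lambda>k. extend_zero (f k) (path X (ennreal \<delta>) \<omega>)) \<longlonglongrightarrow> 0" by simp
    qed (use am b in auto)
    then show ?thesis by (simp add: h_def transition_def)
  qed
  obtain k1 where k1: "\<And>x. x \<in> K \<Longrightarrow> h k1 x < e / 2"
    using decseq_uniformly_small[OF K hc hdec hlim, of "e / 2"] e by auto
  define k where "k = max k0 k1"
  have late: "emeasure (law X (Some x)) (shift X (ennreal \<delta>) -` \<Gamma> k \<inter> sample_space X) = ennreal (h k x)" for x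
  proof -
    have "emeasure (law X (Some x)) (shift X (ennreal \<delta>) -` \<Gamma> k \<inter> sample_space X)
        = emeasure (law X (Some x)) (sample_space X \<inter> (shift X (ennreal \<delta>) -` \<Gamma> k \<inter> sample_space X))"
      by (rule arg_cong[where f="emeasure _"]) blast
    also have "\<dots> = (\<integral>\<^sup>+\<omega>. indicator (sample_space X) \<omega> * emeasure (law X (path X (ennreal \<delta>) \<omega>)) (\<Gamma> k) \<partial>law X (Some x))"
      using Markov_event_natural[OF \<Gamma>n[of k]] sample_space_filt unfolding Markov_event_def by blast
    also have "\<dots> = (\<integral>\<^sup>+\<omega>. ennreal (extend_zero (f k) (path X (ennreal \<delta>) \<omega>)) \<partial>law X (Some x))"
    proof (rule nn_integral_cong_AE)
      show "AE \<omega> in law X (Some x). indicator (sample_space X) \<omega> * emeasure (law X (path X (ennreal \<delta>) \<omega>)) (\<Gamma> k)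
          = ennreal (extend_zero (f k) (path X (ennreal \<delta>) \<omega>))"
        using AE_path_pos[of \<delta> x, unfolded AE_completion_iff] AE_space
        by eventually_elim (simp add: ef)
    qed
    also have "\<dots> = ennreal (h k x)"
      unfolding h_def transition_def by (rule nn_integral_eq_integral[OF ai]) (use b in auto)
    finally show ?thesis .
  qed
  \<comment> \<open>The restarted path is watched for the full time \<open>T\<close>, longer than
    the time left, so that the same event \<open>\<Gamma> k\<close> appears again.\<close>
  have sub: "\<Gamma> k \<subseteq> hit (- Some ` V k0) 0 (ennreal \<delta>) \<union> (shift X (ennreal \<delta>) -` \<Gamma> k \<inter> sample_space X)"
  proof
    fix \<omega> assume "\<omega> \<in> \<Gamma> k"
    then obtain s where s: "\<omega> \<in> sample_space X" "s < ennreal T" "path X s \<omega> \<in> - Some ` closure (V k)" by (auto simp: \<Gamma>_def hit_def)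
    show "\<omega> \<in> hit (- Some ` V k0) 0 (ennreal \<delta>) \<union> (shift X (ennreal \<delta>) -` \<Gamma> k \<inter> sample_space X)"
    proof (cases "s < ennreal \<delta>")
      case True
      have "V k0 \<subseteq> closure (V k)"
        using incseqD[OF V(1), of k0 k] closure_subset[of "V k"] by (auto simp: k_def)
      then have "path X s \<omega> \<in> - Some ` V k0" using s(3) by blast
      then show ?thesis using s(1) True by (auto simp: hit_def)
    next
      case False
      then have eq: "s - ennreal \<delta> + ennreal \<delta> = s" by (intro diff_add_cancel_ennreal) simp
      have "s - ennreal \<delta> \<le> s" by (rule diff_le_self_ennreal)
      then have "s - ennreal \<delta> < ennreal T" using s(2) by (rule le_less_trans)
      moreover have "path X (s - ennreal \<delta>) (shift X (ennreal \<delta>) \<omega>) \<in> - Some ` closure (V k)"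
        unfolding path_shift[OF s(1)] eq by (rule s(3))
      ultimately have "shift X (ennreal \<delta>) \<omega> \<in> \<Gamma> k"
        unfolding \<Gamma>_def hit_def using shift_space[OF s(1)] by auto
      then show ?thesis using s(1) by blast
    qed
  qed
  show thesis
  proof (rule that[of k])
    fix x assume x: "x \<in> K"
    obtain H where H: "H \<in> sets (law X (Some x))" "hit (- Some ` V k0) 0 (ennreal \<delta>) \<subseteq> H" "emeasure (law X (Some x)) H \<le> ennreal (e / 2)"
      using \<delta>(2)[OF x] by blast
    have sm: "shift X (ennreal \<delta>) -` \<Gamma> k \<inter> sample_space X \<in> sets (law X (Some x))"
      using measurable_sets[OF shift_natural \<Gamma>n, of "ennreal \<delta>" k] natural_subset_law by auto
    have "emeasure (law X (Some x)) (\<Gamma> k) \<le> emeasure (law X (Some x)) (H \<union> (shift X (ennreal \<delta>) -` \<Gamma> k \<inter> sample_space X))"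
      using sub H(2) by (intro emeasure_mono sets.Un H(1) sm) blast
    also have "\<dots> \<le> emeasure (law X (Some x)) H + emeasure (law X (Some x)) (shift X (ennreal \<delta>) -` \<Gamma> k \<inter> sample_space X)"
      by (rule emeasure_subadditive[OF H(1) sm])
    also have "\<dots> \<le> ennreal (e / 2) + ennreal (e / 2)"
    proof (rule add_mono[OF H(3)])
      have "h k x \<le> h k1 x" using decseqD[OF hdec, of k1 k x] by (simp add: k_def)
      then show "emeasure (law X (Some x)) (shift X (ennreal \<delta>) -` \<Gamma> k \<inter> sample_space X) \<le> ennreal (e / 2)"
        unfolding late using k1[OF x] by (intro ennreal_leI) simp
    qed
    also have "\<dots> = ennreal e" using e by (simp flip: ennreal_plus)
    finally show "emeasure (law X (Some x)) (hit (- Some ` closure (V k)) 0 (ennreal T)) \<le> ennreal e" unfolding \<Gamma>_def .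
  qed
qed

end

section \<open>Convergence\<close>

lemma emeasure_add_measure:
  assumes s: "sets \<nu> = sets \<mu>" and B: "B \<in> sets \<mu>"
  shows "emeasure (add_measure \<mu> \<nu>) B = emeasure \<mu> B + emeasure \<nu> B"
  unfolding add_measure_def
proof (rule emeasure_measure_of[OF refl])
  show "sets \<mu> \<subseteq> Pow (space \<mu>)" by (rule sets.space_closed)
  show "B \<in> sets (measure_of (space \<mu>) (sets \<mu>) (\<lambda>B. emeasure \<mu> B + emeasure \<nu> B))" using B by simp
  have "countably_additive (sets \<mu>) (\<lambda>B. emeasure \<mu> B + emeasure \<nu> B)"
  proof (rule countably_additiveI)
    fix F :: "nat \<Rightarrow> 'a set" assume F: "range F \<subseteq> sets \<mu>" "disjoint_family F"
    have "(\<Sum>i. emeasure \<mu> (F i) + emeasure \<nu> (F i)) = (\<Sum>i. emeasure \<mu> (F i)) + (\<Sum>i. emeasure \<nu> (F i))"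
      by (intro suminf_add[symmetric] summableI)
    then show "(\<Sum>i. emeasure \<mu> (F i) + emeasure \<nu> (F i)) = emeasure \<mu> (\<Union> (range F)) + emeasure \<nu> (\<Union> (range F))"
      using suminf_emeasure[OF F] suminf_emeasure[of F \<nu>] F s by simp
  qed
  then show "countably_additive (sets (measure_of (space \<mu>) (sets \<mu>) (\<lambda>B. emeasure \<mu> B + emeasure \<nu> B))) (\<lambda>B. emeasure \<mu> B + emeasure \<nu> B)"
    by simp
qed (simp add: positive_def)

lemma AE_add_measureD:
  assumes s: "sets \<nu> = sets \<mu>" and ae: "AE x in add_measure \<mu> \<nu>. P x"
  shows "AE x in \<mu>. P x" "AE x in \<nu>. P x"
proof -
  have sp: "space (add_measure \<mu> \<nu>) = space \<mu>" "sets (add_measure \<mu> \<nu>) = sets \<mu>"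
    unfolding add_measure_def by simp_all
  obtain N where N: "{x \<in> space (add_measure \<mu> \<nu>). \<not> P x} \<subseteq> N" "emeasure (add_measure \<mu> \<nu>) N = 0" "N \<in> sets (add_measure \<mu> \<nu>)"
    using ae by (rule AE_E)
  have "emeasure \<mu> N + emeasure \<nu> N = 0" using N(2) emeasure_add_measure[OF s] N(3) sp by simp
  then have z: "emeasure \<mu> N = 0" "emeasure \<nu> N = 0" by simp_all
  show "AE x in \<mu>. P x" by (rule AE_I[OF _ z(1)]) (use N sp in auto)
  show "AE x in \<nu>. P x" by (rule AE_I[OF _ z(2)]) (use N sp sets_eq_imp_space_eq[OF s] s in auto)
qed

lemma Linf_norm_lessD:
  assumes "Linf_norm \<nu> f < ereal C"
  shows "AE x in \<nu>. \<bar>f x\<bar> \<le> ereal C"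
proof -
  obtain C' where "C' < C" "AE x in \<nu>. \<bar>f x\<bar> \<le> ereal C'"
    using assms unfolding Linf_norm_def Inf_less_iff by auto
  then show ?thesis by (auto elim!: eventually_mono intro: order_trans)
qed

lemma le_add_of_abs_diff_le:
  fixes a b :: ennreal
  assumes d: "\<bar>enn2ereal a - enn2ereal b\<bar> \<le> ereal C" and fin: "a < \<top>" "b < \<top>" and C: "0 \<le> C"
  shows "a \<le> b + ennreal C" "b \<le> a + ennreal C"
proof -
  obtain r s where rs: "a = ennreal r" "b = ennreal s" "0 \<le> r" "0 \<le> s"
    using fin by (metis ennreal_cases less_irrefl)
  have "\<bar>r - s\<bar> \<le> C" using d rs by (simp add: enn2ereal_ennreal)
  then show "a \<le> b + ennreal C" "b \<le> a + ennreal C"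
    unfolding rs(1,2) using rs(3,4) C by (simp_all flip: ennreal_plus add: ennreal_leI)
qed

section \<open>Choice of the constants\<close>

context Feller_setting
begin

text \<open>The level \<open>k\<close> of the containment is fixed by \<open>K\<close>,
  \<open>T\<close> and the admissible error, and then \<open>j\<close> such that the compact set
  \<open>closure (V k)\<close> lies in \<open>V j\<close>. All further constants refer to
  \<open>V j\<close> and to the limit measure, so they do not depend on \<open>n\<close>.\<close>

lemma locally_uniform_convergence:
  assumes R: "Revuz_correspondence X p A \<mu>" "\<And>n. Revuz_correspondence X p (As n) (\<mu>s n)"
    and S: "\<And>k. restrict_to \<mu> (V k) \<in> S00 X p" "\<And>k n. restrict_to (\<mu>s n) (V k) \<in> S00 X p"
    and lim: "\<And>k. (\<lambda>n. Linf_norm (add_measure (restrict_to (\<mu>s n) (V k)) (restrict_to \<mu> (V k)))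
                (\<lambda>x. enn2ereal (pot (V k) (\<mu>s n) x) - enn2ereal (pot (V k) \<mu> x))) \<longlonglongrightarrow> 0"
    and e: "0 < \<epsilon>" and T: "0 < T" and K: "compact K"
  shows "(\<lambda>n. SUP x\<in>K. emeasure (Pr (Some x))
          {\<omega> \<in> sample_space X.
             ereal \<epsilon> < (SUP t\<in>{0..T}. \<bar>enn2ereal (As n t \<omega>) - enn2ereal (A t \<omega>)\<bar>)}) \<longlonglongrightarrow> 0"
proof (rule order_tendstoI)
  fix a :: ennreal assume "0 < a"
  then obtain b where "0 < b" "b < a" using dense by blast
  then obtain \<eta> where \<eta>: "0 < \<eta>" "ennreal \<eta> < a" by (cases b) auto
  obtain k where k: "\<And>x. x \<in> K \<Longrightarrow> emeasure (law X (Some x)) (hit (- Some ` closure (V k)) 0 (ennreal (T + 1))) \<le> ennreal (\<eta> / 2)"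
    using containment[OF K, of "T + 1" "\<eta> / 2"] T \<eta>(1) by auto
  obtain j where j: "closure (V k) \<subseteq> V j" using compact_subset_V[OF V(3)] .
  obtain B where B: "0 \<le> B" "\<And>x. pot (V j) \<mu> x \<le> ennreal B" by (rule S00D[OF S(1)[of j]]) blast
  \<comment> \<open>Solves 4 l e^T = \<epsilon>, the error of the local estimate.\<close>
  define l where "l = \<epsilon> / (4 * exp T)"
  have l: "0 < l" "4 * l * exp T \<le> \<epsilon>" using e by (auto simp: l_def)
  \<comment> \<open>At most 1/2 for the maximal inequality, and at most \<eta>/4 so that its bound
    2m uses half of the admissible error.\<close>
  define m where "m = min (1 / 2) (\<eta> / 4)"
  have m: "0 < m" "m \<le> 1 / 2" "2 * m \<le> \<eta> / 2" using \<eta> by (auto simp: m_def)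
  \<comment> \<open>C \<le> 1 allows 3B + 2C to be replaced by 3B + 2; the quotient is then exactly
    what the bound \<open>q\<close> requires.\<close>
  define C where "C = min 1 (l\<^sup>2 * m / (2 * (3 * B + 2)))"
  have C: "0 < C" "C \<le> 1" using l m B(1) by (auto simp: C_def)
  have q: "2 * C * (3 * B + 2 * C) / l\<^sup>2 \<le> m"
  proof -
    have "C * (2 * (3 * B + 2)) \<le> l\<^sup>2 * m / (2 * (3 * B + 2)) * (2 * (3 * B + 2))"
      using B(1) by (intro mult_right_mono) (auto simp: C_def)
    also have "\<dots> = l\<^sup>2 * m" using B(1) by simp
    finally have 1: "C * (2 * (3 * B + 2)) \<le> l\<^sup>2 * m" .
    have "2 * C * (3 * B + 2 * C) \<le> 2 * C * (3 * B + 2)" using C by (intro mult_left_mono) auto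
    also have "\<dots> \<le> l\<^sup>2 * m" using 1 by (simp add: mult_ac)
    finally show ?thesis using l by (simp add: field_simps)
  qed
  have "eventually (\<lambda>n. Linf_norm (add_measure (restrict_to (\<mu>s n) (V j)) (restrict_to \<mu> (V j)))
                (\<lambda>x. enn2ereal (pot (V j) (\<mu>s n) x) - enn2ereal (pot (V j) \<mu> x)) < ereal C) sequentially"
    by (rule order_tendstoD(2)[OF lim]) (use C in simp)
  then show "eventually (\<lambda>n. (SUP x\<in>K. emeasure (Pr (Some x))
          {\<omega> \<in> sample_space X.
             ereal \<epsilon> < (SUP t\<in>{0..T}. \<bar>enn2ereal (As n t \<omega>) - enn2ereal (A t \<omega>)\<bar>)}) < a) sequentially"
  proof eventually_elim
    case (elim n)
    have "AE x in add_measure (restrict_to (\<mu>s n) (V j)) (restrict_to \<mu> (V j)).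
        pot (V j) (\<mu>s n) x \<le> pot (V j) \<mu> x + ennreal C \<and> pot (V j) \<mu> x \<le> pot (V j) (\<mu>s n) x + ennreal C"
      using Linf_norm_lessD[OF elim]
    proof eventually_elim
      case (elim x)
      \<comment> \<open>Used for finiteness alone, which turns the bound on a difference of extended
        reals into two inequalities between sums.\<close>
      obtain B' where "0 \<le> B'" and B': "\<And>x. pot (V j) (\<mu>s n) x \<le> ennreal B'" by (rule S00D[OF S(2)[of n j]]) blast
      have f1: "pot (V j) (\<mu>s n) x < \<top>" by (rule le_less_trans[OF B']) simp
      have f2: "pot (V j) \<mu> x < \<top>" by (rule le_less_trans[OF B(2)]) simp
      show ?case using le_add_of_abs_diff_le[OF elim f1 f2] C(1) by simp
    qed
    moreover have "sets (restrict_to \<mu> (V j)) = sets (restrict_to (\<mu>s n) (V j))"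
      using S(1)[of j] S(2)[of n j] by (simp add: S00_def)
    ultimately have ae: "AE x in restrict_to (\<mu>s n) (V j). pot (V j) (\<mu>s n) x \<le> pot (V j) \<mu> x + ennreal C"
        "AE x in restrict_to \<mu> (V j). pot (V j) \<mu> x \<le> pot (V j) (\<mu>s n) x + ennreal C"
      using AE_add_measureD by (auto elim!: eventually_mono)
    have "emeasure (Pr (Some x)) {\<omega> \<in> sample_space X. ereal \<epsilon> < (SUP t\<in>{0..T}. \<bar>enn2ereal (As n t \<omega>) - enn2ereal (A t \<omega>)\<bar>)} \<le> ennreal \<eta>"
      if x: "x \<in> K" for x
    proof -
      have "emeasure (Pr (Some x)) {\<omega> \<in> sample_space X. ereal \<epsilon> < (SUP t\<in>{0..T}. \<bar>enn2ereal (As n t \<omega>) - enn2ereal (A t \<omega>)\<bar>)}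
        \<le> emeasure (law X (Some x)) (hit (- Some ` closure (V k)) 0 (ennreal (T + 1))) + ennreal (2 * (2 * C * (3 * B + 2 * C) / l\<^sup>2))"
        by (rule local_estimate[OF R(2) V(2) S(2) R(1) S(1) ae B(2,1) _ l(1) _ _ l(2) V(3) j])
           (use C T q m(2) in auto)
      also have "\<dots> \<le> ennreal (\<eta> / 2) + ennreal (\<eta> / 2)"
        using q m(3) by (intro add_mono k[OF x] ennreal_leI) linarith
      also have "\<dots> = ennreal \<eta>" using \<eta>(1) by (simp flip: ennreal_plus)
      finally show ?thesis .
    qed
    then show ?case by (intro le_less_trans[OF SUP_least \<eta>(2)])
  qed
qed simp

end

theorem theorem3p5:
  fixes X :: "('w, 'a::{metric_space, second_countable_topology}) process"
    and Xd :: "('v, 'a) process"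
    and m :: "'a measure"
    and p :: "real \<Rightarrow> 'a \<Rightarrow> 'a \<Rightarrow> ennreal"
    and \<mu> :: "'a measure" and \<mu>s :: "nat \<Rightarrow> 'a measure"
    and V :: "nat \<Rightarrow> 'a set"
    and A :: "real \<Rightarrow> 'w \<Rightarrow> ennreal" and As :: "nat \<Rightarrow> real \<Rightarrow> 'w \<Rightarrow> ennreal"
  assumes "locally_compact_space (euclidean :: 'a topology)"
    and "standard_process X" and "standard_process Xd"
    and "dual_with_density X Xd m p"
    and "sets \<mu> = sets borel" and "\<And>n. sets (\<mu>s n) = sets borel"
    and "incseq V" and "\<And>k. open (V k)" and "\<And>k. compact (closure (V k))"
    and "(\<Union>k. V k) = UNIV"
    and "\<And>k. restrict_to \<mu> (V k) \<in> S00 X p"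
    and "\<And>k n. restrict_to (\<mu>s n) (V k) \<in> S00 X p"
    and "\<And>k. (\<lambda>n. Linf_norm (add_measure (restrict_to (\<mu>s n) (V k)) (restrict_to \<mu> (V k)))
                (\<lambda>x. enn2ereal (potential p 1 (restrict_to (\<mu>s n) (V k)) x)
                   - enn2ereal (potential p 1 (restrict_to \<mu> (V k)) x))) \<longlonglongrightarrow> 0"
  shows "\<mu> \<in> smooth_measures X p \<and> (\<forall>n. \<mu>s n \<in> smooth_measures X p) \<and>
    (conservative X \<and> doubly_Feller X \<and>
     Revuz_correspondence X p A \<mu> \<and> (\<forall>n. Revuz_correspondence X p (As n) (\<mu>s n)) \<longrightarrow>
     (\<forall>\<epsilon>>0. \<forall>T>0. \<forall>K. compact K \<longrightarrow>
       (\<lambda>n. SUP x\<in>K. emeasure (completion (law X (Some x)))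
          {\<omega> \<in> sample_space X.
             ereal \<epsilon> < (SUP t\<in>{0..T}. \<bar>enn2ereal (As n t \<omega>) - enn2ereal (A t \<omega>)\<bar>)}) \<longlonglongrightarrow> 0))"
proof -
  interpret standard_proc X by unfold_locales (rule assms(2))
  have "\<mu> \<in> smooth_measures X p"
    by (rule locally_S00_smooth[OF assms(7-10,5,11)])
  moreover have "\<mu>s n \<in> smooth_measures X p" for n
    by (rule locally_S00_smooth[OF assms(7-10,6,12)])
  moreover have "(\<lambda>n. SUP x\<in>K. emeasure (completion (law X (Some x)))
          {\<omega> \<in> sample_space X.
             ereal \<epsilon> < (SUP t\<in>{0..T}. \<bar>enn2ereal (As n t \<omega>) - enn2ereal (A t \<omega>)\<bar>)}) \<longlonglongrightarrow> 0"
    if X: "conservative X" "doubly_Feller X" and R: "Revuz_correspondence X p A \<mu>" "\<And>n. Revuz_correspondence X p (As n) (\<mu>s n)"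
      and "0 < \<epsilon>" "0 < T" "compact K" for \<epsilon> T K
  proof -
    interpret Feller_setting X p V
    proof
      show "conservative X" by (rule X)
      show "Feller X" "strong_Feller X" using X(2) unfolding doubly_Feller_def by blast+
      show "jointly_measurable_density p"
        using assms(4) unfolding dual_with_density_def jointly_measurable_density_def by blast
    qed (rule assms)+
    show ?thesis by (rule locally_uniform_convergence[OF R assms(11-13) that(5-7)])
  qed
  ultimately show ?thesis by blast
qed

end
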